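(* Let $k\ge1$, let $D\subset\mathbb R^2$ be a shape-regular curvilinear boundary-layer element, and let $Q_h\xi|_D=(Q^0_{k,D}\xi,Q^\partial_{b,D}\xi)$ be the interpolation--projection operator on $D$. Then for any $\xi\in H^{k+1}(D)$, $$(\nabla_w Q_h\xi,\vec q)_D=(\mathbb Q_{k-1,D}\nabla\xi,\vec q)_D+\langle Q^\partial_{b,D}\xi-\xi,\ \vec q\cdot\vec n\rangle_{\partial D}\qquad\forall\,\vec q\in[\mathbb P_{k-1}(D)]^2,$$ $$\big|\langle Q^\partial_{b,D}\xi-\xi,\ \vec q\cdot\vec n\rangle_{\partial D}\big|\lesssim h_D^{k}\,\|\xi\|_{H^{k+1}(D)}\,\|\vec q\|_{L^2(D)}\qquad\forall\,\vec q\in[\mathbb P_{k-1}(D)]^2,$$ $$\|\nabla_w Q_h\xi-\mathbb Q_{k-1,D}\nabla\xi\|_{L^2(D)}\lesssim h_D^{k}\,\|\xi\|_{H^{k+1}(D)},$$ where $\mathbb Q_{k-1,D}$ is the $L^2(D)$ projection onto $[\mathbb P_{k-1}(D)]^2$ and the hidden constants depend only on the shape-regularity parameters and the polynomial degree $k$.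
   Context: $A\lesssim B$ means $A\le \text{const}\cdot B$. The element $D$ has four sides: one outer side (possibly curved), two straight outer--inner sides, and one straight inner side; $D$ need not be convex. $\partial D_{proj}$ denotes the union of the outer side and the two outer--inner sides, $\partial D_{int}$ the inner side; $\vec n$ is the outward unit normal on $\partial D$. Shape-regular means: (A1) $D$ is a curvilinear polygon with a $C^{0,1}$ curved side and diameter $h_D$; (A2) $D$ is star-shaped with respect to a disc $\mathfrak B_D\subset D$ of radius $\rho_D h_D$, $0<\rho_D<1/2$; (A3) $\rho_D>\rho_{\min}>0$ with $\rho_{\min}$ a uniform lower bound. $\mathbb P_k(D)$ denotes polynomials of degree $\le k$ on $D$; for a side $e$, $\mathbb P_k|_e$ is the set of restrictions to $e$ of bivariate polynomials of degree $\le k$ (for straight $e$ this is $\mathbb P_k(e)$). For $v=(v_0,v_b)$ with $v_0\in L^2(D)$, $v_b\in L^2(\partial D)$, the weak gradient $\nabla_w v\in[\mathbb P_{k-1}(D)]^2$ is the unique polynomial field satisfying $(\nabla_w v,\vec q)_D=-(v_0,\nabla\cdot\vec q)_D+\langle v_b,\vec q\cdot\vec n\rangle_{\partial D}$ for all $\vec q\in[\mathbb P_{k-1}(D)]^2$, where $(\cdot,\cdot)_D$ and $\langle\cdot,\cdot\rangle_{\partial D}$ are $L^2$ inner products. Operator $Q_h$: $Q^0_{k,D}$ is the $L^2(D)$ projection onto $\mathbb P_k(D)$; on each side $e\subset\partial D_{proj}$, $Q^\partial_{b,D}\xi|_e$ is the $L^2(e)$ projection of $\xi$ onto $\mathbb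 P_k|_e$; on the inner side $e=\partial D_{int}$, $Q^\partial_{b,D}\xi|_e=I^\partial_{k,e}\xi$, the standard nodal (Lagrange) interpolant of degree $k$ on the segment $e$ (for a fixed nodal distribution including the endpoints). Functions in $H^{k+1}(D)$ are identified with their continuous representatives on $\overline D$. *)

theory Defs
  imports "HOL-Analysis.Analysis"
begin

section \<open>Polynomials in two variables\<close>

definition poly2 :: "nat \<Rightarrow> (real^2 \<Rightarrow> real) set" where
  "poly2 k = {p. \<exists>c :: nat \<Rightarrow> nat \<Rightarrow> real.
      p = (\<lambda>x. \<Sum>i\<le>k. \<Sum>j\<le>k - i. c i j * (x $ 1) ^ i * (x $ 2) ^ j)}"

definition vpoly2 :: "nat \<Rightarrow> (real^2 \<Rightarrow> real^2) set" where
  "vpoly2 k = {q. \<forall>i. (\<lambda>x. q x $ i) \<in> poly2 k}"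

text \<open>
  Restrictions of bivariate polynomials to a curve \<open>e\<close>. They are extensional
  functions (\<open>undefined\<close> off \<open>e\<close>), so that an element is determined by its values on \<open>e\<close>,
  even when different bivariate polynomials agree there.
\<close>

definition side_poly :: "nat \<Rightarrow> (real^2) set \<Rightarrow> (real^2 \<Rightarrow> real) set" where
  "side_poly k e = (\<lambda>p. restrict p e) ` poly2 k"


section \<open>Lebesgue and Sobolev spaces on an open set\<close>

definition L2_inner :: "(real^2) set \<Rightarrow> (real^2 \<Rightarrow> 'a::real_inner) \<Rightarrow> (real^2 \<Rightarrow> 'a) \<Rightarrow> real" where
  "L2_inner D f g = (LINT x|lebesgue_on D. f x \<bullet> g x)"

definition L2_norm :: "(real^2) set \<Rightarrow> (real^2 \<Rightarrow> 'a::real_inner) \<Rightarrow> real" where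
  "L2_norm D f = sqrt (L2_inner D f f)"

definition L2_space :: "(real^2) set \<Rightarrow> (real^2 \<Rightarrow> real) set" where
  "L2_space D = {f. f \<in> borel_measurable (lebesgue_on D) \<and>
      integrable (lebesgue_on D) (\<lambda>x. (f x)\<^sup>2)}"

text \<open>
  Orthogonal projection onto a space \<open>V\<close> of polynomials (or polynomial fields), as globally
  defined functions: a polynomial is determined by its values on a nonempty open set.
\<close>

definition L2_proj ::
  "(real^2) set \<Rightarrow> (real^2 \<Rightarrow> 'a::real_inner) set \<Rightarrow> (real^2 \<Rightarrow> 'a) \<Rightarrow> real^2 \<Rightarrow> 'a" where
  "L2_proj D V f = (THE p. p \<in> V \<and> (\<forall>r\<in>V. L2_inner D p r = L2_inner D f r))"

definition partial :: "2 \<Rightarrow> (real^2 \<Rightarrow> real) \<Rightarrow> real^2 \<Rightarrow> real" where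
  "partial i f x = frechet_derivative f (at x) (axis i 1)"

definition divergence :: "(real^2 \<Rightarrow> real^2) \<Rightarrow> real^2 \<Rightarrow> real" where
  "divergence q x = (\<Sum>i\<in>UNIV. partial i (\<lambda>y. q y $ i) x)"

text \<open>Differentiability of every iterated partial derivative amounts to being infinitely
  often continuously differentiable.\<close>

definition smooth :: "(real^2 \<Rightarrow> real) \<Rightarrow> bool" where
  "smooth f \<longleftrightarrow> (\<forall>is x. foldr partial is f differentiable (at x))"

definition test_functions :: "(real^2) set \<Rightarrow> (real^2 \<Rightarrow> real) set" where
  "test_functions D = {\<phi>. smooth \<phi> \<and> (\<exists>K. compact K \<and> K \<subseteq> D \<and> (\<forall>x. x \<notin> K \<longrightarrow> \<phi> x = 0))}"

definition is_weak_deriv ::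
  "(real^2) set \<Rightarrow> nat \<Rightarrow> nat \<Rightarrow> (real^2 \<Rightarrow> real) \<Rightarrow> (real^2 \<Rightarrow> real) \<Rightarrow> bool" where
  "is_weak_deriv D i j f g \<longleftrightarrow>
     (\<forall>\<phi>\<in>test_functions D.
        L2_inner D f ((partial 1 ^^ i) ((partial 2 ^^ j) \<phi>)) = (-1) ^ (i + j) * L2_inner D g \<phi>)"

definition sobolev :: "nat \<Rightarrow> (real^2) set \<Rightarrow> (real^2 \<Rightarrow> real) set" where
  "sobolev m D = {f \<in> L2_space D.
      \<forall>i j. i + j \<le> m \<longrightarrow> (\<exists>g\<in>L2_space D. is_weak_deriv D i j f g)}"

text \<open>Weak derivatives are unique up to null sets, so the choice below is immaterial.\<close>

definition weak_deriv :: "(real^2) set \<Rightarrow> nat \<Rightarrow> nat \<Rightarrow> (real^2 \<Rightarrow> real) \<Rightarrow> real^2 \<Rightarrow> real" where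
  "weak_deriv D i j f = (SOME g. g \<in> L2_space D \<and> is_weak_deriv D i j f g)"

definition sobolev_grad :: "(real^2) set \<Rightarrow> (real^2 \<Rightarrow> real) \<Rightarrow> real^2 \<Rightarrow> real^2" where
  "sobolev_grad D f x = vector [weak_deriv D 1 0 f x, weak_deriv D 0 1 f x]"

definition sobolev_norm :: "nat \<Rightarrow> (real^2) set \<Rightarrow> (real^2 \<Rightarrow> real) \<Rightarrow> real" where
  "sobolev_norm m D f = sqrt (\<Sum>(i, j)\<in>{(i, j). i + j \<le> m}. (L2_norm D (weak_deriv D i j f))\<^sup>2)"

text \<open>For open \<open>D\<close> the continuous representative is unique on the closure of \<open>D\<close>; its values
  elsewhere are never used.\<close>

definition cont_rep :: "(real^2) set \<Rightarrow> (real^2 \<Rightarrow> real) \<Rightarrow> real^2 \<Rightarrow> real" where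
  "cont_rep D f = (SOME g. continuous_on (closure D) g \<and> (AE x in lebesgue_on D. g x = f x))"


section \<open>Curvilinear boundary-layer elements\<close>

text \<open>
  An element is given by a parametrisation over \<open>[0,1]\<close> of its outer side and by the two end
  points of its inner side. The outer-inner sides are the segments joining the end of the outer
  side to the first, and the start of the outer side to the second of these points.
\<close>

record bl_element =
  outer_side :: "real \<Rightarrow> real^2"
  inner_pt1 :: "real^2"
  inner_pt2 :: "real^2"

definition oi_side1 :: "bl_element \<Rightarrow> real \<Rightarrow> real^2" where
  "oi_side1 E = linepath (pathfinish (outer_side E)) (inner_pt1 E)"

definition inner_side :: "bl_element \<Rightarrow> real \<Rightarrow> real^2" where
  "inner_side E = linepath (inner_pt1 E) (inner_pt2 E)"

definition oi_side2 :: "bl_element \<Rightarrow> real \<Rightarrow> real^2" where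
  "oi_side2 E = linepath (inner_pt2 E) (pathstart (outer_side E))"

definition bdry_loop :: "bl_element \<Rightarrow> real \<Rightarrow> real^2" where
  "bdry_loop E = outer_side E +++ oi_side1 E +++ inner_side E +++ oi_side2 E"

text \<open>The element itself, as an open set; when \<^term>\<open>bdry_loop E\<close> is a simple closed path, its
  frontier is the union of the four sides by the Jordan curve theorem.\<close>

definition region :: "bl_element \<Rightarrow> (real^2) set" where
  "region E = inside (path_image (bdry_loop E))"

definition star_shaped_wrt :: "(real^2) set \<Rightarrow> (real^2) set \<Rightarrow> bool" where
  "star_shaped_wrt D B \<longleftrightarrow> (\<forall>x\<in>D. \<forall>y\<in>B. closed_segment y x \<subseteq> D)"

definition curvilinear_polygon :: "bl_element \<Rightarrow> bool" where
  "curvilinear_polygon E \<longleftrightarrow>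
     simple_path (bdry_loop E) \<and> (\<exists>L. L-lipschitz_on {0..1} (outer_side E))"

definition shape_regular :: "real \<Rightarrow> bl_element \<Rightarrow> bool" where
  "shape_regular \<rho>min E \<longleftrightarrow>
     curvilinear_polygon E \<and>
     (\<exists>\<rho> z. 0 < \<rho> \<and> \<rho> < 1/2 \<and> \<rho> > \<rho>min \<and>
        ball z (\<rho> * diameter (region E)) \<subseteq> region E \<and>
        star_shaped_wrt (region E) (ball z (\<rho> * diameter (region E))))"


section \<open>Boundary integrals\<close>

text \<open>Integration with respect to arc length. A Lipschitz path is differentiable almost
  everywhere, so the values of \<^const>\<open>vector_derivative\<close> at the other parameters are
  immaterial.\<close>

definition side_integral :: "(real \<Rightarrow> real^2) \<Rightarrow> (real^2 \<Rightarrow> real) \<Rightarrow> real" where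
  "side_integral \<gamma> f = (LINT t|lebesgue_on {0..1}. f (\<gamma> t) * norm (vector_derivative \<gamma> (at t)))"

definition bdry_pairing :: "bl_element \<Rightarrow> (real^2 \<Rightarrow> real) \<Rightarrow> (real^2 \<Rightarrow> real) \<Rightarrow> real" where
  "bdry_pairing E f g =
     (\<Sum>\<gamma>\<leftarrow>[outer_side E, oi_side1 E, oi_side2 E, inner_side E]. side_integral \<gamma> (\<lambda>x. f x * g x))"

text \<open>
  The unit vector \<open>\<nu>\<close> is the outward normal of \<open>D\<close> at \<open>x\<close> if, close to \<open>x\<close>, the set \<open>D\<close> contains
  every cone with apex \<open>x\<close> strictly inside the half plane opposite to \<open>\<nu>\<close> and avoids every cone
  strictly inside the half plane of \<open>\<nu>\<close>. Such a vector is unique; for a Lipschitz domain it exists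
  at almost every boundary point.
\<close>

definition is_outward_normal :: "(real^2) set \<Rightarrow> real^2 \<Rightarrow> real^2 \<Rightarrow> bool" where
  "is_outward_normal D x \<nu> \<longleftrightarrow> norm \<nu> = 1 \<and>
     (\<forall>\<eta>>0. \<forall>\<^sub>F y in at x.
        ((y - x) \<bullet> \<nu> \<le> - \<eta> * norm (y - x) \<longrightarrow> y \<in> D) \<and>
        ((y - x) \<bullet> \<nu> \<ge> \<eta> * norm (y - x) \<longrightarrow> y \<notin> D))"

definition outward_normal :: "(real^2) set \<Rightarrow> real^2 \<Rightarrow> real^2" where
  "outward_normal D x = (THE \<nu>. is_outward_normal D x \<nu>)"

definition normal_trace :: "bl_element \<Rightarrow> (real^2 \<Rightarrow> real^2) \<Rightarrow> real^2 \<Rightarrow> real" where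
  "normal_trace E q x = q x \<bullet> outward_normal (region E) x"


section \<open>Weak gradient and interpolation--projection operator\<close>

text \<open>A weak function is a pair of an interior part and a boundary part.\<close>

definition weak_grad ::
  "nat \<Rightarrow> bl_element \<Rightarrow> (real^2 \<Rightarrow> real) \<times> (real^2 \<Rightarrow> real) \<Rightarrow> real^2 \<Rightarrow> real^2" where
  "weak_grad k E v = (THE w. w \<in> vpoly2 (k - 1) \<and>
     (\<forall>q\<in>vpoly2 (k - 1).
        L2_inner (region E) w q =
          - L2_inner (region E) (fst v) (divergence q) + bdry_pairing E (snd v) (normal_trace E q)))"

definition side_proj :: "nat \<Rightarrow> (real \<Rightarrow> real^2) \<Rightarrow> (real^2 \<Rightarrow> real) \<Rightarrow> real^2 \<Rightarrow> real" where
  "side_proj k \<gamma> f = (THE p. p \<in> side_poly k (path_image \<gamma>) \<and>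
     (\<forall>r\<in>side_poly k (path_image \<gamma>).
        side_integral \<gamma> (\<lambda>x. p x * r x) = side_integral \<gamma> (\<lambda>x. f x * r x)))"

text \<open>Nodal distribution of degree \<open>k\<close> on the reference segment \<open>[0,1]\<close>, end points included.\<close>

definition nodal_distribution :: "nat \<Rightarrow> (nat \<Rightarrow> real) \<Rightarrow> bool" where
  "nodal_distribution k \<tau> \<longleftrightarrow> \<tau> 0 = 0 \<and> \<tau> k = 1 \<and> (\<forall>j<k. \<tau> j < \<tau> (Suc j))"

definition nodal_interp ::
  "nat \<Rightarrow> (nat \<Rightarrow> real) \<Rightarrow> (real \<Rightarrow> real^2) \<Rightarrow> (real^2 \<Rightarrow> real) \<Rightarrow> real^2 \<Rightarrow> real" where
  "nodal_interp k \<tau> \<gamma> f = (THE p. p \<in> side_poly k (path_image \<gamma>) \<and>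
     (\<forall>j\<le>k. p (\<gamma> (\<tau> j)) = f (\<gamma> (\<tau> j))))"

text \<open>The order of the case distinction only matters at the four corners, a null set for
  \<^const>\<open>bdry_pairing\<close>.\<close>

definition Qb :: "nat \<Rightarrow> (nat \<Rightarrow> real) \<Rightarrow> bl_element \<Rightarrow> (real^2 \<Rightarrow> real) \<Rightarrow> real^2 \<Rightarrow> real" where
  "Qb k \<tau> E \<xi> x =
     (let f = cont_rep (region E) \<xi> in
      if x \<in> path_image (inner_side E) then nodal_interp k \<tau> (inner_side E) f x
      else if x \<in> path_image (oi_side1 E) then side_proj k (oi_side1 E) f x
      else if x \<in> path_image (oi_side2 E) then side_proj k (oi_side2 E) f x
      else side_proj k (outer_side E) f x)"

definition Qh ::
  "nat \<Rightarrow> (nat \<Rightarrow> real) \<Rightarrow> bl_element \<Rightarrow> (real^2 \<Rightarrow> real) \<Rightarrow> (real^2 \<Rightarrow> real) \<times> (real^2 \<Rightarrow> real)" where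
  "Qh k \<tau> E \<xi> = (L2_proj (region E) (poly2 k) \<xi>, Qb k \<tau> E \<xi>)"

end

theory Submission
  imports Defs "HOL-Analysis.Analysis"
begin

text \<open>
  The element is star-shaped with respect to a disc of radius \<open>r = \<rho>min h\<close>, so its gauge \<open>N\<close> about the
  centre \<open>z\<close> is Lipschitz and its boundary is \<open>{N = 1}\<close>. Averaging the Taylor polynomials of the
  mollified function over the disc produces the continuous representative of \<open>\<xi>\<close> together with
  polynomials of degree \<open>k\<close> at uniform distance at most \<open>C h\<^sup>k \<parallel>\<xi>\<parallel>\<close> from it. Green's formula needs no
  trace theory: test the weak derivatives with \<open>q\<^sub>i c(N)\<close>, where \<open>c\<close> drops from \<open>1\<close> to \<open>0\<close> in the shell
  \<open>a < N < b\<close>, write the shell integral in the coordinates \<open>z + s (\<gamma>(t) - z)\<close>, and let the shell shrink to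
  the boundary. The same coordinates bound the length of the boundary by \<open>C h\<close>. On every side the boundary
  projection (an \<open>L\<^sup>2\<close> best approximation, or an interpolant with a fixed Lebesgue constant) is as
  good as the polynomial above, and an inverse inequality on the disc bounds \<open>q\<close>. Finally, the
  estimate of the weak gradient follows by testing the identity with the difference itself.
\<close>

text \<open>The constant may depend on \<open>\<rho>min\<close> and \<open>k\<close> only, so every
  constant is fixed before the element is chosen, and the powers of \<open>h\<close> must balance:
  the distance to the polynomial contributes \<open>h^k\<close>, the length of a side
  \<open>h\<close>, and the inverse inequality \<open>1/h\<close>. Three obstacles shape the proof.
  The outer side is merely Lipschitz: it has a tangent almost everywhere, which may vanish on a set
  of positive measure. Boundary arguments therefore run over a Borel set of parameters with nonzero
  tangent, and the other parameters are shown to contribute nothing. Secondly, \<open>D\<close> need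
  not be convex, so the gauge is no norm; star-shapedness with respect to a whole disc still makes
  it Lipschitz. Thirdly, mollification is legitimate only away from the boundary, so Sobolev
  functions are studied on copies of \<open>D\<close> dilated by \<open>s < 1\<close>, whose points
  have a margin \<open>(1 - s) * r\<close>. Lebesgue points serve twice, for the tangents and for
  the convergence of mollified functions.\<close>

lemmas BI_integrable_add = Bochner_Integration.integrable_add
lemmas BI_integrable_bound = Bochner_Integration.integrable_bound
lemmas BI_integrable_sum = Bochner_Integration.integrable_sum
lemmas BI_integral_add = Bochner_Integration.integral_add
lemmas BI_integral_cong = Bochner_Integration.integral_cong
lemmas BI_integral_cong_AE = Bochner_Integration.integral_cong_AE
lemmas BI_integral_diff = Bochner_Integration.integral_diff
lemmas BI_integral_mono = Bochner_Integration.integral_mono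
lemmas BI_integral_nonneg = Bochner_Integration.integral_nonneg
lemmas BI_integral_sum = Bochner_Integration.integral_sum

section \<open>Real analysis: differentiation almost everywhere\<close>

subsection \<open>Lebesgue points and Lipschitz functions of one variable\<close>

text \<open>Induction over the construction of integrable functions. For an indicator, regularity
  squeezes the set between a closed and an open one and Urysohn's lemma interpolates; sums and
  dominated limits follow by the triangle inequality.\<close>

lemma continuous_L1_dense:
 fixes f :: "'a::euclidean_space => real"
 assumes "integrable lebesgue f" "e > 0"
 shows "\<exists>g. continuous_on UNIV g & integrable lebesgue g & (\<integral>x. \<bar>f x - g x\<bar> \<partial>lebesgue) < e" using assms
proof (induction arbitrary: e rule: integrable_induct)
 case (base A c)
 have A: "A \<in> lmeasurable" using base by (simp add: fmeasurable_def)
 \<comment> \<open>The summand 1 keeps the quotient defined for \<open>c = 0\<close>. The set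
   \<open>U - K\<close> on which \<open>h\<close> may differ from the indicator has measure below
   \<open>2 * d\<close>, so the error is at most \<open>\<bar>c\<bar> * (2 * d) < e\<close>.\<close>
 define d where "d = e / (2 * (\<bar>c\<bar> + 1))"
 have d: "d > 0" using base by (auto simp: d_def)
 have de: "(\<bar>c\<bar> + 1) * (2 * d) = e"
 proof -
  have "2 * \<bar>c\<bar> + 2 ~= 0" using abs_ge_zero[of c] by linarith
  then show ?thesis by (simp add: d_def field_simps)
 qed
 obtain U where U: "open U" "A \<subseteq> U" "U - A \<in> lmeasurable" "emeasure lebesgue (U - A) < ennreal d" using sets_lebesgue_outer_open[of A d] base d by auto
 obtain K where K: "closed K" "K \<subseteq> A" "A - K \<in> lmeasurable" "emeasure lebesgue (A - K) < ennreal d" using sets_lebesgue_inner_closed[of A d] base d by auto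
 have "K \<inter> (-U) = {}" using U K by auto
 obtain h :: "'a => real" where h: "continuous_on UNIV h" "!!x. h x \<in> closed_segment 1 0"
   "!!x. x \<in> K ==> h x = 1" "!!x. x \<in> -U ==> h x = 0" using Urysohn[of K "-U" 1 "0::real"] U(1) K(1) \<open>K \<inter> (-U) = {}\<close> by (metis closed_Compl)
 have h01: "0 <= h x" "h x <= 1" for x using h(2)[of x] by (auto simp: closed_segment_eq_real_ivl)
 have UK: "U - K \<in> lmeasurable"
 proof -
  have "U - K = (U - A) \<union> (A - K)" using U K by auto
  then show ?thesis using U K by auto
 qed
 have mUK: "measure lebesgue (U - K) < 2 * d"
 proof -
  have eq: "U - K = (U - A) \<union> (A - K)" using U K by auto
  have 1: "measure lebesgue (U - A) < d" using U(4) d by (simp add: emeasure_eq_measure2[OF U(3)] ennreal_less_iff)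
  have 2: "measure lebesgue (A - K) < d" using K(4) d by (simp add: emeasure_eq_measure2[OF K(3)] ennreal_less_iff)
  have "measure lebesgue (U - K) <= measure lebesgue (U - A) + measure lebesgue (A - K)" unfolding eq using U K by (intro measure_Un_le) auto
  then show ?thesis using 1 2 by linarith
 qed
 have Ul: "U \<in> lmeasurable"
 proof -
  have "U = (U - A) \<union> A" using U by auto
  then show ?thesis using U A by (metis fmeasurable.Un)
 qed
 have hm: "h \<in> borel_measurable lebesgue" using borel_measurable_continuous_onI[OF h(1)] by (simp add: measurable_completion)
 have hi: "integrable lebesgue h" by (rule BI_integrable_bound[where f="indicat_real U"])
   (use Ul hm h01 h(4) in \<open>auto simp: indicator_def fmeasurable_def\<close>)
 have bd: "\<bar>indicat_real A x *\<^sub>R c - c * h x\<bar> <= \<bar>c\<bar> * indicat_real (U - K) x" for x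
 proof -
  have "\<bar>indicat_real A x - h x\<bar> <= indicat_real (U - K) x" using h01[of x] h(3)[of x] h(4)[of x] U(2) K(2) by (auto simp: indicator_def split: if_splits)
  moreover have "\<bar>indicat_real A x *\<^sub>R c - c * h x\<bar> = \<bar>c\<bar> * \<bar>indicat_real A x - h x\<bar>" by (simp add: abs_mult[symmetric] algebra_simps)
  ultimately show ?thesis by (simp add: mult_left_mono)
 qed
 have "(\<integral>x. \<bar>indicat_real A x *\<^sub>R c - c * h x\<bar> \<partial>lebesgue) <= (\<integral>x. \<bar>c\<bar> * indicat_real (U - K) x \<partial>lebesgue)"
  by (rule integral_mono) (use bd UK hi base A in \<open>auto simp: fmeasurable_def\<close>)
 also have "... = \<bar>c\<bar> * measure lebesgue (U - K)" using UK by simp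
 also have "... <= \<bar>c\<bar> * (2 * d)" using mUK by (intro mult_left_mono) auto
 also have "... < (\<bar>c\<bar> + 1) * (2 * d)" using d by simp
 also have "... = e" by (rule de)
 finally show ?case using h(1) hi by (intro exI[of _ "%x. c * h x"]) (auto intro!: continuous_intros)
next
 case (add f g)
 obtain a where a: "continuous_on UNIV a" "integrable lebesgue a" "(\<integral>x. \<bar>f x - a x\<bar> \<partial>lebesgue) < e/2" using add.IH(1)[of "e/2"] add.prems by auto
 obtain b where b: "continuous_on UNIV b" "integrable lebesgue b" "(\<integral>x. \<bar>g x - b x\<bar> \<partial>lebesgue) < e/2" using add.IH(2)[of "e/2"] add.prems by auto
 have "(\<integral>x. \<bar>f x + g x - (a x + b x)\<bar> \<partial>lebesgue) <= (\<integral>x. \<bar>f x - a x\<bar> + \<bar>g x - b x\<bar> \<partial>lebesgue)"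
  by (rule integral_mono) (use a b add in auto)
 also have "... = (\<integral>x. \<bar>f x - a x\<bar> \<partial>lebesgue) + (\<integral>x. \<bar>g x - b x\<bar> \<partial>lebesgue)" using a b add by simp
 also have "... < e" using a b by simp
 finally show ?case using a b by (intro exI[of _ "%x. a x + b x"]) (auto intro!: continuous_intros)
next
 case (lim f s)
 have "(%i. \<integral>x. \<bar>f x - s i x\<bar> \<partial>lebesgue) \<longlonglongrightarrow> (\<integral>x. (0::real) \<partial>(lebesgue::'a measure))"
 \<comment> \<open>The approximants are bounded by twice \<open>norm (f x)\<close>, so three times
   that value dominates the error.\<close>
 proof (rule integral_dominated_convergence[where w="%x. 3 * norm (f x)"])
  show "AE x in lebesgue. (%i. \<bar>f x - s i x\<bar>) \<longlonglongrightarrow> 0"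
  proof (rule AE_I2)
   fix x :: 'a
   have "(%i. \<bar>f x - s i x\<bar>) \<longlonglongrightarrow> \<bar>f x - f x\<bar>" using lim.hyps(2)[of x] by (intro tendsto_intros) auto
   then show "(%i. \<bar>f x - s i x\<bar>) \<longlonglongrightarrow> 0" by simp
  qed
  show "AE x in lebesgue. norm \<bar>f x - s i x\<bar> <= 3 * norm (f x)" for i
  proof (rule AE_I2)
   fix x :: 'a
   show "norm \<bar>f x - s i x\<bar> <= 3 * norm (f x)" using lim.hyps(3)[of x i] by auto
  qed
 qed (use lim in auto)
 then have "eventually (%i. (\<integral>x. \<bar>f x - s i x\<bar> \<partial>lebesgue) < e/2) sequentially" using lim.prems by (intro order_tendstoD(2)[where y=0]) auto
 then obtain i where i: "(\<integral>x. \<bar>f x - s i x\<bar> \<partial>lebesgue) < e/2" using eventually_happens sequentially_bot by blast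
 obtain a where a: "continuous_on UNIV a" "integrable lebesgue a" "(\<integral>x. \<bar>s i x - a x\<bar> \<partial>lebesgue) < e/2" using lim.IH[of "e/2" i] lim.prems by auto
 have "(\<integral>x. \<bar>f x - a x\<bar> \<partial>lebesgue) <= (\<integral>x. \<bar>f x - s i x\<bar> + \<bar>s i x - a x\<bar> \<partial>lebesgue)"
  by (rule integral_mono) (use a lim in auto)
 also have "... = (\<integral>x. \<bar>f x - s i x\<bar> \<partial>lebesgue) + (\<integral>x. \<bar>s i x - a x\<bar> \<partial>lebesgue)" using a lim by simp
 also have "... < e" using a i by simp
 finally show ?case using a by auto
qed

lemma emeasure_cball_5:
 fixes a :: "'a::euclidean_space"
 assumes "r > 0"
 shows "emeasure lebesgue (cball a (5 * r)) = 5 ^ DIM('a) * emeasure lebesgue (cball a r)" using assms by (simp add: emeasure_cball power_mult_distrib ennreal_mult' mult_ac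
   flip: ennreal_power ennreal_numeral)

text \<open>Countable subadditivity with the sum written as an integral over the counting measure,
  so that the balls of a covering can stay indexed by their centres.\<close>

lemma emeasure_UN_countable_le:
 assumes "countable C" "!!i. i \<in> C ==> A i \<in> sets M"
 shows "emeasure M (\<Union>i\<in>C. A i) <= (\<integral>\<^sup>+i. emeasure M (A i) \<partial>count_space C)"
proof -
 have "emeasure M (\<Union>i\<in>C. A i) = (\<integral>\<^sup>+x. indicator (\<Union>i\<in>C. A i) x \<partial>M)"
  using assms by (intro nn_integral_indicator[symmetric] sets.countable_UN'') auto
 also have "... <= (\<integral>\<^sup>+x. (\<integral>\<^sup>+i. indicator (A i) x \<partial>count_space C) \<partial>M)"
 proof (intro nn_integral_mono)
  fix x
  show "indicator (\<Union>i\<in>C. A i) x <= (\<integral>\<^sup>+i. indicator (A i) x \<partial>count_space C)"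
  proof (cases "x \<in> (\<Union>i\<in>C. A i)")
   case True
   then obtain i where "i \<in> C" "x \<in> A i" by auto
   then have "1 <= (\<integral>\<^sup>+i. indicator (A i) x \<partial>count_space C)" using nn_integral_ge_point[of i C "%i. indicator (A i) x"] by simp
   moreover have "indicator (\<Union>i\<in>C. A i) x = (1::ennreal)" using True by (simp only: indicator_simps)
   ultimately show ?thesis by simp
  qed auto
 qed
 also have "... = (\<integral>\<^sup>+i. (\<integral>\<^sup>+x. indicator (A i) x \<partial>M) \<partial>count_space C)"
  using assms by (intro nn_integral_count_space_nn_integral) auto
 also have "... = (\<integral>\<^sup>+i. emeasure M (A i) \<partial>count_space C)" using assms by (intro nn_integral_cong) auto
 finally show ?thesis .
qed

text \<open>The weak type estimate for the maximal function with radii at most 1: Vitali's covering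
  lemma selects disjoint balls whose fivefold enlargements cover \<open>S\<close>, and the integrals
  of \<open>f\<close> over disjoint balls add up to at most the full integral.\<close>

lemma maximal_inequality:
 fixes f :: "'a::euclidean_space => ennreal"
 assumes f: "f \<in> borel_measurable lebesgue"
  and S: "!!x. x \<in> S ==> \<exists>r. 0 < r & r <= 1 \<and>
   \<alpha> * emeasure lebesgue (cball x r) <= (\<integral>\<^sup>+y\<in>cball x r. f y \<partial>lebesgue)"
 obtains U where "U \<in> sets lebesgue" "S \<subseteq> U"
  "\<alpha> * emeasure lebesgue U <= 5 ^ DIM('a) * (\<integral>\<^sup>+y. f y \<partial>lebesgue)"
proof -
 obtain r where r: "!!x. x \<in> S ==> 0 < r x & r x <= 1 \<and>
   \<alpha> * emeasure lebesgue (cball x (r x)) <= (\<integral>\<^sup>+y\<in>cball x (r x). f y \<partial>lebesgue)" using S by metis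
 have "S \<subseteq> (\<Union>i\<in>S. cball i (r i))" using r by force
 then obtain C where C: "countable C" "C \<subseteq> S"
  "pairwise (%i j. disjnt (cball i (r i)) (cball j (r j))) C"
  "S \<subseteq> (\<Union>i\<in>C. cball i (5 * r i))" by (rule Vitali_covering_lemma_cballs[of S "%x. x" r S 1]) (use r in auto)
 define U where "U = (\<Union>i\<in>C. cball i (5 * r i))"
 have disj: "disjoint_family_on (%i. cball i (r i)) C" using C(3) by (auto simp: disjoint_family_on_def pairwise_def disjnt_def)
 have "\<alpha> * emeasure lebesgue U <= \<alpha> * (\<integral>\<^sup>+i. emeasure lebesgue (cball i (5 * r i)) \<partial>count_space C)"
  unfolding U_def by (intro mult_left_mono emeasure_UN_countable_le C) auto
 also have "... = (\<integral>\<^sup>+i. 5 ^ DIM('a) * (\<alpha> * emeasure lebesgue (cball i (r i))) \<partial>count_space C)"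
 proof -
  have "emeasure lebesgue (cball i (5 * r i)) = 5 ^ DIM('a) * emeasure lebesgue (cball i (r i))" if "i \<in> C" for i using C(2) r that by (intro emeasure_cball_5) auto
  then show ?thesis by (subst nn_integral_cmult[symmetric]) (auto intro!: nn_integral_cong simp: mult_ac simp del: emeasure_completion)
 qed
 also have "... <= (\<integral>\<^sup>+i. 5 ^ DIM('a) * (\<integral>\<^sup>+y\<in>cball i (r i). f y \<partial>lebesgue) \<partial>count_space C)"
  using C(2) r by (intro nn_integral_mono mult_left_mono) auto
 \<comment> \<open>The integral over a ball is its mass in the measure with density
   \<open>f\<close>, so disjointness enters as additivity of that measure.\<close>
 also have "... = 5 ^ DIM('a) * (\<integral>\<^sup>+i. emeasure (density lebesgue f) (cball i (r i)) \<partial>count_space C)"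
  by (subst nn_integral_cmult) (auto simp: emeasure_density f)
 also have "... = 5 ^ DIM('a) * emeasure (density lebesgue f) (\<Union>i\<in>C. cball i (r i))" using C(1) disj by (subst emeasure_UN_countable) auto
 also have "... <= 5 ^ DIM('a) * emeasure (density lebesgue f) UNIV" by (intro mult_left_mono emeasure_mono) auto
 also have "... = 5 ^ DIM('a) * (\<integral>\<^sup>+y. f y \<partial>lebesgue)" by (subst emeasure_density) (auto simp: f)
 finally show ?thesis using C(1,4) by (intro that[of U]) (auto simp: U_def)
qed

text \<open>Split \<open>f\<close> into a continuous \<open>g\<close> and a remainder of small
  \<open>L1\<close> norm. Continuity disposes of \<open>g\<close>; the maximal inequality bounds the
  set where the means of \<open>\<bar>f - g\<bar>\<close> are large, and Chebyshev's inequality the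
  set where the remainder itself is large.\<close>

lemma Lebesgue_points_1:
 fixes f :: "'a::euclidean_space => real"
 assumes f: "integrable lebesgue f" and e: "e > 0"
 shows "negligible {x. \<forall>d>0. \<exists>r. 0 < r & r < d \<and>
  (\<integral>\<^sup>+y\<in>cball x r. ennreal \<bar>f y - f x\<bar> \<partial>lebesgue) \<ge> ennreal e * emeasure lebesgue (cball x r)}"
  (is "negligible ?B")
proof -
 \<comment> \<open>Three errors of size \<open>e/4\<close> stay below \<open>e\<close>. The
   threshold \<open>e/4\<close> gives the factor \<open>4/e\<close>, the maximal inequality
   \<open>5 ^ DIM('a)\<close>, and Chebyshev's inequality the summand 1.\<close>
 define K :: real where "K = (4/e) * (5 ^ DIM('a) + 1)"
 have K: "K > 0" using e by (simp add: K_def add_pos_pos)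
 have "\<exists>T. ?B \<subseteq> T & T \<in> lmeasurable & measure lebesgue T < eps" if eps: "eps > 0" for eps
 proof -
  define dt where "dt = eps / (2*K)"
  have dt: "dt > 0" using K eps by (simp add: dt_def)
  obtain g where g: "continuous_on UNIV g" "integrable lebesgue g" "(\<integral>x. \<bar>f x - g x\<bar> \<partial>lebesgue) < dt" using continuous_L1_dense[OF f dt] by auto
  define I where "I = (\<integral>x. \<bar>f x - g x\<bar> \<partial>lebesgue)"
  have I0: "I \<ge> 0" by (simp add: I_def)
  have I: "(\<integral>\<^sup>+y. ennreal \<bar>f y - g y\<bar> \<partial>lebesgue) = ennreal I" unfolding I_def using f g by (intro nn_integral_eq_integral) auto
  have fgm[measurable]: "f \<in> borel_measurable lebesgue" "g \<in> borel_measurable lebesgue" using f g by auto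
  define S where "S = {x. \<exists>r. 0 < r & r <= 1 \<and>
   ennreal (e/4) * emeasure lebesgue (cball x r) <= (\<integral>\<^sup>+y\<in>cball x r. ennreal \<bar>f y - g y\<bar> \<partial>lebesgue)}"
  obtain U where U: "U \<in> sets lebesgue" "S \<subseteq> U"
   "ennreal (e/4) * emeasure lebesgue U <= 5 ^ DIM('a) * (\<integral>\<^sup>+y. ennreal \<bar>f y - g y\<bar> \<partial>lebesgue)"
   by (rule maximal_inequality[of "%y. ennreal \<bar>f y - g y\<bar>" S "ennreal (e/4)"]) (auto simp: S_def)
  define V where "V = {x. e/4 <= \<bar>f x - g x\<bar>}"
  have Vm: "V \<in> sets lebesgue" using borel_measurable_le[of "%_. e/4" lebesgue "%x. \<bar>f x - g x\<bar>"] by (simp add: V_def)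
  have V: "ennreal (e/4) * emeasure lebesgue V <= ennreal I"
  proof -
   have "ennreal (e/4) * emeasure lebesgue V = (\<integral>\<^sup>+y\<in>V. ennreal (e/4) \<partial>lebesgue)" using Vm by (simp add: nn_integral_cmult_indicator)
   also have "... <= (\<integral>\<^sup>+y. ennreal \<bar>f y - g y\<bar> \<partial>lebesgue)" by (intro nn_integral_mono) (auto simp: V_def indicator_def intro!: ennreal_leI)
   finally show ?thesis by (simp add: I)
  qed
  have sub: "?B \<subseteq> U \<union> V"
  proof
   fix x assume x: "x \<in> ?B"
   show "x \<in> U \<union> V"
   proof (rule ccontr)
    assume n: "x \<notin> U \<union> V"
    have "continuous (at x) g" using g(1) by (simp add: continuous_on_eq_continuous_at)
    then obtain d where d: "d > 0" "!!y. dist y x < d ==> dist (g y) (g x) < e/4" using e unfolding continuous_at_eps_delta by (metis divide_pos_pos zero_less_numeral)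
    obtain r where r: "0 < r" "r < min d 1"
    "(\<integral>\<^sup>+y\<in>cball x r. ennreal \<bar>f y - f x\<bar> \<partial>lebesgue) \<ge> ennreal e * emeasure lebesgue (cball x r)"
    proof -
    have "\<exists>r. 0 < r & r < min d 1 \<and>
    (\<integral>\<^sup>+y\<in>cball x r. ennreal \<bar>f y - f x\<bar> \<partial>lebesgue) \<ge> ennreal e * emeasure lebesgue (cball x r)"
    using x d(1) by (elim CollectE allE[of _ "min d 1"]) auto
    then show ?thesis using that by blast
    qed
    have ns: "x \<notin> S" using n U by auto
    then have a: "(\<integral>\<^sup>+y\<in>cball x r. ennreal \<bar>f y - g y\<bar> \<partial>lebesgue) < ennreal (e/4) * emeasure lebesgue (cball x r)"
    using r by (auto simp: S_def not_le)
    have fg: "\<bar>g x - f x\<bar> < e/4" using n by (simp add: V_def abs_minus_commute)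
    have "(\<integral>\<^sup>+y\<in>cball x r. ennreal \<bar>f y - f x\<bar> \<partial>lebesgue)
    <= (\<integral>\<^sup>+y\<in>cball x r. (ennreal \<bar>f y - g y\<bar> + ennreal (e/2)) \<partial>lebesgue)"
    proof (intro nn_integral_mono)
    fix y
    show "ennreal \<bar>f y - f x\<bar> * indicator (cball x r) y <= (ennreal \<bar>f y - g y\<bar> + ennreal (e/2)) * indicator (cball x r) y"
    proof (cases "y \<in> cball x r")
    case True
    then have "\<bar>g y - g x\<bar> < e/4" using d(2)[of y] r by (auto simp: dist_real_def dist_commute)
    then have "\<bar>f y - f x\<bar> <= \<bar>f y - g y\<bar> + e/2" using fg by linarith
    then show ?thesis using True e by (simp add: ennreal_plus[symmetric] ennreal_leI del: ennreal_plus)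
    qed auto
    qed
    also have "... = (\<integral>\<^sup>+y\<in>cball x r. ennreal \<bar>f y - g y\<bar> \<partial>lebesgue) + ennreal (e/2) * emeasure lebesgue (cball x r)" unfolding distrib_right
    proof (subst nn_integral_add)
    show "(%y. ennreal \<bar>f y - g y\<bar> * indicator (cball x r) y) \<in> borel_measurable lebesgue"
    by (intro borel_measurable_times_ennreal borel_measurable_indicator) (measurable, simp)
    show "(%y. ennreal (e/2) * indicator (cball x r) y) \<in> borel_measurable lebesgue" by (intro borel_measurable_times_ennreal borel_measurable_indicator) (measurable, simp)
    qed (simp add: nn_integral_cmult_indicator del: emeasure_completion)
    also have "... < ennreal (e/4) * emeasure lebesgue (cball x r) + ennreal (e/2) * emeasure lebesgue (cball x r)"
    proof -
    have "ennreal (e/2) * emeasure lebesgue (cball x r) ~= \<infinity>" using r by (simp add: ennreal_mult_eq_top_iff emeasure_cball)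
    then show ?thesis using a by (subst (1 2) add.commute) (simp add: ennreal_add_left_cancel_less del: emeasure_completion)
    qed
    also have "... = ennreal (3*e/4) * emeasure lebesgue (cball x r)" using e by (simp add: distrib_right[symmetric] ennreal_plus[symmetric] del: ennreal_plus)
    also have "... <= ennreal e * emeasure lebesgue (cball x r)" using e by (intro mult_right_mono ennreal_leI) auto
    finally show False using r by auto
   qed
  qed
  have fin: "emeasure lebesgue U <= ennreal ((4/e) * (5 ^ DIM('a) * I))"
  proof -
   have "emeasure lebesgue U = ennreal (4/e) * (ennreal (e/4) * emeasure lebesgue U)" using e by (simp add: mult.assoc[symmetric] ennreal_mult[symmetric])
   also have "... <= ennreal (4/e) * (5 ^ DIM('a) * ennreal I)" using U(3) I by (intro mult_left_mono) auto
   also have "... = ennreal ((4/e) * (5 ^ DIM('a) * I))"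
   proof -
    have "(5::ennreal) ^ DIM('a) = ennreal (5 ^ DIM('a))" by (metis ennreal_numeral ennreal_power zero_le_numeral)
    moreover have "ennreal ((4/e) * (5 ^ DIM('a) * I)) = ennreal (4/e) * (ennreal (5 ^ DIM('a)) * ennreal I)"
    proof -
    have "ennreal ((4/e) * (5 ^ DIM('a) * I)) = ennreal (4/e) * ennreal (5 ^ DIM('a) * I)" using e I0 by (intro ennreal_mult) auto
    also have "ennreal (5 ^ DIM('a) * I) = ennreal (5 ^ DIM('a)) * ennreal I" using I0 by (intro ennreal_mult) auto
    finally show ?thesis .
    qed
    ultimately show ?thesis by simp
   qed
   finally show ?thesis .
  qed
  have finV: "emeasure lebesgue V <= ennreal ((4/e) * I)"
  proof -
   have "emeasure lebesgue V = ennreal (4/e) * (ennreal (e/4) * emeasure lebesgue V)" using e by (simp add: mult.assoc[symmetric] ennreal_mult[symmetric])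
   also have "... <= ennreal (4/e) * ennreal I" using V by (intro mult_left_mono) auto
   also have "... = ennreal ((4/e) * I)" using e I0 by (simp add: ennreal_mult[symmetric])
   finally show ?thesis .
  qed
  have "emeasure lebesgue (U \<union> V) <= emeasure lebesgue U + emeasure lebesgue V" using U Vm by (intro emeasure_subadditive) auto
  also have "... <= ennreal ((4/e) * (5 ^ DIM('a) * I)) + ennreal ((4/e) * I)" by (intro add_mono fin finV)
  also have "... = ennreal (K * I)" using e I0 by (simp add: K_def ennreal_plus[symmetric] algebra_simps del: ennreal_plus)
  finally have m: "emeasure lebesgue (U \<union> V) <= ennreal (K * I)" .
  then have lm: "U \<union> V \<in> lmeasurable" using U Vm by (intro fmeasurableI) (auto intro: le_less_trans)
  have "measure lebesgue (U \<union> V) <= K * I" using m I0 K by (simp add: emeasure_eq_measure2[OF lm] ennreal_le_iff)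
  also have "... <= K * dt" using g(3) K by (intro mult_left_mono) (auto simp: I_def)
  also have "... < eps" using K eps by (simp add: dt_def)
  finally show ?thesis using sub lm by blast
 qed
 then show ?thesis by (simp add: negligible_outer)
qed

theorem Lebesgue_points:
 fixes f :: "'a::euclidean_space => real"
 assumes f: "integrable lebesgue f"
 shows "AE x in lebesgue. \<forall>e>0. \<exists>d>0. \<forall>r. 0 < r & r < d -->
  (\<integral>\<^sup>+y\<in>cball x r. ennreal \<bar>f y - f x\<bar> \<partial>lebesgue) <= ennreal e * emeasure lebesgue (cball x r)"
proof -
 define B where "B e = {x. \<forall>d>0. \<exists>r. 0 < r & r < d \<and>
  (\<integral>\<^sup>+y\<in>cball x r. ennreal \<bar>f y - f x\<bar> \<partial>lebesgue) \<ge> ennreal e * emeasure lebesgue (cball x r)}" for e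
 have "negligible (\<Union>n. B (1 / Suc n))" using Lebesgue_points_1[OF f] by (intro negligible_countable_Union) (auto simp: B_def)
 then have "(\<Union>n. B (1 / Suc n)) \<in> null_sets lebesgue" by (simp add: negligible_iff_null_sets)
 moreover have "{x. \<not> (\<forall>e>0. \<exists>d>0. \<forall>r. 0 < r & r < d -->
  (\<integral>\<^sup>+y\<in>cball x r. ennreal \<bar>f y - f x\<bar> \<partial>lebesgue) <= ennreal e * emeasure lebesgue (cball x r))}
  \<subseteq> (\<Union>n. B (1 / Suc n))"
 proof
  fix x assume "x \<in> {x. \<not> (\<forall>e>0. \<exists>d>0. \<forall>r. 0 < r & r < d -->
  (\<integral>\<^sup>+y\<in>cball x r. ennreal \<bar>f y - f x\<bar> \<partial>lebesgue) <= ennreal e * emeasure lebesgue (cball x r))}"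
  then obtain e :: real where e: "e > 0" and n: "\<not> (\<exists>d>0. \<forall>r. 0 < r & r < d -->
  (\<integral>\<^sup>+y\<in>cball x r. ennreal \<bar>f y - f x\<bar> \<partial>lebesgue) <= ennreal e * emeasure lebesgue (cball x r))" by blast
  obtain n where n1: "1 / Suc n < e" using e nat_approx_posE by blast
  have "x \<in> B (1 / Suc n)"
  proof (unfold B_def, intro CollectI allI impI)
   fix d :: real assume "d > 0"
   then obtain r where r: "0 < r" "r < d"
    "(\<integral>\<^sup>+y\<in>cball x r. ennreal \<bar>f y - f x\<bar> \<partial>lebesgue) > ennreal e * emeasure lebesgue (cball x r)" using n by (auto simp: not_le)
   have "ennreal (1 / Suc n) * emeasure lebesgue (cball x r) <= ennreal e * emeasure lebesgue (cball x r)" using n1 by (intro mult_right_mono ennreal_leI) auto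
   then show "\<exists>r>0. r < d & ennreal (1 / Suc n) * emeasure lebesgue (cball x r) <= (\<integral>\<^sup>+y\<in>cball x r. ennreal \<bar>f y - f x\<bar> \<partial>lebesgue)"
    using r by (intro exI[of _ r]) auto
  qed
  then show "x \<in> (\<Union>n. B (1 / Suc n))" by blast
 qed
 ultimately show ?thesis by (intro AE_I[where N="\<Union>n. B (1 / Suc n)"]) auto
qed

lemma UN_symmetric_Ioc: "(\<Union>i. {- real i<..real i}) = UNIV"
proof (intro equalityI subsetI UNIV_I)
 fix x :: real
 obtain n where "\<bar>x\<bar> < real n" using reals_Archimedean2 by blast
 then show "x \<in> (\<Union>i. {- real i<..real i})" by (intro UN_I[of n]) auto
qed

text \<open>\<open>H x = K * x - F x\<close> is monotone too, and the Stieltjes measures of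
  \<open>F\<close> and \<open>H\<close> add up to \<open>K\<close> times Lebesgue measure on
  half-open intervals, hence on all Borel sets. Dropping the part of \<open>H\<close> gives the
  bound.\<close>

lemma emeasure_interval_measure_le:
 fixes F :: "real => real"
 assumes mono: "!!x y. x <= y ==> 0 <= F y - F x & F y - F x <= K * (y - x)"
  and A: "A \<in> sets borel" and K: "K \<ge> 0"
 shows "emeasure (interval_measure F) A <= ennreal K * emeasure lborel A"
proof -
 define H where "H x = K * x - F x" for x
 have mH: "x <= y ==> H x <= H y" for x y using mono[of x y] by (simp add: H_def algebra_simps)
 have mF: "x <= y ==> F x <= F y" for x y using mono[of x y] by simp
 have cF: "continuous_on UNIV F"
 proof (rule continuous_on_subset[OF lipschitz_on_continuous_on[of K UNIV F]])
  show "K-lipschitz_on UNIV F"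
  proof (rule lipschitz_onI[OF _ K])
   fix x y :: real
   show "dist (F x) (F y) <= K * dist x y" using mono[of x y] mono[of y x] by (cases "x <= y") (auto simp: dist_real_def)
  qed
 qed auto
 have cH: "continuous_on UNIV H" unfolding H_def by (intro continuous_intros cF)
 have rF: "continuous (at_right a) F" and rH: "continuous (at_right a) H" for a using cF cH by (auto simp: continuous_on_eq_continuous_at continuous_at_imp_continuous_within)
 define N where "N = measure_of UNIV (sets borel) (%A. emeasure (interval_measure F) A + emeasure (interval_measure H) A)"
 have sN[simp]: "sets N = sets borel" unfolding N_def using sets.sigma_sets_eq[of "borel::real measure"] by (simp add: sets_measure_of[of _ UNIV])
 have eN: "emeasure N A = emeasure (interval_measure F) A + emeasure (interval_measure H) A" if "A \<in> sets borel" for A unfolding N_def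
 proof (rule emeasure_measure_of_sigma[OF _ _ _ that])
  show "sigma_algebra UNIV (sets (borel::real measure))" using sets.sigma_algebra_axioms[of "borel::real measure"] by simp
  show "positive (sets borel) (%A. emeasure (interval_measure F) A + emeasure (interval_measure H) A)" by (simp add: positive_def)
  show "countably_additive (sets borel) (%A. emeasure (interval_measure F) A + emeasure (interval_measure H) A)" unfolding countably_additive_def
   by (auto simp: suminf_add[symmetric] suminf_emeasure)
 qed
 have "N = density lborel (%_. ennreal K)"
 proof (rule measure_eqI_generator_eq[where E="range (%(a, b). {a<..b::real})" and \<Omega>=UNIV and A="%i. {-real i <.. real i}"])
  show "Int_stable (range (%(a, b). {a<..b::real}))" by (auto simp: Int_stable_def)
  show "range (%(a, b). {a<..b::real}) \<subseteq> Pow UNIV" by auto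
  show "sets N = sigma_sets UNIV (range (%(a, b). {a<..b::real}))" by (simp add: borel_sigma_sets_Ioc)
  then show "sets (density lborel (%_. ennreal K)) = sigma_sets UNIV (range (%(a, b). {a<..b::real}))" by simp
  show "range (%i. {- real i<..real i}) \<subseteq> range (%(a, b). {a<..b})" by auto
  show "(\<Union>i. {- real i<..real i}) = UNIV" by (rule UN_symmetric_Ioc)
  show "emeasure N {- real i<..real i} ~= \<infinity>" for i by (simp add: eN emeasure_interval_measure_Ioc mF mH rF rH ennreal_add_eq_top)
  fix X assume "X \<in> range (%(a, b). {a<..b::real})"
  then obtain a b where X: "X = {a<..b}" by auto
  show "emeasure N X = emeasure (density lborel (%_. ennreal K)) X"
  proof (cases "a <= b")
   case True
   then show ?thesis using mF[OF True] mH[OF True] K unfolding X by (simp add: eN emeasure_interval_measure_Ioc mF mH rF rH emeasure_density nn_integral_cmult_indicator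
    ennreal_plus[symmetric] ennreal_mult[symmetric] del: ennreal_plus) (simp add: H_def algebra_simps)
  qed (simp add: X)
 qed
 then have "emeasure N A = ennreal K * emeasure lborel A" using A by (simp add: emeasure_density nn_integral_cmult_indicator)
 moreover have "emeasure (interval_measure F) A <= emeasure N A" by (simp add: eN A)
 ultimately show ?thesis by simp
qed

text \<open>By the comparison with Lebesgue measure the Stieltjes measure of \<open>F\<close> is
  absolutely continuous; its Radon--Nikodym density is the derivative in integrated form.\<close>

lemma monotone_Lipschitz_density:
 fixes F :: "real => real"
 assumes mono: "!!x y. x <= y ==> 0 <= F y - F x & F y - F x <= K * (y - x)" and K: "K \<ge> 0"
 obtains g where "g \<in> borel_measurable borel" "!!x. 0 <= g x"
  "!!a b. a <= b ==> (g has_integral F b - F a) {a..b}"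
proof -
 let ?M = "interval_measure F"
 have mF: "x <= y ==> F x <= F y" for x y using mono[of x y] by simp
 have cF: "continuous_on UNIV F"
 proof (rule continuous_on_subset[OF lipschitz_on_continuous_on[of K UNIV F]])
  show "K-lipschitz_on UNIV F"
  proof (rule lipschitz_onI[OF _ K])
   fix x y :: real
   show "dist (F x) (F y) <= K * dist x y" using mono[of x y] mono[of y x] by (cases "x <= y") (auto simp: dist_real_def)
  qed
 qed auto
 have rF: "continuous (at_right a) F" for a using cF by (auto simp: continuous_on_eq_continuous_at continuous_at_imp_continuous_within)
 have ac: "absolutely_continuous lborel ?M" unfolding absolutely_continuous_def
 proof
  fix A :: "real set" assume A: "A \<in> null_sets lborel"
  then have "emeasure ?M A <= ennreal K * 0" using emeasure_interval_measure_le[of F K A] mono K by (auto simp: null_sets_def)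
  then show "A \<in> null_sets ?M" using A by (auto simp: null_sets_def)
 qed
 obtain f where f: "f \<in> borel_measurable lborel" "density lborel f = ?M" using sigma_finite_measure.Radon_Nikodym[OF sigma_finite_lborel ac] by auto
 have fm[measurable]: "f \<in> borel_measurable borel" using f by simp
 \<comment> \<open>Bounded intervals have finite Stieltjes measure, so the density is finite almost
   everywhere and can be made real-valued.\<close>
 have fin: "AE x in lborel. f x ~= \<infinity>"
 proof -
  have "AE x in lborel. x \<in> {-real n <.. real n} --> f x ~= \<infinity>" for n
  proof -
   have "(\<integral>\<^sup>+x. f x * indicator {-real n<..real n} x \<partial>lborel) = ennreal (F n - F (-n))"
    using emeasure_interval_measure_Ioc[of "-n" n F] mF rF by (simp add: f(2)[symmetric] emeasure_density)
   then have "AE x in lborel. f x * indicator {-real n<..real n} x ~= \<infinity>" by (intro nn_integral_noteq_infinite) auto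
   then show ?thesis by eventually_elim (auto simp: indicator_def)
  qed
  then have "AE x in lborel. \<forall>n. x \<in> {-real n <.. real n} --> f x ~= \<infinity>" by (subst AE_all_countable) blast
  then show ?thesis
  proof eventually_elim
   case (elim x)
   have "x \<in> (\<Union>i. {- real i<..real i})" by (simp add: UN_symmetric_Ioc)
   then show ?case using elim by blast
  qed
 qed
 define g where "g x = enn2real (f x)" for x
 have gm[measurable]: "g \<in> borel_measurable borel" unfolding g_def by measurable
 have gf: "AE x in lborel. ennreal (g x) = f x" using fin by eventually_elim (auto simp: g_def less_top)
 have "(g has_integral F b - F a) {a..b}" if "a <= b" for a b
 proof -
  have "(\<integral>\<^sup>+x. ennreal (g x * indicator {a<..b} x) \<partial>lborel) = (\<integral>\<^sup>+x. f x * indicator {a<..b} x \<partial>lborel)"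
   using gf by (intro nn_integral_cong_AE) (auto simp: indicator_def)
  also have "... = ennreal (F b - F a)" using emeasure_interval_measure_Ioc[of a b F] mF rF that by (simp add: f(2)[symmetric] emeasure_density)
  finally have "((%x. g x * indicator {a<..b} x) has_integral F b - F a) UNIV" using that mF[OF that] by (intro nn_integral_has_integral) (auto simp: g_def)
  then have "(g has_integral F b - F a) {a<..b}" by (subst has_integral_restrict_UNIV[symmetric])
    (auto elim!: has_integral_eq[rotated] simp: indicator_def)
  then show ?thesis by (rule has_integral_spike_set_eq[THEN iffD1, rotated -1])
    (rule negligible_subset[of "{a}"]; auto)+
 qed
 then show ?thesis using that[of g] by (auto simp: g_def)
qed

text \<open>Adding \<open>L * x\<close> makes the function monotone, so its increments are integrals
  of a density; at a Lebesgue point of the density the difference quotients converge to it.\<close>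

theorem Lipschitz_real_differentiable_AE:
 fixes F :: "real => real"
 assumes L: "L-lipschitz_on UNIV F"
 obtains g where "g \<in> borel_measurable borel"
  "!!a b. a <= b ==> (g has_integral F b - F a) {a..b}"
  "AE x in lebesgue. (F has_real_derivative g x) (at x)"
proof -
 have L0: "L \<ge> 0" using L by (rule lipschitz_on_nonneg)
 define G where "G x = F x + L * x" for x
 have mono: "0 <= G y - G x & G y - G x <= 2 * L * (y - x)" if "x <= y" for x y using lipschitz_onD[OF L, of x y] that by (auto simp: G_def dist_real_def algebra_simps abs_le_iff)
 obtain g0 where g0: "g0 \<in> borel_measurable borel" "!!x. 0 <= g0 x"
  "!!a b. a <= b ==> (g0 has_integral G b - G a) {a..b}" using monotone_Lipschitz_density[OF mono] L0 by auto
 define g where "g x = g0 x - L" for x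
 have gm[measurable]: "g \<in> borel_measurable borel" unfolding g_def using g0(1) by measurable
 have gi: "(g has_integral F b - F a) {a..b}" if "a <= b" for a b
 proof -
  have "((%x. g0 x - L) has_integral (G b - G a) - (b - a) *\<^sub>R L) {a..b}" using has_integral_const_real[of L a b] that
   by (intro has_integral_diff g0(3)) (auto simp: content_real)
  then show ?thesis by (simp add: g_def[abs_def] G_def algebra_simps)
 qed
 have ga: "set_integrable lebesgue {a..b} g" for a b
 proof (cases "a <= b")
  case True
  have "g0 absolutely_integrable_on {a..b}" using g0(2) g0(3)[OF True] by (intro nonnegative_absolutely_integrable_1) (auto simp: integrable_on_def)
  moreover have "(%_. L) absolutely_integrable_on {a..b}" by (rule absolutely_integrable_on_const) auto
  ultimately show ?thesis unfolding g_def by (rule set_integral_diff)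
 qed (simp add: set_integrable_def)
 \<comment> \<open>The density is only locally integrable. Lebesgue points are taken for its
   truncations, one of which agrees with it near any given point.\<close>
 define B where "B n x = g x * indicator {-real n..real n} x" for n x
 have Bi: "integrable lebesgue (B n)" for n using ga[of "-real n" "real n"] by (simp add: set_integrable_def B_def[abs_def] mult.commute)
 have "AE x in lebesgue. \<forall>n. \<forall>e>0. \<exists>d>0. \<forall>r. 0 < r & r < d -->
  (\<integral>\<^sup>+y\<in>cball x r. ennreal \<bar>B n y - B n x\<bar> \<partial>lebesgue) <= ennreal e * emeasure lebesgue (cball x r)"
  by (subst AE_all_countable) (intro allI Lebesgue_points Bi)
 then have "AE x in lebesgue. (F has_real_derivative g x) (at x)"
 proof eventually_elim
  case (elim x)
  obtain n where n: "\<bar>x\<bar> + 1 < real n" using reals_Archimedean2 by blast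
  show ?case unfolding has_field_derivative_def has_derivative_at_within
  proof (intro conjI bounded_linear_mult_right tendstoI)
   fix e :: real assume e: "e > 0"
   obtain d where d: "d > 0" "!!r. 0 < r ==> r < d ==>
    (\<integral>\<^sup>+y\<in>cball x r. ennreal \<bar>B n y - B n x\<bar> \<partial>lebesgue) <= ennreal (e/4) * emeasure lebesgue (cball x r)"
    using elim[rule_format, of "e/4" n] e by auto
   \<comment> \<open>An interval inside \<open>cball x r\<close> has its error controlled by the
     integral over the ball, whose length is \<open>2 * r\<close>; this turns the tolerance
     \<open>e/4\<close> into \<open>e/2 * r\<close>.\<close>
   have main: "\<bar>F b - F a - g x * (b - a)\<bar> <= e/2 * r" if r: "0 < r" "r < min d 1" and ab: "a <= b" "{a..b} \<subseteq> cball x r" for a b r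
   proof -
    have sub: "{a..b} \<subseteq> {-real n..real n}" using r ab n by (auto simp: dist_real_def subset_iff abs_if split: if_splits)
    have xn: "x \<in> {-real n..real n}" using n by auto
    have hi: "((%y. g y - g x) has_integral F b - F a - g x * (b - a)) {a..b}"
    using has_integral_diff[OF gi[OF ab(1)] has_integral_const_real[of "g x" a b]] ab by (simp add: content_real mult.commute)
    have si: "(%y. g y - g x) absolutely_integrable_on {a..b}" by (intro set_integral_diff ga absolutely_integrable_on_const) auto
    have "F b - F a - g x * (b - a) = (LINT y:{a..b}|lebesgue. g y - g x)" using hi si by (metis integral_unique set_lebesgue_integral_eq_integral(2))
    then have "ennreal \<bar>F b - F a - g x * (b - a)\<bar> <= (\<integral>\<^sup>+y. ennreal (norm (indicator {a..b} y *\<^sub>R (g y - g x))) \<partial>lebesgue)"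
    using integral_norm_bound_ennreal[of lebesgue "%y. indicator {a..b} y *\<^sub>R (g y - g x)"] si by (simp add: set_integrable_def set_lebesgue_integral_def)
    also have "... <= (\<integral>\<^sup>+y\<in>cball x r. ennreal \<bar>B n y - B n x\<bar> \<partial>lebesgue)"
    using sub xn ab by (intro nn_integral_mono) (auto simp: B_def indicator_def subset_iff)
    also have "... <= ennreal (e/4) * emeasure lebesgue (cball x r)" using d(2)[of r] r by auto
    also have "emeasure lebesgue (cball x r) = ennreal (2 * r)" using r by (simp add: cball_eq_atLeastAtMost)
    also have "ennreal (e/4) * ennreal (2*r) = ennreal (e/2 * r)" using e r by (simp add: ennreal_mult[symmetric])
    finally show ?thesis using e r by (subst (asm) ennreal_le_iff) auto
   qed
   show "\<forall>\<^sub>F y in at x. dist ((F y - F x - g x * (y - x)) /\<^sub>R norm (y - x)) 0 < e" unfolding eventually_at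
   proof (intro exI[of _ "min d 1"] conjI ballI impI)
    fix y assume y: "y ~= x & dist y x < min d 1"
    define r where "r = \<bar>y - x\<bar>"
    have r: "0 < r" "r < min d 1" using y by (auto simp: r_def dist_real_def)
    have "\<bar>F y - F x - g x * (y - x)\<bar> <= e/2 * r"
    proof (cases "x <= y")
    case True then show ?thesis using main[OF r, of x y] by (auto simp: r_def dist_real_def subset_iff)
    next
    case False
    then have "\<bar>F x - F y - g x * (x - y)\<bar> <= e/2 * r" using main[OF r, of y x] by (auto simp: r_def dist_real_def subset_iff)
    moreover have "F x - F y - g x * (x - y) = - (F y - F x - g x * (y - x))" by (simp add: algebra_simps)
    ultimately show ?thesis by (simp only: abs_minus_cancel)
    qed
    also have "... < e * r" using e r by simp
    finally show "dist ((F y - F x - g x * (y - x)) /\<^sub>R norm (y - x)) 0 < e" using r by (simp add: r_def[symmetric] abs_mult field_simps)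
   qed (use d in auto)
  qed
 qed
 then show ?thesis using that[OF gm gi] by blast
qed

lemma norm_vector_derivative_le_Lipschitz:
 fixes gm :: "real => 'a::real_normed_vector"
 assumes L: "L-lipschitz_on S gm" and S: "open S" "t \<in> S"
  and v: "(gm has_vector_derivative v) (at t)"
 shows "norm v <= L"
proof (rule field_le_epsilon)
 fix e :: real assume "e > 0"
 then obtain d where d: "d > 0" "!!s. norm (s - t) < d ==> norm (gm s - gm t - (s - t) *\<^sub>R v) <= e * norm (s - t)"
  using v unfolding has_vector_derivative_def has_derivative_at_alt by blast
 obtain d' where d': "d' > 0" "ball t d' \<subseteq> S" using S open_contains_ball by blast
 define h where "h = min d d' / 2"
 have h: "h > 0" "h < d" "h < d'" using d d' by (auto simp: h_def)
 have "t + h \<in> S" using d' h by (auto simp: subset_iff dist_real_def)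
 then have "norm (gm (t + h) - gm t) <= L * h" using lipschitz_onD[OF L _ S(2), of "t + h"] h by (simp add: dist_norm)
 moreover have "norm (gm (t + h) - gm t - h *\<^sub>R v) <= e * h" using d(2)[of "t + h"] h by simp
 moreover have "norm (h *\<^sub>R v) <= norm (gm (t + h) - gm t) + norm (gm (t + h) - gm t - h *\<^sub>R v)" by (metis norm_triangle_sub add.commute norm_minus_commute)
 ultimately have "h * norm v <= h * (L + e)" using h by (simp add: algebra_simps)
 then show "norm v <= L + e" using h by simp
qed

theorem Lipschitz_path_differentiable_AE:
 fixes gm :: "real => real^'n"
 assumes L: "L-lipschitz_on {0..1} gm"
 obtains g where "g \<in> borel_measurable borel"
  "!!a b. 0 <= a ==> a <= b ==> b <= 1 ==> (g has_integral gm b - gm a) {a..b}"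
  "AE t in lebesgue. t \<in> {0<..<1} --> (gm has_vector_derivative g t) (at t) & norm (g t) <= L"
proof -
 \<comment> \<open>Clamping the parameter extends the path to the whole line with the same Lipschitz
   constant, so the scalar theorem applies to each component.\<close>
 define c where "c t = max 0 (min 1 t)" for t :: real
 have c01: "c t \<in> {0..1}" and cid: "t \<in> {0..1} ==> c t = t" for t by (auto simp: c_def)
 have cL: "\<bar>c s - c t\<bar> <= \<bar>s - t\<bar>" for s t by (auto simp: c_def)
 have L0: "L \<ge> 0" using L by (rule lipschitz_on_nonneg)
 define F where "F i t = gm (c t) $ i" for i t
 have FL: "L-lipschitz_on UNIV (F i)" for i
 proof (rule lipschitz_onI[OF _ L0])
  fix s t :: real
  have "dist (F i s) (F i t) <= dist (gm (c s)) (gm (c t))" by (simp add: F_def dist_vec_nth_le)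
  also have "... <= L * dist (c s) (c t)" using lipschitz_onD[OF L c01 c01] .
  also have "... <= L * dist s t" using cL L0 by (intro mult_left_mono) (auto simp: dist_real_def)
  finally show "dist (F i s) (F i t) <= L * dist s t" .
 qed
 have "\<exists>g. g \<in> borel_measurable borel & (\<forall>a b. a <= b --> (g has_integral F i b - F i a) {a..b}) \<and>
  (AE x in lebesgue. (F i has_real_derivative g x) (at x))" for i using Lipschitz_real_differentiable_AE[OF FL[of i]] by metis
 then obtain h where h: "!!i. h i \<in> borel_measurable borel"
  "!!i a b. a <= b ==> (h i has_integral F i b - F i a) {a..b}"
  "!!i. AE x in lebesgue. (F i has_real_derivative h i x) (at x)" by metis
 define g where "g t = (\<chi> i. h i t)" for t
 have gm: "g \<in> borel_measurable borel" unfolding g_def using h(1) by (subst borel_measurable_euclidean_space) (auto simp: Basis_vec_def inner_axis)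
 have 1: "(g has_integral gm b - gm a) {a..b}" if "0 <= a" "a <= b" "b <= 1" for a b
 proof -
  have "((%x. g x \<bullet> axis i 1) has_integral (gm b - gm a) \<bullet> axis i 1) {a..b}" for i using h(2)[OF that(2), of i] that by (simp add: g_def F_def cid inner_axis)
  then show ?thesis by (subst has_integral_componentwise_iff) (auto simp: Basis_vec_def)
 qed
 have "AE t in lebesgue. \<forall>i\<in>UNIV. (F i has_real_derivative h i t) (at t)" by (rule AE_finite_allI) (auto simp: h(3))
 then have 2: "AE t in lebesgue. t \<in> {0<..<1} --> (gm has_vector_derivative g t) (at t) & norm (g t) <= L"
 proof eventually_elim
  case (elim t)
  show ?case
  proof
   assume t: "t \<in> {0<..<1}"
   have "((%s. gm (c s)) has_vector_derivative g t) (at t)" unfolding has_vector_derivative_def by (subst has_derivative_componentwise_within)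
    (use elim in \<open>auto simp: Basis_vec_def inner_axis F_def[abs_def] g_def has_field_derivative_def mult_commute_abs\<close>)
   then have v: "(gm has_vector_derivative g t) (at t)" by (rule has_vector_derivative_transform_within_open[where S="{0<..<1}"]) (use t cid in auto)
   moreover have "norm (g t) <= L"
   proof -
    show ?thesis by (rule norm_vector_derivative_le_Lipschitz[OF lipschitz_on_subset[OF L, of "{0<..<1}"] _ _ v]) (use t in auto)
   qed
   ultimately show "(gm has_vector_derivative g t) (at t) & norm (g t) <= L" by simp
  qed
 qed
 show ?thesis using that[OF gm 1 2] by blast
qed

section \<open>Polynomials, their projections and norms\<close>

subsection \<open>Bivariate polynomials\<close>

definition index2 :: "nat => (nat \<times> nat) set" where
 "index2 k = {(i, j). i + j <= k}"

definition mono2 :: "nat \<times> nat => real^2 => real" where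
 "mono2 ij x = (x $ 1) ^ fst ij * (x $ 2) ^ snd ij"

lemma finite_index2 [simp]: "finite (index2 k)" by (rule finite_subset[of _ "{..k} \<times> {..k}"]) (auto simp: index2_def)

lemma index2_mono: "k <= l ==> index2 k \<subseteq> index2 l" by (auto simp: index2_def)

lemma sum_index2: "(\<Sum>i\<le>k. \<Sum>j\<le>k - i. f i j) = (\<Sum>(i, j)\<in>index2 k. f i j)"
proof -
 have "(\<Sum>i\<le>k. \<Sum>j\<le>k - i. f i j) = (\<Sum>(i, j)\<in>Sigma {..k} (%i. {..k - i}). f i j)" by (rule sum.Sigma) auto
 also have "Sigma {..k} (%i. {..k - i}) = index2 k" by (auto simp: index2_def)
 finally show ?thesis .
qed

lemma poly2_iff: "p \<in> poly2 k \<longleftrightarrow> (\<exists>c. p = (%x. \<Sum>ij\<in>index2 k. c ij * mono2 ij x))"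
proof
 assume "p \<in> poly2 k"
 then obtain c where "p = (%x. \<Sum>i\<le>k. \<Sum>j\<le>k - i. c i j * (x $ 1) ^ i * (x $ 2) ^ j)" by (auto simp: poly2_def)
 then show "\<exists>c. p = (%x. \<Sum>ij\<in>index2 k. c ij * mono2 ij x)" by (intro exI[of _ "%(i, j). c i j"]) (auto simp: sum_index2 mono2_def intro!: sum.cong)
next
 assume "\<exists>c. p = (%x. \<Sum>ij\<in>index2 k. c ij * mono2 ij x)"
 then obtain c where "p = (%x. \<Sum>ij\<in>index2 k. c ij * mono2 ij x)" by blast
 then show "p \<in> poly2 k" unfolding poly2_def by (intro CollectI exI[of _ "%i j. c (i, j)"]) (auto simp: sum_index2 mono2_def intro!: sum.cong)
qed

lemma poly2_add [intro]: "p \<in> poly2 k ==> q \<in> poly2 k ==> (%x. p x + q x) \<in> poly2 k" unfolding poly2_iff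
proof (elim exE)
 fix c d assume "p = (%x. \<Sum>ij\<in>index2 k. c ij * mono2 ij x)" "q = (%x. \<Sum>ij\<in>index2 k. d ij * mono2 ij x)"
 then show "\<exists>c. (%x. p x + q x) = (%x. \<Sum>ij\<in>index2 k. c ij * mono2 ij x)" by (intro exI[of _ "%ij. c ij + d ij"]) (simp add: sum.distrib algebra_simps)
qed

lemma poly2_scale [intro]: "p \<in> poly2 k ==> (%x. a * p x) \<in> poly2 k" unfolding poly2_iff
proof (elim exE)
 fix c assume "p = (%x. \<Sum>ij\<in>index2 k. c ij * mono2 ij x)"
 then show "\<exists>c. (%x. a * p x) = (%x. \<Sum>ij\<in>index2 k. c ij * mono2 ij x)" by (intro exI[of _ "%ij. a * c ij"]) (simp add: sum_distrib_left algebra_simps)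
qed

lemma poly2_zero [simp, intro]: "(%x. 0) \<in> poly2 k" unfolding poly2_iff by (intro exI[of _ "%_. 0"]) simp

lemma poly2_uminus [intro]: "p \<in> poly2 k ==> (%x. - p x) \<in> poly2 k" using poly2_scale[of p k "-1"] by simp

lemma poly2_diff [intro]: "p \<in> poly2 k ==> q \<in> poly2 k ==> (%x. p x - q x) \<in> poly2 k" using poly2_add[of p k "%x. - q x"] by auto

lemma poly2_sum [intro]: "(!!i. i \<in> I ==> p i \<in> poly2 k) ==> (%x. \<Sum>i\<in>I. p i x) \<in> poly2 k" by (induction I rule: infinite_finite_induct) auto

lemma mono2_poly2: "ij \<in> index2 k ==> mono2 ij \<in> poly2 k" unfolding poly2_iff by (intro exI[of _ "%ij'. of_bool (ij' = ij)"] ext) (simp add: sum_of_bool_mult_eq)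

lemma poly2_mono: "k <= l ==> poly2 k \<subseteq> poly2 l"
proof
 fix p assume "k <= l" "p \<in> poly2 k"
 then show "p \<in> poly2 l" using index2_mono[of k l] mono2_poly2[of _ l] by (auto simp: poly2_iff[of _ k] intro!: poly2_sum poly2_scale)
qed

lemma poly2_const [simp, intro]: "(%x. a) \<in> poly2 k" using poly2_scale[OF mono2_poly2[of "(0, 0)" k], of a] by (simp add: index2_def mono2_def)

lemma poly2_nth: "k \<ge> 1 ==> (%x. x $ i) \<in> poly2 k" using mono2_poly2[of "(1, 0)" k] mono2_poly2[of "(0, 1)" k] exhaust_2[of i] by (auto simp: index2_def mono2_def[abs_def])

lemma poly2_mult:
 assumes "p \<in> poly2 k" "q \<in> poly2 l"
 shows "(%x. p x * q x) \<in> poly2 (k + l)"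
proof -
 obtain c d where p: "p = (%x. \<Sum>ij\<in>index2 k. c ij * mono2 ij x)"
  and q: "q = (%x. \<Sum>ij\<in>index2 l. d ij * mono2 ij x)" using assms by (auto simp: poly2_iff)
 have "(%x. p x * q x) = (%x. \<Sum>a\<in>index2 k. \<Sum>b\<in>index2 l. (c a * d b) * mono2 (fst a + fst b, snd a + snd b) x)"
  unfolding p q by (simp add: sum_product mono2_def power_add mult_ac)
 moreover have "mono2 (fst a + fst b, snd a + snd b) \<in> poly2 (k + l)" if "a \<in> index2 k" "b \<in> index2 l" for a b using that by (intro mono2_poly2) (auto simp: index2_def)
 ultimately show ?thesis by (auto intro!: poly2_sum poly2_scale)
qed

lemma poly2_power: "p \<in> poly2 k ==> (%x. p x ^ n) \<in> poly2 (k * n)" by (induction n) (auto dest: poly2_mult)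

lemma poly2_affine:
 assumes "p \<in> poly2 k"
 shows "(%x. p (z + a *\<^sub>R x)) \<in> poly2 k"
proof -
 obtain c where p: "p = (%x. \<Sum>ij\<in>index2 k. c ij * mono2 ij x)" using assms by (auto simp: poly2_iff)
 have "(%x. mono2 ij (z + a *\<^sub>R x)) \<in> poly2 k" if "ij \<in> index2 k" for ij
 proof -
  have l: "(%x. (z + a *\<^sub>R x) $ i) \<in> poly2 1" for i using poly2_add[OF poly2_const[of "z $ i"] poly2_scale[OF poly2_nth[of 1 i], of a]] by simp
  have "(%x. mono2 ij (z + a *\<^sub>R x)) \<in> poly2 (1 * fst ij + 1 * snd ij)" unfolding mono2_def by (intro poly2_mult poly2_power l)
  then show ?thesis using poly2_mono[of "fst ij + snd ij" k] that by (auto simp: index2_def)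
 qed
 then show ?thesis unfolding p by (intro poly2_sum poly2_scale) auto
qed

lemma continuous_mono2: "continuous_on S (mono2 ij)" unfolding mono2_def by (intro continuous_intros)

lemma continuous_poly2: "p \<in> poly2 k ==> continuous_on S p" by (auto simp: poly2_iff intro!: continuous_intros continuous_mono2)

lemma mono2_has_derivative:
 "(mono2 ij has_derivative (%h. real (fst ij) * mono2 (fst ij - 1, snd ij) x * h $ 1
   + real (snd ij) * mono2 (fst ij, snd ij - 1) x * h $ 2)) (at x)"
proof -
 have l: "((%x::real^2. x $ i) has_derivative (%h. h $ i)) (at x)" for i by (rule bounded_linear.has_derivative[OF bounded_linear_vec_nth has_derivative_ident])
 show ?thesis unfolding mono2_def by (rule derivative_eq_intros l refl)+ (simp add: algebra_simps)
qed

lemma poly2_has_derivative: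
 assumes "p \<in> poly2 k"
 obtains p1 p2 where "p1 \<in> poly2 k" "p2 \<in> poly2 k"
  "!!x. (p has_derivative (%h. p1 x * h $ 1 + p2 x * h $ 2)) (at x)"
proof -
 obtain c where p: "p = (%x. \<Sum>ij\<in>index2 k. c ij * mono2 ij x)" using assms by (auto simp: poly2_iff)
 define p1 where "p1 x = (\<Sum>ij\<in>index2 k. c ij * (real (fst ij) * mono2 (fst ij - 1, snd ij) x))" for x
 define p2 where "p2 x = (\<Sum>ij\<in>index2 k. c ij * (real (snd ij) * mono2 (fst ij, snd ij - 1) x))" for x
 have "p1 \<in> poly2 k" "p2 \<in> poly2 k" unfolding p1_def[abs_def] p2_def[abs_def] by (intro poly2_sum poly2_scale mono2_poly2; auto simp: index2_def)+
 moreover have "(p has_derivative (%h. p1 x * h $ 1 + p2 x * h $ 2)) (at x)" for x unfolding p p1_def p2_def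
  by (rule has_derivative_eq_rhs[OF has_derivative_sum[OF has_derivative_mult_right[OF mono2_has_derivative]]])
   (simp add: sum_distrib_left sum_distrib_right sum.distrib[symmetric] algebra_simps)
 ultimately show ?thesis using that by blast
qed

lemma partial_eqI:
 assumes "(f has_derivative f') (at x)"
 shows "partial i f x = f' (axis i 1)" unfolding partial_def frechet_derivative_at[OF assms, symmetric] by (rule refl)

lemma poly2_linepath:
 assumes "p \<in> poly2 k"
 obtains P :: "real poly" where "degree P <= k" "!!t. p (linepath a b t) = poly P t"
proof -
 obtain c where p: "p = (%x. \<Sum>ij\<in>index2 k. c ij * mono2 ij x)" using assms by (auto simp: poly2_iff)
 define l where "l i = [:a $ i, b $ i - a $ i:]" for i :: 2
 define P where "P = (\<Sum>ij\<in>index2 k. smult (c ij) (l 1 ^ fst ij * l 2 ^ snd ij))"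
 have dl: "degree (l i) <= 1" for i by (simp add: l_def)
 have "degree (l 1 ^ fst ij * l 2 ^ snd ij) <= k" if "ij \<in> index2 k" for ij
 proof -
  have "degree (l 1 ^ fst ij * l 2 ^ snd ij) <= degree (l 1 ^ fst ij) + degree (l 2 ^ snd ij)" by (rule degree_mult_le)
  also have "... <= 1 * fst ij + 1 * snd ij" by (intro add_mono order_trans[OF degree_power_le] mult_right_mono dl) auto
  also have "... <= k" using that by (auto simp: index2_def)
  finally show ?thesis .
 qed
 then have "degree P <= k" unfolding P_def by (intro degree_sum_le) (auto intro!: order_trans[OF degree_smult_le])
 moreover have "p (linepath a b t) = poly P t" for t by (simp add: p P_def poly_sum l_def mono2_def linepath_def algebra_simps)
 ultimately show ?thesis using that by blast
qed

lemma poly2_of_poly: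
 assumes "degree P <= k" "l \<in> poly2 1"
 shows "(%x. poly P (l x)) \<in> poly2 k"
proof -
 have "(%x. l x ^ i) \<in> poly2 k" if "i <= degree P" for i using poly2_power[OF assms(2), of i] poly2_mono[of i k] that assms(1) by auto
 then show ?thesis unfolding poly_altdef by (intro poly2_sum poly2_scale) auto
qed

text \<open>On the line from a point of \<open>S\<close> to \<open>x\<close> the polynomial has
  infinitely many zeros near the start, so it also vanishes at the other end.\<close>

lemma poly2_eq_0_open:
 assumes "p \<in> poly2 k" "open S" "S ~= {}" "!!x. x \<in> S ==> p x = 0"
 shows "p x = 0"
proof -
 obtain a where a: "a \<in> S" using assms by blast
 obtain P where P: "degree P <= k" "!!t::real. p (linepath a x t) = poly P t" using poly2_linepath[OF assms(1), of a x] by blast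
 obtain d where d: "d > 0" "ball a d \<subseteq> S" using assms a open_contains_ball by blast
 have "open (linepath a x -` S)" using assms(2) by (intro open_vimage) (auto simp: linepath_def[abs_def] intro!: continuous_intros)
 moreover have "0 \<in> linepath a x -` S" using a by (simp add: linepath_def)
 ultimately obtain e where e: "e > 0" "ball 0 e \<subseteq> linepath a x -` S" by (meson open_contains_ball)
 have "infinite (ball (0::real) e)" using e by (simp add: ball_eq_greaterThanLessThan infinite_Ioo)
 moreover have "ball 0 e \<subseteq> {t. poly P t = 0}"
 proof
  fix t :: real assume "t \<in> ball 0 e"
  then have "linepath a x t \<in> S" using e by auto
  then show "t \<in> {t. poly P t = 0}" using P(2)[of t] assms(4) by simp
 qed
 ultimately have "P = 0" using poly_roots_finite[of P] finite_subset by blast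
 then show ?thesis using P(2)[of 1] by (simp add: linepath_def)
qed

text \<open>The one-variable identity theorem applied twice: the coefficients with respect to the
  first variable are polynomials in the second.\<close>

lemma mono2_independent:
 assumes "!!x. (\<Sum>ij\<in>index2 k. c ij * mono2 ij x) = 0" "ij \<in> index2 k"
 shows "c ij = 0"
proof -
 have eq: "(\<Sum>i\<le>k. (\<Sum>j\<le>k - i. c (i, j) * b ^ j) * a ^ i) = 0" for a b :: real
 proof -
  have "(\<Sum>i\<le>k. (\<Sum>j\<le>k - i. c (i, j) * b ^ j) * a ^ i) = (\<Sum>ij\<in>index2 k. c ij * mono2 ij (vector [a, b]))"
   using sum_index2[of "%i j. c (i, j) * mono2 (i, j) (vector [a, b])" k] by (simp add: mono2_def sum_distrib_left sum_distrib_right mult_ac case_prod_unfold)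
  then show ?thesis using assms(1) by simp
 qed
 have "(\<Sum>j\<le>k - i. c (i, j) * b ^ j) = 0" if "i <= k" for i b using polyfun_eq_0[of "%i. \<Sum>j\<le>k - i. c (i, j) * b ^ j" k] eq[of b] that by auto
 then have "c (i, j) = 0" if "i <= k" "j <= k - i" for i j using polyfun_eq_0[of "%j. c (i, j)" "k - i"] that by auto
 then show ?thesis using assms(2) by (cases ij) (auto simp: index2_def)
qed

subsection \<open>Riesz representation on finite-dimensional spaces\<close>

text \<open>On the unit vector of \<open>a\<close> plus \<open>s\<close> times the null vector the
  form is affine in \<open>s\<close> with slope \<open>2 * t\<close>; a nonzero slope would make it
  negative somewhere.\<close>

lemma psd_null_vector:
 fixes G :: "'i => 'i => real"
 assumes fin: "finite I" and a: "a \<notin> I" and sym: "!!i j. G i j = G j i"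
  and psd: "!!c. (\<Sum>i\<in>insert a I. \<Sum>j\<in>insert a I. c i * c j * G i j) \<ge> 0"
  and null: "(\<Sum>i\<in>I. \<Sum>j\<in>I. c i * c j * G i j) = 0"
 shows "(\<Sum>i\<in>I. c i * G i a) = 0"
proof (rule ccontr)
 define t where "t = (\<Sum>i\<in>I. c i * G i a)"
 assume "(\<Sum>i\<in>I. c i * G i a) ~= 0"
 then have t: "t ~= 0" by (simp add: t_def)
 have Q: "2 * s * t + G a a \<ge> 0" for s
 proof -
  define d where "d = (%i. if i = a then 1 else s * c i)"
  have d: "d a = 1" "!!i. i \<in> I ==> d i = s * c i" using a by (auto simp: d_def)
  have "(\<Sum>i\<in>insert a I. \<Sum>j\<in>insert a I. d i * d j * G i j)
   = G a a + (\<Sum>j\<in>I. d j * G a j) + (\<Sum>i\<in>I. d i * G i a) + (\<Sum>i\<in>I. \<Sum>j\<in>I. d i * d j * G i j)"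
   using fin a by (simp add: sum.distrib d(1) algebra_simps)
  also have "(\<Sum>j\<in>I. d j * G a j) = s * t" unfolding t_def sum_distrib_left by (intro sum.cong) (auto simp: d sym)
  also have "(\<Sum>i\<in>I. d i * G i a) = s * t" unfolding t_def sum_distrib_left by (intro sum.cong) (auto simp: d)
  also have "(\<Sum>i\<in>I. \<Sum>j\<in>I. d i * d j * G i j) = s^2 * (\<Sum>i\<in>I. \<Sum>j\<in>I. c i * c j * G i j)"
   unfolding sum_distrib_left by (intro sum.cong) (auto simp: d power2_eq_square)
  finally show ?thesis using psd[of d] null by simp
 qed
 have "2 * (- (G a a + 1) / (2 * t)) * t + G a a = -1" using t by (simp add: field_simps)
 then show False using Q[of "- (G a a + 1) / (2 * t)"] by simp
qed

text \<open>Elimination for a possibly singular Gram matrix. Solvability rests on the right-hand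
  side annihilating the null vectors of the form; the new index is eliminated with the help of a
  vector orthogonal to all the old ones.\<close>

lemma psd_system_solvable:
 fixes G :: "'i => 'i => real"
 assumes "finite I" and sym: "!!i j. G i j = G j i"
  and psd: "!!c. (\<Sum>i\<in>I. \<Sum>j\<in>I. c i * c j * G i j) \<ge> 0"
  and null: "!!c. (\<Sum>i\<in>I. \<Sum>j\<in>I. c i * c j * G i j) = 0 ==> (\<Sum>i\<in>I. c i * l i) = 0"
 shows "\<exists>w. \<forall>i\<in>I. (\<Sum>j\<in>I. w j * G i j) = l i" using assms(1) psd null
proof (induction I arbitrary: l rule: finite_induct)
 case empty
 then show ?case by simp
next
 case (insert a I)
 note psd = insert.prems(1) and null = insert.prems(2)
 have ext: "(\<Sum>i\<in>insert a I. \<Sum>j\<in>insert a I. (c(a := 0)) i * (c(a := 0)) j * G i j)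
  = (\<Sum>i\<in>I. \<Sum>j\<in>I. c i * c j * G i j)" for c
 proof -
  have "(\<Sum>i\<in>insert a I. \<Sum>j\<in>insert a I. (c(a := 0)) i * (c(a := 0)) j * G i j)
   = (\<Sum>i\<in>I. \<Sum>j\<in>I. (c(a := 0)) i * (c(a := 0)) j * G i j)" using insert.hyps by simp
  also have "... = (\<Sum>i\<in>I. \<Sum>j\<in>I. c i * c j * G i j)" using insert.hyps by (intro sum.cong) auto
  finally show ?thesis .
 qed
 have psdI: "(\<Sum>i\<in>I. \<Sum>j\<in>I. c i * c j * G i j) \<ge> 0" for c using psd[of "c(a := 0)"] unfolding ext .
 have nullI: "(\<Sum>i\<in>I. c i * l i) = 0" if "(\<Sum>i\<in>I. \<Sum>j\<in>I. c i * c j * G i j) = 0" for c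
 proof -
  have "(\<Sum>i\<in>insert a I. (c(a := 0)) i * l i) = 0" by (rule null) (simp only: ext that)
  moreover have "(\<Sum>i\<in>I. (c(a := 0)) i * l i) = (\<Sum>i\<in>I. c i * l i)" using insert.hyps by (intro sum.cong) auto
  ultimately show ?thesis using insert.hyps by simp
 qed
 obtain u where u: "!!i. i \<in> I ==> (\<Sum>j\<in>I. u j * G i j) = G i a" using insert.IH[of "%i. G i a"] psdI psd_null_vector[OF insert.hyps(1,2) sym psd] by blast
 obtain w where w: "!!i. i \<in> I ==> (\<Sum>j\<in>I. w j * G i j) = l i" using insert.IH[of l] psdI nullI by blast
 \<comment> \<open>Since \<open>u\<close> solves the old system for the column of \<open>a\<close>,
   this is the unit vector of \<open>a\<close> made orthogonal to the old unit vectors. Its own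
   energy is the Schur complement \<open>s\<close>.\<close>
 define e where "e = (%i. if i = a then 1 else - u i)"
 have e: "e a = 1" "!!i. i \<in> I ==> e i = - u i" using insert.hyps by (auto simp: e_def)
 define s where "s = G a a - (\<Sum>j\<in>I. u j * G a j)"
 have eG: "(\<Sum>j\<in>insert a I. e j * G i j) = (if i = a then s else 0)" if "i \<in> insert a I" for i
 proof -
  have "(\<Sum>j\<in>insert a I. e j * G i j) = G i a + (\<Sum>j\<in>I. e j * G i j)" using insert.hyps by (simp add: e)
  also have "(\<Sum>j\<in>I. e j * G i j) = - (\<Sum>j\<in>I. u j * G i j)" unfolding sum_negf[symmetric] by (intro sum.cong) (auto simp: e)
  finally show ?thesis using u[of i] that insert.hyps by (auto simp: s_def)
 qed
 have Qe: "(\<Sum>i\<in>insert a I. \<Sum>j\<in>insert a I. e i * e j * G i j) = s"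
 proof -
  have "(\<Sum>i\<in>insert a I. \<Sum>j\<in>insert a I. e i * e j * G i j) = (\<Sum>i\<in>insert a I. e i * (\<Sum>j\<in>insert a I. e j * G i j))"
   by (simp only: sum_distrib_left mult.assoc)
  also have "... = (\<Sum>i\<in>insert a I. e i * (if i = a then s else 0))" by (intro sum.cong) (auto simp only: eG)
  also have "... = s" using insert.hyps e(1) by (simp add: sum.delta' if_distrib cong: if_cong)
  finally show ?thesis .
 qed
 define w' where "w' = w(a := 0)"
 have w': "(\<Sum>j\<in>insert a I. w' j * G i j) = (\<Sum>j\<in>I. w j * G i j)" for i using insert.hyps by (simp add: w'_def) (intro sum.cong, auto)
 show ?case
 \<comment> \<open>If \<open>s\<close> vanishes, \<open>e\<close> is a null vector and the condition
   on \<open>l\<close> supplies the missing equation. Otherwise a multiple of \<open>e\<close>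
   corrects the equation for \<open>a\<close> without disturbing the others.\<close>
 proof (cases "s = 0")
  case True
  then have "(\<Sum>i\<in>insert a I. e i * l i) = 0" using null[of e] Qe by simp
  then have "l a = (\<Sum>i\<in>I. u i * l i)" using insert.hyps sum.cong[of I I "%i. e i * l i" "%i. - (u i * l i)"] by (simp add: e sum_negf)
  also have "... = (\<Sum>i\<in>I. \<Sum>j\<in>I. u i * (w j * G i j))" by (intro sum.cong) (auto simp: w[symmetric] sum_distrib_left)
  also have "... = (\<Sum>j\<in>I. w j * (\<Sum>i\<in>I. u i * G j i))" by (subst sum.swap) (simp add: sum_distrib_left sym mult_ac)
  also have "... = (\<Sum>j\<in>I. w j * G a j)" by (intro sum.cong) (auto simp: u sym)
  finally have "\<forall>i\<in>insert a I. (\<Sum>j\<in>insert a I. w' j * G i j) = l i" unfolding w' using w by auto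
  then show ?thesis by blast
 next
  case False
  define t where "t = (l a - (\<Sum>j\<in>I. w j * G a j)) / s"
  have "(\<Sum>j\<in>insert a I. (w' j + t * e j) * G i j) = l i" if "i \<in> insert a I" for i
  proof -
   have "(\<Sum>j\<in>insert a I. (w' j + t * e j) * G i j)
    = (\<Sum>j\<in>insert a I. w' j * G i j) + t * (\<Sum>j\<in>insert a I. e j * G i j)"
    unfolding sum_distrib_left sum.distrib[symmetric] by (intro sum.cong) (auto simp: algebra_simps)
   then show ?thesis unfolding w' eG[OF that] using w False that insert.hyps by (auto simp: t_def)
  qed
  then show ?thesis by (intro exI[of _ "%j. w' j + t * e j"]) blast
 qed
qed

text \<open>Positive semidefiniteness suffices, which covers restrictions of polynomials to a curve.\<close>

lemma poly2_Riesz: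
 fixes B :: "(real^2 => real) => (real^2 => real) => real"
 assumes sym: "!!p q. B p q = B q p"
  and add: "!!p q r. p \<in> poly2 k ==> q \<in> poly2 k ==> r \<in> poly2 k ==> B (%x. p x + q x) r = B p r + B q r"
  and scale: "!!a p r. p \<in> poly2 k ==> r \<in> poly2 k ==> B (%x. a * p x) r = a * B p r"
  and pos: "!!p. p \<in> poly2 k ==> B p p \<ge> 0"
  and ladd: "!!p q. p \<in> poly2 k ==> q \<in> poly2 k ==> l (%x. p x + q x) = l p + l q"
  and lscale: "!!a p. p \<in> poly2 k ==> l (%x. a * p x) = a * l p"
  and null: "!!p. p \<in> poly2 k ==> B p p = 0 ==> l p = 0"
 shows "\<exists>w\<in>poly2 k. \<forall>q\<in>poly2 k. B w q = l q"
proof -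
 have B0: "B (%x. 0) r = 0" if "r \<in> poly2 k" for r using scale[of "%x. 0" r 0] that by simp
 have l0: "l (%x. 0) = 0" using lscale[of "%x. 0" 0] by simp
 have Bs: "B (%x. \<Sum>i\<in>I. c i * p i x) r = (\<Sum>i\<in>I. c i * B (p i) r)"
  if "finite I" "!!i. i \<in> I ==> p i \<in> poly2 k" "r \<in> poly2 k" for I :: "(nat \<times> nat) set" and c p r using that
 proof (induction I rule: finite_induct)
  case (insert a I)
  then show ?case using add[of "%x. c a * p a x" "%x. \<Sum>i\<in>I. c i * p i x" r] scale[of "p a" r "c a"]
    poly2_sum[of I "%i x. c i * p i x"] poly2_scale by (simp add: poly2_sum)
 qed (simp add: B0)
 have ls: "l (%x. \<Sum>i\<in>I. c i * p i x) = (\<Sum>i\<in>I. c i * l (p i))" if "finite I" "!!i. i \<in> I ==> p i \<in> poly2 k" for I :: "(nat \<times> nat) set" and c p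
  using that
 proof (induction I rule: finite_induct)
  case (insert a I)
  then show ?case using ladd[of "%x. c a * p a x" "%x. \<Sum>i\<in>I. c i * p i x"] lscale[of "p a" "c a"] by (simp add: poly2_sum poly2_scale)
 qed (simp add: l0)
 let ?I = "index2 k"
 define G where "G i j = B (mono2 i) (mono2 j)" for i j
 define P where "P c = (%x. \<Sum>i\<in>?I. c i * mono2 i x)" for c
 have P: "P c \<in> poly2 k" for c by (auto simp: P_def poly2_iff)
 have BP: "B (P c) q = (\<Sum>i\<in>?I. c i * B (mono2 i) q)" if "q \<in> poly2 k" for c q unfolding P_def using that by (intro Bs) (auto intro: mono2_poly2)
 have BPP: "B (P c) (P d) = (\<Sum>i\<in>?I. \<Sum>j\<in>?I. c i * d j * G i j)" for c d
 proof -
  have "B (mono2 i) (P d) = (\<Sum>j\<in>?I. d j * G i j)" if "i \<in> ?I" for i using BP[OF mono2_poly2[OF that], of d] by (simp add: sym[of "mono2 i"] G_def)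
  then show ?thesis by (simp add: BP[OF P] sum_distrib_left mult.assoc)
 qed
 have lP: "l (P c) = (\<Sum>i\<in>?I. c i * l (mono2 i))" for c unfolding P_def by (intro ls) (auto intro: mono2_poly2)
 obtain w where w: "!!i. i \<in> ?I ==> (\<Sum>j\<in>?I. w j * G i j) = l (mono2 i)"
 proof -
  have "\<exists>w. \<forall>i\<in>?I. (\<Sum>j\<in>?I. w j * G i j) = l (mono2 i)"
   by (rule psd_system_solvable) (use sym pos[OF P] null[OF P] in \<open>auto simp: BPP lP G_def\<close>)
  then show ?thesis using that by blast
 qed
 have "B (P w) q = l q" if q: "q \<in> poly2 k" for q
 proof -
  obtain c where c: "q = P c" using q unfolding poly2_iff P_def by blast
  have "B (P w) q = B (P c) (P w)" by (simp add: c sym)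
  also have "... = (\<Sum>i\<in>?I. c i * (\<Sum>j\<in>?I. w j * G i j))" by (simp add: BPP sum_distrib_left mult.assoc)
  also have "... = l q" by (simp add: c lP w)
  finally show ?thesis .
 qed
 then show ?thesis using P by blast
qed

subsection \<open>Integrals over bounded sets\<close>

lemma integral_lebesgue_on:
 fixes f :: "'a::euclidean_space => 'b::{banach,second_countable_topology}"
 assumes "D \<in> sets lebesgue"
 shows "(LINT x|lebesgue_on D. f x) = (LINT x|lebesgue. indicator D x *\<^sub>R f x)" using assms by (simp add: integral_restrict_space)

lemma integrable_lebesgue_on_iff:
 fixes f :: "'a::euclidean_space => 'b::{banach,second_countable_topology}"
 assumes "D \<in> sets lebesgue"
 shows "integrable (lebesgue_on D) f \<longleftrightarrow> integrable lebesgue (%x. indicator D x *\<^sub>R f x)" using assms by (simp add: integrable_restrict_space)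

lemma integrable_on_bounded_continuous:
 fixes f :: "'a::euclidean_space => real"
 assumes "continuous_on UNIV f" "bounded D" "D \<in> sets lebesgue"
 shows "integrable (lebesgue_on D) f"
proof -
 have "compact (closure D)" using assms by (simp add: compact_closure)
 then have "bounded (f ` closure D)" using assms(1) by (meson compact_continuous_image compact_imp_bounded continuous_on_subset subset_UNIV)
 then obtain b where b: "!!x. x \<in> D ==> \<bar>f x\<bar> <= b" using closure_subset unfolding bounded_iff by fastforce
 have "D \<in> lmeasurable" using assms bounded_set_imp_lmeasurable by blast
 then have "finite_measure (lebesgue_on D)" by (rule finite_measure_lebesgue_on)
 then show ?thesis
 proof (rule finite_measure.integrable_const_bound[where B=b])
  show "AE x in lebesgue_on D. norm (f x) <= b" using b assms(3) by (intro AE_I2) auto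
  show "f \<in> borel_measurable (lebesgue_on D)" using borel_measurable_continuous_onI[OF assms(1)] by (simp add: measurable_completion measurable_restrict_space1)
 qed
qed

lemma poly2_integrable:
 "p \<in> poly2 k ==> bounded D ==> D \<in> sets lebesgue ==> integrable (lebesgue_on D) p" by (intro integrable_on_bounded_continuous continuous_poly2)

lemma poly2_L2_integrable:
 "p \<in> poly2 k ==> q \<in> poly2 k ==> bounded D ==> D \<in> sets lebesgue ==> integrable (lebesgue_on D) (%x. p x * q x)" by (rule poly2_integrable[OF poly2_mult])

text \<open>Vanishing almost everywhere makes the open set on which the polynomial is nonzero
  negligible, hence empty.\<close>

lemma poly2_L2_definite:
 assumes p: "p \<in> poly2 k" and D: "open D" "D ~= {}" "bounded D" and 0: "L2_inner D p p = 0"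
 shows "p x = 0"
proof -
 have Dm: "D \<in> sets lebesgue" using D by auto
 have "AE x in lebesgue_on D. p x * p x = 0" using 0 poly2_L2_integrable[OF p p D(3) Dm] by (subst integral_nonneg_eq_0_iff_AE[symmetric]) (auto simp: L2_inner_def)
 then have ae: "AE x in lebesgue. x \<in> D --> p x = 0" using Dm by (simp add: AE_restrict_space_iff)
 have "p x = 0" if x: "x \<in> D" for x
 proof (rule ccontr)
  assume "p x ~= 0"
  have o: "open (D \<inter> p -` (-{0}))" using continuous_open_preimage[OF continuous_poly2[OF p, of D] D(1), of "-{0}"] by auto
  moreover have "negligible (D \<inter> p -` (-{0}))"
  proof -
   have eq: "{x \<in> space lebesgue. \<not> (x \<in> D --> p x = 0)} = D \<inter> p -` (-{0})" by auto
   have "D \<inter> p -` (-{0}) \<in> sets lebesgue" using o by auto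
   then show ?thesis using ae AE_iff_null[of lebesgue "%x. x \<in> D --> p x = 0"] unfolding eq negligible_iff_null_sets by simp
  qed
  ultimately have "D \<inter> p -` (-{0}) = {}" using open_not_negligible by blast
  then show False using x \<open>p x ~= 0\<close> by auto
 qed
 then show ?thesis using poly2_eq_0_open[OF p D(1,2)] by blast
qed

lemma L2_inner_real: "L2_inner D f g = (LINT x|lebesgue_on D. f x * g x)" for f g :: "real^2 => real" by (simp add: L2_inner_def)

lemma poly2_L2_eqI:
 assumes D: "open D" "D ~= {}" "bounded D" and w: "w \<in> poly2 k" "w' \<in> poly2 k"
  and eq: "!!q. q \<in> poly2 k ==> L2_inner D w q = L2_inner D w' q"
 shows "w = w'"
proof -
 have Dm: "D \<in> sets lebesgue" using D by auto
 have d: "(%x. w x - w' x) \<in> poly2 k" using w by auto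
 have "L2_inner D (%x. w x - w' x) (%x. w x - w' x) = 0" using eq[OF d] poly2_L2_integrable[OF w(1) d D(3) Dm] poly2_L2_integrable[OF w(2) d D(3) Dm]
  by (simp add: L2_inner_real left_diff_distrib)
 from poly2_L2_definite[OF d D this] have "w x = w' x" for x by simp
 then show ?thesis by (rule ext)
qed

text \<open>Uniqueness, from definiteness on a nonempty open set, is what gives meaning to the
  definite descriptions in \<open>L2_proj\<close>.\<close>

lemma poly2_L2_Riesz:
 assumes D: "open D" "D ~= {}" "bounded D"
  and ladd: "!!p q. p \<in> poly2 k ==> q \<in> poly2 k ==> l (%x. p x + q x) = l p + l q"
  and lscale: "!!a p. p \<in> poly2 k ==> l (%x. a * p x) = a * l p"
 shows "\<exists>!w. w \<in> poly2 k & (\<forall>q\<in>poly2 k. L2_inner D w q = l q)"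
proof -
 have Dm: "D \<in> sets lebesgue" using D by auto
 note int = poly2_L2_integrable[OF _ _ D(3) Dm]
 have add: "L2_inner D (%x. p x + q x) r = L2_inner D p r + L2_inner D q r" if "p \<in> poly2 k" "q \<in> poly2 k" "r \<in> poly2 k" for p q r
  using int[of p k r] int[of q k r] that by (simp add: L2_inner_real distrib_right)
 have scale: "L2_inner D (%x. a * p x) r = a * L2_inner D p r" for a p r by (simp add: L2_inner_real mult.assoc)
 have ex: "\<exists>w\<in>poly2 k. \<forall>q\<in>poly2 k. L2_inner D w q = l q"
 proof (rule poly2_Riesz)
  fix p assume p: "p \<in> poly2 k" "L2_inner D p p = 0"
  have "p = (%x. 0)" using poly2_L2_definite[OF p(1) D p(2)] by (intro ext)
  then show "l p = 0" using lscale[of "%x. 0" 0] by simp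
 qed (use add scale ladd lscale in \<open>auto simp: L2_inner_real mult.commute\<close>)
 show ?thesis
 proof (rule ex_ex1I)
  show "\<exists>w. w \<in> poly2 k & (\<forall>q\<in>poly2 k. L2_inner D w q = l q)" using ex by blast
  fix w w' assume "w \<in> poly2 k & (\<forall>q\<in>poly2 k. L2_inner D w q = l q)"
   "w' \<in> poly2 k & (\<forall>q\<in>poly2 k. L2_inner D w' q = l q)"
  then show "w = w'" by (intro poly2_L2_eqI[OF D]) auto
 qed
qed

lemma L2_inner_vec:
 fixes w q :: "real^2 => real^2"
 assumes "!!i. integrable (lebesgue_on D) (%x. (w x $ i) * (q x $ i))"
 shows "L2_inner D w q = (\<Sum>i\<in>UNIV. L2_inner D (%x. w x $ i) (%x. q x $ i))"
proof -
 have "L2_inner D w q = (LINT x|lebesgue_on D. (\<Sum>i\<in>UNIV. (w x $ i) * (q x $ i)))" by (simp only: L2_inner_def inner_vec_def inner_real_def)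
 also have "... = (\<Sum>i\<in>UNIV. LINT x|lebesgue_on D. (w x $ i) * (q x $ i))" by (rule BI_integral_sum) (rule assms)
 finally show ?thesis by (simp only: L2_inner_real)
qed

lemma vpoly2_nth: "q \<in> vpoly2 k ==> (%x. q x $ i) \<in> poly2 k" by (simp add: vpoly2_def)

lemma vpoly2_diff: "p \<in> vpoly2 k ==> q \<in> vpoly2 k ==> (%x. p x - q x) \<in> vpoly2 k" by (auto simp: vpoly2_def)

lemma vpoly2_axis: "p \<in> poly2 k ==> (%x. axis i (p x)) \<in> vpoly2 k" unfolding vpoly2_def
proof (intro CollectI allI)
 fix j assume "p \<in> poly2 k"
 then show "(%x. axis i (p x) $ j) \<in> poly2 k" by (cases "j = i") (auto simp: axis_def)
qed

lemma vpoly2_L2_integrable: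
 assumes "w \<in> vpoly2 k" "q \<in> vpoly2 k" "bounded D" "D \<in> sets lebesgue"
 shows "integrable (lebesgue_on D) (%x. (w x $ i) * (q x $ i))" using assms by (intro poly2_L2_integrable vpoly2_nth)

lemma vpoly2_L2_eqI:
 assumes D: "open D" "D ~= {}" "bounded D" and w: "w \<in> vpoly2 k" "w' \<in> vpoly2 k"
  and eq: "!!q. q \<in> vpoly2 k ==> L2_inner D w q = L2_inner D w' q"
 shows "w = w'"
proof -
 have ax: "L2_inner D V (%x. axis i (p x)) = L2_inner D (%x. V x $ i) p" for V :: "real^2 => real^2" and i p by (simp add: L2_inner_def inner_axis)
 have "(%x. w x $ i) = (%x. w' x $ i)" for i by (rule poly2_L2_eqI[OF D, where k=k]) (use w vpoly2_nth eq[OF vpoly2_axis] in \<open>auto simp: ax\<close>)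
 then have "w x $ i = w' x $ i" for x i by (rule fun_cong)
 then show ?thesis by (simp add: vec_eq_iff fun_eq_iff)
qed

text \<open>Test fields along a single axis determine each component of the representer. The
  functional is kept general because it also serves the weak gradient.\<close>

lemma vpoly2_L2_Riesz:
 assumes D: "open D" "D ~= {}" "bounded D"
  and ladd: "!!p q. p \<in> vpoly2 k ==> q \<in> vpoly2 k ==> l (%x. p x + q x) = l p + l q"
  and lscale: "!!a p. p \<in> vpoly2 k ==> l (%x. a *\<^sub>R p x) = a * l p"
 shows "\<exists>!w. w \<in> vpoly2 k & (\<forall>q\<in>vpoly2 k. L2_inner D w q = l q)"
proof -
 have Dm: "D \<in> sets lebesgue" using D by auto
 have ax: "axis i (a + b) = axis i a + axis i b" "axis i (c * a) = c *\<^sub>R axis i a" for i :: 2 and a b c :: real by (auto simp: axis_def vec_eq_iff)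
 have "\<exists>w. w \<in> poly2 k & (\<forall>q\<in>poly2 k. L2_inner D w q = l (%x. axis i (q x)))" for i :: 2 by (rule ex1_implies_ex, rule poly2_L2_Riesz[OF D])
   (use ladd lscale in \<open>auto simp: ax vpoly2_axis\<close>)
 then obtain w where w: "!!i. w i \<in> poly2 k" "!!i q. q \<in> poly2 k ==> L2_inner D (w i) q = l (%x. axis i (q x))" by metis
 define W where "W x = (\<chi> i. w i x)" for x
 have W: "W \<in> vpoly2 k" using w by (simp add: vpoly2_def W_def)
 have Wq: "L2_inner D W q = l q" if q: "q \<in> vpoly2 k" for q
 proof -
  have "L2_inner D W q = (\<Sum>i\<in>UNIV. L2_inner D (w i) (%x. q x $ i))" using L2_inner_vec[OF vpoly2_L2_integrable[OF W q D(3) Dm]] by (simp add: W_def[abs_def])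
  also have "... = l (%x. axis 1 (q x $ 1)) + l (%x. axis 2 (q x $ 2))" using w(2) vpoly2_nth[OF q] by (simp add: sum_2)
  also have "... = l (%x. axis 1 (q x $ 1) + axis 2 (q x $ 2))" by (intro ladd[symmetric] vpoly2_axis vpoly2_nth q)
  also have "(%x. axis 1 (q x $ 1) + axis 2 (q x $ 2)) = q" by (auto simp: vec_eq_iff axis_def forall_2)
  finally show ?thesis .
 qed
 show ?thesis
 proof (rule ex_ex1I)
  show "\<exists>w. w \<in> vpoly2 k & (\<forall>q\<in>vpoly2 k. L2_inner D w q = l q)" using W Wq by blast
  fix w w' assume "w \<in> vpoly2 k & (\<forall>q\<in>vpoly2 k. L2_inner D w q = l q)"
   "w' \<in> vpoly2 k & (\<forall>q\<in>vpoly2 k. L2_inner D w' q = l q)"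
  then show "w = w'" by (intro vpoly2_L2_eqI[OF D]) auto
 qed
qed

subsection \<open>Inverse inequality\<close>

lemma L2_inner_Cauchy_Schwarz:
 fixes f g :: "real^2 => real"
 assumes "integrable (lebesgue_on D) (%x. f x * f x)" "integrable (lebesgue_on D) (%x. f x * g x)"
  "integrable (lebesgue_on D) (%x. g x * g x)"
 shows "\<bar>L2_inner D f g\<bar> <= L2_norm D f * L2_norm D g"
proof -
 define a b c where "a = L2_inner D f f" and "b = L2_inner D f g" and "c = L2_inner D g g"
 have a0: "a \<ge> 0" and c0: "c \<ge> 0" by (simp_all add: a_def c_def L2_inner_def)
 have Q: "a - 2 * t * b + t^2 * c \<ge> 0" for t
 proof -
  have "0 <= (LINT x|lebesgue_on D. (f x - t * g x)^2)" by simp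
  also have "(%x. (f x - t * g x)^2) = (%x. f x * f x - 2 * t * (f x * g x) + t^2 * (g x * g x))" by (auto simp: power2_eq_square algebra_simps)
  also have "(LINT x|lebesgue_on D. f x * f x - 2 * t * (f x * g x) + t^2 * (g x * g x)) = a - 2 * t * b + t^2 * c" using assms by (simp add: a_def b_def c_def L2_inner_real)
  finally show ?thesis .
 qed
 have "b^2 <= a * c"
 proof (cases "c = 0")
  case True
  \<comment> \<open>With \<open>c = 0\<close> and \<open>b\<close> nonzero, this value of
    \<open>t\<close> would make the nonnegative quadratic equal to -1.\<close>
  then have "b = 0" using Q[of "(a + 1) / (2 * b)"] by (cases "b = 0") auto
  then show ?thesis using True by simp
 next
  case False
  then have "a - 2 * (b / c) * b + (b / c)^2 * c = a - b^2 / c" by (simp add: power2_eq_square field_simps)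
  then have "b^2 / c <= a" using Q[of "b / c"] by simp
  then show ?thesis using False c0 by (simp add: pos_divide_le_eq)
 qed
 then have "\<bar>b\<bar> <= sqrt (a * c)" by (simp add: real_le_rsqrt)
 then show ?thesis by (simp add: L2_norm_def a_def b_def c_def real_sqrt_mult)
qed

lemma L2_norm_nonneg [simp]: "L2_norm D f \<ge> 0" by (simp add: L2_norm_def L2_inner_def)

lemma L2_norm_square: "(L2_norm D f)^2 = L2_inner D f f" by (simp add: L2_norm_def L2_inner_def)

text \<open>Each coefficient is a linear functional of the polynomial, hence the inner product with
  a fixed \<open>w ij\<close> over the small ball. Cauchy--Schwarz bounds the coefficients, and the
  monomials are at most 1 on the unit ball.\<close>

lemma poly2_unit_ball_bound:
 assumes \<rho>: "\<rho> > 0"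
 shows "\<exists>K>0. \<forall>p\<in>poly2 k. \<forall>x\<in>cball 0 1. \<bar>p x\<bar> <= K * L2_norm (ball 0 \<rho>) p"
proof -
 let ?D = "ball (0::real^2) \<rho>"
 have D: "open ?D" "?D ~= {}" "bounded ?D" "?D \<in> sets lebesgue" using \<rho> by auto
 \<comment> \<open>The coefficients are picked by choice; they depend linearly on the polynomial
   because the monomials are independent.\<close>
 have "\<exists>c. \<forall>p\<in>poly2 k. p = (%x. \<Sum>ij\<in>index2 k. c p ij * mono2 ij x)" by (intro bchoice ballI) (simp add: poly2_iff)
 then obtain c where c: "!!p. p \<in> poly2 k ==> p = (%x. \<Sum>ij\<in>index2 k. c p ij * mono2 ij x)" by blast
 have uniq: "c p ij = d ij" if p: "p \<in> poly2 k" "!!x. p x = (\<Sum>ij\<in>index2 k. d ij * mono2 ij x)" "ij \<in> index2 k" for p d ij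
 proof -
  have "(\<Sum>ij\<in>index2 k. (c p ij - d ij) * mono2 ij x) = 0" for x using fun_cong[OF c[OF p(1)], of x] p(2)[of x] by (simp add: left_diff_distrib sum_subtractf)
  then show ?thesis using mono2_independent[of "%ij. c p ij - d ij" k ij] p(3) by auto
 qed
 have add: "c (%x. p x + q x) ij = c p ij + c q ij" if "p \<in> poly2 k" "q \<in> poly2 k" "ij \<in> index2 k" for p q ij
 proof (rule uniq[OF poly2_add[OF that(1,2)] _ that(3)])
  fix x
  have "p x + q x = (\<Sum>ij\<in>index2 k. c p ij * mono2 ij x) + (\<Sum>ij\<in>index2 k. c q ij * mono2 ij x)"
   by (rule arg_cong2[where f="(+)", OF fun_cong[OF c[OF that(1)]] fun_cong[OF c[OF that(2)]]])
  then show "p x + q x = (\<Sum>ij\<in>index2 k. (c p ij + c q ij) * mono2 ij x)" by (simp add: distrib_right sum.distrib)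
 qed
 have scale: "c (%x. a * p x) ij = a * c p ij" if "p \<in> poly2 k" "ij \<in> index2 k" for p a ij
 proof (rule uniq[OF poly2_scale[OF that(1)] _ that(2)])
  fix x
  have "a * p x = a * (\<Sum>ij\<in>index2 k. c p ij * mono2 ij x)" by (rule arg_cong[where f="(*) a", OF fun_cong[OF c[OF that(1)]]])
  then show "a * p x = (\<Sum>ij\<in>index2 k. (a * c p ij) * mono2 ij x)" by (simp add: sum_distrib_left mult.assoc)
 qed
 have "\<exists>w. w \<in> poly2 k & (\<forall>q\<in>poly2 k. L2_inner ?D w q = c q ij)" if "ij \<in> index2 k" for ij
  by (rule ex1_implies_ex, rule poly2_L2_Riesz[OF D(1-3)]) (use add scale that in auto)
 then obtain w where w: "!!ij. ij \<in> index2 k ==> w ij \<in> poly2 k"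
  "!!ij q. ij \<in> index2 k ==> q \<in> poly2 k ==> L2_inner ?D (w ij) q = c q ij" by metis
 define K where "K = 1 + (\<Sum>ij\<in>index2 k. L2_norm ?D (w ij))"
 have "\<bar>p x\<bar> <= K * L2_norm ?D p" if p: "p \<in> poly2 k" and x: "x \<in> cball 0 1" for p x
 proof -
  have m: "\<bar>mono2 ij x\<bar> <= 1" for ij
  proof -
   have "\<bar>x $ i\<bar> <= 1" for i using x component_le_norm_cart[of x i] by simp
   then show ?thesis by (auto simp: mono2_def abs_mult power_abs intro!: mult_le_one power_le_one)
  qed
  have cb: "\<bar>c p ij\<bar> <= L2_norm ?D (w ij) * L2_norm ?D p" if "ij \<in> index2 k" for ij unfolding w(2)[OF that p, symmetric] using w(1)[OF that] p D
   by (intro L2_inner_Cauchy_Schwarz poly2_L2_integrable) auto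
  have "\<bar>p x\<bar> <= (\<Sum>ij\<in>index2 k. \<bar>c p ij * mono2 ij x\<bar>)" by (subst c[OF p]) (rule sum_abs)
  also have "... <= (\<Sum>ij\<in>index2 k. (L2_norm ?D (w ij) * L2_norm ?D p) * 1)" unfolding abs_mult by (intro sum_mono mult_mono cb m) auto
  also have "... <= K * L2_norm ?D p" by (simp add: K_def sum_distrib_right[symmetric] distrib_right)
  finally show ?thesis .
 qed
 moreover have "K > 0" by (simp add: K_def sum_nonneg add_pos_nonneg)
 ultimately show ?thesis by blast
qed

lemma integral_affine:
 fixes f :: "'a::euclidean_space => real"
 assumes "f \<in> borel_measurable borel" "c ~= 0"
 shows "(LINT x|lborel. f x) = \<bar>c\<bar> ^ DIM('a) * (LINT x|lborel. f (z + c *\<^sub>R x))" using assms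
proof -
 have "(LINT x|lborel. f x) = integral\<^sup>L (density (distr lborel borel (%x. z + c *\<^sub>R x)) (%_. ennreal (\<bar>c\<bar> ^ DIM('a)))) f"
  by (rule arg_cong[where f="%M. integral\<^sup>L M f", OF lborel_affine[OF assms(2), of z]])
 also have "... = (LINT x|distr lborel borel (%x. z + c *\<^sub>R x). \<bar>c\<bar> ^ DIM('a) * f x)" using assms(1) by (subst integral_density) auto
 also have "... = (LINT x|lborel. \<bar>c\<bar> ^ DIM('a) * f (z + c *\<^sub>R x))" using assms(1) by (subst integral_distr) auto
 finally show ?thesis by simp
qed

lemma L2_norm_affine:
 fixes f :: "real^2 => real"
 assumes f: "continuous_on UNIV f" and h: "h > 0"
 shows "L2_norm (ball z (\<rho> * h)) f = h * L2_norm (ball 0 \<rho>) (%x. f (z + h *\<^sub>R x))"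
proof -
 have fm[measurable]: "f \<in> borel_measurable borel" using borel_measurable_continuous_onI[OF f] .
 have bm: "(%x. indicator (ball z r) x * (f x)^2) \<in> borel_measurable borel" if "f \<in> borel_measurable borel" for z :: "real^2" and r and f :: "real^2 => real"
  using that by (intro borel_measurable_times borel_measurable_indicator borel_measurable_power) simp_all
 have eq: "L2_inner (ball z r) f f = (LINT x|lborel. indicator (ball z r) x * (f x)^2)" if "f \<in> borel_measurable borel" for z :: "real^2" and r and f :: "real^2 => real"
 proof -
  have "(%x. indicator (ball z r) x * (f x)^2) \<in> borel_measurable lborel"  using bm[OF that] by simp
  then show ?thesis unfolding L2_inner_real by (subst integral_lebesgue_on) (simp_all add: integral_completion power2_eq_square)
 qed
 have "L2_inner (ball z (\<rho> * h)) f f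
   = h^2 * (LINT x|lborel. indicator (ball z (\<rho> * h)) (z + h *\<^sub>R x) * (f (z + h *\<^sub>R x))^2)"
  using h by (subst eq[OF fm], subst integral_affine[OF bm[OF fm], where z=z and c=h]) auto
 also have "(%x. indicator (ball z (\<rho> * h)) (z + h *\<^sub>R x) * (f (z + h *\<^sub>R x))^2)
  = (%x. indicator (ball 0 \<rho>) x * (f (z + h *\<^sub>R x))^2)" using h by (auto simp: indicator_def dist_norm mult.commute[of \<rho>])
 also have "(LINT x|lborel. indicator (ball 0 \<rho>) x * (f (z + h *\<^sub>R x))^2)
  = L2_inner (ball 0 \<rho>) (%x. f (z + h *\<^sub>R x)) (%x. f (z + h *\<^sub>R x))" by (subst eq) auto
 finally show ?thesis using h by (simp add: L2_norm_def real_sqrt_mult)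
qed

text \<open>Scaling from the unit ball; \<open>1/h\<close> is the scaling factor of the
  \<open>L2\<close> norm in two dimensions. The constant is quantified before \<open>z\<close> and
  \<open>h\<close>, so it depends on \<open>\<rho>\<close> and \<open>k\<close> only.\<close>

theorem inverse_inequality:
 assumes \<rho>: "\<rho> > 0"
 shows "\<exists>K>0. \<forall>z h. \<forall>p\<in>poly2 k. h > 0 --> (\<forall>x\<in>cball z h. \<bar>p x\<bar> <= K / h * L2_norm (ball z (\<rho> * h)) p)"
proof -
 obtain K where K: "K > 0" "!!p x. p \<in> poly2 k ==> x \<in> cball 0 1 ==> \<bar>p x\<bar> <= K * L2_norm (ball 0 \<rho>) p" using poly2_unit_ball_bound[OF \<rho>, of k] by blast
 have "\<bar>p x\<bar> <= K / h * L2_norm (ball z (\<rho> * h)) p" if "p \<in> poly2 k" "h > 0" "x \<in> cball z h" for p x z h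
 proof -
  have "(1/h) *\<^sub>R (x - z) \<in> cball 0 1" using that by (simp add: dist_norm norm_minus_commute)
  then have "\<bar>p (z + h *\<^sub>R ((1/h) *\<^sub>R (x - z)))\<bar> <= K * L2_norm (ball 0 \<rho>) (%x. p (z + h *\<^sub>R x))" by (intro K(2)[OF poly2_affine[OF that(1)]])
  then show ?thesis using that L2_norm_affine[OF continuous_poly2[OF that(1)] that(2), of z \<rho>] by simp
 qed
 then show ?thesis using K(1) by blast
qed

subsection \<open>Projections on a side\<close>

definition lip_arc :: "(real => real^2) => bool" where
 "lip_arc gm \<longleftrightarrow> arc gm & (\<exists>L. L-lipschitz_on {0..1} gm)"

abbreviation speed :: "(real => real^2) => real => real" where
 "speed gm t \<equiv> norm (vector_derivative gm (at t))"

abbreviation I01 :: "real measure" where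
 "I01 \<equiv> lebesgue_on {0..1}"

text \<open>Derivatives of a path are known at interior parameters only; the two end points form a
  null set.\<close>

lemma AE_I01: "(AE t in I01. P t) \<longleftrightarrow> (AE t in lebesgue. t \<in> {0<..<1} --> P t)"
proof -
 have "{0, 1::real} \<in> null_sets lebesgue" by (simp flip: negligible_iff_null_sets)
 then have "AE t in lebesgue. t \<notin> {0, 1::real}" by (rule AE_not_in)
 then have "(AE t in lebesgue. t \<in> {0..1} --> P t) \<longleftrightarrow> (AE t in lebesgue. t \<in> {0<..<1} --> P t)"
 proof (intro iffI)
  assume a: "AE t in lebesgue. t \<notin> {0, 1::real}" "AE t in lebesgue. t \<in> {0..1} --> P t"
  from a(2) show "AE t in lebesgue. t \<in> {0<..<1} --> P t" by eventually_elim auto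
 next
  assume a: "AE t in lebesgue. t \<notin> {0, 1::real}" "AE t in lebesgue. t \<in> {0<..<1} --> P t"
  then show "AE t in lebesgue. t \<in> {0..1} --> P t" by eventually_elim force
 qed
 then show ?thesis by (subst AE_restrict_space_iff) auto
qed

lemma lip_arc_derivative:
 assumes "lip_arc gm"
 obtains g L where "g \<in> borel_measurable borel"
  "!!a b. 0 <= a ==> a <= b ==> b <= 1 ==> (g has_integral gm b - gm a) {a..b}"
  "AE t in I01. (gm has_vector_derivative g t) (at t)"
  "AE t in I01. vector_derivative gm (at t) = g t"
  "AE t in I01. norm (g t) <= L"
proof -
 obtain L where "L-lipschitz_on {0..1} gm" using assms by (auto simp: lip_arc_def)
 from Lipschitz_path_differentiable_AE[OF this] obtain g where g: "g \<in> borel_measurable borel"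
  "!!a b. 0 <= a ==> a <= b ==> b <= 1 ==> (g has_integral gm b - gm a) {a..b}"
  "AE t in lebesgue. t \<in> {0<..<1} --> (gm has_vector_derivative g t) (at t) & norm (g t) <= L" by blast
 have 3: "AE t in I01. (gm has_vector_derivative g t) (at t) & norm (g t) <= L" unfolding AE_I01 using g(3) .
 show ?thesis
 proof (rule that[OF g(1,2)])
  show "AE t in I01. vector_derivative gm (at t) = g t" using 3 by eventually_elim (auto simp: vector_derivative_at)
 qed (use 3 in auto)
qed

text \<open>Completeness of Lebesgue measure: functions with unspecified values on a null set, such
  as \<open>vector_derivative\<close> along a Lipschitz path, remain measurable.\<close>

lemma borel_measurable_lebesgue_on_AE:
 fixes f g :: "'a::euclidean_space => 'b::euclidean_space"
 assumes S: "S \<in> sets lebesgue" and f: "f \<in> borel_measurable (lebesgue_on S)" and ae: "AE x in lebesgue_on S. f x = g x"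
 shows "g \<in> borel_measurable (lebesgue_on S)"
proof -
 have "(%x. if x \<in> S then f x else 0) \<in> borel_measurable lebesgue" using f S by (simp add: borel_measurable_if)
 moreover have "AE x in lebesgue. (if x \<in> S then f x else 0) = (if x \<in> S then g x else 0)" using ae S by (simp add: AE_restrict_space_iff)
 ultimately have "(%x. if x \<in> S then g x else 0) \<in> borel_measurable lebesgue" by (rule borel_measurable_AE)
 then show ?thesis using S by (simp add: borel_measurable_if)
qed

lemma borel_measurable_I01: "g \<in> borel_measurable borel ==> g \<in> borel_measurable I01" by (simp add: measurable_completion measurable_restrict_space1)

lemma vector_derivative_measurable:
 assumes "lip_arc gm"
 shows "(%t. vector_derivative gm (at t)) \<in> borel_measurable I01"
proof -
 obtain g where g: "g \<in> borel_measurable borel" "AE t in I01. vector_derivative gm (at t) = g t" by (rule lip_arc_derivative[OF assms], rule that; assumption)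
 show ?thesis by (rule borel_measurable_lebesgue_on_AE[OF _ borel_measurable_I01[OF g(1)]]) (use g(2) in \<open>auto elim: eventually_mono\<close>)
qed

lemma finite_measure_I01: "finite_measure I01" by (rule finite_measure_lebesgue_on) simp

lemma speed_integrable:
 assumes gm: "lip_arc gm" and u: "u \<in> borel_measurable I01" "AE t in I01. \<bar>u t\<bar> <= M"
 shows "integrable I01 (%t. u t * speed gm t)"
proof -
 obtain g L where g: "AE t in I01. vector_derivative gm (at t) = g t" "AE t in I01. norm (g t) <= L" by (rule lip_arc_derivative[OF gm], rule that; assumption)
 show ?thesis
 proof (rule finite_measure.integrable_const_bound[OF finite_measure_I01, where B="\<bar>M\<bar> * \<bar>L\<bar>"])
  show "AE t in I01. norm (u t * speed gm t) <= \<bar>M\<bar> * \<bar>L\<bar>" using g u(2) by eventually_elim (auto simp: abs_mult intro!: mult_mono)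
  show "(%t. u t * speed gm t) \<in> borel_measurable I01" using u(1) vector_derivative_measurable[OF gm] by measurable
 qed
qed

lemma continuous_I01:
 fixes u :: "real => real"
 assumes "continuous_on {0..1} u"
 obtains M where "u \<in> borel_measurable I01" "!!t. t \<in> {0..1} ==> \<bar>u t\<bar> <= M"
proof -
 have "bounded (u ` {0..1})" using assms compact_continuous_image compact_imp_bounded by blast
 then obtain M where "\<forall>x\<in>u ` {0..1}. norm x <= M" unfolding bounded_iff by blast
 then have M: "\<bar>u t\<bar> <= M" if "t \<in> {0..1}" for t using that by auto
 have "u \<in> borel_measurable I01" using assms by (intro continuous_imp_measurable_on_sets_lebesgue) auto
 then show ?thesis using M by (rule that)
qed

lemma speed_integrable_continuous:
 assumes gm: "lip_arc gm" and u: "continuous_on {0..1} u"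
 shows "integrable I01 (%t. u t * speed gm t)"
proof -
 obtain M where "u \<in> borel_measurable I01" "!!t. t \<in> {0..1} ==> \<bar>u t\<bar> <= M" using continuous_I01[OF u] by blast
 then show ?thesis by (intro speed_integrable[OF gm, where M=M]) (auto intro!: AE_I2)
qed

text \<open>The speed may vanish on a set of positive measure, but not almost everywhere on an interval,
 since the path is injective.\<close>

lemma speed_nondegenerate:
 assumes gm: "lip_arc gm" and u: "continuous_on {0..1} u" and 0: "AE t in I01. u t * speed gm t = 0"
  and t: "t \<in> {0..1}"
 shows "u t = (0::real)"
proof (rule ccontr)
 assume ut: "u t ~= 0"
 obtain g where g: "!!a b. 0 <= a ==> a <= b ==> b <= 1 ==> (g has_integral gm b - gm a) {a..b}"
  "AE t in I01. vector_derivative gm (at t) = g t" by (rule lip_arc_derivative[OF gm], rule that; assumption)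
 obtain d where d: "d > 0" "!!s. s \<in> {0..1} ==> dist s t < d ==> dist (u s) (u t) < \<bar>u t\<bar>" using u t ut unfolding continuous_on_iff by (metis zero_less_abs_iff)
 define a b where "a = max 0 (t - d/2)" and "b = min 1 (t + d/2)"
 have ab: "0 <= a" "a < b" "b <= 1" using d(1) t by (auto simp: a_def b_def)
 have nz: "u s ~= 0" if "s \<in> {a..b}" for s
 proof -
  have "dist (u s) (u t) < \<bar>u t\<bar>" using that d(1) ab by (intro d(2)) (auto simp: a_def b_def dist_real_def)
  then show ?thesis by (auto simp: dist_real_def)
 qed
 have "AE s in I01. s \<in> {a..b} --> g s = 0" using 0 g(2) by eventually_elim (use nz in auto)
 then have "AE s in lebesgue. s \<in> {0<..<1} \<inter> {a..b} --> g s = 0" unfolding AE_I01 by (auto elim: eventually_mono)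
 then obtain N where N: "N \<in> null_sets lebesgue" "!!s. s \<notin> N ==> s \<in> {0<..<1} \<inter> {a..b} --> g s = 0" by (rule AE_E3) auto
 have "(g has_integral 0) {a..b}"
 proof (rule has_integral_negligible[of "N \<union> {0, 1}"])
  show "negligible (N \<union> {0, 1})" using N by (auto simp: negligible_iff_null_sets[symmetric] intro!: negligible_Un)
  show "g s = 0" if "s \<in> {a..b} - (N \<union> {0, 1})" for s using N(2)[of s] that ab by auto
 qed
 then have "gm b = gm a" using g(1)[of a b] ab has_integral_unique[of g _ "{a..b}"] by fastforce
 then show False using gm ab unfolding lip_arc_def arc_def inj_on_def by force
qed

lemma path_image_mem: "t \<in> {0..1} ==> gm t \<in> path_image gm" by (simp add: path_image_def)

lemma side_integral_cong:
 "(!!t. t \<in> {0..1} ==> f (gm t) = g (gm t)) ==> side_integral gm f = side_integral gm g" unfolding side_integral_def by (intro BI_integral_cong) auto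

lemma poly2_path_continuous: "lip_arc gm ==> p \<in> poly2 k ==> continuous_on {0..1} (%t. p (gm t))"
 using continuous_on_compose2[OF continuous_poly2[of p k UNIV]] by (auto simp: lip_arc_def arc_def path_def)

lemma side_proj_exists:
 assumes gm: "lip_arc gm" and f: "continuous_on {0..1} (%t. f (gm t))"
 obtains p where "p \<in> poly2 k" "side_proj k gm f = restrict p (path_image gm)"
  "!!q. q \<in> poly2 k ==> (LINT t|I01. p (gm t) * q (gm t) * speed gm t) = (LINT t|I01. f (gm t) * q (gm t) * speed gm t)"
proof -
 note cp = poly2_path_continuous[OF gm]
 define B where "B p q = (LINT t|I01. p (gm t) * q (gm t) * speed gm t)" for p q :: "real^2 => real"
 define l where "l q = (LINT t|I01. f (gm t) * q (gm t) * speed gm t)" for q :: "real^2 => real"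
 have iB: "integrable I01 (%t. p (gm t) * q (gm t) * speed gm t)" if "p \<in> poly2 k" "q \<in> poly2 k" for p q
  by (intro speed_integrable_continuous[OF gm] continuous_intros cp[OF that(1)] cp[OF that(2)])
 have il: "integrable I01 (%t. f (gm t) * q (gm t) * speed gm t)" if "q \<in> poly2 k" for q by (intro speed_integrable_continuous[OF gm] continuous_intros cp[OF that] f)
 have B0: "AE t in I01. p (gm t) * speed gm t = 0" if "p \<in> poly2 k" "B p p = 0" for p
 proof -
  have "AE t in I01. p (gm t) * p (gm t) * speed gm t = 0" using that(2) iB[OF that(1) that(1)] unfolding B_def by (subst integral_nonneg_eq_0_iff_AE[symmetric]) auto
  then show ?thesis by eventually_elim auto
 qed
 have addB: "B (%x. p x + q x) r = B p r + B q r" if "p \<in> poly2 k" "q \<in> poly2 k" "r \<in> poly2 k" for p q r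
  using iB[of p r] iB[of q r] that by (simp add: B_def distrib_right)
 have scaleB: "B (%x. a * p x) r = a * B p r" for a p r by (simp add: B_def mult.assoc)
 have "\<exists>w\<in>poly2 k. \<forall>q\<in>poly2 k. B w q = l q"
 proof (rule poly2_Riesz)
  show "l (%x. p x + q x) = l p + l q" if "p \<in> poly2 k" "q \<in> poly2 k" for p q using il[of p] il[of q] that by (simp add: l_def distrib_left distrib_right)
  show "l (%x. a * p x) = a * l p" for a p by (simp add: l_def mult_ac)
  show "B p p \<ge> 0" for p by (simp add: B_def)
  show "B p q = B q p" for p q by (simp add: B_def mult_ac)
  \<comment> \<open>A null polynomial of the form vanishes wherever the speed does not, so the
    right-hand side does not see it: this is the compatibility condition for a semidefinite
    form.\<close>
  fix p assume p: "p \<in> poly2 k" "B p p = 0"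
  have "AE t in I01. f (gm t) * p (gm t) * speed gm t = 0" using B0[OF p] by eventually_elim auto
  then show "l p = 0" unfolding l_def by (simp add: integral_eq_zero_AE)
 qed (use addB scaleB in auto)
 then obtain w where w: "w \<in> poly2 k" "!!q. q \<in> poly2 k ==> B w q = l q" by blast
 let ?e = "path_image gm"
 have Br: "side_integral gm (%x. restrict p ?e x * restrict r ?e x) = B p r" for p r using side_integral_cong[of "%x. restrict p ?e x * restrict r ?e x" gm "%x. p x * r x"]
  by (simp add: side_integral_def B_def path_image_mem)
 have lr: "side_integral gm (%x. f x * restrict r ?e x) = l r" for r using side_integral_cong[of "%x. f x * restrict r ?e x" gm "%x. f x * r x"]
  by (simp add: side_integral_def l_def path_image_mem)
 have "side_proj k gm f = restrict w ?e" unfolding side_proj_def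
 proof (rule the_equality)
  show "restrict w ?e \<in> side_poly k ?e & (\<forall>r\<in>side_poly k ?e.
    side_integral gm (%x. restrict w ?e x * r x) = side_integral gm (%x. f x * r x))" using w by (auto simp: side_poly_def Br lr simp del: restrict_apply)
  fix p assume p: "p \<in> side_poly k ?e & (\<forall>r\<in>side_poly k ?e.
    side_integral gm (%x. p x * r x) = side_integral gm (%x. f x * r x))"
  then obtain v where v: "p = restrict v ?e" "v \<in> poly2 k" by (auto simp: side_poly_def)
  have vq: "B v q = l q" if "q \<in> poly2 k" for q
  proof -
   have "restrict q ?e \<in> side_poly k ?e" using that by (auto simp: side_poly_def)
   then show ?thesis using p v(1) Br[of v q] lr[of q] by (simp del: restrict_apply)
  qed
  have d: "(%x. v x - w x) \<in> poly2 k" using v w by auto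
  have "B (%x. v x - w x) (%x. v x - w x) = 0" using addB[of v "%x. -1 * w x" "%x. v x - w x"] scaleB[of "-1" w "%x. v x - w x"] d v w vq poly2_scale[of w k "-1"] by simp
  \<comment> \<open>Two solutions may differ as bivariate polynomials;
    \<open>speed_nondegenerate\<close> makes them agree on the curve, which is all that the
    extensional restriction records.\<close>
  then have "v (gm t) - w (gm t) = 0" if "t \<in> {0..1}" for t using speed_nondegenerate[OF gm cp[OF d] B0[OF d] that] by simp
  then show "p = restrict w ?e" unfolding v(1) by (intro restrict_ext) (auto simp: path_image_def)
 qed
 then show ?thesis using that[OF w(1)] w(2) by (simp add: B_def l_def)
qed

text \<open>Pythagoras: the squared error of \<open>q\<close> is the squared error of the projection
  plus the square of \<open>p - q\<close>. The mixed terms cancel because \<open>p - q\<close> is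
  itself a test polynomial.\<close>

lemma side_proj_best:
 assumes gm: "lip_arc gm" and f: "continuous_on {0..1} (%t. f (gm t))" and q: "q \<in> poly2 k"
 obtains p where "p \<in> poly2 k" "side_proj k gm f = restrict p (path_image gm)"
  "(LINT t|I01. (p (gm t) - f (gm t))^2 * speed gm t) <= (LINT t|I01. (f (gm t) - q (gm t))^2 * speed gm t)"
proof -
 note cp = poly2_path_continuous[OF gm]
 obtain p where p: "p \<in> poly2 k" "side_proj k gm f = restrict p (path_image gm)"
  "!!q. q \<in> poly2 k ==> (LINT t|I01. p (gm t) * q (gm t) * speed gm t) = (LINT t|I01. f (gm t) * q (gm t) * speed gm t)"
  by (rule side_proj_exists[OF gm f], rule that; assumption)
 define r where "r x = p x - q x" for x
 have r: "r \<in> poly2 k" unfolding r_def[abs_def] using p(1) q by auto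
 have i1: "integrable I01 (%t. (p (gm t) - f (gm t))^2 * speed gm t)"
  and i2: "integrable I01 (%t. f (gm t) * r (gm t) * speed gm t)"
  and i3: "integrable I01 (%t. p (gm t) * r (gm t) * speed gm t)"
  and i4: "integrable I01 (%t. (r (gm t))^2 * speed gm t)" by (intro speed_integrable_continuous[OF gm] continuous_intros cp[OF p(1)] cp[OF q] cp[OF r] f)+
 have "(LINT t|I01. (f (gm t) - q (gm t))^2 * speed gm t) =
  (LINT t|I01. (p (gm t) - f (gm t))^2 * speed gm t + 2 * (f (gm t) * r (gm t) * speed gm t)
    - 2 * (p (gm t) * r (gm t) * speed gm t) + (r (gm t))^2 * speed gm t)" by (intro BI_integral_cong) (auto simp: r_def power2_eq_square algebra_simps)
 also have "... = (LINT t|I01. (p (gm t) - f (gm t))^2 * speed gm t) + (LINT t|I01. (r (gm t))^2 * speed gm t)" using p(3)[OF r] i1 i2 i3 i4 by simp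
 finally have "(LINT t|I01. (p (gm t) - f (gm t))^2 * speed gm t) <= (LINT t|I01. (f (gm t) - q (gm t))^2 * speed gm t)" by simp
 then show ?thesis using that p by blast
qed

subsection \<open>Nodal interpolation on a segment\<close>

definition lagrange :: "nat => (nat => real) => nat => real poly" where
 "lagrange k \<tau> j = (\<Prod>i\<in>{..k} - {j}. [:- \<tau> i / (\<tau> j - \<tau> i), 1 / (\<tau> j - \<tau> i):])"

lemma poly_lagrange: "poly (lagrange k \<tau> j) t = (\<Prod>i\<in>{..k} - {j}. (t - \<tau> i) / (\<tau> j - \<tau> i))" by (simp add: lagrange_def poly_prod diff_divide_distrib)

lemma degree_lagrange: "j <= k ==> degree (lagrange k \<tau> j) <= k"
proof -
 assume j: "j <= k"
 have "degree (lagrange k \<tau> j) <= (\<Sum>i\<in>{..k} - {j}. degree [:- \<tau> i / (\<tau> j - \<tau> i), 1 / (\<tau> j - \<tau> i):])"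
  using degree_prod_sum_le[OF finite_Diff[OF finite_atMost[of k]], of "%i. [:- \<tau> i / (\<tau> j - \<tau> i), 1 / (\<tau> j - \<tau> i):]" "{j}"]
  unfolding lagrange_def comp_def .
 also have "... <= (\<Sum>i\<in>{..k} - {j}. 1)" by (intro sum_mono) simp
 also have "... = k" using j by simp
 finally show ?thesis .
qed

lemma nodal_distribution_inj: "nodal_distribution k \<tau> ==> inj_on \<tau> {..k}"
 and nodal_distribution_range: "nodal_distribution k \<tau> ==> j <= k ==> \<tau> j \<in> {0..1}"
proof -
 assume nd: "nodal_distribution k \<tau>"
 have less: "\<tau> i < \<tau> j" if "i < j" "j <= k" for i j using that
 proof (induction j)
  case (Suc j)
  have "\<tau> j < \<tau> (Suc j)" using nd Suc by (auto simp: nodal_distribution_def)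
  moreover have "\<tau> i <= \<tau> j" using Suc by (cases "i = j") auto
  ultimately show ?case by simp
 qed simp
 show "inj_on \<tau> {..k}" by (intro inj_onI) (metis atMost_iff less less_irrefl nat_neq_iff)
 show "\<tau> j \<in> {0..1}" if "j <= k" for j using less[of 0 j] less[of j k] that nd by (cases "j = 0"; cases "j = k") (auto simp: nodal_distribution_def)
qed

lemma lagrange_nodes:
 assumes "inj_on \<tau> {..k}" "i <= k" "j <= k"
 shows "poly (lagrange k \<tau> j) (\<tau> i) = (if i = j then 1 else 0)"
proof (cases "i = j")
 case True
 moreover have "\<tau> j - \<tau> x ~= 0" if "x \<in> {..k} - {j}" for x using that assms(3) inj_onD[OF assms(1), of j x] by auto
 ultimately have "(\<Prod>x\<in>{..k} - {j}. (\<tau> i - \<tau> x) / (\<tau> j - \<tau> x)) = 1" by (intro prod.neutral ballI) simp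
 then show ?thesis using True by (simp only: poly_lagrange) simp
next
 case False
 then show ?thesis using assms by (auto simp: poly_lagrange intro!: prod_zero)
qed

lemma poly_eq_nodes:
 assumes "inj_on \<tau> {..k}" "degree P <= k" "degree Q <= k" "!!j. j <= k ==> poly P (\<tau> j) = poly Q (\<tau> j :: real)"
 shows "P = Q"
proof (rule ccontr)
 assume "P ~= Q"
 then have "P - Q ~= 0" by simp
 have "card (\<tau> ` {..k}) <= card {x. poly (P - Q) x = 0}" using assms(4) \<open>P - Q ~= 0\<close> by (intro card_mono poly_roots_finite) auto
 also have "... <= degree (P - Q)" using \<open>P - Q ~= 0\<close> by (rule card_poly_roots_bound)
 also have "... <= k" using assms(2,3) by (rule degree_diff_le)
 finally show False using assms(1) by (simp add: card_image)
qed

text \<open>An upper bound for the Lebesgue constant of the nodes: the numerators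
  \<open>\<bar>t - \<tau> i\<bar>\<close> of the Lagrange basis are at most 1 on
  \<open>[0,1]\<close> and are dropped, which makes the bound an explicit function of the
  nodes.\<close>

definition lebesgue_const :: "nat => (nat => real) => real" where
 "lebesgue_const k \<tau> = (\<Sum>j\<le>k. \<Prod>i\<in>{..k} - {j}. 1 / \<bar>\<tau> j - \<tau> i\<bar>)"

lemma lebesgue_const_nonneg: "lebesgue_const k \<tau> \<ge> 0" by (auto simp: lebesgue_const_def intro!: sum_nonneg prod_nonneg)

lemma poly_nodes_bound:
 assumes nd: "nodal_distribution k \<tau>" and P: "degree P <= k"
  and M: "!!j. j <= k ==> \<bar>poly P (\<tau> j)\<bar> <= M" and t: "t \<in> {0..1}"
 shows "\<bar>poly P t\<bar> <= lebesgue_const k \<tau> * M"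
proof -
 note inj = nodal_distribution_inj[OF nd]
 have "P = (\<Sum>j\<le>k. smult (poly P (\<tau> j)) (lagrange k \<tau> j))" by (rule poly_eq_nodes[OF inj P])
   (auto intro!: degree_sum_le order_trans[OF degree_smult_le] degree_lagrange
    simp: poly_sum lagrange_nodes[OF inj] if_distrib cong: if_cong)
 then have "\<bar>poly P t\<bar> = \<bar>\<Sum>j\<le>k. poly P (\<tau> j) * poly (lagrange k \<tau> j) t\<bar>" by (metis (no_types, lifting) poly_smult poly_sum sum.cong)
 also have "... <= (\<Sum>j\<le>k. \<bar>poly P (\<tau> j)\<bar> * \<bar>poly (lagrange k \<tau> j) t\<bar>)" unfolding abs_mult[symmetric] by (rule sum_abs)
 also have "... <= (\<Sum>j\<le>k. M * (\<Prod>i\<in>{..k} - {j}. 1 / \<bar>\<tau> j - \<tau> i\<bar>))"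
 proof (intro sum_mono mult_mono)
  fix j assume j: "j \<in> {..k}"
  show "\<bar>poly (lagrange k \<tau> j) t\<bar> <= (\<Prod>i\<in>{..k} - {j}. 1 / \<bar>\<tau> j - \<tau> i\<bar>)" unfolding poly_lagrange abs_prod
  proof (intro prod_mono conjI)
   fix i assume i: "i \<in> {..k} - {j}"
   have "\<bar>t - \<tau> i\<bar> <= 1" using nodal_distribution_range[OF nd, of i] t i by auto
   then show "\<bar>(t - \<tau> i) / (\<tau> j - \<tau> i)\<bar> <= 1 / \<bar>\<tau> j - \<tau> i\<bar>" by (simp add: divide_right_mono)
  qed auto
  show "0 <= M" using M[of 0] by linarith
 qed (use M in auto)
 also have "... = lebesgue_const k \<tau> * M" by (simp add: lebesgue_const_def sum_distrib_left[symmetric] mult.commute)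
 finally show ?thesis .
qed

text \<open>Interpolation reproduces \<open>q\<close>, so \<open>p - q\<close> interpolates
  \<open>f - q\<close>, and the nodal bound \<open>M\<close> grows at most by the Lebesgue constant.
  Working on the reference parameter makes the factor independent of the end points.\<close>

lemma nodal_interp_bound:
 assumes nd: "nodal_distribution k \<tau>" and ab: "a ~= b" and q: "q \<in> poly2 k"
  and M: "!!j. j <= k ==> \<bar>f (linepath a b (\<tau> j)) - q (linepath a b (\<tau> j))\<bar> <= M"
 obtains p where "p \<in> poly2 k" "nodal_interp k \<tau> (linepath a b) f = restrict p (path_image (linepath a b))"
  "!!t. t \<in> {0..1} ==> \<bar>p (linepath a b t) - q (linepath a b t)\<bar> <= lebesgue_const k \<tau> * M"
proof -
 note inj = nodal_distribution_inj[OF nd]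
 let ?gm = "linepath a b" and ?e = "path_image (linepath a b)"
 define P where "P = (\<Sum>j\<le>k. smult (f (?gm (\<tau> j))) (lagrange k \<tau> j))"
 have dP: "degree P <= k" unfolding P_def by (auto intro!: degree_sum_le order_trans[OF degree_smult_le] degree_lagrange)
 have Pn: "poly P (\<tau> j) = f (?gm (\<tau> j))" if "j <= k" for j using that by (simp add: P_def poly_sum lagrange_nodes[OF inj] if_distrib cong: if_cong)
 \<comment> \<open>The affine function \<open>l\<close> recovers the parameter along the segment and
   turns a polynomial in \<open>t\<close> into a bivariate polynomial of no larger degree.\<close>
 define l where "l x = ((x - a) \<bullet> (b - a)) / ((b - a) \<bullet> (b - a))" for x :: "real^2"
 have l: "l \<in> poly2 1"
 proof -
  have eq: "l = (%x. (\<Sum>i\<in>UNIV. ((b - a) $ i / ((b - a) \<bullet> (b - a))) * (x $ i - a $ i)))" by (auto simp: l_def inner_vec_def sum_divide_distrib mult_ac)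
  show ?thesis unfolding eq by (intro poly2_sum poly2_scale poly2_diff poly2_nth poly2_const order_refl)
 qed
 have lt: "l (?gm t) = t" for t
 proof -
  have "?gm t - a = t *\<^sub>R (b - a)" by (simp add: linepath_def algebra_simps)
  then show ?thesis using ab by (simp add: l_def)
 qed
 define p where "p x = poly P (l x)" for x
 have p: "p \<in> poly2 k" unfolding p_def[abs_def] by (rule poly2_of_poly[OF dP l])
 have pt: "p (?gm t) = poly P t" for t by (simp add: p_def lt)
 have mem: "?gm (\<tau> j) \<in> ?e" if "j <= k" for j using nodal_distribution_range[OF nd that] by (rule path_image_mem)
 have "nodal_interp k \<tau> ?gm f = restrict p ?e" unfolding nodal_interp_def
 proof (rule the_equality)
  show "restrict p ?e \<in> side_poly k ?e & (\<forall>j\<le>k. restrict p ?e (?gm (\<tau> j)) = f (?gm (\<tau> j)))" using p mem by (auto simp: side_poly_def pt Pn)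
  fix r assume r: "r \<in> side_poly k ?e & (\<forall>j\<le>k. r (?gm (\<tau> j)) = f (?gm (\<tau> j)))"
  then obtain v where v: "r = restrict v ?e" "v \<in> poly2 k" by (auto simp: side_poly_def)
  obtain V where V: "degree V <= k" "!!t::real. v (?gm t) = poly V t" using poly2_linepath[OF v(2), of a b] by blast
  have "V = P" by (rule poly_eq_nodes[OF inj V(1) dP]) (use r v mem V(2) Pn in \<open>auto simp flip: V(2)\<close>)
  then have "v (?gm t) = p (?gm t)" for t using V(2) pt by simp
  then show "r = restrict p ?e" unfolding v(1) by (intro restrict_ext) (auto simp: path_image_def)
 qed
 moreover have "\<bar>p (?gm t) - q (?gm t)\<bar> <= lebesgue_const k \<tau> * M" if t: "t \<in> {0..1}" for t
 proof -
  obtain V where V: "degree V <= k" "!!t::real. q (?gm t) = poly V t" using poly2_linepath[OF q, of a b] by blast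
  have "\<bar>poly (P - V) t\<bar> <= lebesgue_const k \<tau> * M" using M by (intro poly_nodes_bound[OF nd _ _ t] degree_diff_le dP V(1)) (auto simp: Pn V(2))
  then show ?thesis by (simp add: pt V(2))
 qed
 ultimately show ?thesis using that p by blast
qed

section \<open>Mollifiers and weak derivatives\<close>

subsection \<open>A smooth bump function\<close>

text \<open>The whole sequence of derivatives is carried along, because the mollifier uses all of
  them by index.\<close>

definition smooth1 :: "(real => real) => bool" where
 "smooth1 f \<longleftrightarrow> (\<exists>F. F 0 = f & (\<forall>n t. (F n has_real_derivative F (Suc n) t) (at t)))"

text \<open>Coinduction: a class of functions closed under differentiation consists of smooth
  functions, since a choice of derivative can be iterated inside it.\<close>

lemma smooth1I:
 assumes "f \<in> S" and S: "!!f. f \<in> S ==> \<exists>f'\<in>S. \<forall>t. (f has_real_derivative f' t) (at t)"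
 shows "smooth1 f"
proof -
 obtain D where D: "!!f. f \<in> S ==> D f \<in> S" "!!f t. f \<in> S ==> (f has_real_derivative D f t) (at t)" using S by metis
 define F where "F n = (D ^^ n) f" for n
 have "F n \<in> S" for n by (induction n) (auto simp: F_def D assms)
 then show ?thesis unfolding smooth1_def by (intro exI[of _ F]) (auto simp: F_def D)
qed

lemma smooth1D:
 assumes "smooth1 f"
 obtains f' where "smooth1 f'" "!!t. (f has_real_derivative f' t) (at t)"
proof -
 obtain F where F: "F 0 = f" "!!n t. (F n has_real_derivative F (Suc n) t) (at t)" using assms by (auto simp: smooth1_def)
 have "smooth1 (F (Suc 0))" unfolding smooth1_def by (intro exI[of _ "%n. F (Suc n)"]) (auto simp: F)
 then show ?thesis using that F by metis
qed

text \<open>Sums of products of smooth functions: a class that contains the product and is closed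
  under the Leibniz rule, as \<open>smooth1I\<close> demands.\<close>

inductive_set smooth1_products :: "(real => real) set" where
 mult: "smooth1 f ==> smooth1 g ==> (%t. f t * g t) \<in> smooth1_products"
| add: "u \<in> smooth1_products ==> v \<in> smooth1_products ==> (%t. u t + v t) \<in> smooth1_products"

lemma smooth1_mult:
 assumes "smooth1 f" "smooth1 g"
 shows "smooth1 (%t. f t * g t)"
proof (rule smooth1I[of _ smooth1_products])
 show "(%t. f t * g t) \<in> smooth1_products" using assms by (rule mult)
 fix u assume "u \<in> smooth1_products"
 then show "\<exists>u'\<in>smooth1_products. \<forall>t. (u has_real_derivative u' t) (at t)"
 proof induction
  case (mult f g)
  obtain f' where f': "smooth1 f'" "!!t. (f has_real_derivative f' t) (at t)" using smooth1D[OF mult(1)] by blast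
  obtain g' where g': "smooth1 g'" "!!t. (g has_real_derivative g' t) (at t)" using smooth1D[OF mult(2)] by blast
  show ?case
  proof (intro bexI[of _ "%t. f' t * g t + f t * g' t"] allI)
   show "((%t. f t * g t) has_real_derivative f' t * g t + f t * g' t) (at t)" for t by (auto intro!: derivative_eq_intros f' g')
   show "(%t. f' t * g t + f t * g' t) \<in> smooth1_products" by (intro smooth1_products.intros mult f' g')
  qed
 next
  case (add u v)
  then obtain u' v' where "u' \<in> smooth1_products" "\<forall>t. (u has_real_derivative u' t) (at t)"
   "v' \<in> smooth1_products" "\<forall>t. (v has_real_derivative v' t) (at t)" by blast
  then show ?case by (intro bexI[of _ "%t. u' t + v' t"]) (auto intro!: derivative_eq_intros smooth1_products.add)
 qed
qed

lemma smooth1_affine: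
 assumes "smooth1 f"
 shows "smooth1 (%t. c * f (a + b * t))"
proof -
 obtain F where F: "F 0 = f" "!!n t. (F n has_real_derivative F (Suc n) t) (at t)" using assms by (auto simp: smooth1_def)
 have "((%t. c * b ^ n * F n (a + b * t)) has_real_derivative c * b ^ Suc n * F (Suc n) (a + b * t)) (at t)" for n t
  by (rule derivative_eq_intros DERIV_chain2[OF F(2)] refl)+ (simp add: mult_ac)
 then show ?thesis unfolding smooth1_def by (intro exI[of _ "%n t. c * b ^ n * F n (a + b * t)"]) (auto simp: F(1))
qed

text \<open>The classical \<open>exp (- (1/t))\<close> with a polynomial factor in
  \<open>1/t\<close>, which closes the class under differentiation.\<close>

definition flat :: "real poly => real => real" where
 "flat P t = (if t > 0 then poly P (1/t) * exp (- (1/t)) else 0)"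

text \<open>The factor \<open>[:0, 0, 1:]\<close> comes from differentiating \<open>1/t\<close>. At
  the origin the exponential beats every polynomial in \<open>1/t\<close>.\<close>

lemma flat_has_derivative:
 "(flat P has_real_derivative flat ([:0, 0, 1:] * (P - pderiv P)) t) (at t)"
proof -
 let ?Q = "[:0, 0, 1:] * (P - pderiv P)"
 consider "t > 0" | "t < 0" | "t = 0" by linarith
 then show ?thesis
 proof cases
  case 1
  have d: "((%t. poly P (1/t) * exp (- (1/t))) has_real_derivative
    poly ?Q (1/t) * exp (- (1/t))) (at t)" using 1 by (auto intro!: derivative_eq_intros DERIV_chain2[OF poly_DERIV]
    simp: power2_eq_square field_simps)
  have eq: "flat ?Q t = poly ?Q (1/t) * exp (- (1/t))" using 1 by (simp add: flat_def)
  show ?thesis unfolding eq by (rule has_field_derivative_transform_within[OF d 1 UNIV_I]) (auto simp: flat_def dist_real_def)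
 next
  case 2
  have d: "((%t. 0::real) has_real_derivative 0) (at t)" by simp
  have eq: "flat ?Q t = 0" using 2 by (simp add: flat_def)
  show ?thesis unfolding eq by (rule has_field_derivative_transform_within[OF d, where d="-t"]) (use 2 in \<open>auto simp: flat_def dist_real_def\<close>)
 next
  case 3
  have lim: "((%x. poly R x / exp x) \<longlongrightarrow> 0) at_top" for R :: "real poly"
  proof -
   have "((%x. \<Sum>i\<le>degree R. coeff R i * (x ^ i / exp x)) \<longlongrightarrow> (\<Sum>i\<le>degree R. coeff R i * 0)) at_top"
    by (intro tendsto_intros tendsto_power_div_exp_0)
   then show ?thesis by (simp add: poly_altdef sum_divide_distrib)
  qed
  have "((%h. poly ([:0, 1:] * P) (inverse h) / exp (inverse h)) \<longlongrightarrow> 0) (at_right 0)" by (rule filterlim_compose[OF lim filterlim_inverse_at_top_right])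
  then have r: "((%h. flat P h / h) \<longlongrightarrow> 0) (at_right 0)" by (rule Lim_transform_eventually)
    (auto simp: eventually_at_right_less flat_def exp_minus field_simps intro: eventually_mono[OF eventually_at_right_less])
  have l: "((%h. flat P h / h) \<longlongrightarrow> 0) (at_left 0)" by (rule Lim_transform_eventually[OF tendsto_const])
    (auto simp: flat_def intro!: eventually_at_leftI[of "-1"])
  have "((%h. flat P h / h) \<longlongrightarrow> 0) (at 0)" using filterlim_split_at[OF l r] .
  then show ?thesis by (simp add: 3 DERIV_def flat_def)
 qed
qed

lemma smooth1_flat: "smooth1 (flat P)" by (rule smooth1I[of _ "range flat"]) (auto intro!: flat_has_derivative)

text \<open>The product of two flat functions, one switching on at -1 and the other switching off at
  1, divided by its integral. Its derivatives vanish outside \<open>[-1,1]\<close> and, by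
  continuity, at the end points.\<close>

lemma exists_bump:
 "\<exists>\<beta>::nat => real => real. (\<forall>n t. (\<beta> n has_real_derivative \<beta> (Suc n) t) (at t)) & (\<forall>t. \<beta> 0 t \<ge> 0)
  & (\<forall>n t. \<bar>t\<bar> \<ge> 1 --> \<beta> n t = 0) & (\<integral>\<^sup>+t. ennreal (\<beta> 0 t) \<partial>lborel) = 1"
proof -
 define b where "b t = flat 1 (1 + t) * flat 1 (1 - t)" for t
 have "smooth1 b" using smooth1_mult[OF smooth1_affine[OF smooth1_flat[of 1], of 1 1 1] smooth1_affine[OF smooth1_flat[of 1], of 1 1 "-1"]] by (simp add: b_def[abs_def])
 then obtain F where F: "F 0 = b" "!!n t. (F n has_real_derivative F (Suc n) t) (at t)" by (auto simp: smooth1_def)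
 have cF: "continuous_on UNIV (F n)" for n using F(2) by (meson DERIV_isCont continuous_at_imp_continuous_on)
 have out: "F n t = 0" if "\<bar>t\<bar> > 1" for n t using that
 proof (induction n arbitrary: t)
  case 0
  then show ?case by (auto simp: F b_def flat_def)
 next
  case (Suc n)
  have "(F n has_real_derivative 0) (at t)"
   by (rule has_field_derivative_transform_within[of "%_. 0" 0 t UNIV "\<bar>t\<bar> - 1"]) (use Suc in \<open>auto simp: dist_real_def\<close>)
  then show ?case using F(2) DERIV_unique by blast
 qed
 have bd: "F n t = 0" if "\<bar>t\<bar> = 1" for n t
 proof (rule tendsto_unique)
  let ?s = "%k::nat. t * (1 + inverse (real (Suc k)))"
  have "?s \<longlonglongrightarrow> t * (1 + 0)" by (intro tendsto_intros LIMSEQ_inverse_real_of_nat)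
  then have "?s \<longlonglongrightarrow> t" by simp
  then show "(%k. F n (?s k)) \<longlonglongrightarrow> F n t" using cF[of n] continuous_on_tendsto_compose[of UNIV "F n" ?s t sequentially] by auto
  have "\<bar>?s k\<bar> > 1" for k using that by (simp add: abs_mult)
  then show "(%k. F n (?s k)) \<longlonglongrightarrow> 0" using out by simp
 qed simp
 have b0: "b t \<ge> 0" for t by (simp add: b_def flat_def)
 have bm: "b \<in> borel_measurable borel" using cF[of 0] F(1) borel_measurable_continuous_onI by metis
 define I where "I = (\<integral>\<^sup>+t. ennreal (b t) \<partial>lborel)"
 have "I ~= 0"
 proof
  assume "I = 0"
  then have "AE t in lborel. b t = 0" using b0 bm by (auto simp: I_def nn_integral_0_iff_AE antisym_conv)
  then have "AE t in lborel. t \<notin> {-1/2<..<1/2::real}"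
  proof eventually_elim
   case (elim t)
   then show ?case by (auto simp: b_def flat_def split: if_splits)
  qed
  then have "{-1/2<..<1/2::real} \<in> null_sets lborel" by (subst (asm) AE_iff_null_sets[symmetric]) auto
  then show False by (auto simp: null_sets_def)
 qed
 moreover have "I ~= \<infinity>"
 proof -
  have "bounded (b ` {-1..1})" using cF[of 0] F(1) by (metis compact_Icc compact_continuous_image compact_imp_bounded continuous_on_subset subset_UNIV)
  then obtain K where "\<forall>x\<in>b ` {-1..1}. norm x <= K" unfolding bounded_iff by blast
  then have K: "\<bar>b t\<bar> <= K" if "t \<in> {-1..1}" for t using that by auto
  have "I <= (\<integral>\<^sup>+t. ennreal K * indicator {-1..1::real} t \<partial>lborel)" unfolding I_def
  proof (rule nn_integral_mono)
   fix t :: real show "ennreal (b t) <= ennreal K * indicator {-1..1} t"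
   proof (cases "t \<in> {-1..1}")
    case True
    then show ?thesis using K[OF True] b0[of t] by (auto intro!: ennreal_leI)
   next
    case False
    then have "b t = 0" using out[of t 0] F(1) by (auto simp: abs_if split: if_splits)
    then show ?thesis by simp
   qed
  qed
  also have "... < \<infinity>" by (simp add: nn_integral_cmult_indicator ennreal_mult_less_top)
  finally show ?thesis by simp
 qed
 ultimately obtain c where c: "I = ennreal c" "c > 0" by (cases I) (auto simp: zero_less_iff_neq_zero)
 define \<beta> where "\<beta> n t = F n t / c" for n t
 have "(\<integral>\<^sup>+t. ennreal (\<beta> 0 t) \<partial>lborel) = (\<integral>\<^sup>+t. ennreal (1/c) * ennreal (b t) \<partial>lborel)"
  using c b0 by (intro nn_integral_cong) (simp add: \<beta>_def F ennreal_mult[symmetric])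
 also have "... = ennreal (1/c) * I" unfolding I_def using bm by (intro nn_integral_cmult) auto
 also have "... = 1" using c by (simp add: ennreal_mult[symmetric])
 finally have 1: "(\<integral>\<^sup>+t. ennreal (\<beta> 0 t) \<partial>lborel) = 1" .
 show ?thesis
 proof (intro exI[of _ \<beta>] conjI allI impI 1)
  show "(\<beta> n has_real_derivative \<beta> (Suc n) t) (at t)" for n t unfolding \<beta>_def[abs_def] using c by (auto intro!: derivative_eq_intros F(2))
  show "0 <= \<beta> 0 t" for t using b0 c by (simp add: \<beta>_def F)
  show "\<beta> n t = 0" if "1 <= \<bar>t\<bar>" for n t using that bd[of t n] out[of t n] by (cases "\<bar>t\<bar> = 1") (auto simp: \<beta>_def)
 qed
qed

definition bump :: "nat => real => real" where
 "bump = (SOME \<beta>. (\<forall>n t. (\<beta> n has_real_derivative \<beta> (Suc n) t) (at t)) & (\<forall>t. \<beta> 0 t \<ge> 0)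
  & (\<forall>n t. \<bar>t\<bar> \<ge> 1 --> \<beta> n t = 0) & (\<integral>\<^sup>+t. ennreal (\<beta> 0 t) \<partial>lborel) = 1)"

lemma bump_has_derivative: "(bump n has_real_derivative bump (Suc n) t) (at t)"
 and bump_nonneg: "bump 0 t \<ge> 0"
 and bump_zero: "\<bar>t\<bar> \<ge> 1 ==> bump n t = 0"
 and nn_integral_bump: "(\<integral>\<^sup>+t. ennreal (bump 0 t) \<partial>lborel) = 1"
proof -
 have *: "(\<forall>n t. (bump n has_real_derivative bump (Suc n) t) (at t)) & (\<forall>t. bump 0 t \<ge> 0)
  & (\<forall>n t. \<bar>t\<bar> \<ge> 1 --> bump n t = 0) & (\<integral>\<^sup>+t. ennreal (bump 0 t) \<partial>lborel) = 1" unfolding bump_def by (rule someI_ex[OF exists_bump])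
 then show "(bump n has_real_derivative bump (Suc n) t) (at t)" "bump 0 t \<ge> 0"
  "\<bar>t\<bar> \<ge> 1 ==> bump n t = 0" "(\<integral>\<^sup>+t. ennreal (bump 0 t) \<partial>lborel) = 1" by simp_all
qed

lemma continuous_bump: "continuous_on UNIV (bump n)" using bump_has_derivative by (meson DERIV_isCont continuous_at_imp_continuous_on)

lemma bump_bound: "\<exists>K. \<forall>t. \<bar>bump n t\<bar> <= K"
proof -
 have "bounded (bump n ` {-1..1})" by (intro compact_imp_bounded compact_continuous_image continuous_on_subset[OF continuous_bump]) auto
 then obtain K where K: "\<forall>x\<in>bump n ` {-1..1}. norm x <= K" unfolding bounded_iff by blast
 have "\<bar>bump n t\<bar> <= \<bar>K\<bar>" for t
 proof (cases "\<bar>t\<bar> \<ge> 1")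
  case False
  then have "norm (bump n t) <= K" by (intro K[rule_format] imageI) auto
  then show ?thesis by simp
 qed (simp add: bump_zero)
 then show ?thesis by blast
qed

subsection \<open>Integration over the plane\<close>

lemma measurable_vector2: "(%(a, b). vector [a, b] :: real^2) \<in> borel_measurable (borel \<Otimes>\<^sub>M borel)"
proof -
 have "(%(a, b). vector [a, b] :: real^2) = (%p. fst p *\<^sub>R axis 1 1 + snd p *\<^sub>R axis 2 1)" by (auto simp: vec_eq_iff forall_2 axis_def)
 then show ?thesis by simp
qed

lemma measurable_nth: "(%p::real^2. p $ i) \<in> borel_measurable borel" by (intro borel_measurable_continuous_onI continuous_intros)

lemma Basis_real2: "(Basis :: (real^2) set) = {axis 1 1, axis 2 1}" by (auto simp: Basis_vec_def) (metis exhaust_2)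

lemma axis12: "axis 1 1 ~= (axis 2 1 :: real^2)" by (simp add: axis_eq_axis)

text \<open>Volumes of boxes determine Lebesgue measure; the identification with the product measure
  makes Fubini's theorem available in coordinates.\<close>

lemma lborel_real2: "(lborel :: (real^2) measure) = distr (lborel \<Otimes>\<^sub>M lborel) borel (%(a, b). vector [a, b])"
proof (rule lborel_eqI)
 have m: "(%(a, b). vector [a, b] :: real^2) \<in> measurable (lborel \<Otimes>\<^sub>M lborel) borel" using measurable_vector2 by (simp cong: measurable_cong_sets)
 fix l u :: "real^2" assume lu: "!!b. b \<in> Basis ==> l \<bullet> b <= u \<bullet> b"
 have le: "l $ 1 <= u $ 1" "l $ 2 <= u $ 2" using lu[of "axis 1 1"] lu[of "axis 2 1"] by (auto simp: inner_axis)
 have "(%(a, b). vector [a, b] :: real^2) -` box l u \<inter> space (lborel \<Otimes>\<^sub>M lborel)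
  = {l $ 1<..<u $ 1} \<times> {l $ 2<..<u $ 2}" by (auto simp: mem_box_cart forall_2 space_pair_measure)
 then have "emeasure (distr (lborel \<Otimes>\<^sub>M lborel) borel (%(a, b). vector [a, b])) (box l u)
  = emeasure (lborel \<Otimes>\<^sub>M lborel) ({l $ 1<..<u $ 1} \<times> {l $ 2<..<u $ 2})" using m by (subst emeasure_distr) auto
 also have "... = emeasure lborel {l $ 1<..<u $ 1} * emeasure lborel {l $ 2<..<u $ 2}" by (intro lborel.emeasure_pair_measure_Times) auto
 also have "... = ennreal ((u $ 1 - l $ 1) * (u $ 2 - l $ 2))" using le by (simp add: ennreal_mult)
 finally show "emeasure (distr (lborel \<Otimes>\<^sub>M lborel) borel (%(a, b). vector [a, b])) (box l u)
  = ennreal (\<Prod>b\<in>Basis. (u - l) \<bullet> b)" by (simp add: Basis_real2 axis12 inner_axis)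
qed simp

lemma nn_integral_real2:
 fixes f :: "real^2 => ennreal"
 assumes "f \<in> borel_measurable borel"
 shows "(\<integral>\<^sup>+x. f x \<partial>lborel) = (\<integral>\<^sup>+a. \<integral>\<^sup>+b. f (vector [a, b]) \<partial>lborel \<partial>lborel)"
proof -
 have m: "(%(a, b). vector [a, b] :: real^2) \<in> measurable (lborel \<Otimes>\<^sub>M lborel) borel" using measurable_vector2 by (simp cong: measurable_cong_sets)
 have "(\<integral>\<^sup>+x. f x \<partial>lborel) = (\<integral>\<^sup>+p. f ((%(a, b). vector [a, b]) p) \<partial>(lborel \<Otimes>\<^sub>M lborel))"
  using assms m by (subst lborel_real2, subst nn_integral_distr) auto
 also have "... = (\<integral>\<^sup>+a. \<integral>\<^sup>+b. f (vector [a, b]) \<partial>lborel \<partial>lborel)"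
  using measurable_compose[OF m assms] by (subst lborel.nn_integral_fst[symmetric]) (auto simp: comp_def)
 finally show ?thesis .
qed

subsection \<open>Mollification\<close>

text \<open>The \<open>(i, j)\<close> partial derivative of the mollifier
  \<open>mol eps 0 0\<close>. The exponent collects 2 from normalising the mass in the plane and
  \<open>i + j\<close> from the chain rule. The support is a square, contained in the disc of radius
  \<open>2 * eps\<close>.\<close>

definition mol :: "real => nat => nat => real^2 => real" where
 "mol eps i j w = bump i (w $ 1 / eps) * bump j (w $ 2 / eps) / eps ^ (2 + i + j)"

lemma mol_has_derivative:
 assumes "eps > 0"
 shows "(mol eps i j has_derivative (%h. h $ 1 * mol eps (Suc i) j w + h $ 2 * mol eps i (Suc j) w)) (at w)"
proof -
 have l: "((%x::real^2. x $ i / eps) has_derivative (%h. h $ i / eps)) (at w)" for i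
 proof -
  have "((%x::real^2. x $ i) has_derivative (%h. h $ i)) (at w)" by (rule bounded_linear.has_derivative[OF bounded_linear_vec_nth has_derivative_ident])
  from has_derivative_mult_left[OF this, of "1 / eps"] show ?thesis by simp
 qed
 have b: "((%x::real^2. bump n (x $ i / eps)) has_derivative (%h. bump (Suc n) (w $ i / eps) * (h $ i / eps))) (at w)" for n i
  using DERIV_compose_FDERIV[OF bump_has_derivative l, of n i] by (simp add: mult.commute)
 have "((%w. bump i (w $ 1 / eps) * bump j (w $ 2 / eps) * (1 / eps ^ (2 + i + j))) has_derivative
  (%h. h $ 1 * mol eps (Suc i) j w + h $ 2 * mol eps i (Suc j) w)) (at w)"
  by (rule derivative_eq_intros b refl)+ (use assms in \<open>auto simp: mol_def fun_eq_iff field_simps\<close>)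
 then show ?thesis by (simp add: mol_def[abs_def])
qed

lemma continuous_mol: "eps > 0 ==> continuous_on UNIV (mol eps i j)" by (intro continuous_at_imp_continuous_on ballI has_derivative_continuous[OF mol_has_derivative])

lemma mol_measurable [measurable]: "eps > 0 ==> mol eps i j \<in> borel_measurable borel" by (intro borel_measurable_continuous_onI continuous_mol)

lemma mol_shift_measurable: "eps > 0 ==> (%y. mol eps i j (x - y)) \<in> borel_measurable borel" by (rule measurable_compose[OF _ mol_measurable]) auto

lemma mol_bound:
 assumes "eps > 0"
 obtains K where "K > 0" "!!w. \<bar>mol eps i j w\<bar> <= K"
proof -
 obtain A where "!!t. \<bar>bump i t\<bar> <= A" using bump_bound by blast
 moreover obtain B where "!!t. \<bar>bump j t\<bar> <= B" using bump_bound by blast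
 ultimately have AB: "\<bar>bump i s\<bar> * \<bar>bump j t\<bar> <= \<bar>A\<bar> * \<bar>B\<bar>" for s t by (intro mult_mono) (auto intro: order_trans[OF _ abs_ge_self])
 define K where "K = \<bar>A\<bar> * \<bar>B\<bar> / eps ^ (2 + i + j) + 1"
 have "\<bar>mol eps i j w\<bar> <= \<bar>A\<bar> * \<bar>B\<bar> / eps ^ (2 + i + j)" for w using assms AB[of "w $ 1 / eps" "w $ 2 / eps"] unfolding mol_def abs_mult abs_divide
  by (simp add: divide_right_mono)
 then have "\<bar>mol eps i j w\<bar> <= K" for w unfolding K_def by (rule order_trans) simp
 moreover have "K > 0" using assms unfolding K_def by (intro add_nonneg_pos) auto
 ultimately show ?thesis using that by blast
qed

lemma mol_nonneg: "eps > 0 ==> mol eps 0 0 w \<ge> 0" by (simp add: mol_def bump_nonneg)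

lemma mol_support: "eps > 0 ==> mol eps i j w ~= 0 ==> \<bar>w $ 1\<bar> <= eps & \<bar>w $ 2\<bar> <= eps"
proof (rule ccontr)
 assume e: "eps > 0" and nz: "mol eps i j w ~= 0" and "\<not> (\<bar>w $ 1\<bar> <= eps & \<bar>w $ 2\<bar> <= eps)"
 then have "\<bar>w $ 1 / eps\<bar> \<ge> 1 \<or> \<bar>w $ 2 / eps\<bar> \<ge> 1" by (auto simp: abs_divide)
 then show False using nz bump_zero by (auto simp: mol_def)
qed

lemma norm_real2_le: "norm (w::real^2) <= \<bar>w $ 1\<bar> + \<bar>w $ 2\<bar>" using norm_le_l1_cart[of w] by (simp add: sum_2)

lemma mol_support_norm: "eps > 0 ==> mol eps i j w ~= 0 ==> norm w <= 2 * eps" using mol_support[of eps i j w] norm_real2_le[of w] by linarith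

lemma nn_integral_mol:
 assumes e: "eps > 0"
 shows "(\<integral>\<^sup>+w. ennreal (mol eps 0 0 w) \<partial>lborel) = 1"
proof -
 have bm[measurable]: "bump 0 \<in> borel_measurable borel" by (intro borel_measurable_continuous_onI continuous_bump)
 have s: "(\<integral>\<^sup>+t. ennreal (bump 0 (t / eps) / eps) \<partial>lborel) = 1"
 proof -
  have "1 = \<bar>1/eps\<bar> * (\<integral>\<^sup>+t. ennreal (bump 0 (0 + (1/eps) * t)) \<partial>lborel)"
   using nn_integral_real_affine[of "%t. ennreal (bump 0 t)" "1/eps" 0] e by (simp add: nn_integral_bump)
  also have "... = (\<integral>\<^sup>+t. ennreal (1/eps) * ennreal (bump 0 (0 + (1/eps) * t)) \<partial>lborel)" using e by (subst nn_integral_cmult) auto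
  also have "... = (\<integral>\<^sup>+t. ennreal (bump 0 (t / eps) / eps) \<partial>lborel)" using e by (intro nn_integral_cong) (simp add: ennreal_mult[symmetric] bump_nonneg)
  finally show ?thesis by simp
 qed
 have "(\<integral>\<^sup>+w. ennreal (mol eps 0 0 w) \<partial>lborel)
  = (\<integral>\<^sup>+a. \<integral>\<^sup>+b. ennreal (bump 0 (a / eps) / eps) * ennreal (bump 0 (b / eps) / eps) \<partial>lborel \<partial>lborel)"
  using e by (subst nn_integral_real2)
   (auto intro!: nn_integral_cong simp: mol_def bump_nonneg ennreal_mult[symmetric] power2_eq_square)
 also have "... = (\<integral>\<^sup>+a. ennreal (bump 0 (a / eps) / eps) * 1 \<partial>lborel)" by (intro nn_integral_cong, subst nn_integral_cmult) (auto simp: s)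
 finally show ?thesis using s by simp
qed

lemma nn_integral_reflect:
 fixes f :: "'a::euclidean_space => ennreal"
 assumes "f \<in> borel_measurable borel"
 shows "(\<integral>\<^sup>+y. f (x - y) \<partial>lborel) = (\<integral>\<^sup>+y. f y \<partial>lborel)"
proof -
 have "(\<integral>\<^sup>+y. f y \<partial>lborel) = integral\<^sup>N (density (distr lborel borel (%y. x + (-1) *\<^sub>R y)) (%_. ennreal (\<bar>-1\<bar>^DIM('a)))) f"
  by (rule arg_cong[where f="%M. integral\<^sup>N M f", OF lborel_affine[of "-1" x]]) simp
 also have "... = (\<integral>\<^sup>+y. f (x - y) \<partial>lborel)" using assms by (subst nn_integral_density) (auto simp: nn_integral_distr)
 finally show ?thesis ..
qed

lemma nn_integral_mol_reflect: "eps > 0 ==> (\<integral>\<^sup>+y. ennreal (mol eps 0 0 (x - y)) \<partial>lborel) = 1"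
 using nn_integral_reflect[of "%w. ennreal (mol eps 0 0 w)" x] nn_integral_mol by simp

text \<open>Convolution with a differentiated kernel: the members of this family are the derivatives
  of \<open>mollify eps 0 0 f\<close>, whether or not \<open>f\<close> itself has
  derivatives.\<close>

definition mollify :: "real => nat => nat => (real^2 => real) => real^2 => real" where
 "mollify eps i j f x = (LINT y|lborel. f y * mol eps i j (x - y))"

lemma mollify_integrable:
 assumes "eps > 0" "integrable lborel f"
 shows "integrable lborel (%y. f y * mol eps i j (x - y))"
proof -
 obtain K where K: "K > 0" "!!w. \<bar>mol eps i j w\<bar> <= K" using mol_bound[OF assms(1), of i j] by blast
 show ?thesis
 proof (rule BI_integrable_bound[of _ "%y. K * f y"])
  show "AE y in lborel. norm (f y * mol eps i j (x - y)) <= norm (K * f y)"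
   using K by (intro AE_I2) (auto simp: abs_mult mult.commute[of K] intro!: mult_left_mono order_trans[OF K(2) abs_ge_self])
  show "(%y. f y * mol eps i j (x - y)) \<in> borel_measurable lborel" using assms by (auto intro!: borel_measurable_times measurable_compose[OF _ mol_measurable[OF assms(1)]])
 qed (use assms in auto)
qed

lemma mol_Lipschitz:
 assumes e: "eps > 0"
 obtains K where "K > 0" "!!w w'. \<bar>mol eps i j w - mol eps i j w'\<bar> <= K * norm (w - w')"
proof -
 obtain A where A: "A > 0" "!!w. \<bar>mol eps (Suc i) j w\<bar> <= A" using mol_bound[OF e, of "Suc i" j] by blast
 obtain B where B: "B > 0" "!!w. \<bar>mol eps i (Suc j) w\<bar> <= B" using mol_bound[OF e, of i "Suc j"] by blast
 let ?D = "%w (h::real^2). h $ 1 * mol eps (Suc i) j w + h $ 2 * mol eps i (Suc j) w"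
 have 1: "(mol eps i j has_derivative ?D x) (at x within UNIV)" for x using mol_has_derivative[OF e] by simp
 have 2: "onorm (?D x) <= A + B" for x
 proof (rule onorm_le)
  fix h :: "real^2"
  have "norm (?D x h) <= \<bar>h $ 1\<bar> * A + \<bar>h $ 2\<bar> * B"
   unfolding real_norm_def by (rule order_trans[OF abs_triangle_ineq]) (auto simp: abs_mult intro!: add_mono mult_left_mono A B)
  also have "... <= norm h * A + norm h * B" using A B component_le_norm_cart by (intro add_mono mult_right_mono) auto
  finally show "norm (?D x h) <= (A + B) * norm h" by (simp add: algebra_simps)
 qed
 have "norm (mol eps i j w - mol eps i j w') <= (A + B) * norm (w - w')" for w w' by (rule differentiable_bound[OF convex_UNIV 1 2]) auto
 then show ?thesis using that[of "A + B"] A B by auto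
qed

text \<open>The first derivatives of the kernel are Lipschitz, so its Taylor remainder is quadratic
  with a constant uniform in the base point; integrated against \<open>\<bar>f\<bar>\<close> it
  stays quadratic.\<close>

lemma mollify_has_derivative:
 assumes e: "eps > 0" and f: "integrable lborel f"
 shows "(mollify eps i j f has_derivative
  (%h. h $ 1 * mollify eps (Suc i) j f x + h $ 2 * mollify eps i (Suc j) f x)) (at x)"
proof -
 obtain A where A: "A > 0" "!!w w'. \<bar>mol eps (Suc i) j w - mol eps (Suc i) j w'\<bar> <= A * norm (w - w')" using mol_Lipschitz[OF e, of "Suc i" j] by blast
 obtain B where B: "B > 0" "!!w w'. \<bar>mol eps i (Suc j) w - mol eps i (Suc j) w'\<bar> <= B * norm (w - w')" using mol_Lipschitz[OF e, of i "Suc j"] by blast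
 let ?D = "%w (h::real^2). h $ 1 * mol eps (Suc i) j w + h $ 2 * mol eps i (Suc j) w"
 have rem: "\<bar>mol eps i j (w + h) - mol eps i j w - ?D w h\<bar> <= (A + B) * (norm h)^2" for w h
 proof -
  have 1: "w + t *\<^sub>R (w + h - w) \<in> cball w (norm h)" if "t \<in> {0..1}" for t using that by (auto simp: dist_norm mult_left_le_one_le)
  have 2: "(mol eps i j has_derivative ?D x) (at x within cball w (norm h))" if "x \<in> cball w (norm h)" for x by (rule has_derivative_at_withinI[OF mol_has_derivative[OF e]])
  have 3: "onorm (?D x - ?D w) <= (A + B) * norm h" if "x \<in> cball w (norm h)" for x unfolding fun_diff_def
  proof (rule onorm_le)
   have xw: "norm (x - w) <= norm h" using that by (simp add: dist_norm norm_minus_commute)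
   fix y :: "real^2"
   have "norm (?D x y - ?D w y) <= \<bar>y $ 1\<bar> * \<bar>mol eps (Suc i) j x - mol eps (Suc i) j w\<bar> + \<bar>y $ 2\<bar> * \<bar>mol eps i (Suc j) x - mol eps i (Suc j) w\<bar>"
    unfolding real_norm_def abs_mult[symmetric] by (rule order_trans[OF _ abs_triangle_ineq]) (simp add: algebra_simps)
   also have "... <= norm y * (A * norm (x - w)) + norm y * (B * norm (x - w))" using A B component_le_norm_cart by (intro add_mono mult_mono) auto
   also have "... <= norm y * (A * norm h) + norm y * (B * norm h)" using A B xw by (intro add_mono mult_left_mono) auto
   finally show "norm (?D x y - ?D w y) <= (A + B) * norm h * norm y" by (simp add: algebra_simps)
  qed
  have "norm (mol eps i j (w + h) - mol eps i j w - ?D w (w + h - w)) <= norm (w + h - w) * ((A + B) * norm h)" by (rule differentiable_bound_linearization[OF 1 2 3]) auto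
  then show ?thesis by (simp add: power2_eq_square algebra_simps)
 qed
 define I where "I = (LINT y|lborel. \<bar>f y\<bar>)"
 have I0: "I \<ge> 0" by (simp add: I_def)
 note int = mollify_integrable[OF e f]
 have lin: "bounded_linear (%h::real^2. h $ 1 * a + h $ 2 * b)" for a b :: real
  by (intro bounded_linear_add bounded_linear_mult_left[THEN bounded_linear_compose] bounded_linear_vec_nth)
 have main: "\<bar>mollify eps i j f (x + h) - mollify eps i j f x
   - (h $ 1 * mollify eps (Suc i) j f x + h $ 2 * mollify eps i (Suc j) f x)\<bar> <= ((A + B) * I) * (norm h)^2" for h
 proof -
  have "mollify eps i j f (x + h) - mollify eps i j f x
   - (h $ 1 * mollify eps (Suc i) j f x + h $ 2 * mollify eps i (Suc j) f x)
   = (LINT y|lborel. f y * mol eps i j (x + h - y) - f y * mol eps i j (x - y)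
    - (h $ 1 * (f y * mol eps (Suc i) j (x - y)) + h $ 2 * (f y * mol eps i (Suc j) (x - y))))" unfolding mollify_def using int by simp
  also have "... = (LINT y|lborel. f y * (mol eps i j (x - y + h) - mol eps i j (x - y) - ?D (x - y) h))" by (intro BI_integral_cong) (auto simp: algebra_simps)
  also have "\<bar>...\<bar> <= (LINT y|lborel. ((A + B) * (norm h)^2) * \<bar>f y\<bar>)"
  proof (rule order_trans[OF integral_abs_bound integral_mono])
   show "integrable lborel (%y. \<bar>f y * (mol eps i j (x - y + h) - mol eps i j (x - y) - ?D (x - y) h)\<bar>)"
   proof (rule integrable_abs)
    have "integrable lborel (%y. f y * mol eps i j (x + h - y) - f y * mol eps i j (x - y)
    - (h $ 1 * (f y * mol eps (Suc i) j (x - y)) + h $ 2 * (f y * mol eps i (Suc j) (x - y))))" using int by auto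
    then show "integrable lborel (%y. f y * (mol eps i j (x - y + h) - mol eps i j (x - y) - ?D (x - y) h))" by (simp add: algebra_simps)
   qed
   show "integrable lborel (%y. ((A + B) * (norm h)^2) * \<bar>f y\<bar>)" using f by auto
   fix y
   show "\<bar>f y * (mol eps i j (x - y + h) - mol eps i j (x - y) - ?D (x - y) h)\<bar> <= ((A + B) * (norm h)^2) * \<bar>f y\<bar>"
    unfolding abs_mult using mult_left_mono[OF rem[of "x - y" h] abs_ge_zero[of "f y"]] by (simp add: mult.commute)
  qed
  also have "... = ((A + B) * I) * (norm h)^2" by (simp add: I_def)
  finally show ?thesis .
 qed
 define K where "K = (A + B) * I"
 have K: "K \<ge> 0" using A B I0 by (simp add: K_def)
 show ?thesis unfolding has_derivative_at_alt
 proof (intro conjI allI impI lin)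
  fix r :: real assume r: "r > 0"
  show "\<exists>d>0. \<forall>y. norm (y - x) < d --> norm (mollify eps i j f y - mollify eps i j f x
    - ((y - x) $ 1 * mollify eps (Suc i) j f x + (y - x) $ 2 * mollify eps i (Suc j) f x)) <= r * norm (y - x)"
  proof (intro exI[of _ "r / (K + 1)"] conjI allI impI)
   show "r / (K + 1) > 0" using r K by simp
   fix y assume y: "norm (y - x) < r / (K + 1)"
   have "K * norm (y - x) <= (K + 1) * norm (y - x)" by (simp add: mult_right_mono)
   also have "... <= r" using y K by (simp add: pos_less_divide_eq mult.commute less_imp_le)
   finally have "K * norm (y - x) * norm (y - x) <= r * norm (y - x)" by (rule mult_right_mono) simp
   then show "norm (mollify eps i j f y - mollify eps i j f x
    - ((y - x) $ 1 * mollify eps (Suc i) j f x + (y - x) $ 2 * mollify eps i (Suc j) f x)) <= r * norm (y - x)"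
    using main[of "y - x"] by (simp add: K_def[symmetric] power2_eq_square mult.assoc)
  qed
 qed
qed

lemma continuous_mollify: "eps > 0 ==> integrable lborel f ==> continuous_on UNIV (mollify eps i j f)"
 by (intro continuous_at_imp_continuous_on ballI has_derivative_continuous[OF mollify_has_derivative])

subsection \<open>Mollifiers as test functions\<close>

text \<open>Each derivative in \<open>y\<close> raises one index and flips the sign, since the
  variable enters as \<open>x - y\<close>. Iterated partial derivatives thus stay among the kernels,
  which is smoothness in the sense of \<open>smooth\<close>.\<close>

lemma foldr_partial_mol:
 assumes e: "eps > 0"
 shows "\<exists>a b. a + b = length js & foldr partial js (%y. mol eps i j (x - y)) = (%y. (-1) ^ length js * mol eps (i + a) (j + b) (x - y))"
  and "foldr partial js (%y. mol eps i j (x - y)) differentiable (at y)"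
proof -
 have d: "((%y. c * mol eps i j (x - y)) has_derivative
   (%h. - c * (h $ 1 * mol eps (Suc i) j (x - y) + h $ 2 * mol eps i (Suc j) (x - y)))) (at y)" for c i j y
 proof -
  have "((%y. x - y) has_derivative (%h. - h)) (at y)" by (auto intro!: derivative_eq_intros)
  from has_derivative_mult_right[OF has_derivative_compose[OF this mol_has_derivative[OF e]], of c i j]
  show ?thesis by (simp add: algebra_simps)
 qed
 show ex: "\<exists>a b. a + b = length js & foldr partial js (%y. mol eps i j (x - y)) = (%y. (-1) ^ length js * mol eps (i + a) (j + b) (x - y))" for js
 proof (induction js)
  case Nil
  then show ?case by auto
 next
  case (Cons l js)
  then obtain a b where ab: "a + b = length js"
   "foldr partial js (%y. mol eps i j (x - y)) = (%y. (-1) ^ length js * mol eps (i + a) (j + b) (x - y))" by blast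
  have p: "partial l (%y. (-1) ^ length js * mol eps (i + a) (j + b) (x - y)) =
   (%y. - ((-1) ^ length js) * (axis l 1 $ 1 * mol eps (Suc (i + a)) (j + b) (x - y) + axis l 1 $ 2 * mol eps (i + a) (Suc (j + b)) (x - y)))"
   by (rule ext) (rule partial_eqI[OF d])
  consider "l = 1" | "l = 2" using exhaust_2 by blast
  then show ?case
  proof cases
   case 1
   then show ?thesis using ab p by (intro exI[of _ "Suc a"] exI[of _ b]) (auto simp: axis_def)
  next
   case 2
   then show ?thesis using ab p by (intro exI[of _ a] exI[of _ "Suc b"]) (auto simp: axis_def)
  qed
 qed
 obtain a b where ab: "foldr partial js (%y. mol eps i j (x - y)) = (%y. (-1) ^ length js * mol eps (i + a) (j + b) (x - y))" using ex[of js] by blast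
 show "foldr partial js (%y. mol eps i j (x - y)) differentiable (at y)" unfolding ab by (rule differentiableI[OF d])
qed

lemma partial_powers_mol:
 assumes e: "eps > 0"
 shows "(partial 1 ^^ i) ((partial 2 ^^ j) (%y. mol eps 0 0 (x - y))) = (%y. (-1) ^ (i + j) * mol eps i j (x - y))"
proof -
 have d: "((%y. c * mol eps i j (x - y)) has_derivative
   (%h. - c * (h $ 1 * mol eps (Suc i) j (x - y) + h $ 2 * mol eps i (Suc j) (x - y)))) (at y)" for c i j y
 proof -
  have "((%y. x - y) has_derivative (%h. - h)) (at y)" by (auto intro!: derivative_eq_intros)
  from has_derivative_mult_right[OF has_derivative_compose[OF this mol_has_derivative[OF e]], of c i j]
  show ?thesis by (simp add: algebra_simps)
 qed
 have p1: "partial 1 (%y. c * mol eps i j (x - y)) = (%y. - c * mol eps (Suc i) j (x - y))" for c i j by (rule ext, subst partial_eqI[OF d]) (simp add: axis_def)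
 have p2: "partial 2 (%y. c * mol eps i j (x - y)) = (%y. - c * mol eps i (Suc j) (x - y))" for c i j by (rule ext, subst partial_eqI[OF d]) (simp add: axis_def)
 have a: "(partial 2 ^^ j) (%y. mol eps 0 0 (x - y)) = (%y. (-1) ^ j * mol eps 0 j (x - y))" by (induction j) (auto simp: p2)
 show ?thesis by (induction i) (auto simp: a p1)
qed

lemma mol_test_function:
 assumes e: "eps > 0" and "cball x (2 * eps) \<subseteq> D"
 shows "(%y. mol eps 0 0 (x - y)) \<in> test_functions D" unfolding test_functions_def smooth_def
proof (intro CollectI conjI allI exI[of _ "cball x (2 * eps)"] impI)
 show "foldr partial js (%y. mol eps 0 0 (x - y)) differentiable (at y)" for js y by (rule foldr_partial_mol(2)[OF e])
 show "mol eps 0 0 (x - y) = 0" if "y \<notin> cball x (2 * eps)" for y using mol_support_norm[OF e, of 0 0 "x - y"] that by (auto simp: dist_norm)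
qed (use assms in auto)

subsection \<open>Borel representatives\<close>

text \<open>A Borel function on the whole plane, zero almost everywhere off \<open>D\<close>,
  standing for a function that is only Lebesgue measurable on \<open>D\<close>. Reflection and
  Fubini are then available for \<open>lborel\<close>.\<close>

definition represents :: "(real^2) set => (real^2 => real) => (real^2 => real) => bool" where
 "represents D f f' \<longleftrightarrow> f' \<in> borel_measurable borel & integrable lborel f' & integrable lborel (%x. (f' x)^2)
  & (AE x in lebesgue. f' x = indicator D x * f x) & L2_norm D f = sqrt (LINT x|lborel. (f' x)^2)
  & (\<forall>g \<in> borel_measurable borel. L2_inner D f g = (LINT x|lborel. f' x * g x))"

lemma L2_space_represents:
 assumes D: "D \<in> lmeasurable" and f: "f \<in> L2_space D"
 obtains f' where "represents D f f'"
proof -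
 have Dm: "D \<in> sets lebesgue" using D by auto
 have fm: "(%x. indicator D x * f x) \<in> borel_measurable lebesgue" using f Dm by (simp add: L2_space_def borel_measurable_restrict_space_iff)
 obtain f' where f': "f' \<in> borel_measurable lborel" "AE x in lborel. indicator D x * f x = f' x" using completion_ex_borel_measurable_real[OF fm] by auto
 then have f'm[measurable]: "f' \<in> borel_measurable borel" by simp
 have ae: "AE x in lebesgue. f' x = indicator D x * f x" using AE_completion[OF f'(2)] by eventually_elim simp
 have sq: "integrable lebesgue (%x. indicator D x * (f x)^2)" using f integrable_lebesgue_on_iff[OF Dm, of "%x. (f x)^2"] by (simp add: L2_space_def)
 have eqsq: "AE x in lebesgue. indicator D x * (f x)^2 = (f' x)^2" using ae by eventually_elim (auto simp: indicator_def)
 have i2: "integrable lebesgue (%x. (f' x)^2)" by (rule integrable_cong_AE_imp[OF sq _ eqsq]) (simp add: measurable_completion)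
 then have i2b: "integrable lborel (%x. (f' x)^2)" by (simp add: integrable_completion)
 \<comment> \<open>On the finite measure of \<open>D\<close>, square integrability gives
   integrability through \<open>\<bar>u\<bar> <= 1 + u^2\<close>.\<close>
 have "integrable lebesgue (%x. indicator D x + (f' x)^2)" using i2 D by (intro BI_integrable_add) (auto simp: fmeasurable_def)
 then have "integrable lebesgue f'"
 proof (rule BI_integrable_bound)
  show "AE x in lebesgue. norm (f' x) <= norm (indicator D x + (f' x)^2)" using ae
  proof eventually_elim
   case (elim x)
   have "\<bar>f' x\<bar> <= 1 + (f' x)^2"
   proof -
    have "0 <= (\<bar>f' x\<bar> - 1/2)^2 + 3/4" by simp
    then show ?thesis by (simp add: power2_eq_square algebra_simps abs_mult_self_eq)
   qed
   then show ?case using elim by (auto simp: indicator_def)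
  qed
 qed (simp add: measurable_completion)
 then have i1b: "integrable lborel f'" by (simp add: integrable_completion)
 have inner: "L2_inner D f g = (LINT x|lborel. f' x * g x)" if g: "g \<in> borel_measurable borel" for g
 proof -
  have "L2_inner D f g = (LINT x|lebesgue. indicator D x * (f x * g x))" unfolding L2_inner_real by (subst integral_lebesgue_on[OF Dm]) simp
  also have "... = (LINT x|lebesgue. f' x * g x)"
  proof (rule integral_cong_AE)
   have "(%x. (indicator D x * f x) * g x) \<in> borel_measurable lebesgue" using borel_measurable_times[OF fm, of g] g by (simp add: measurable_completion)
   then show "(%x. indicator D x * (f x * g x)) \<in> borel_measurable lebesgue" by (simp add: mult.assoc)
   show "(%x. f' x * g x) \<in> borel_measurable lebesgue" using g by (intro borel_measurable_times) (auto simp: measurable_completion)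
   show "AE x in lebesgue. indicator D x * (f x * g x) = f' x * g x" using ae by eventually_elim simp
  qed
  also have "... = (LINT x|lborel. f' x * g x)" using g by (intro integral_completion) simp
  finally show ?thesis .
 qed
 have "L2_norm D f = sqrt (LINT x|lborel. (f' x)^2)"
 proof -
  have "L2_inner D f f = (LINT x|lebesgue. indicator D x * (f x)^2)" unfolding L2_inner_real by (subst integral_lebesgue_on[OF Dm]) (simp add: power2_eq_square)
  also have "... = (LINT x|lebesgue. (f' x)^2)" by (rule integral_cong_AE) (use sq eqsq in \<open>auto simp: measurable_completion\<close>)
  also have "... = (LINT x|lborel. (f' x)^2)" by (intro integral_completion) simp
  finally show ?thesis by (simp add: L2_norm_def)
 qed
 then show ?thesis using that[of f'] f'm i1b i2b ae inner unfolding represents_def by blast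
qed

text \<open>The kernel centred at \<open>x\<close> is itself an admissible test function, and the
  signs from reflection and from integration by parts cancel. Derivatives of the mollified function
  are therefore mollified weak derivatives.\<close>

lemma mollify_weak_deriv:
 assumes e: "eps > 0" and x: "cball x (2 * eps) \<subseteq> D" and w: "is_weak_deriv D i j f g"
  and f: "represents D f f'" and g: "represents D g g'"
 shows "mollify eps i j f' x = mollify eps 0 0 g' x"
proof -
 have m: "(%y. mol eps i j (x - y)) \<in> borel_measurable borel" for i j using mol_shift_measurable[OF e] by simp
 have "L2_inner D f ((partial 1 ^^ i) ((partial 2 ^^ j) (%y. mol eps 0 0 (x - y))))
  = (-1) ^ (i + j) * L2_inner D g (%y. mol eps 0 0 (x - y))" using w mol_test_function[OF e x] unfolding is_weak_deriv_def by blast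
 also have "L2_inner D g (%y. mol eps 0 0 (x - y)) = mollify eps 0 0 g' x" using g m unfolding represents_def mollify_def by blast
 also have "L2_inner D f ((partial 1 ^^ i) ((partial 2 ^^ j) (%y. mol eps 0 0 (x - y))))
  = (-1) ^ (i + j) * L2_inner D f (%y. mol eps i j (x - y))" unfolding partial_powers_mol[OF e] L2_inner_real
  by (subst integral_mult_right_zero[symmetric], rule BI_integral_cong) auto
 also have "L2_inner D f (%y. mol eps i j (x - y)) = mollify eps i j f' x" using f m unfolding represents_def mollify_def by blast
 finally show ?thesis by simp
qed

text \<open>Jensen's inequality for the kernel as a probability density, obtained from the
  nonnegativity of the variance. If the right-hand side is infinite nothing remains to be
  shown.\<close>

lemma mollify_square_le:
 assumes e: "eps > 0" and f: "f \<in> borel_measurable borel" "integrable lborel f"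
 shows "ennreal ((mollify eps 0 0 f x)^2) <= (\<integral>\<^sup>+y. ennreal ((f y)^2) * ennreal (mol eps 0 0 (x - y)) \<partial>lborel)"
  (is "_ <= ?R")
proof (cases "?R = \<infinity>")
 case False
 have m[measurable]: "(%y. mol eps 0 0 (x - y)) \<in> borel_measurable borel" using mol_shift_measurable[OF e] by simp
 have fm[measurable]: "f \<in> borel_measurable borel" by (rule f)
 note nn = mol_nonneg[OF e]
 define T where "T = mollify eps 0 0 f x"
 have R: "?R = (\<integral>\<^sup>+y. ennreal ((f y)^2 * mol eps 0 0 (x - y)) \<partial>lborel)" using nn by (simp add: ennreal_mult)
 have i2: "integrable lborel (%y. (f y)^2 * mol eps 0 0 (x - y))" using False nn unfolding R by (intro integrableI_nonneg) (auto simp: less_top)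
 have i0: "has_bochner_integral lborel (%y. mol eps 0 0 (x - y)) 1" by (rule has_bochner_integral_nn_integral) (use nn nn_integral_mol_reflect[OF e] in auto)
 have "0 <= (LINT y|lborel. (f y - T)^2 * mol eps 0 0 (x - y))" using nn by simp
 also have "(%y. (f y - T)^2 * mol eps 0 0 (x - y))
  = (%y. (f y)^2 * mol eps 0 0 (x - y) - 2 * T * (f y * mol eps 0 0 (x - y)) + T^2 * mol eps 0 0 (x - y))" by (auto simp: power2_eq_square algebra_simps)
 also have "(LINT y|lborel. (f y)^2 * mol eps 0 0 (x - y) - 2 * T * (f y * mol eps 0 0 (x - y)) + T^2 * mol eps 0 0 (x - y))
  = (LINT y|lborel. (f y)^2 * mol eps 0 0 (x - y)) - 2 * T * T + T^2 * 1" using i2 mollify_integrable[OF e f(2), of 0 0 x] i0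
  by (simp add: has_bochner_integral_iff T_def mollify_def)
 finally have "T^2 <= (LINT y|lborel. (f y)^2 * mol eps 0 0 (x - y))" by (simp add: power2_eq_square)
 then have "ennreal (T^2) <= ennreal (LINT y|lborel. (f y)^2 * mol eps 0 0 (x - y))" by (rule ennreal_leI)
 also have "... = ?R" unfolding R using i2 nn by (intro nn_integral_eq_integral[symmetric]) auto
 finally show ?thesis by (simp add: T_def)
qed simp

text \<open>Integrate the pointwise bound and exchange the integrals: the kernel has mass 1 in
  either variable.\<close>

lemma nn_integral_mollify_square_le:
 assumes e: "eps > 0" and f: "f \<in> borel_measurable borel" "integrable lborel f"
 shows "(\<integral>\<^sup>+x. ennreal ((mollify eps 0 0 f x)^2) \<partial>lborel) <= (\<integral>\<^sup>+y. ennreal ((f y)^2) \<partial>lborel)"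
proof -
 have fm[measurable]: "f \<in> borel_measurable borel" by (rule f)
 have mm[measurable]: "(%(x, y). mol eps 0 0 (x - y)) \<in> borel_measurable (lborel \<Otimes>\<^sub>M lborel)"
  using measurable_compose[OF _ mol_measurable[OF e], of "%(x, y). x - y" "lborel \<Otimes>\<^sub>M lborel" 0 0] by (simp add: case_prod_unfold)
 have "(\<integral>\<^sup>+x. ennreal ((mollify eps 0 0 f x)^2) \<partial>lborel)
  <= (\<integral>\<^sup>+x. \<integral>\<^sup>+y. ennreal ((f y)^2) * ennreal (mol eps 0 0 (x - y)) \<partial>lborel \<partial>lborel)"
  by (intro nn_integral_mono mollify_square_le assms)
 also have "... = (\<integral>\<^sup>+y. \<integral>\<^sup>+x. ennreal ((f y)^2) * ennreal (mol eps 0 0 (x - y)) \<partial>lborel \<partial>lborel)"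
  by (rule lborel_pair.Fubini') measurable
 also have "... = (\<integral>\<^sup>+y. ennreal ((f y)^2) * (\<integral>\<^sup>+x. ennreal (mol eps 0 0 (x - y)) \<partial>lborel) \<partial>lborel)"
  using measurable_compose[OF _ mol_measurable[OF e]] by (intro nn_integral_cong nn_integral_cmult) auto
 also have "(%y. \<integral>\<^sup>+x. ennreal (mol eps 0 0 (x - y)) \<partial>lborel) = (%y. 1)"
 proof
  fix y
  have "(\<integral>\<^sup>+x. ennreal (mol eps 0 0 x) \<partial>lborel)
   = integral\<^sup>N (density (distr lborel borel (%x. -y + 1 *\<^sub>R x)) (%_. ennreal (\<bar>1\<bar>^DIM(real^2)))) (%x. ennreal (mol eps 0 0 x))"
   by (rule arg_cong[where f="%M. integral\<^sup>N M (%x. ennreal (mol eps 0 0 x))", OF lborel_affine[of 1 "-y"]]) simp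
  also have "... = (\<integral>\<^sup>+x. ennreal (mol eps 0 0 (x - y)) \<partial>lborel)" using e by (subst nn_integral_density) (auto simp: nn_integral_distr)
  finally show "(\<integral>\<^sup>+x. ennreal (mol eps 0 0 (x - y)) \<partial>lborel) = 1" using nn_integral_mol[OF e] by simp
 qed
 finally show ?thesis by simp
qed

text \<open>At a Lebesgue point the mean deviation over a disc of radius \<open>2 * eps\<close> is
  small, and the kernel is bounded by a fixed multiple of the reciprocal area of that disc.\<close>

lemma mollify_tendsto_AE:
 assumes f: "f \<in> borel_measurable borel" "integrable lborel f"
 shows "AE x in lebesgue. \<forall>r>0. \<exists>d>0. \<forall>eps. 0 < eps & eps < d --> \<bar>mollify eps 0 0 f x - f x\<bar> <= r"
proof -
 obtain A where A: "!!t. \<bar>bump 0 t\<bar> <= A" using bump_bound by blast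
 have A0: "A \<ge> 0" using A[of 0] by linarith
 have "AE x in lebesgue. \<forall>e>0. \<exists>d>0. \<forall>r. 0 < r & r < d -->
  (\<integral>\<^sup>+y\<in>cball x r. ennreal \<bar>f y - f x\<bar> \<partial>lebesgue) <= ennreal e * emeasure lebesgue (cball x r)"
  by (rule Lebesgue_points) (use f in \<open>simp add: integrable_completion\<close>)
 then show ?thesis
 proof eventually_elim
  case (elim x)
  show ?case
  proof (intro allI impI)
   fix r :: real assume r: "r > 0"
   \<comment> \<open>The kernel bound \<open>A^2 / eps^2\<close> times the area of a disc of radius
     \<open>2 * eps\<close> leaves \<open>4 * A^2\<close> times the area of the unit disc; the
     summand 1 keeps the denominator positive.\<close>
   define e where "e = r / (A^2 * (4 * unit_ball_vol (real DIM(real^2))) + 1)"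
   have dp: "A^2 * (4 * unit_ball_vol (real DIM(real^2))) + 1 > 0" by (intro add_nonneg_pos) (auto simp: unit_ball_vol_nonneg)
   have e: "e > 0" unfolding e_def using r dp by (rule divide_pos_pos)
   obtain d where d: "d > 0" "!!r. 0 < r ==> r < d ==>
    (\<integral>\<^sup>+y\<in>cball x r. ennreal \<bar>f y - f x\<bar> \<partial>lebesgue) <= ennreal e * emeasure lebesgue (cball x r)" using elim e by blast
   have "\<bar>mollify eps 0 0 f x - f x\<bar> <= r" if eps: "0 < eps" "eps < d/2" for eps
   proof -
    have m[measurable]: "(%y. mol eps 0 0 (x - y)) \<in> borel_measurable borel" using mol_shift_measurable[OF eps(1)] by simp
    have fm[measurable]: "f \<in> borel_measurable borel" by (rule f)
    have i0: "has_bochner_integral lborel (%y. mol eps 0 0 (x - y)) 1"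
    by (rule has_bochner_integral_nn_integral) (use mol_nonneg[OF eps(1)] nn_integral_mol_reflect[OF eps(1)] in auto)
    have mb: "mol eps 0 0 w <= A^2 / eps^2" for w
    proof -
    have "bump 0 (w $ 1 / eps) * bump 0 (w $ 2 / eps) <= A * A" using A bump_nonneg A0 by (intro mult_mono) (auto intro: order_trans[OF abs_ge_self])
    then show ?thesis unfolding mol_def by (simp add: divide_right_mono power2_eq_square)
    qed
    have "mollify eps 0 0 f x - f x = (LINT y|lborel. f y * mol eps 0 0 (x - y)) - (LINT y|lborel. f x * mol eps 0 0 (x - y))"
    using i0 by (simp add: mollify_def has_bochner_integral_iff)
    also have "... = (LINT y|lborel. (f y - f x) * mol eps 0 0 (x - y))" using mollify_integrable[OF eps(1) f(2), of 0 0 x] i0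
    by (subst BI_integral_diff[symmetric]) (auto simp: has_bochner_integral_iff left_diff_distrib)
    finally have eq: "mollify eps 0 0 f x - f x = (LINT y|lborel. (f y - f x) * mol eps 0 0 (x - y))" .
    have int: "integrable lborel (%y. (f y - f x) * mol eps 0 0 (x - y))" using mollify_integrable[OF eps(1) f(2), of 0 0 x] i0
    by (auto simp: has_bochner_integral_iff left_diff_distrib)
    have "ennreal \<bar>mollify eps 0 0 f x - f x\<bar> <= (\<integral>\<^sup>+y. ennreal (norm ((f y - f x) * mol eps 0 0 (x - y))) \<partial>lborel)"
    unfolding eq using integral_norm_bound_ennreal[OF int] by simp
    also have "... <= (\<integral>\<^sup>+y. ennreal (A^2 / eps^2) * (ennreal \<bar>f y - f x\<bar> * indicator (cball x (2 * eps)) y) \<partial>lborel)"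
    proof (intro nn_integral_mono)
    fix y
    show "ennreal (norm ((f y - f x) * mol eps 0 0 (x - y))) <= ennreal (A^2 / eps^2) * (ennreal \<bar>f y - f x\<bar> * indicator (cball x (2 * eps)) y)"
    proof (cases "mol eps 0 0 (x - y) = 0")
    case False
    then have "y \<in> cball x (2 * eps)" using mol_support_norm[OF eps(1) False] by (simp add: dist_norm)
    moreover have "norm ((f y - f x) * mol eps 0 0 (x - y)) <= (A^2 / eps^2) * \<bar>f y - f x\<bar>"
    using mult_right_mono[OF mb[of "x - y"] abs_ge_zero[of "f y - f x"]] mol_nonneg[OF eps(1), of "x - y"] by (simp add: abs_mult mult.commute)
    ultimately show ?thesis by (simp add: ennreal_mult[symmetric] ennreal_leI)
    qed simp
    qed
    also have "... = ennreal (A^2 / eps^2) * (\<integral>\<^sup>+y\<in>cball x (2 * eps). ennreal \<bar>f y - f x\<bar> \<partial>lborel)"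
    by (auto intro!: nn_integral_cmult borel_measurable_times_ennreal borel_measurable_indicator)
    also have "(\<integral>\<^sup>+y\<in>cball x (2 * eps). ennreal \<bar>f y - f x\<bar> \<partial>lborel) = (\<integral>\<^sup>+y\<in>cball x (2 * eps). ennreal \<bar>f y - f x\<bar> \<partial>lebesgue)"
    by (auto intro!: nn_integral_completion[symmetric] borel_measurable_times_ennreal borel_measurable_indicator)
    also have "ennreal (A^2 / eps^2) * ... <= ennreal (A^2 / eps^2) * (ennreal e * emeasure lebesgue (cball x (2 * eps)))" using eps by (intro mult_left_mono d(2)) auto
    also have "emeasure lebesgue (cball x (2 * eps)) = ennreal (unit_ball_vol (real DIM(real^2)) * (2 * eps)^2)" using eps by (simp add: emeasure_cball)
    also have "ennreal (A^2 / eps^2) * (ennreal e * ennreal (unit_ball_vol (real DIM(real^2)) * (2 * eps)^2))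
    = ennreal (e * (A^2 * (4 * unit_ball_vol (real DIM(real^2)))))" using eps e by (simp add: ennreal_mult[symmetric] unit_ball_vol_nonneg power2_eq_square field_simps)
    also have "... <= ennreal r"
    proof (rule ennreal_leI)
    have "e * (A^2 * (4 * unit_ball_vol (real DIM(real^2)))) <= e * (A^2 * (4 * unit_ball_vol (real DIM(real^2))) + 1)" using e by (intro mult_left_mono) auto
    also have "... = r" unfolding e_def using dp by simp
    finally show "e * (A^2 * (4 * unit_ball_vol (real DIM(real^2)))) <= r" .
    qed
    finally show ?thesis using r by (subst (asm) ennreal_le_iff) auto
   qed
   then show "\<exists>d>0. \<forall>eps. 0 < eps & eps < d --> \<bar>mollify eps 0 0 f x - f x\<bar> <= r" using d(1) by (intro exI[of _ "d/2"]) auto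
  qed
 qed
qed

text \<open>An average with respect to a probability density stays in the interval that contains the
  averaged values.\<close>

lemma mollify_uniform:
 assumes e: "eps > 0" and f: "integrable lborel f" and D: "cball x (2 * eps) \<subseteq> D"
  and ae: "AE y in lborel. y \<in> D --> f y = g y"
  and r: "!!y. y \<in> cball x (2 * eps) ==> \<bar>g y - c\<bar> <= r"
 shows "\<bar>mollify eps 0 0 f x - c\<bar> <= r"
proof -
 have m[measurable]: "(%y. mol eps 0 0 (x - y)) \<in> borel_measurable borel" using mol_shift_measurable[OF e] by simp
 have i0: "has_bochner_integral lborel (%y. mol eps 0 0 (x - y)) 1" by (rule has_bochner_integral_nn_integral) (use mol_nonneg[OF e] nn_integral_mol_reflect[OF e] in auto)
 have int: "integrable lborel (%y. (f y - c) * mol eps 0 0 (x - y))" using mollify_integrable[OF e f, of 0 0 x] i0 by (auto simp: has_bochner_integral_iff left_diff_distrib)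
 have "mollify eps 0 0 f x - c = (LINT y|lborel. f y * mol eps 0 0 (x - y)) - (LINT y|lborel. c * mol eps 0 0 (x - y))" using i0 by (simp add: mollify_def has_bochner_integral_iff)
 also have "... = (LINT y|lborel. (f y - c) * mol eps 0 0 (x - y))" using mollify_integrable[OF e f, of 0 0 x] i0
  by (subst BI_integral_diff[symmetric]) (auto simp: has_bochner_integral_iff left_diff_distrib)
 also have "\<bar>...\<bar> <= (LINT y|lborel. r * mol eps 0 0 (x - y))"
 proof (rule order_trans[OF integral_abs_bound integral_mono_AE])
  show "integrable lborel (%y. \<bar>(f y - c) * mol eps 0 0 (x - y)\<bar>)" using int by (rule integrable_abs)
  show "integrable lborel (%y. r * mol eps 0 0 (x - y))" using i0 by (auto simp: has_bochner_integral_iff)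
  show "AE y in lborel. \<bar>(f y - c) * mol eps 0 0 (x - y)\<bar> <= r * mol eps 0 0 (x - y)" using ae
  proof eventually_elim
   case (elim y)
   show ?case
   proof (cases "mol eps 0 0 (x - y) = 0")
    case False
    then have y: "y \<in> cball x (2 * eps)" using mol_support_norm[OF e False] by (simp add: dist_norm)
    then have "\<bar>f y - c\<bar> <= r" using elim D r by auto
    then show ?thesis using mol_nonneg[OF e, of "x - y"] by (simp add: abs_mult mult_right_mono)
   qed simp
  qed
 qed
 also have "... = r" using i0 by (simp add: has_bochner_integral_iff)
 finally show ?thesis .
qed

section \<open>Polynomial approximation of Sobolev functions\<close>

subsection \<open>Averaged Taylor polynomials\<close>

text \<open>A family of functions closed under taking partial derivatives; \<open>taylor n i j x w\<close> is the
 \<open>n\<close>-th derivative of \<open>U i j\<close> at \<open>x\<close> in the direction \<open>w\<close>.\<close>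

locale derivative_family =
 fixes U :: "nat => nat => real^2 => real"
 assumes deriv: "!!i j x. (U i j has_derivative (%h. h $ 1 * U (Suc i) j x + h $ 2 * U i (Suc j) x)) (at x)"
begin

lemma cont: "continuous_on S (U i j)" by (intro continuous_at_imp_continuous_on ballI has_derivative_continuous[OF deriv])

primrec taylor :: "nat => nat => nat => real^2 => real^2 => real" where
 "taylor 0 i j x w = U i j x"
| "taylor (Suc n) i j x w = w $ 1 * taylor n (Suc i) j x w + w $ 2 * taylor n i (Suc j) x w"

text \<open>Squares of the derivatives of order \<open>n\<close> above \<open>(i, j)\<close>, each
  with its binomial multiplicity. The recursion mirrors that of \<open>taylor\<close>, so
  Cauchy--Schwarz applies level by level.\<close>

primrec energy :: "nat => nat => nat => real^2 => real" where
 "energy 0 i j x = (U i j x)^2"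
| "energy (Suc n) i j x = energy n (Suc i) j x + energy n i (Suc j) x"

lemma energy_nonneg: "energy n i j x \<ge> 0" by (induction n arbitrary: i j) auto

lemma energy_continuous: "continuous_on S (energy n i j)" by (induction n arbitrary: i j) (auto intro!: continuous_intros cont simp: energy_def[abs_def])

lemma taylor_square_le: "(taylor n i j x w)^2 <= norm w ^ (2 * n) * energy n i j x"
proof (induction n arbitrary: i j)
 case (Suc n)
 have w: "(norm w)^2 = (w $ 1)^2 + (w $ 2)^2" by (simp add: power2_norm_eq_inner inner_vec_def sum_2) (simp add: power2_eq_square)
 let ?a = "taylor n (Suc i) j x w" and ?b = "taylor n i (Suc j) x w"
 have "(w $ 1 * ?a + w $ 2 * ?b)^2 <= ((w $ 1)^2 + (w $ 2)^2) * (?a^2 + ?b^2)"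
 proof -
  have "0 <= (w $ 1 * ?b - w $ 2 * ?a)^2" by simp
  then show ?thesis by (simp add: power2_eq_square algebra_simps)
 qed
 also have "... <= (norm w)^2 * (norm w ^ (2 * n) * energy n (Suc i) j x + norm w ^ (2 * n) * energy n i (Suc j) x)"
  unfolding w[symmetric] by (intro mult_left_mono add_mono Suc.IH) auto
 also have "... = norm w ^ (2 * Suc n) * energy (Suc n) i j x" by (simp add: algebra_simps power2_eq_square power_add)
 finally show ?case by simp
qed simp

lemma taylor_continuous:
 "continuous_on S a ==> continuous_on S b ==> continuous_on S (%s. taylor n i j (a s) (b s))"
proof (induction n arbitrary: i j)
 case 0
 then show ?case using continuous_on_compose2[OF cont[of UNIV i j]] by auto
qed (auto intro!: continuous_intros)

lemma taylor_line_derivative: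
 "((%t. taylor n i j (y + t *\<^sub>R w) w) has_real_derivative taylor (Suc n) i j (y + t *\<^sub>R w) w) (at t)"
proof (induction n arbitrary: i j)
 case 0
 have "((%t. y + t *\<^sub>R w) has_derivative (%s. s *\<^sub>R w)) (at t)" by (auto intro!: derivative_eq_intros)
 from has_derivative_compose[OF this deriv[of i j]]
 show ?case unfolding has_field_derivative_def taylor.simps by (rule has_derivative_eq_rhs) (simp add: fun_eq_iff algebra_simps)
next
 case (Suc n)
 show ?case unfolding taylor.simps(2)[of n i j] by (rule DERIV_cong[OF DERIV_add[OF DERIV_cmult[OF Suc.IH] DERIV_cmult[OF Suc.IH]]]) simp
qed

lemma taylor_remainder:
 "((%t. (1 - t) ^ k / fact k * taylor (Suc k) 0 0 (y + t *\<^sub>R (x - y)) (x - y)) has_integral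
  U 0 0 x - (\<Sum>n<Suc k. taylor n 0 0 y (x - y) / fact n)) {0..1}"
proof -
 let ?g = "%n t. taylor n 0 0 (y + t *\<^sub>R (x - y)) (x - y)"
 have vd: "(?g m has_vector_derivative ?g (Suc m) t) (at t within {0..1})" for m t
  by (rule has_vector_derivative_at_within[OF taylor_line_derivative[unfolded has_real_derivative_iff_has_vector_derivative]])
 have "((%t. ((1 - t) ^ (Suc k - 1) / fact (Suc k - 1)) *\<^sub>R ?g (Suc k) t) has_integral
  ?g 0 1 - (\<Sum>n<Suc k. ((1 - 0) ^ n / fact n) *\<^sub>R ?g n 0)) {0..1}" by (rule Taylor_has_integral) (use vd in \<open>auto simp del: taylor.simps\<close>)
 then show ?thesis by simp
qed

text \<open>The Taylor polynomial averaged over its base point. The average trades point values for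
  integrals, so that \<open>L2\<close> bounds on the derivatives of order \<open>Suc k\<close>
  control the remainder.\<close>

definition avg_taylor :: "nat => (real^2) set => real^2 => real" where
 "avg_taylor k B x = (LINT y|lebesgue_on B. (\<Sum>n<Suc k. taylor n 0 0 y (x - y) / fact n)) / measure lebesgue B"

text \<open>Expanding \<open>x - y\<close> moves factors \<open>y $ l\<close> into the integrand, so
  the induction needs an arbitrary continuous weight \<open>ph\<close>.\<close>

lemma taylor_integral_poly2:
 assumes B: "bounded B" "B \<in> sets lebesgue" and ph: "continuous_on UNIV ph"
 shows "(%x. LINT y|lebesgue_on B. ph y * taylor n i j y (x - y)) \<in> poly2 n" using ph
proof (induction n arbitrary: i j ph)
 case 0
 then show ?case by simp
next
 case (Suc n)
 have int: "integrable (lebesgue_on B) (%y. \<psi> y * taylor n i j y (x - y))" if "continuous_on UNIV \<psi>" for \<psi> i j x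
  by (intro integrable_on_bounded_continuous B continuous_intros that taylor_continuous)
 have c: "continuous_on UNIV (%y. ph y * y $ l)" for l by (intro continuous_intros Suc.prems)
 have "(LINT y|lebesgue_on B. ph y * taylor (Suc n) i j y (x - y)) =
  x $ 1 * (LINT y|lebesgue_on B. ph y * taylor n (Suc i) j y (x - y)) - (LINT y|lebesgue_on B. (ph y * y $ 1) * taylor n (Suc i) j y (x - y))
 + (x $ 2 * (LINT y|lebesgue_on B. ph y * taylor n i (Suc j) y (x - y)) - (LINT y|lebesgue_on B. (ph y * y $ 2) * taylor n i (Suc j) y (x - y)))" for x
 proof -
  have "(LINT y|lebesgue_on B. ph y * taylor (Suc n) i j y (x - y)) =
   (LINT y|lebesgue_on B. x $ 1 * (ph y * taylor n (Suc i) j y (x - y)) - (ph y * y $ 1) * taylor n (Suc i) j y (x - y)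
   + (x $ 2 * (ph y * taylor n i (Suc j) y (x - y)) - (ph y * y $ 2) * taylor n i (Suc j) y (x - y)))" by (intro BI_integral_cong) (auto simp: algebra_simps)
  then show ?thesis using int[OF Suc.prems] int[OF c] by simp
 qed
 moreover have "(%x. x $ l * (LINT y|lebesgue_on B. ph y * taylor n i j y (x - y))) \<in> poly2 (Suc n)" for l i j
  using poly2_mult[OF poly2_nth[of 1 l] Suc.IH[OF Suc.prems, of i j]] by simp
 moreover have "(%x. (LINT y|lebesgue_on B. (ph y * y $ l) * taylor n i j y (x - y))) \<in> poly2 (Suc n)" for l i j using Suc.IH[OF c, of l i j] poly2_mono[of n "Suc n"] by auto
 ultimately show ?case by (simp only: fun_eq_iff) (intro poly2_add poly2_diff)
qed

lemma taylor_integrable: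
 "bounded B ==> B \<in> sets lebesgue ==> integrable (lebesgue_on B) (%y. taylor n i j y (x - y) / fact m)"
 by (intro integrable_on_bounded_continuous continuous_intros taylor_continuous) auto

lemma avg_taylor_poly2:
 assumes B: "bounded B" "B \<in> sets lebesgue"
 shows "avg_taylor k B \<in> poly2 k"
proof -
 have "avg_taylor k B = (%x. (1 / measure lebesgue B) * (\<Sum>n<Suc k. LINT y|lebesgue_on B. (1 / fact n) * taylor n 0 0 y (x - y)))" unfolding avg_taylor_def
  by (rule ext, subst BI_integral_sum) (auto simp: taylor_integrable[OF B] intro!: sum.cong)
 moreover have "(%x. LINT y|lebesgue_on B. (1 / fact n) * taylor n 0 0 y (x - y)) \<in> poly2 k" if "n < Suc k" for n
  using taylor_integral_poly2[OF B, of "%_. 1 / fact n" n 0 0] poly2_mono[of n k] that by auto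
 ultimately show ?thesis by (simp only:) (intro poly2_scale poly2_sum, auto)
qed

text \<open>With \<open>c\<close> tuned to the integrals, this pointwise bound does the work of a
  Cauchy--Schwarz inequality under the integral.\<close>

lemma sqrt_le_AMGM: "c > 0 ==> q \<ge> 0 ==> sqrt q <= (c + q / c) / 2"
proof -
 assume a: "c > 0" "q \<ge> 0"
 have "0 <= (sqrt q - c)^2" by simp
 then have "2 * c * sqrt q <= q + c^2" using a by (simp add: power2_diff mult_ac)
 then show ?thesis using a by (simp add: field_simps power2_eq_square)
qed

text \<open>Contraction of the plane towards \<open>x\<close> by the factor \<open>1 - t\<close> has
  Jacobian \<open>(1 - t)^2\<close>.\<close>

lemma nn_integral_contract:
 fixes F :: "real^2 => ennreal"
 assumes "F \<in> borel_measurable borel" "t < 1"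
 shows "(\<integral>\<^sup>+y. ennreal ((1 - t)^2) * F (y + t *\<^sub>R (x - y)) \<partial>lborel) = (\<integral>\<^sup>+y. F y \<partial>lborel)"
proof -
 have "(\<integral>\<^sup>+y. F y \<partial>lborel) = integral\<^sup>N (density (distr lborel borel (%y. t *\<^sub>R x + (1 - t) *\<^sub>R y)) (%_. ennreal (\<bar>1 - t\<bar>^DIM(real^2)))) F"
  by (rule arg_cong[where f="%M. integral\<^sup>N M F", OF lborel_affine[of "1 - t" "t *\<^sub>R x"]]) (use assms in auto)
 also have "... = (\<integral>\<^sup>+y. ennreal ((1 - t)^2) * F (t *\<^sub>R x + (1 - t) *\<^sub>R y) \<partial>lborel)"
  using assms by (subst nn_integral_density) (auto simp: nn_integral_distr power2_abs)
 also have "(%y. t *\<^sub>R x + (1 - t) *\<^sub>R y) = (%y. y + t *\<^sub>R (x - y))" by (auto simp: algebra_simps)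
 finally show ?thesis by (metis (no_types, lifting) nn_integral_cong)
qed

declare energy.simps [simp del] taylor.simps [simp del]

text \<open>The remainder is integrated over the segments from the ball to \<open>x\<close>.
  Contracting the ball towards \<open>x\<close> costs the Jacobian \<open>(1 - t)^2\<close>, whose
  square root must come from the weight \<open>(1 - t) ^ k\<close> of the remainder; this is where
  \<open>k \<ge> 1\<close> enters. The energy over \<open>W\<close> then bounds every time slice
  uniformly in \<open>t\<close>.\<close>

lemma avg_taylor_error:
 assumes k: "k \<ge> 1" and r: "r > 0" and d: "!!y. y \<in> ball c r ==> norm (x - y) <= d"
  and W: "W \<in> sets borel" "!!y t. y \<in> ball c r ==> 0 <= t ==> t < 1 ==> y + t *\<^sub>R (x - y) \<in> W"
  and N: "N > 0" "(\<integral>\<^sup>+w. ennreal (indicator W w * energy (Suc k) 0 0 w) \<partial>lborel) <= ennreal (N^2)"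
 shows "\<bar>U 0 0 x - avg_taylor k (ball c r) x\<bar> <= d ^ Suc k * N / r"
proof -
 let ?B = "ball c r"
 define b where "b = measure lebesgue ?B"
 have b: "b = pi * r^2" using r by (simp add: b_def content_ball unit_ball_vol_2)
 have b0: "b > 0" using r by (simp add: b)
 have Bm: "bounded ?B" "?B \<in> sets lebesgue" by auto
 have eb: "emeasure lborel ?B = ennreal b" using b r by (simp add: emeasure_ball unit_ball_vol_2)
 have d0: "d \<ge> 0"
 proof -
  have "norm (x - c) <= d" using r by (intro d) simp
  then show ?thesis using norm_ge_zero[of "x - c"] by linarith
 qed
 define S where "S y = (\<Sum>n<Suc k. taylor n 0 0 y (x - y) / fact n)" for y
 have Si: "integrable (lebesgue_on ?B) S" unfolding S_def[abs_def] by (intro BI_integrable_sum taylor_integrable Bm)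
 \<comment> \<open>This value balances the AM-GM bound: each of its two terms contributes at most
   \<open>N * sqrt b / 2\<close> over the ball.\<close>
 define \<kappa> where "\<kappa> = N / sqrt b"
 have \<kappa>: "\<kappa> > 0" using N b0 by (simp add: \<kappa>_def)
 define q where "q t y = (\<kappa> + (1 - t)^2 * energy (Suc k) 0 0 (y + t *\<^sub>R (x - y)) / \<kappa>) / 2" for t y
 have q0: "q t y \<ge> 0" for t y using \<kappa> energy_nonneg by (simp add: q_def)
 have qt: "(%t. ennreal (q t y)) \<in> borel_measurable borel" for y unfolding q_def by (intro measurable_compose[OF borel_measurable_continuous_onI measurable_ennreal]
   continuous_intros continuous_on_compose2[OF energy_continuous[of UNIV]]) (use \<kappa> in auto)
 have qy: "(%y. ennreal (q t y)) \<in> borel_measurable borel" for t unfolding q_def by (intro measurable_compose[OF borel_measurable_continuous_onI measurable_ennreal]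
   continuous_intros continuous_on_compose2[OF energy_continuous[of UNIV]]) (use \<kappa> in auto)
 have qm: "(%(t, y). ennreal (q t y)) \<in> borel_measurable (lborel \<Otimes>\<^sub>M lborel)"
 proof -
  have "continuous_on UNIV (%p. q (fst p) (snd p))" unfolding q_def by (intro continuous_intros continuous_on_compose2[OF energy_continuous[of UNIV]]) (use \<kappa> in auto)
  then have "(%p. q (fst p) (snd p)) \<in> borel_measurable borel" by (rule borel_measurable_continuous_onI)
  then show ?thesis by (simp add: case_prod_unfold borel_prod[symmetric] cong: measurable_cong_sets)
 qed
 define f where "f t y = ennreal (d ^ Suc k) * (ennreal (q t y) * indicator {0..1} t) * indicator ?B y" for t y
 have fm: "(%(t, y). f t y) \<in> borel_measurable (lborel \<Otimes>\<^sub>M lborel)"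
 proof -
  have "(%p. ennreal (d ^ Suc k) * ((case p of (t, y) => ennreal (q t y)) * indicator {0..1} (fst p)) * indicator ?B (snd p)) \<in> borel_measurable (lborel \<Otimes>\<^sub>M lborel)"
  proof -
   have i1: "(%t::real. indicator {0..1} t :: ennreal) \<in> borel_measurable lborel" by simp
   have i2: "(%y. indicator ?B y :: ennreal) \<in> borel_measurable lborel" by (rule borel_measurable_indicator) simp
   show ?thesis by (intro borel_measurable_times_ennreal qm borel_measurable_const
    measurable_compose[OF measurable_fst i1] measurable_compose[OF measurable_snd i2])
  qed
  then show ?thesis by (simp add: f_def case_prod_unfold)
 qed
 have rem: "ennreal \<bar>U 0 0 x - S y\<bar> <= (\<integral>\<^sup>+t. f t y \<partial>lborel)" if y: "y \<in> ?B" for y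
 proof -
  let ?f = "%t. (1 - t) ^ k / fact k * taylor (Suc k) 0 0 (y + t *\<^sub>R (x - y)) (x - y)"
  have hi: "(?f has_integral U 0 0 x - S y) {0..1}" unfolding S_def by (rule taylor_remainder)
  have cf: "continuous_on UNIV ?f" by (intro continuous_intros taylor_continuous) auto
  have ci: "integrable (lebesgue_on {0..1}) ?f" by (intro integrable_on_bounded_continuous cf) auto
  have "(LINT t|lebesgue_on {0..1}. ?f t) = integral {0..1} ?f" by (rule lebesgue_integral_eq_integral[OF ci]) simp
  then have "U 0 0 x - S y = (LINT t|lebesgue_on {0..1}. ?f t)" by (simp only: integral_unique[OF hi])
  also have "... = (LINT t|lebesgue. indicator {0..1} t * ?f t)" by (subst integral_lebesgue_on) auto
  finally have eq: "U 0 0 x - S y = (LINT t|lebesgue. indicator {0..1} t * ?f t)" .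
  have "ennreal \<bar>U 0 0 x - S y\<bar> <= (\<integral>\<^sup>+t. ennreal (norm (indicator {0..1} t * ?f t)) \<partial>lebesgue)"
   unfolding eq using integral_norm_bound_ennreal[of lebesgue "%t. indicator {0..1} t * ?f t"] ci by (simp add: integrable_lebesgue_on_iff)
  also have "... <= (\<integral>\<^sup>+t. ennreal (d ^ Suc k) * (ennreal (q t y) * indicator {0..1} t) \<partial>lebesgue)"
  proof (intro nn_integral_mono)
   fix t :: real
   show "ennreal (norm (indicator {0..1} t * ?f t)) <= ennreal (d ^ Suc k) * (ennreal (q t y) * indicator {0..1} t)"
   proof (cases "t \<in> {0..1}")
    case True
    let ?E = "energy (Suc k) 0 0 (y + t *\<^sub>R (x - y))"
    have nd: "norm (x - y) <= d" by (rule d[OF y])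
    have "\<bar>taylor (Suc k) 0 0 (y + t *\<^sub>R (x - y)) (x - y)\<bar> <= sqrt (norm (x - y) ^ (2 * Suc k) * ?E)"
    by (subst real_sqrt_abs[symmetric]) (intro real_sqrt_le_mono taylor_square_le)
    also have "... = norm (x - y) ^ Suc k * sqrt ?E" by (subst real_sqrt_mult, subst power_even_eq, subst real_sqrt_abs) (simp del: power_Suc)
    also have "... <= d ^ Suc k * sqrt ?E" using nd by (intro mult_right_mono power_mono) (auto simp: energy_nonneg)
    finally have 1: "\<bar>taylor (Suc k) 0 0 (y + t *\<^sub>R (x - y)) (x - y)\<bar> <= d ^ Suc k * sqrt ?E" .
    have "(1 - t) ^ k / fact k <= (1 - t) ^ k" using True by (simp add: divide_le_eq mult_le_cancel_left1 fact_ge_1)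
    also have "... <= (1 - t) ^ 1" using True k by (intro power_decreasing) auto
    finally have 2: "(1 - t) ^ k / fact k <= 1 - t" by simp
    have 3: "(1 - t) * sqrt ?E <= q t y"
    proof -
    have "(1 - t) * sqrt ?E = sqrt ((1 - t)^2 * ?E)" using True by (simp add: real_sqrt_mult)
    also have "... <= q t y" unfolding q_def using \<kappa> energy_nonneg by (intro sqrt_le_AMGM) auto
    finally show ?thesis .
    qed
    have "\<bar>?f t\<bar> <= (1 - t) * (d ^ Suc k * sqrt ?E)" unfolding abs_mult using 1 2 True by (intro mult_mono) auto
    also have "... <= d ^ Suc k * q t y" using mult_left_mono[OF 3, of "d ^ Suc k"] d0 by (simp add: mult_ac)
    finally have "\<bar>?f t\<bar> <= d ^ Suc k * q t y" .
    then show ?thesis using True d0 q0 by (simp add: ennreal_mult[symmetric] ennreal_leI del: taylor.simps power_Suc)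
   qed simp
  qed
  also have "... = (\<integral>\<^sup>+t. ennreal (d ^ Suc k) * (ennreal (q t y) * indicator {0..1} t) \<partial>lborel)"
   using qt by (auto intro!: nn_integral_completion borel_measurable_times_ennreal)
  also have "... = (\<integral>\<^sup>+t. f t y \<partial>lborel)" using y by (simp add: f_def)
  finally show ?thesis .
 qed
 have inner: "(\<integral>\<^sup>+y. ennreal (q t y) * indicator ?B y \<partial>lborel) <= ennreal (N * sqrt b)" if t: "t \<in> {0..<1}" for t
 proof -
  let ?E = "%w. energy (Suc k) 0 0 w"
  have Em[measurable]: "(%w. ennreal (indicator W w * ?E w)) \<in> borel_measurable borel" using W(1) borel_measurable_continuous_onI[OF energy_continuous[of UNIV "Suc k" 0 0]]
   by (intro measurable_compose[OF _ measurable_ennreal] borel_measurable_times borel_measurable_indicator) auto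
  have "(\<integral>\<^sup>+y. ennreal (q t y) * indicator ?B y \<partial>lborel)
   <= (\<integral>\<^sup>+y. ennreal (\<kappa>/2) * indicator ?B y + ennreal (1 / (2*\<kappa>)) * (ennreal ((1 - t)^2) * ennreal (indicator W (y + t *\<^sub>R (x - y)) * ?E (y + t *\<^sub>R (x - y)))) \<partial>lborel)"
  proof (intro nn_integral_mono)
   fix y
   show "ennreal (q t y) * indicator ?B y <= ennreal (\<kappa>/2) * indicator ?B y + ennreal (1 / (2*\<kappa>)) * (ennreal ((1 - t)^2) * ennreal (indicator W (y + t *\<^sub>R (x - y)) * ?E (y + t *\<^sub>R (x - y))))"
   proof (cases "y \<in> ?B")
    case True
    then have "y + t *\<^sub>R (x - y) \<in> W" using W(2)[OF True, of t] t by auto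
    moreover have "q t y = \<kappa>/2 + 1 / (2*\<kappa>) * ((1 - t)^2 * ?E (y + t *\<^sub>R (x - y)))" using \<kappa> by (simp add: q_def field_simps)
    ultimately show ?thesis using True \<kappa> energy_nonneg[of "Suc k" 0 0] by (simp add: ennreal_mult[symmetric] ennreal_plus[symmetric] del: ennreal_plus)
   qed simp
  qed
  also have "... = ennreal (\<kappa>/2) * emeasure lborel ?B + ennreal (1 / (2*\<kappa>)) * (\<integral>\<^sup>+y. ennreal ((1 - t)^2) * ennreal (indicator W (y + t *\<^sub>R (x - y)) * ?E (y + t *\<^sub>R (x - y))) \<partial>lborel)"
  proof -
   let ?F = "%y. ennreal (indicator W (y + t *\<^sub>R (x - y)) * ?E (y + t *\<^sub>R (x - y)))"
   have F: "?F \<in> borel_measurable lborel" by (rule measurable_compose[OF _ Em, of "%y. y + t *\<^sub>R (x - y)"]) simp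
   have F': "(%y. ennreal ((1 - t)^2) * ?F y) \<in> borel_measurable lborel" by (intro borel_measurable_times_ennreal borel_measurable_const F)
   have B: "(%y. ennreal (\<kappa>/2) * indicator ?B y) \<in> borel_measurable lborel"
    by (intro borel_measurable_times_ennreal borel_measurable_const borel_measurable_indicator) simp
   have "(\<integral>\<^sup>+y. ennreal (\<kappa>/2) * indicator ?B y \<partial>lborel) = ennreal (\<kappa>/2) * emeasure lborel ?B" by (rule nn_integral_cmult_indicator) simp
   moreover have "(\<integral>\<^sup>+y. ennreal (1 / (2*\<kappa>)) * (ennreal ((1 - t)^2) * ?F y) \<partial>lborel)
    = ennreal (1 / (2*\<kappa>)) * (\<integral>\<^sup>+y. ennreal ((1 - t)^2) * ?F y \<partial>lborel)" by (rule nn_integral_cmult[OF F'])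
   ultimately show ?thesis by (subst nn_integral_add[OF B borel_measurable_times_ennreal[OF borel_measurable_const F']]) simp
  qed
  also have "(\<integral>\<^sup>+y. ennreal ((1 - t)^2) * ennreal (indicator W (y + t *\<^sub>R (x - y)) * ?E (y + t *\<^sub>R (x - y))) \<partial>lborel)
    = (\<integral>\<^sup>+w. ennreal (indicator W w * ?E w) \<partial>lborel)" using nn_integral_contract[OF Em, of t x] t by simp
  also have "ennreal (\<kappa>/2) * emeasure lborel ?B + ennreal (1 / (2*\<kappa>)) * ... <= ennreal (\<kappa>/2) * ennreal b + ennreal (1 / (2*\<kappa>)) * ennreal (N^2)"
   unfolding eb by (intro add_mono mult_left_mono N) auto
  also have "... = ennreal (\<kappa>/2 * b + 1 / (2*\<kappa>) * N^2)" using \<kappa> b0 by (simp add: ennreal_mult[symmetric] ennreal_plus[symmetric] del: ennreal_plus)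
  also have "\<kappa>/2 * b + 1 / (2*\<kappa>) * N^2 = N * sqrt b" using b0 N by (simp add: \<kappa>_def field_simps power2_eq_square)
  finally show ?thesis .
 qed
 have "ennreal \<bar>LINT y|lebesgue_on ?B. U 0 0 x - S y\<bar> <= (\<integral>\<^sup>+y. ennreal (norm (U 0 0 x - S y)) \<partial>lebesgue_on ?B)"
  using integral_norm_bound_ennreal[of "lebesgue_on ?B" "%y. U 0 0 x - S y"] Si Bm by (simp add: integrable_on_bounded_continuous)
 also have "... = (\<integral>\<^sup>+y. ennreal (norm (U 0 0 x - S y)) * indicator ?B y \<partial>lebesgue)" by (simp add: nn_integral_restrict_space)
 also have "... <= (\<integral>\<^sup>+y. (\<integral>\<^sup>+t. f t y \<partial>lborel) \<partial>lebesgue)" using rem by (intro nn_integral_mono) (auto simp: indicator_def)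
 also have "... = (\<integral>\<^sup>+y. (\<integral>\<^sup>+t. f t y \<partial>lborel) \<partial>lborel)" using measurable_compose[OF measurable_pair_swap' fm]
  by (auto intro!: nn_integral_completion lborel.borel_measurable_nn_integral simp: case_prod_unfold)
 also have "... = (\<integral>\<^sup>+t. (\<integral>\<^sup>+y. f t y \<partial>lborel) \<partial>lborel)" by (rule lborel_pair.Fubini') (rule fm)
 also have "... <= (\<integral>\<^sup>+t. ennreal (d ^ Suc k) * ennreal (N * sqrt b) * indicator {0..1::real} t \<partial>lborel)"
 proof (rule nn_integral_mono_AE)
  \<comment> \<open>At \<open>t = 1\<close> the ball is contracted to a point and the substitution
    degenerates.\<close>
  have "AE t in lborel. t ~= (1::real)" by (rule AE_lborel_singleton)
  then show "AE t in lborel. (\<integral>\<^sup>+y. f t y \<partial>lborel) <= ennreal (d ^ Suc k) * ennreal (N * sqrt b) * indicator {0..1::real} t"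
  proof eventually_elim
   case (elim t)
   show ?case
   proof (cases "t \<in> {0..1}")
    case True
    have "(\<integral>\<^sup>+y. f t y \<partial>lborel) = (\<integral>\<^sup>+y. ennreal (d ^ Suc k) * (ennreal (q t y) * indicator ?B y) \<partial>lborel)"
    using True by (intro nn_integral_cong) (simp add: f_def mult.assoc)
    also have "... = ennreal (d ^ Suc k) * (\<integral>\<^sup>+y. ennreal (q t y) * indicator ?B y \<partial>lborel)"
    proof (rule nn_integral_cmult)
    have "(%y. indicator ?B y :: ennreal) \<in> borel_measurable lborel" by (rule borel_measurable_indicator) simp
    moreover have "(%y. ennreal (q t y)) \<in> borel_measurable lborel" using qy by simp
    ultimately show "(%y. ennreal (q t y) * indicator ?B y) \<in> borel_measurable lborel" by (intro borel_measurable_times_ennreal)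
    qed
    also have "... <= ennreal (d ^ Suc k) * ennreal (N * sqrt b)" using True elim by (intro mult_left_mono inner) auto
    finally show ?thesis using True by simp
   qed (simp add: f_def)
  qed
 qed
 also have "... = ennreal (d ^ Suc k * (N * sqrt b))" using d0 N b0 by (simp add: nn_integral_cmult_indicator ennreal_mult[symmetric])
 finally have fin: "\<bar>LINT y|lebesgue_on ?B. U 0 0 x - S y\<bar> <= d ^ Suc k * (N * sqrt b)" using d0 N b0 by (subst (asm) ennreal_le_iff) auto
 have "(LINT y|lebesgue_on ?B. U 0 0 x - S y) = U 0 0 x * b - avg_taylor k ?B x * b"
 proof -
  have av: "avg_taylor k ?B x = (LINT y|lebesgue_on ?B. S y) / b" unfolding avg_taylor_def S_def b_def by (rule refl)
  have mb: "measure (lebesgue_on ?B) ?B = b" unfolding b_def by (subst measure_restrict_space) auto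
  have "(LINT y|lebesgue_on ?B. U 0 0 x - S y) = (LINT y|lebesgue_on ?B. U 0 0 x) - (LINT y|lebesgue_on ?B. S y)"
   by (rule BI_integral_diff[OF _ Si]) (intro integrable_on_bounded_continuous continuous_intros Bm)
  also have "(LINT y|lebesgue_on ?B. U 0 0 x) = U 0 0 x * b" using mb by simp
  finally show ?thesis using b0 by (simp add: av)
 qed
 then have "\<bar>U 0 0 x - avg_taylor k ?B x\<bar> * b <= d ^ Suc k * N * sqrt b" using fin b0 by (simp add: left_diff_distrib[symmetric] abs_mult mult.assoc)
 moreover have "sqrt b * sqrt b = b" "sqrt b > 0" using b0 by auto
 ultimately have "(\<bar>U 0 0 x - avg_taylor k ?B x\<bar> * sqrt b) * sqrt b <= (d ^ Suc k * N) * sqrt b" by (simp only: mult.assoc)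
 then have "\<bar>U 0 0 x - avg_taylor k ?B x\<bar> * sqrt b <= d ^ Suc k * N" using \<open>sqrt b > 0\<close> by (rule mult_right_le_imp_le)
 \<comment> \<open>Dividing by the area \<open>b = pi * r^2\<close> leaves
   \<open>1 / sqrt b\<close>, which is weakened to \<open>1 / r\<close>.\<close>
 moreover have "r <= sqrt b"
 proof -
  have "r^2 * 1 <= r^2 * pi" using pi_ge_two by (intro mult_left_mono) auto
  then show ?thesis using r by (intro real_le_rsqrt) (simp add: b mult.commute)
 qed
 ultimately have "\<bar>U 0 0 x - avg_taylor k ?B x\<bar> * r <= d ^ Suc k * N" by (meson abs_ge_zero mult_left_mono order_trans)
 then show ?thesis using r by (simp add: pos_le_divide_eq)
qed

text \<open>The constant terms cancel; what remains is the mean over the ball of the first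
  derivative in the direction \<open>x - x'\<close>.\<close>

lemma avg_taylor_1_diff:
 assumes r: "r > 0" and W: "W \<in> sets borel" "ball c r \<subseteq> W"
  and N: "N > 0" "(\<integral>\<^sup>+w. ennreal (indicator W w * energy (Suc 0) 0 0 w) \<partial>lborel) <= ennreal (N^2)"
 shows "\<bar>avg_taylor 1 (ball c r) x - avg_taylor 1 (ball c r) x'\<bar> <= norm (x - x') * N / r"
proof -
 let ?B = "ball c r" and ?E = "energy (Suc 0) 0 0"
 define b where "b = measure lebesgue ?B"
 have b: "b = pi * r^2" using r by (simp add: b_def content_ball unit_ball_vol_2)
 have b0: "b > 0" using r by (simp add: b)
 have Bm: "bounded ?B" "?B \<in> sets lebesgue" by auto
 have mb: "measure (lebesgue_on ?B) ?B = b" unfolding b_def by (subst measure_restrict_space) auto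
 define w where "w = x - x'"
 have av: "avg_taylor 1 ?B x = (LINT y|lebesgue_on ?B. taylor 0 0 0 y (x - y) / fact 0 + taylor (Suc 0) 0 0 y (x - y) / fact (Suc 0)) / b" for x
  unfolding avg_taylor_def b_def by simp
 have ti: "integrable (lebesgue_on ?B) (%y. taylor n 0 0 y (x - y))" for n x using taylor_integrable[OF Bm, of n 0 0 x 0] by simp
 have "(avg_taylor 1 ?B x - avg_taylor 1 ?B x') * b
  = (LINT y|lebesgue_on ?B. (taylor 0 0 0 y (x - y) / fact 0 + taylor (Suc 0) 0 0 y (x - y) / fact (Suc 0))
    - (taylor 0 0 0 y (x' - y) / fact 0 + taylor (Suc 0) 0 0 y (x' - y) / fact (Suc 0)))" unfolding av using b0
  by (subst BI_integral_diff) (auto intro!: BI_integrable_add ti simp: left_diff_distrib simp del: fact_Suc)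
 also have "... = (LINT y|lebesgue_on ?B. taylor (Suc 0) 0 0 y w)" by (intro BI_integral_cong) (auto simp: w_def taylor.simps algebra_simps)
 also have "\<bar>...\<bar> <= (LINT y|lebesgue_on ?B. norm w * ((N / sqrt b + ?E y / (N / sqrt b)) / 2))"
 proof (rule order_trans[OF integral_abs_bound integral_mono])
  show "integrable (lebesgue_on ?B) (%y. \<bar>taylor (Suc 0) 0 0 y w\<bar>)" by (intro integrable_abs integrable_on_bounded_continuous Bm taylor_continuous continuous_intros)
  show "integrable (lebesgue_on ?B) (%y. norm w * ((N / sqrt b + ?E y / (N / sqrt b)) / 2))"
   using N b0 by (intro integrable_on_bounded_continuous Bm energy_continuous continuous_intros) auto
  fix y
  have "\<bar>taylor (Suc 0) 0 0 y w\<bar> <= sqrt (norm w ^ (2 * Suc 0) * ?E y)" by (subst real_sqrt_abs[symmetric]) (intro real_sqrt_le_mono taylor_square_le)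
  also have "... = norm w * sqrt (?E y)" by (simp add: real_sqrt_mult)
  also have "... <= norm w * ((N / sqrt b + ?E y / (N / sqrt b)) / 2)" using N b0 by (intro mult_left_mono sqrt_le_AMGM energy_nonneg) auto
  finally show "\<bar>taylor (Suc 0) 0 0 y w\<bar> <= norm w * ((N / sqrt b + ?E y / (N / sqrt b)) / 2)" .
 qed
 also have "... = norm w * ((N / sqrt b * b + (LINT y|lebesgue_on ?B. ?E y) / (N / sqrt b)) / 2)"
 proof -
  have Ei: "integrable (lebesgue_on ?B) ?E" by (intro integrable_on_bounded_continuous Bm energy_continuous)
  have "(LINT y|lebesgue_on ?B. N / sqrt b + ?E y / (N / sqrt b)) = (LINT y|lebesgue_on ?B. N / sqrt b) + (LINT y|lebesgue_on ?B. ?E y / (N / sqrt b))"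
  proof (rule BI_integral_add)
   show "integrable (lebesgue_on ?B) (%y. N / sqrt b)" by (intro integrable_on_bounded_continuous Bm continuous_intros)
   show "integrable (lebesgue_on ?B) (%y. ?E y / (N / sqrt b))" using Ei by (rule integrable_divide)
  qed
  also have "(LINT y|lebesgue_on ?B. N / sqrt b) = N / sqrt b * b" using mb by simp
  finally show ?thesis by (simp del: divide_divide_eq_right)
 qed
 also have "... <= norm w * ((N / sqrt b * b + N^2 / (N / sqrt b)) / 2)"
 proof -
  have Ei: "integrable (lebesgue_on ?B) ?E" by (intro integrable_on_bounded_continuous Bm energy_continuous)
  have "ennreal (LINT y|lebesgue_on ?B. ?E y) = (\<integral>\<^sup>+y. ennreal (?E y) \<partial>lebesgue_on ?B)"
   using Ei energy_nonneg by (intro nn_integral_eq_integral[symmetric]) auto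
  also have "... = (\<integral>\<^sup>+y. ennreal (?E y) * indicator ?B y \<partial>lebesgue)" by (simp add: nn_integral_restrict_space)
  also have "... = (\<integral>\<^sup>+y. ennreal (?E y) * indicator ?B y \<partial>lborel)" by (rule nn_integral_completion)
  also have "... <= (\<integral>\<^sup>+w. ennreal (indicator W w * ?E w) \<partial>lborel)" using W by (intro nn_integral_mono) (auto simp: indicator_def)
  also have "... <= ennreal (N^2)" by (rule N)
  finally have "(LINT y|lebesgue_on ?B. ?E y) <= N^2" by (subst (asm) ennreal_le_iff) auto
  then show ?thesis using N b0 by (intro mult_left_mono divide_right_mono add_left_mono) auto
 qed
 also have "(N / sqrt b * b + N^2 / (N / sqrt b)) / 2 = N * sqrt b"
 proof -
  have "b = sqrt b * sqrt b" using b0 by simp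
  then have "N / sqrt b * b = N * sqrt b" using b0 by (metis nonzero_eq_divide_eq mult.assoc times_divide_eq_left real_sqrt_gt_zero less_irrefl)
  then show ?thesis using N b0 by (simp add: power2_eq_square)
 qed
 finally have fin: "\<bar>(avg_taylor 1 ?B x - avg_taylor 1 ?B x') * b\<bar> <= norm w * (N * sqrt b)" .
 moreover have sb: "sqrt b * sqrt b = b" "sqrt b > 0" using b0 by auto
 ultimately have "(\<bar>avg_taylor 1 ?B x - avg_taylor 1 ?B x'\<bar> * sqrt b) * sqrt b <= (norm w * N) * sqrt b" using b0 by (simp add: abs_mult mult.assoc)
 then have "\<bar>avg_taylor 1 ?B x - avg_taylor 1 ?B x'\<bar> * sqrt b <= norm w * N" using sb(2) by (rule mult_right_le_imp_le)
 moreover have "r <= sqrt b"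
 proof -
  have "r^2 * 1 <= r^2 * pi" using pi_ge_two by (intro mult_left_mono) auto
  then show ?thesis using r by (intro real_le_rsqrt) (simp add: b mult.commute)
 qed
 ultimately have "\<bar>avg_taylor 1 ?B x - avg_taylor 1 ?B x'\<bar> * r <= norm w * N" by (meson abs_ge_zero mult_left_mono order_trans)
 then show ?thesis using r by (simp add: pos_le_divide_eq w_def)
qed

text \<open>Average over a small ball on the way from \<open>x\<close> to \<open>z\<close>, visible
  from both points inside \<open>W\<close>. It is at distance at most \<open>l * h\<close> and has
  radius of order \<open>l * r\<close>, so the second-order remainders are of order
  \<open>l\<close>, while the two averaged polynomial values differ by order
  \<open>norm (x - x') / l\<close>.\<close>

lemma star_shaped_Hoelder:
 assumes r: "r > 0" and W: "W \<in> sets borel" and star: "star_shaped_wrt W (ball z r)" and BW: "ball z r \<subseteq> W"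
  and h: "!!x y. x \<in> W ==> y \<in> W ==> norm (x - y) <= h"
  and N: "N > 0" "(\<integral>\<^sup>+w. ennreal (indicator W w * energy (Suc 0) 0 0 w) \<partial>lborel) <= ennreal (N^2)"
   "(\<integral>\<^sup>+w. ennreal (indicator W w * energy (Suc 1) 0 0 w) \<partial>lborel) <= ennreal (N^2)"
  and x: "x \<in> W" "x' \<in> W" and l: "0 < l" "l <= 1" "norm (x - x') <= l * r / 2"
 shows "\<bar>U 0 0 x - U 0 0 x'\<bar> <= 4 * l * h^2 * N / r + 2 * norm (x - x') * N / (l * r)"
proof -
 define c where "c = x + l *\<^sub>R (z - x)"
 define \<rho> where "\<rho> = l * r / 2"
 have \<rho>: "\<rho> > 0" using l r by (simp add: \<rho>_def)
 \<comment> \<open>The ray from \<open>u\<close> through \<open>y\<close>, stretched by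
   \<open>1/l\<close>, ends in the large ball; star-shapedness then puts the whole segment from
   \<open>y\<close> to \<open>u\<close> into \<open>W\<close>.\<close>
 define e where "e u y = u + (1/l) *\<^sub>R (y - u)" for u y :: "real^2"
 have y_eq: "y = u + l *\<^sub>R (e u y - u)" for u y using l by (simp add: e_def)
 have eb: "e u y \<in> ball z r" if "y \<in> ball c \<rho>" "u \<in> {x, x'}" for u y
 proof -
  have 1: "norm (y - c) < l * r / 2" using that by (simp add: \<rho>_def dist_norm norm_minus_commute)
  have eq: "l *\<^sub>R (e u y - z) = (y - c) + (1 - l) *\<^sub>R (x - u)" using l by (simp add: e_def c_def algebra_simps)
  have "norm ((1 - l) *\<^sub>R (x - u)) <= 1 * (l * r / 2)" unfolding norm_scaleR using that(2) l r by (intro mult_mono) auto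
  then have "norm (l *\<^sub>R (e u y - z)) < l * r" unfolding eq using 1 norm_triangle_ineq[of "y - c" "(1 - l) *\<^sub>R (x - u)"] by linarith
  then show ?thesis using l by (simp add: dist_norm norm_minus_commute)
 qed
 have seg: "y + t *\<^sub>R (u - y) \<in> W" if "y \<in> ball c \<rho>" "u \<in> {x, x'}" "0 <= t" "t <= 1" for u y t
 proof -
  have "y + t *\<^sub>R (u - y) = (1 - (1 - (1 - t) * l)) *\<^sub>R e u y + (1 - (1 - t) * l) *\<^sub>R u" using l by (simp add: e_def algebra_simps)
  moreover have "0 <= 1 - (1 - t) * l" "1 - (1 - t) * l <= 1" using that l by (auto simp: mult_le_one)
  ultimately have "y + t *\<^sub>R (u - y) \<in> closed_segment (e u y) u" unfolding in_segment by blast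
  then show ?thesis using star eb[OF that(1,2)] that(2) x unfolding star_shaped_wrt_def by blast
 qed
 have dist: "norm (u - y) <= l * h" if "y \<in> ball c \<rho>" "u \<in> {x, x'}" for u y
 proof -
  have "norm (u - y) = l * norm (u - e u y)" using l by (subst (1) y_eq[of y u]) (simp add: norm_minus_commute[of _ u])
  then show ?thesis using l h[of u "e u y"] eb[OF that] that(2) x BW by (auto intro!: mult_left_mono)
 qed
 have err: "\<bar>U 0 0 u - avg_taylor 1 (ball c \<rho>) u\<bar> <= 2 * l * h^2 * N / r" if u: "u \<in> {x, x'}" for u
 proof -
  have "\<bar>U 0 0 u - avg_taylor 1 (ball c \<rho>) u\<bar> <= (l * h) ^ Suc 1 * N / \<rho>"
   by (rule avg_taylor_error[OF _ \<rho>, where W=W]) (use dist[OF _ u] seg[OF _ u] W N in auto)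
  also have "... = 2 * l * h^2 * N / r" using l r by (simp add: \<rho>_def power2_eq_square)
  finally show ?thesis .
 qed
 have "ball c \<rho> \<subseteq> W" using seg[of _ x 0] by auto
 then have "\<bar>avg_taylor 1 (ball c \<rho>) x - avg_taylor 1 (ball c \<rho>) x'\<bar> <= norm (x - x') * N / \<rho>" by (intro avg_taylor_1_diff[OF \<rho> W _ N(1,2)])
 also have "... = 2 * norm (x - x') * N / (l * r)" by (simp add: \<rho>_def)
 finally show ?thesis using err[of x] err[of x'] by simp
qed

text \<open>Every level of the recursion doubles the number of squared derivatives, whence
  \<open>2 ^ n\<close>.\<close>

lemma energy_integral_le:
 assumes "W \<in> sets borel" and "!!a b. a + b = i + j + n ==> (\<integral>\<^sup>+w. ennreal (indicator W w * (U a b w)^2) \<partial>lborel) <= ennreal S"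
  and S: "S \<ge> 0"
 shows "(\<integral>\<^sup>+w. ennreal (indicator W w * energy n i j w) \<partial>lborel) <= ennreal (2 ^ n * S)" using assms(2)
proof (induction n arbitrary: i j)
 case 0
 then show ?case by (simp add: energy.simps)
next
 case (Suc n)
 have m: "(%w. ennreal (indicator W w * energy n i j w)) \<in> borel_measurable lborel" for i j using assms(1) borel_measurable_continuous_onI[OF energy_continuous[of UNIV n i j]]
  by (intro measurable_compose[OF _ measurable_ennreal] borel_measurable_times borel_measurable_indicator) auto
 have "(\<integral>\<^sup>+w. ennreal (indicator W w * energy (Suc n) i j w) \<partial>lborel)
  = (\<integral>\<^sup>+w. ennreal (indicator W w * energy n (Suc i) j w) + ennreal (indicator W w * energy n i (Suc j) w) \<partial>lborel)"
  using energy_nonneg by (intro nn_integral_cong) (simp add: energy.simps distrib_left ennreal_plus[symmetric] del: ennreal_plus)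
 also have "... = (\<integral>\<^sup>+w. ennreal (indicator W w * energy n (Suc i) j w) \<partial>lborel) + (\<integral>\<^sup>+w. ennreal (indicator W w * energy n i (Suc j) w) \<partial>lborel)"
  by (rule nn_integral_add[OF m m])
 also have "... <= ennreal (2 ^ n * S) + ennreal (2 ^ n * S)" by (intro add_mono Suc.IH Suc.prems) auto
 also have "... = ennreal (2 ^ Suc n * S)" using S by (simp add: ennreal_plus[symmetric] del: ennreal_plus)
 finally show ?case .
qed

end

subsection \<open>Star-shaped sets\<close>

text \<open>The small ball consists of convex combinations of \<open>x\<close> with points of the
  given ball. It provides the margin \<open>(1 - s) * r\<close> that mollification on the dilated
  domain requires.\<close>

lemma star_shaped_shrink:
 assumes star: "star_shaped_wrt D (ball z r)" and BD: "ball z r \<subseteq> D" and x: "x \<in> D" and s: "0 <= s" "s < 1"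
 shows "ball (z + s *\<^sub>R (x - z)) ((1 - s) * r) \<subseteq> D"
proof
 fix y assume y: "y \<in> ball (z + s *\<^sub>R (x - z)) ((1 - s) * r)"
 define b where "b = z + (1 / (1 - s)) *\<^sub>R (y - (z + s *\<^sub>R (x - z)))"
 have "b \<in> ball z r" using y s by (simp add: b_def dist_norm norm_minus_commute pos_divide_less_eq mult.commute)
 moreover have "y = (1 - s) *\<^sub>R b + s *\<^sub>R x"
 proof -
  have "(1 - s) *\<^sub>R b = (1 - s) *\<^sub>R z + (y - (z + s *\<^sub>R (x - z)))" using s by (simp add: b_def scaleR_add_right)
  then show ?thesis by (simp add: algebra_simps)
 qed
 ultimately have "b \<in> ball z r" "y \<in> closed_segment b x" using s by (auto simp: in_segment)
 then show "y \<in> D" using star x unfolding star_shaped_wrt_def by blast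
qed

definition shrink :: "real^2 => real => (real^2) set => (real^2) set" where
 "shrink z s D = (%x. z + s *\<^sub>R (x - z)) ` D"

lemma mem_shrink: "s > 0 ==> x \<in> shrink z s D \<longleftrightarrow> z + (1/s) *\<^sub>R (x - z) \<in> D"
proof -
 assume s: "s > 0"
 have "x = z + s *\<^sub>R (z + (1/s) *\<^sub>R (x - z) - z)" using s by simp
 moreover have "z + (1/s) *\<^sub>R (z + s *\<^sub>R (w - z) - z) = w" for w using s by simp
 ultimately show ?thesis unfolding shrink_def by (metis (no_types, lifting) image_iff)
qed

lemma open_shrink: "s > 0 ==> open D ==> open (shrink z s D)"
proof -
 assume s: "s > 0" and D: "open D"
 have "shrink z s D = (%x. z + (1/s) *\<^sub>R (x - z)) -` D" using mem_shrink[OF s] by auto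
 then show ?thesis using D by (simp only:) (intro open_vimage continuous_intros)
qed

lemma shrink_subset:
 assumes "star_shaped_wrt D (ball z r)" "ball z r \<subseteq> D" "r > 0" "0 <= s" "s < 1"
 shows "shrink z s D \<subseteq> D"
proof -
 have "z + s *\<^sub>R (x - z) \<in> D" if "x \<in> D" for x using star_shaped_shrink[OF assms(1,2) that assms(4,5)] assms by (force simp: subset_iff)
 then show ?thesis by (auto simp: shrink_def)
qed

lemma star_shaped_shrink_self:
 assumes star: "star_shaped_wrt D (ball z r)" and s: "0 < s"
 shows "star_shaped_wrt (shrink z s D) (ball z (s * r))" unfolding star_shaped_wrt_def
proof (intro ballI subsetI)
 fix x y w assume x: "x \<in> shrink z s D" and y: "y \<in> ball z (s * r)" and w: "w \<in> closed_segment y x"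
 obtain u where u: "0 <= u" "u <= 1" "w = (1 - u) *\<^sub>R y + u *\<^sub>R x" using w by (auto simp: in_segment)
 have y': "z + (1/s) *\<^sub>R (y - z) \<in> ball z r" using y s by (simp add: dist_norm norm_minus_commute divide_less_eq mult.commute)
 have x': "z + (1/s) *\<^sub>R (x - z) \<in> D" using x s by (simp add: mem_shrink)
 have "z + (1/s) *\<^sub>R (w - z) = (1 - u) *\<^sub>R (z + (1/s) *\<^sub>R (y - z)) + u *\<^sub>R (z + (1/s) *\<^sub>R (x - z))" using s by (simp add: u vec_eq_iff field_simps)
 then have "z + (1/s) *\<^sub>R (w - z) \<in> closed_segment (z + (1/s) *\<^sub>R (y - z)) (z + (1/s) *\<^sub>R (x - z))" using u unfolding in_segment by blast
 then have "z + (1/s) *\<^sub>R (w - z) \<in> D" using star x' y' unfolding star_shaped_wrt_def by blast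
 then show "w \<in> shrink z s D" using s by (simp add: mem_shrink)
qed

lemma ball_subset_shrink: "ball z r \<subseteq> D ==> 0 < s ==> ball z (s * r) \<subseteq> shrink z s D"
proof
 fix x assume "ball z r \<subseteq> D" "0 < s" "x \<in> ball z (s * r)"
 moreover from this have "z + (1/s) *\<^sub>R (x - z) \<in> ball z r" by (simp add: dist_norm norm_minus_commute divide_less_eq mult.commute)
 ultimately show "x \<in> shrink z s D" by (auto simp: mem_shrink)
qed

lemma shrink_exhausts:
 assumes "open D" "x \<in> D"
 obtains s0 where "0 < s0" "s0 < 1" "!!s. s0 <= s ==> s < 1 ==> x \<in> shrink z s D"
proof -
 obtain d where d: "d > 0" "ball x d \<subseteq> D" using assms open_contains_ball by blast
 define n where "n = norm (x - z)"
 \<comment> \<open>Chosen so that, for \<open>s \<ge> s0\<close>, stretching \<open>x\<close> away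
   from \<open>z\<close> by \<open>1/s\<close> moves it by less than \<open>d\<close>.\<close>
 define s0 where "s0 = (n + d/2) / (n + d)"
 have n0: "n \<ge> 0" by (simp add: n_def)
 have s0: "0 < s0" "s0 < 1" using d n0 by (auto simp: s0_def add_pos_nonneg add_nonneg_pos)
 show ?thesis
 proof (rule that[OF s0])
  fix s assume s: "s0 <= s" "s < 1"
  have sp: "s > 0" using s s0 by linarith
  have "(1/s - 1) * n < d"
  proof -
   have "n + d/2 <= s * (n + d)" using s d n0 by (simp add: s0_def pos_divide_le_eq add_nonneg_pos)
   then have "(1 - s) * n < s * d" using d s sp by (simp add: algebra_simps)
   then show ?thesis using sp by (simp add: field_simps)
  qed
  moreover have "z + (1/s) *\<^sub>R (x - z) - x = (1/s - 1) *\<^sub>R (x - z)" by (simp add: algebra_simps)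
  ultimately have "norm (z + (1/s) *\<^sub>R (x - z) - x) < d" using sp s by (simp add: n_def)
  then have "z + (1/s) *\<^sub>R (x - z) \<in> D" using d by (auto simp: dist_norm norm_minus_commute subset_iff)
  then show "x \<in> shrink z s D" using sp by (simp add: mem_shrink)
 qed
qed

subsection \<open>Sobolev functions on star-shaped domains\<close>

lemma weak_deriv_props:
 assumes "xi \<in> sobolev m D" "i + j <= m"
 shows "weak_deriv D i j xi \<in> L2_space D" "is_weak_deriv D i j xi (weak_deriv D i j xi)"
proof -
 have "\<exists>g. g \<in> L2_space D & is_weak_deriv D i j xi g" using assms by (auto simp: sobolev_def)
 from someI_ex[OF this] show "weak_deriv D i j xi \<in> L2_space D" "is_weak_deriv D i j xi (weak_deriv D i j xi)" by (simp_all add: weak_deriv_def)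
qed

lemma sobolev_norm_eq: "sobolev_norm m D f = sqrt (\<Sum>ij\<in>index2 m. (L2_norm D (weak_deriv D (fst ij) (snd ij) f))^2)"
 unfolding sobolev_norm_def index2_def by (simp add: case_prod_unfold)

lemma sobolev_norm_nonneg: "sobolev_norm m D f \<ge> 0" unfolding sobolev_norm_eq by (simp add: sum_nonneg)

lemma L2_norm_weak_deriv_le: "i + j <= m ==> L2_norm D (weak_deriv D i j f) <= sobolev_norm m D f"
proof -
 assume ij: "i + j <= m"
 have "(L2_norm D (weak_deriv D i j f))^2 <= (\<Sum>ij\<in>index2 m. (L2_norm D (weak_deriv D (fst ij) (snd ij) f))^2)"
  using member_le_sum[of "(i, j)" "index2 m" "%ij. (L2_norm D (weak_deriv D (fst ij) (snd ij) f))^2"] ij by (simp add: index2_def finite_index2[unfolded index2_def])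
 then show ?thesis unfolding sobolev_norm_eq by (rule real_le_rsqrt)
qed

lemma mollify_derivative_family: "eps > 0 ==> integrable lborel f ==> derivative_family (%i j. mollify eps i j f)" by standard (rule mollify_has_derivative)

text \<open>On the dilated domain the derivatives of the mollified function are mollified weak
  derivatives, and mollification does not increase the \<open>L2\<close> norm.\<close>

lemma mollify_energy:
 assumes D: "open D" "bounded D" and star: "star_shaped_wrt D (ball z r)" and BD: "ball z r \<subseteq> D"
  and xi: "xi \<in> sobolev m D" and rep: "represents D xi f" and ij: "i + j <= m"
  and s: "0 < s" "s < 1" and e: "eps > 0" "2 * eps < (1 - s) * r"
 shows "(\<integral>\<^sup>+w. ennreal (indicator (shrink z s D) w * (mollify eps i j f w)^2) \<partial>lborel) <= ennreal ((sobolev_norm m D xi)^2)"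
proof -
 have Dl: "D \<in> lmeasurable" using D by (simp add: lmeasurable_open)
 obtain g where g: "represents D (weak_deriv D i j xi) g" using L2_space_represents[OF Dl weak_deriv_props(1)[OF xi ij]] .
 have gm: "g \<in> borel_measurable borel" "integrable lborel g" "integrable lborel (%x. (g x)^2)"
  "L2_norm D (weak_deriv D i j xi) = sqrt (LINT x|lborel. (g x)^2)" using g by (auto simp: represents_def)
 have eq: "mollify eps i j f w = mollify eps 0 0 g w" if "w \<in> shrink z s D" for w
 proof -
  obtain x where x: "x \<in> D" "w = z + s *\<^sub>R (x - z)" using \<open>w \<in> shrink z s D\<close> by (auto simp: shrink_def)
  have "cball w (2 * eps) \<subseteq> D" using star_shaped_shrink[OF star BD x(1), of s] s e unfolding x(2) by (force simp: subset_iff)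
  then show ?thesis by (rule mollify_weak_deriv[OF e(1) _ weak_deriv_props(2)[OF xi ij] rep g])
 qed
 have "(\<integral>\<^sup>+w. ennreal (indicator (shrink z s D) w * (mollify eps i j f w)^2) \<partial>lborel)
  <= (\<integral>\<^sup>+w. ennreal ((mollify eps 0 0 g w)^2) \<partial>lborel)" by (intro nn_integral_mono ennreal_leI) (auto simp: indicator_def eq)
 also have "... <= (\<integral>\<^sup>+w. ennreal ((g w)^2) \<partial>lborel)" by (rule nn_integral_mollify_square_le[OF e(1) gm(1,2)])
 also have "... = ennreal (LINT x|lborel. (g x)^2)" by (intro nn_integral_eq_integral gm) auto
 also have "... <= ennreal ((sobolev_norm m D xi)^2)"
 proof (rule ennreal_leI)
  have "(LINT x|lborel. (g x)^2) = (L2_norm D (weak_deriv D i j xi))^2" by (simp add: gm(4))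
  also have "... <= (sobolev_norm m D xi)^2" using L2_norm_weak_deriv_le[OF ij] by (intro power_mono) auto
  finally show "(LINT x|lborel. (g x)^2) <= (sobolev_norm m D xi)^2" .
 qed
 finally show ?thesis .
qed

text \<open>Hoelder bounds for the mollified functions, uniform in the dilation and the mollifier,
  survive in the limit and give the continuous representative. For the polynomials no limit is
  taken: the slack \<open>dt\<close> absorbs the effect of dilation and mollification.\<close>

theorem sobolev_approximation:
 assumes D: "open D" "bounded D" and star: "star_shaped_wrt D (ball z r)" and BD: "ball z r \<subseteq> D" and r: "r > 0"
  and h: "!!x y. x \<in> D ==> y \<in> D ==> norm (x - y) <= h" and k: "k \<ge> 1"
  and xi: "xi \<in> sobolev (k + 1) D"
 obtains g where "continuous_on (closure D) g" "AE x in lebesgue_on D. g x = xi x"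
  "!!dt. dt > 0 ==> \<exists>p\<in>poly2 k. \<forall>x\<in>closure D. \<bar>g x - p x\<bar> <= 2 ^ (k + 2) * h ^ Suc k / r * sobolev_norm (k + 1) D xi + dt"
proof -
 have Dl: "D \<in> lmeasurable" using D by (simp add: lmeasurable_open)
 have Dm: "D \<in> sets lebesgue" using D by simp
 have zD: "z \<in> D" using BD r by auto
 have h0: "h \<ge> 0" using h[OF zD zD] by simp
 define S where "S = sobolev_norm (k + 1) D xi"
 have S0: "S \<ge> 0" by (simp add: S_def sobolev_norm_nonneg)
 have xi2: "xi \<in> L2_space D" using xi by (simp add: sobolev_def)
 obtain f where f: "represents D xi f" using L2_space_represents[OF Dl xi2] .
 have fm: "f \<in> borel_measurable borel" "integrable lborel f" "AE x in lebesgue. f x = indicator D x * xi x" using f by (auto simp: represents_def)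
 \<comment> \<open>The bound is put into the form of the square of a positive number:
   \<open>dt\<close> keeps it positive, and \<open>2 ^ Suc k\<close> exceeds the square root of
   \<open>2 ^ n\<close>.\<close>
 have energy: "(\<integral>\<^sup>+w. ennreal (indicator (shrink z s D) w * derivative_family.energy (%i j. mollify eps i j f) n 0 0 w) \<partial>lborel)
   <= ennreal ((2 ^ Suc k * (S + dt))^2)" if s: "0 < s" "s < 1" and e: "eps > 0" "2 * eps < (1 - s) * r" and n: "n <= Suc k" and dt: "dt > 0" for s eps n dt
 proof -
  interpret derivative_family "%i j. mollify eps i j f" by (rule mollify_derivative_family[OF e(1) fm(2)])
  have "(\<integral>\<^sup>+w. ennreal (indicator (shrink z s D) w * energy n 0 0 w) \<partial>lborel) <= ennreal (2 ^ n * S^2)"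
  proof (rule energy_integral_le)
   show "shrink z s D \<in> sets borel" using open_shrink[OF s(1) D(1)] by simp
   fix a b assume "a + b = 0 + 0 + n"
   then show "(\<integral>\<^sup>+w. ennreal (indicator (shrink z s D) w * (mollify eps a b f w)^2) \<partial>lborel) <= ennreal (S^2)"
    unfolding S_def using n by (intro mollify_energy[OF D star BD xi f _ s e]) auto
  qed simp
  also have "... <= ennreal ((2 ^ Suc k * (S + dt))^2)"
  proof (rule ennreal_leI)
   have "(2::real) ^ n * S^2 <= 2 ^ Suc k * (S + dt)^2" using n S0 dt by (intro mult_mono power_increasing power_mono) auto
   also have "... <= (2 ^ Suc k)^2 * (S + dt)^2" by (intro mult_right_mono self_le_power) (auto intro: one_le_power simp del: power_Suc)
   finally show "2 ^ n * S^2 <= (2 ^ Suc k * (S + dt))^2" by (simp add: power_mult_distrib del: power_Suc)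
  qed
  finally show ?thesis .
 qed
 have approx: "\<exists>p\<in>poly2 k. \<forall>x\<in>shrink z s D. \<bar>mollify eps 0 0 f x - p x\<bar> <= h ^ Suc k * (2 ^ Suc k * (S + dt)) / (s * r)"
  if s: "0 < s" "s < 1" and e: "eps > 0" "2 * eps < (1 - s) * r" and dt: "dt > 0" for s eps dt
 proof -
  interpret derivative_family "%i j. mollify eps i j f" by (rule mollify_derivative_family[OF e(1) fm(2)])
  have sub: "shrink z s D \<subseteq> D" using shrink_subset[OF star BD r] s by auto
  have bs: "ball z (s * r) \<subseteq> shrink z s D" by (rule ball_subset_shrink[OF BD s(1)])
  have st: "star_shaped_wrt (shrink z s D) (ball z (s * r))" by (rule star_shaped_shrink_self[OF star s(1)])
  show ?thesis
  proof (intro bexI[of _ "avg_taylor k (ball z (s * r))"] ballI)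
   fix x assume x: "x \<in> shrink z s D"
   show "\<bar>mollify eps 0 0 f x - avg_taylor k (ball z (s * r)) x\<bar> <= h ^ Suc k * (2 ^ Suc k * (S + dt)) / (s * r)"
   proof (rule avg_taylor_error[OF k])
    show "0 < s * r" "0 < 2 ^ Suc k * (S + dt)" using s r S0 dt by (auto simp: add_nonneg_pos)
    show "norm (x - y) <= h" if "y \<in> ball z (s * r)" for y using that x bs sub by (intro h) auto
    show "shrink z s D \<in> sets borel" using open_shrink[OF s(1) D(1)] by simp
    show "y + t *\<^sub>R (x - y) \<in> shrink z s D" if "y \<in> ball z (s * r)" "0 <= t" "t < 1" for y t
    proof -
    have "y + t *\<^sub>R (x - y) = (1 - t) *\<^sub>R y + t *\<^sub>R x" by (simp add: algebra_simps)
    then have "y + t *\<^sub>R (x - y) \<in> closed_segment y x" using that unfolding in_segment by auto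
    then show ?thesis using st x that(1) unfolding star_shaped_wrt_def by blast
    qed
    show "(\<integral>\<^sup>+w. ennreal (indicator (shrink z s D) w * energy (Suc k) 0 0 w) \<partial>lborel) <= ennreal ((2 ^ Suc k * (S + dt))^2)"
    by (rule energy[OF s e _ dt]) simp
   qed
  qed (rule avg_taylor_poly2; auto)
 qed
 define K where "K = 2 ^ Suc k * (S + 1)"
 have K: "K > 0" using S0 by (simp add: K_def add_nonneg_pos)
 have hoelder: "\<bar>mollify eps 0 0 f x - mollify eps 0 0 f x'\<bar> <= (8 * h^2 * K / r + 4 * K / r) * sqrt (norm (x - x'))"
  if s: "1/2 <= s" "s < 1" and e: "eps > 0" "2 * eps < (1 - s) * r" and x: "x \<in> shrink z s D" "x' \<in> shrink z s D"
   and n: "norm (x - x') < min 1 ((r/4)^2)" for s eps x x'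
 proof (cases "x = x'")
  case False
  interpret derivative_family "%i j. mollify eps i j f" by (rule mollify_derivative_family[OF e(1) fm(2)])
  have s0: "0 < s" using s by linarith
  \<comment> \<open>The two terms of the Hoelder estimate, of order \<open>l\<close> and
    \<open>norm (x - x') / l\<close>, become comparable for this choice.\<close>
  define l where "l = sqrt (norm (x - x'))"
  have ll: "l * l = norm (x - x')" by (simp add: l_def)
  have l: "0 < l" "l <= 1" using False n by (auto simp: l_def)
  have "l < r/4"
  proof -
   have "l^2 < (r/4)^2" using n ll by (simp add: power2_eq_square)
   then show ?thesis using r by (intro power2_less_imp_less[of l "r/4"]) auto
  qed
  then have "l * l <= l * (r / 4)" using l by (intro mult_left_mono) auto
  also have "... <= l * (s * r) / 2" using l s r by (simp add: field_simps)
  finally have lr: "norm (x - x') <= l * (s * r) / 2" by (simp add: ll)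
  have "\<bar>mollify eps 0 0 f x - mollify eps 0 0 f x'\<bar> <= 4 * l * h^2 * K / (s * r) + 2 * norm (x - x') * K / (l * (s * r))"
  proof (rule star_shaped_Hoelder[where W="shrink z s D" and z=z])
   show "shrink z s D \<in> sets borel" using open_shrink[OF s0 D(1)] by simp
   show "star_shaped_wrt (shrink z s D) (ball z (s * r))" by (rule star_shaped_shrink_self[OF star s0])
   show "ball z (s * r) \<subseteq> shrink z s D" by (rule ball_subset_shrink[OF BD s0])
   show "norm (x - y) <= h" if "x \<in> shrink z s D" "y \<in> shrink z s D" for x y using that shrink_subset[OF star BD r, of s] s by (intro h) auto
   show "(\<integral>\<^sup>+w. ennreal (indicator (shrink z s D) w * energy (Suc 0) 0 0 w) \<partial>lborel) <= ennreal (K^2)"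
    unfolding K_def using k by (intro energy[OF s0 s(2) e]) auto
   show "(\<integral>\<^sup>+w. ennreal (indicator (shrink z s D) w * energy (Suc 1) 0 0 w) \<partial>lborel) <= ennreal (K^2)"
    unfolding K_def using k by (intro energy[OF s0 s(2) e]) auto
  qed (use s0 r K x l lr in auto)
  also have "... = 4 * l * h^2 * K / (s * r) + 2 * l * K / (s * r)" unfolding ll[symmetric] using l by simp
  also have "... <= 4 * l * h^2 * K / (1/2 * r) + 2 * l * K / (1/2 * r)" using l K s r s0 by (intro add_mono divide_left_mono mult_right_mono mult_pos_pos) auto
  also have "... = (8 * h^2 * K / r + 4 * K / r) * l" by (simp add: field_simps)
  finally show ?thesis by (simp add: l_def)
 qed simp
 define M where "M = 8 * h^2 * K / r + 4 * K / r"
 have M: "M > 0" using K r by (simp add: M_def add_nonneg_pos)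
 \<comment> \<open>Off one null set \<open>f\<close> agrees with \<open>xi\<close> and is the limit
   of its mollifications, so the Hoelder bound passes to \<open>f\<close> there.\<close>
 obtain T where T: "T \<in> null_sets lebesgue" "!!x. x \<notin> T ==> f x = indicator D x * xi x \<and>
  (\<forall>r>0. \<exists>d>0. \<forall>eps. 0 < eps & eps < d --> \<bar>mollify eps 0 0 f x - f x\<bar> <= r)"
 proof -
  have "AE x in lebesgue. f x = indicator D x * xi x \<and>
  (\<forall>r>0. \<exists>d>0. \<forall>eps. 0 < eps & eps < d --> \<bar>mollify eps 0 0 f x - f x\<bar> <= r)" using fm(3) mollify_tendsto_AE[OF fm(1,2)] by eventually_elim blast
  then show ?thesis by (rule AE_E3) (rule that, auto)
 qed
 have hoelder_f: "\<bar>f x - f x'\<bar> <= M * sqrt (norm (x - x'))" if x: "x \<in> D - T" "x' \<in> D - T" "norm (x - x') < min 1 ((r/4)^2)" for x x'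
 proof (rule field_le_epsilon)
  fix e :: real assume e: "e > 0"
  obtain s1 where s1: "0 < s1" "s1 < 1" "!!s. s1 <= s ==> s < 1 ==> x \<in> shrink z s D" using shrink_exhausts[OF D(1), of x z] x by blast
  obtain s2 where s2: "0 < s2" "s2 < 1" "!!s. s2 <= s ==> s < 1 ==> x' \<in> shrink z s D" using shrink_exhausts[OF D(1), of x' z] x by blast
  define s where "s = max (1/2) (max s1 s2)"
  have s: "1/2 <= s" "s < 1" "x \<in> shrink z s D" "x' \<in> shrink z s D" using s1 s2 by (auto simp: s_def)
  obtain d1 where d1: "d1 > 0" "!!eps. 0 < eps ==> eps < d1 ==> \<bar>mollify eps 0 0 f x - f x\<bar> <= e/2" using T(2)[of x] x e by (meson DiffD2 half_gt_zero)
  obtain d2 where d2: "d2 > 0" "!!eps. 0 < eps ==> eps < d2 ==> \<bar>mollify eps 0 0 f x' - f x'\<bar> <= e/2" using T(2)[of x'] x e by (meson DiffD2 half_gt_zero)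
  define eps where "eps = min (min d1 d2) ((1 - s) * r / 2) / 2"
  have eps: "0 < eps" "eps < d1" "eps < d2" "2 * eps < (1 - s) * r" using d1 d2 s r by (auto simp: eps_def min_def)
  show "\<bar>f x - f x'\<bar> <= M * sqrt (norm (x - x')) + e" using hoelder[OF s(1,2) eps(1,4) s(3,4) x(3)] d1(2)[OF eps(1,2)] d2(2)[OF eps(1,3)] unfolding M_def by linarith
 qed
 have uc: "uniformly_continuous_on (D - T) f" unfolding uniformly_continuous_on_def
 proof (intro allI impI)
  fix e :: real assume e: "e > 0"
  define d where "d = min (min 1 ((r/4)^2)) ((e / (2 * M))^2)"
  have "d > 0" using e M r by (simp add: d_def)
  moreover have "dist (f x') (f x) < e" if "x \<in> D - T" "x' \<in> D - T" "dist x' x < d" for x x'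
  proof -
   have n: "norm (x' - x) < min 1 ((r/4)^2)" "norm (x' - x) < (e / (2 * M))^2" using that by (auto simp: d_def dist_norm)
   have "sqrt (norm (x' - x)) < e / (2 * M)" using n(2) e M by (intro real_less_lsqrt) auto
   then have "M * sqrt (norm (x' - x)) < e" using M e by (simp add: field_simps)
   then show ?thesis using hoelder_f[OF that(2,1) n(1)] by (simp add: dist_real_def)
  qed
  ultimately show "\<exists>d>0. \<forall>x\<in>D - T. \<forall>x'\<in>D - T. dist x' x < d --> dist (f x') (f x) < e" by blast
 qed
 \<comment> \<open>A null set contains no nonempty open set, so its complement is dense in
   \<open>D\<close>; the uniformly continuous function then extends to the closure.\<close>
 have clD: "closure (D - T) = closure D"
 proof (rule antisym)
  have "D \<subseteq> closure (D - T)"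
  proof
   fix x assume x: "x \<in> D"
   show "x \<in> closure (D - T)"
   proof (rule ccontr)
    assume n: "x \<notin> closure (D - T)"
    have o: "open (D - closure (D - T))" using D by (simp add: open_Diff)
    have "D - closure (D - T) \<subseteq> T" using closure_subset[of "D - T"] by auto
    then have "negligible (D - closure (D - T))" using T(1) negligible_subset by (auto simp: negligible_iff_null_sets)
    then have "D - closure (D - T) = {}" using o open_not_negligible by blast
    then show False using x n by auto
   qed
  qed
  then show "closure D \<subseteq> closure (D - T)" by (simp add: closure_minimal)
 qed (rule closure_mono, auto)
 obtain g where g: "uniformly_continuous_on (closure D) g" "!!x. x \<in> D - T ==> f x = g x" using uniformly_continuous_on_extension_on_closure[OF uc] unfolding clD by metis
 have cg: "continuous_on (closure D) g" using g(1) by (rule uniformly_continuous_imp_continuous)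
 have aeg: "AE x in lebesgue. x \<in> D --> f x = g x & g x = xi x" using AE_not_in[OF T(1)] by eventually_elim (use g(2) T(2) in auto)
 show ?thesis
 proof (rule that[OF cg])
  show "AE x in lebesgue_on D. g x = xi x" using aeg Dm by (simp add: AE_restrict_space_iff) (auto elim: eventually_mono)
  fix dt :: real assume dt: "dt > 0"
  define A where "A = h ^ Suc k * 2 ^ Suc k / r"
  have A0: "A \<ge> 0" using h0 r by (simp add: A_def)
  \<comment> \<open>Replacing \<open>S\<close> by \<open>S + et\<close> in the bound may cost at
    most \<open>dt / 2\<close>.\<close>
  define et where "et = dt / (4 * (A + 1))"
  have et: "et > 0" "2 * A * et <= dt / 2" using dt A0 by (auto simp: et_def field_simps)
  obtain d where d: "d > 0" "!!x x'. x \<in> closure D ==> x' \<in> closure D ==> dist x' x < d ==> dist (g x') (g x) < dt / 4"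
   using g(1) dt unfolding uniformly_continuous_on_def by (metis divide_pos_pos zero_less_numeral)
  \<comment> \<open>The dilation moves points of \<open>D\<close> by at most
    \<open>(1 - s) * h < d\<close>, over which \<open>g\<close> changes by less than
    \<open>dt / 4\<close>; \<open>s \<ge> 1/2\<close> keeps the radius \<open>s * r\<close>
    comparable to \<open>r\<close>.\<close>
  define s where "s = max (1/2) (1 - d / (2 * (h + 1)))"
  have s: "1/2 <= s" "s < 1" "(1 - s) * h < d"
  proof -
   show "1/2 <= s" "s < 1" using d(1) h0 by (auto simp: s_def)
   have "(1 - s) * h <= d / (2 * (h + 1)) * h" using h0 by (intro mult_right_mono) (auto simp: s_def)
   also have "... = d * (h / (2 * (h + 1)))" by simp
   also have "... < d * 1" using d(1) h0 by (intro mult_strict_left_mono) (auto simp: divide_less_eq)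
   finally show "(1 - s) * h < d" by simp
  qed
  have s0: "0 < s" using s by linarith
  define eps where "eps = min (d / 4) ((1 - s) * r / 4)"
  have eps: "eps > 0" "2 * eps < (1 - s) * r" "2 * eps < d"
  proof -
   have 1: "0 < (1 - s) * r" using s r by simp
   have 2: "eps <= d / 4" "eps <= (1 - s) * r / 4" by (auto simp: eps_def)
   show "eps > 0" using 1 d(1) by (simp add: eps_def)
   show "2 * eps < (1 - s) * r" "2 * eps < d" using 1 2 d(1) by linarith+
  qed
  obtain p where p: "p \<in> poly2 k" "!!x. x \<in> shrink z s D ==> \<bar>mollify eps 0 0 f x - p x\<bar> <= h ^ Suc k * (2 ^ Suc k * (S + et)) / (s * r)"
   using approx[OF s0 s(2) eps(1,2) et(1)] by blast
  \<comment> \<open>The polynomial \<open>p\<close> approximates on the dilated domain; composition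
    with the dilation transports it to \<open>D\<close> without raising the degree.\<close>
  define q where "q x = p ((1 - s) *\<^sub>R z + s *\<^sub>R x)" for x
  have q: "q \<in> poly2 k" unfolding q_def[abs_def] by (rule poly2_affine[OF p(1)])
  have main: "\<bar>g x - q x\<bar> <= 2 ^ (k + 2) * h ^ Suc k / r * S + dt" if x: "x \<in> D" for x
  proof -
   define y where "y = z + s *\<^sub>R (x - z)"
   have y: "y \<in> shrink z s D" using x by (auto simp: y_def shrink_def)
   have yD: "y \<in> D" using shrink_subset[OF star BD r, of s] s s0 y by auto
   have cb: "cball y (2 * eps) \<subseteq> D" using star_shaped_shrink[OF star BD x, of s] s s0 eps unfolding y_def by (force simp: subset_iff)
   have "norm (y - x) = (1 - s) * norm (x - z)"
   proof -
    have "y - x = - ((1 - s) *\<^sub>R (x - z))" by (simp add: y_def algebra_simps)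
    then show ?thesis using s by simp
   qed
   also have "... <= (1 - s) * h" using s h[OF x zD] by (intro mult_left_mono) auto
   finally have "dist y x < d" using s by (simp add: dist_norm)
   then have 1: "\<bar>g y - g x\<bar> < dt / 4" using d(2)[of x y] x yD closure_subset by (auto simp: dist_real_def)
   have 2: "\<bar>mollify eps 0 0 f y - g y\<bar> <= dt / 4"
   proof (rule mollify_uniform[OF eps(1) fm(2) cb])
    show "AE y in lborel. y \<in> D --> f y = g y"
    proof -
    have "AE y in lebesgue. y \<in> D --> f y = g y" using aeg by eventually_elim auto
    then show ?thesis by (simp add: AE_completion_iff)
    qed
    fix w assume w: "w \<in> cball y (2 * eps)"
    then have "dist w y < d" using eps by (simp add: dist_commute)
    moreover have "w \<in> D" using w cb by auto
    ultimately show "\<bar>g w - g y\<bar> <= dt / 4" using d(2)[of y w] yD closure_subset by (force simp: dist_real_def)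
   qed
   have 3: "\<bar>mollify eps 0 0 f y - q x\<bar> <= h ^ Suc k * (2 ^ Suc k * (S + et)) / (s * r)" using p(2)[OF y] by (simp add: q_def y_def algebra_simps)
   \<comment> \<open>Bounding \<open>1/s\<close> by 2 turns \<open>2 ^ Suc k\<close> into
     \<open>2 ^ (k + 2)\<close>.\<close>
   also have "... <= h ^ Suc k * (2 ^ Suc k * (S + et)) / (1/2 * r)" using s r s0 h0 S0 et by (intro divide_left_mono mult_right_mono mult_nonneg_nonneg mult_pos_pos) auto
   also have "... = 2 * A * S + 2 * A * et" by (simp add: A_def algebra_simps add_divide_distrib)
   also have "... <= 2 ^ (k + 2) * h ^ Suc k / r * S + dt / 2" using et(2) by (simp add: A_def mult_ac)
   finally show ?thesis using 1 2 by linarith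
  qed
  have "\<bar>g x - q x\<bar> <= 2 ^ (k + 2) * h ^ Suc k / r * S + dt" if x: "x \<in> closure D" for x by (rule continuous_le_on_closure[OF _ x main])
    (intro continuous_intros cg continuous_poly2[OF q])
  then show "\<exists>p\<in>poly2 k. \<forall>x\<in>closure D. \<bar>g x - p x\<bar> <= 2 ^ (k + 2) * h ^ Suc k / r * sobolev_norm (k + 1) D xi + dt"
   using q unfolding S_def by blast
 qed
qed

section \<open>Geometry of the boundary: gauge, tangents, normals\<close>

subsection \<open>The Jordan curve theorem in the plane\<close>

text \<open>The curve is homeomorphic to a circle, so Jordan--Brouwer separation yields a bounded
  component of the complement, and the frontier of this component is already the whole
  curve.\<close>

lemma Jordan_real2:
 fixes c :: "real => real^2"
 assumes c: "simple_path c" "pathfinish c = pathstart c"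
 shows "open (inside (path_image c))" "bounded (inside (path_image c))" "inside (path_image c) ~= {}"
  "frontier (inside (path_image c)) = path_image c"
proof -
 let ?S = "path_image c"
 have S: "compact ?S" "closed ?S" "bounded ?S" using c(1) compact_simple_path_image compact_imp_closed compact_imp_bounded by blast+
 have "?S homeomorphic sphere (0::complex) 1" by (rule homeomorphic_simple_path_image_circle[OF c]) simp
 also have "sphere (0::complex) 1 homeomorphic sphere (0::real^2) 1" by (rule homeomorphic_spheres_gen) auto
 finally have hom: "?S homeomorphic sphere (0::real^2) 1" .
 have "\<not> connected (- ?S)" by (rule Jordan_Brouwer_separation[OF hom]) simp
 then obtain C where C: "C \<in> components (- ?S)" "bounded C" using cobounded_has_bounded_component[of "- ?S"] S(3) by auto
 have CI: "C \<subseteq> inside ?S"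
 proof
  fix x assume "x \<in> C"
  then have "connected_component_set (- ?S) x = C" "x \<notin> ?S" using C(1) connected_component_eq by (force simp: components_def)+
  then show "x \<in> inside ?S" using C(2) by (simp add: inside_def)
 qed
 show o: "open (inside ?S)" by (rule open_inside[OF S(2)])
 show "bounded (inside ?S)" using S(3) by (rule bounded_inside)
 show "inside ?S ~= {}" using CI in_components_nonempty[OF C(1)] by blast
 have "frontier C = ?S" by (rule Jordan_Brouwer_frontier[OF hom C(1)]) simp
 then have "?S \<subseteq> closure (inside ?S)" using closure_mono[OF CI] by (auto simp: frontier_def)
 moreover have n: "?S \<inter> inside ?S = {}" by (auto simp: inside_def)
 ultimately have "?S \<subseteq> frontier (inside ?S)" using n by (auto simp: frontier_def interior_open[OF o])
 then show "frontier (inside ?S) = ?S" using frontier_inside_subset[OF S(2)] by blast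
qed

subsection \<open>The gauge of a star-shaped domain\<close>

locale star_domain =
 fixes D :: "(real^2) set" and z :: "real^2" and r :: real
 assumes openD: "open D" and boundedD: "bounded D" and r0: "r > 0" and ballD: "ball z r \<subseteq> D"
  and starD: "star_shaped_wrt D (ball z r)"
begin

lemma zD: "z \<in> D" using ballD r0 by auto

lemma shrink_mono:
 assumes "0 < s" "s <= t" "x \<in> shrink z s D"
 shows "x \<in> shrink z t D"
proof -
 have y: "z + (1/s) *\<^sub>R (x - z) \<in> D" using assms mem_shrink by auto
 have "z + (1/t) *\<^sub>R (x - z) = (1 - s/t) *\<^sub>R z + (s/t) *\<^sub>R (z + (1/s) *\<^sub>R (x - z))" using assms by (simp add: vec_eq_iff field_simps)
 then have "z + (1/t) *\<^sub>R (x - z) \<in> closed_segment z (z + (1/s) *\<^sub>R (x - z))" using assms unfolding in_segment by (intro exI[of _ "s/t"]) auto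
 then have "z + (1/t) *\<^sub>R (x - z) \<in> D"
 proof -
  have "z \<in> ball z r" using r0 by simp
  then show ?thesis using starD y \<open>z + (1/t) *\<^sub>R (x - z) \<in> closed_segment z (z + (1/s) *\<^sub>R (x - z))\<close> unfolding star_shaped_wrt_def by blast
 qed
 then show ?thesis using assms by (simp add: mem_shrink)
qed

text \<open>The Minkowski functional of \<open>D\<close> about \<open>z\<close>. As \<open>D\<close>
  is only star-shaped, it is positively homogeneous but in general not subadditive.\<close>

definition minkowski :: "real^2 => real" where
 "minkowski x = Inf {s. 0 < s & x \<in> shrink z s D}"

lemma gauge_nonempty: "norm (x - z) < s * r ==> 0 < s ==> x \<in> shrink z s D" using ball_subset_shrink[OF ballD, of s] by (auto simp: dist_norm norm_minus_commute subset_iff)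

lemma gauge_set_nonempty: "{s. 0 < s & x \<in> shrink z s D} ~= {}"
proof -
 have "x \<in> shrink z (norm (x - z) / r + 1) D"
 proof (rule gauge_nonempty)
  show "0 < norm (x - z) / r + 1" using r0 by (intro add_nonneg_pos) auto
  show "norm (x - z) < (norm (x - z) / r + 1) * r" using r0 by (simp add: distrib_right)
 qed
 moreover have "0 < norm (x - z) / r + 1" using r0 by (intro add_nonneg_pos) auto
 ultimately show ?thesis by blast
qed

lemma gauge_le: "0 < s ==> x \<in> shrink z s D ==> minkowski x <= s" unfolding minkowski_def by (rule cInf_lower) (auto intro: bdd_belowI[of _ 0])

lemma gauge_nonneg: "minkowski x \<ge> 0" unfolding minkowski_def by (rule cInf_greatest[OF gauge_set_nonempty]) auto

lemma gauge_less: "minkowski x < s ==> x \<in> shrink z s D"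
proof -
 assume "minkowski x < s"
 then obtain t where "0 < t" "x \<in> shrink z t D" "t < s" unfolding minkowski_def using cInf_lessD[OF gauge_set_nonempty] by blast
 then show ?thesis using shrink_mono[of t s x] by auto
qed

lemma shrink_1: "shrink z 1 D = D" by (auto simp: shrink_def)

lemma gauge_less_1_iff: "minkowski x < 1 \<longleftrightarrow> x \<in> D"
proof
 show "minkowski x < 1 ==> x \<in> D" using gauge_less[of x 1] by (simp add: shrink_1)
 assume "x \<in> D"
 then obtain s0 where "0 < s0" "s0 < 1" "!!s. s0 <= s ==> s < 1 ==> x \<in> shrink z s D" using shrink_exhausts[OF openD, of x z] by blast
 then show "minkowski x < 1" using gauge_le[of s0 x] by force
qed

text \<open>The substitute for the triangle inequality: a point of a dilate of \<open>D\<close> plus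
  a vector of a dilated ball is a convex combination, up to scaling, of a point of \<open>D\<close>
  and a point of the ball. Star-shapedness is used with respect to the whole ball, not just its
  centre.\<close>

lemma gauge_add_le: "minkowski (x + w) <= minkowski x + norm w / r"
proof (rule field_le_epsilon)
 fix e :: real assume e: "e > 0"
 define s t where "s = minkowski x + e/2" and "t = norm w / r + e/2"
 have s: "s > 0" and t: "t > 0" using e gauge_nonneg[of x] r0 by (auto simp: s_def t_def add_nonneg_pos)
 have "x \<in> shrink z s D" using e by (intro gauge_less) (simp add: s_def)
 then have xs: "z + (1/s) *\<^sub>R (x - z) \<in> D" using s by (simp add: mem_shrink)
 have "norm w < t * r" using e r0 by (simp add: t_def field_simps)
 then have wt: "z + (1/t) *\<^sub>R w \<in> ball z r" using t by (simp add: dist_norm divide_less_eq mult.commute)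
 have "z + (1/(s + t)) *\<^sub>R (x + w - z) = (1 - s/(s + t)) *\<^sub>R (z + (1/t) *\<^sub>R w) + (s/(s + t)) *\<^sub>R (z + (1/s) *\<^sub>R (x - z))"
 proof -
  have 1: "1 - s/(s + t) = t/(s + t)" using s t by (simp add: field_simps)
  have a: "(t/(s + t)) *\<^sub>R (z + (1/t) *\<^sub>R w) = (t/(s + t)) *\<^sub>R z + (1/(s + t)) *\<^sub>R w" using t by (simp add: scaleR_add_right)
  have b: "(s/(s + t)) *\<^sub>R (z + (1/s) *\<^sub>R (x - z)) = (s/(s + t)) *\<^sub>R z + (1/(s + t)) *\<^sub>R (x - z)" using s by (simp add: scaleR_add_right)
  have c: "(t/(s + t)) *\<^sub>R z + (s/(s + t)) *\<^sub>R z = z" using s t by (simp add: scaleR_add_left[symmetric] add_divide_distrib[symmetric] add.commute)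
  have "(t/(s + t)) *\<^sub>R (z + (1/t) *\<^sub>R w) + (s/(s + t)) *\<^sub>R (z + (1/s) *\<^sub>R (x - z))
   = ((t/(s + t)) *\<^sub>R z + (s/(s + t)) *\<^sub>R z) + ((1/(s + t)) *\<^sub>R w + (1/(s + t)) *\<^sub>R (x - z))" unfolding a b by (simp only: add_ac)
  also have "... = z + (1/(s + t)) *\<^sub>R (x + w - z)" unfolding c scaleR_add_right[symmetric] by (simp add: algebra_simps)
  finally show ?thesis unfolding 1 by (rule sym)
 qed
 then have "z + (1/(s + t)) *\<^sub>R (x + w - z) \<in> closed_segment (z + (1/t) *\<^sub>R w) (z + (1/s) *\<^sub>R (x - z))"
  using s t unfolding in_segment by (intro exI[of _ "s/(s + t)"]) auto
 then have "z + (1/(s + t)) *\<^sub>R (x + w - z) \<in> D" using starD xs wt unfolding star_shaped_wrt_def by blast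
 then have "x + w \<in> shrink z (s + t) D" using s t by (simp add: mem_shrink)
 then have "minkowski (x + w) <= s + t" using s t by (intro gauge_le) auto
 then show "minkowski (x + w) <= minkowski x + norm w / r + e" by (simp add: s_def t_def)
qed

lemma gauge_Lipschitz: "\<bar>minkowski x - minkowski y\<bar> <= norm (x - y) / r"
 using gauge_add_le[of x "y - x"] gauge_add_le[of y "x - y"] by (simp add: norm_minus_commute abs_le_iff)

lemma continuous_gauge: "continuous_on S minkowski"
proof (rule lipschitz_on_continuous_on)
 show "(1/r)-lipschitz_on S minkowski" using gauge_Lipschitz r0 by (intro lipschitz_onI) (auto simp: dist_norm dist_real_def)
qed

lemma gauge_z: "minkowski z = 0"
proof -
 have "minkowski z <= e" if "e > 0" for e using that r0 by (intro gauge_le gauge_nonempty) auto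
 then show ?thesis using gauge_nonneg[of z] field_le_epsilon[of "minkowski z" 0] by force
qed

lemma gauge_le_norm: "minkowski x <= norm (x - z) / r" using gauge_Lipschitz[of x z] gauge_nonneg[of x] by (simp add: gauge_z)

lemma gauge_scale:
 assumes "0 <= s"
 shows "minkowski (z + s *\<^sub>R (x - z)) = s * minkowski x"
proof (cases "s = 0")
 case False
 then have s: "s > 0" using assms by simp
 have le: "minkowski (z + s *\<^sub>R (x - z)) <= s * minkowski x" if s: "s > 0" for s x
 proof -
  have "minkowski (z + s *\<^sub>R (x - z)) / s <= minkowski x"
  proof (rule field_le_epsilon)
   fix e :: real assume e: "e > 0"
   define t where "t = minkowski x + e"
   have t: "t > 0" using e gauge_nonneg[of x] by (simp add: t_def add_nonneg_pos)
   have "x \<in> shrink z t D" using e by (intro gauge_less) (simp add: t_def)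
   then have "z + s *\<^sub>R (x - z) \<in> shrink z (s * t) D" using s t by (simp add: mem_shrink)
   then have "minkowski (z + s *\<^sub>R (x - z)) <= s * t" using s t by (intro gauge_le) auto
   then show "minkowski (z + s *\<^sub>R (x - z)) / s <= minkowski x + e" using s by (simp add: t_def field_simps)
  qed
  then show ?thesis using s by (simp add: field_simps)
 qed
 have "minkowski x <= (1/s) * minkowski (z + s *\<^sub>R (x - z))" using le[of "1/s" "z + s *\<^sub>R (x - z)"] s by simp
 then show ?thesis using le[OF s, of x] s by (simp add: field_simps)
qed (simp add: gauge_z)

lemma gauge_frontier:
 assumes x: "x \<in> frontier D"
 shows "minkowski x = 1"
proof (rule antisym)
 have "x \<in> closure D" using x by (simp add: frontier_def)
 then show "minkowski x <= 1" by (rule continuous_le_on_closure[OF continuous_gauge]) (use gauge_less_1_iff less_imp_le in blast)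
 show "1 <= minkowski x" using x openD gauge_less_1_iff[of x] by (simp add: frontier_def interior_open)
qed

lemma gauge_eq_1_frontier:
 assumes "minkowski x = 1"
 shows "x \<in> frontier D"
proof -
 have nx: "x \<notin> D" using assms gauge_less_1_iff[of x] by simp
 have "x \<in> closure D"
 proof (rule closed_sequentially[OF closed_closure])
  let ?s = "%n. 1 - inverse (real (Suc n))"
  have s: "0 <= ?s n" "?s n < 1" for n by (auto simp: field_simps)
  show "z + ?s n *\<^sub>R (x - z) \<in> closure D" for n using gauge_scale[OF s(1), of n x] s(2)[of n] assms gauge_less_1_iff closure_subset by (metis mult.right_neutral subsetD)
  have "(%n. z + ?s n *\<^sub>R (x - z)) \<longlonglongrightarrow> z + (1 - 0) *\<^sub>R (x - z)" by (intro tendsto_intros LIMSEQ_inverse_real_of_nat)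
  then show "(%n. z + ?s n *\<^sub>R (x - z)) \<longlonglongrightarrow> x" by simp
 qed
 then show ?thesis using nx openD by (simp add: frontier_def interior_open)
qed

definition cross :: "real^2 => real^2 => real" where
 "cross a b = a $ 1 * b $ 2 - a $ 2 * b $ 1"

lemma cross_square: "(cross a b)^2 + (a \<bullet> b)^2 = (norm a)^2 * (norm b)^2"
 by (simp add: cross_def power2_norm_eq_inner inner_vec_def sum_2) (simp add: power2_eq_square algebra_simps)

lemma abs_cross_le: "\<bar>cross a b\<bar> <= norm a * norm b"
proof (rule power2_le_imp_le)
 show "\<bar>cross a b\<bar>^2 <= (norm a * norm b)^2" using cross_square[of a b] zero_le_power2[of "a \<bullet> b"] unfolding power_mult_distrib power2_abs by linarith
qed auto

lemma bounded_linear_cross: "bounded_linear (%w. cross w v)"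
 unfolding cross_def by (intro bounded_linear_sub bounded_linear_mult_left[THEN bounded_linear_compose] bounded_linear_vec_nth)

text \<open>The tangent line at a boundary point keeps distance \<open>r\<close> from the centre.\<close>

lemma tangent_cross:
 assumes gm: "!!t. t \<in> {0..1} ==> gm t \<in> frontier D" and t: "t \<in> {0<..<1}"
  and v: "(gm has_vector_derivative v) (at t)"
 shows "r * norm v <= \<bar>cross (gm t - z) v\<bar>"
proof (cases "v = 0")
 case False
 define X where "X = gm t - z"
 have gt: "minkowski (gm t) = 1" using gm[of t] t gauge_frontier by auto
 \<comment> \<open>The nearby curve point has gauge 1, the multiple \<open>1 + dt * a\<close> of
   \<open>gm t\<close> has gauge \<open>1 + dt * a\<close>. The Lipschitz bound for the gauge,
   divided by \<open>dt\<close>, compares \<open>v\<close> with \<open>a\<close> times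
   \<open>X\<close>.\<close>
 have key: "r * \<bar>a\<bar> <= norm (v - a *\<^sub>R X)" for a
 proof (rule field_le_epsilon)
  fix e :: real assume e: "e > 0"
  obtain d where d: "d > 0" "!!s. norm (s - t) < d ==> norm (gm s - gm t - (s - t) *\<^sub>R v) <= e * norm (s - t)"
   using v e unfolding has_vector_derivative_def has_derivative_at_alt by blast
  define dt where "dt = min (min (d/2) ((1 - t)/2)) (1 / (\<bar>a\<bar> + 1))"
  have dt: "dt > 0" "dt < d" "t + dt \<in> {0..1}" "dt * \<bar>a\<bar> <= 1"
  proof -
   have p: "0 < 1 / (\<bar>a\<bar> + 1)" by (simp add: add_nonneg_pos)
   show "dt > 0" using d(1) t p by (auto simp: dt_def)
   have le: "dt <= d/2" "dt <= (1 - t)/2" "dt <= 1 / (\<bar>a\<bar> + 1)"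
    unfolding dt_def by (auto intro: min.coboundedI1 min.coboundedI2 simp del: le_divide_eq_numeral1 min_less_iff_conj min.bounded_iff)
   show "dt < d" using le d by linarith
   show "t + dt \<in> {0..1}" using le t \<open>dt > 0\<close> by auto
   have "dt * \<bar>a\<bar> <= 1 / (\<bar>a\<bar> + 1) * \<bar>a\<bar>" using le by (intro mult_right_mono) auto
   also have "... <= 1" by (simp add: divide_le_eq)
   finally show "dt * \<bar>a\<bar> <= 1" .
  qed
  have "\<bar>dt * a\<bar> <= 1" using dt by (simp add: abs_mult)
  then have "0 <= 1 + dt * a" by linarith
  then have g1: "minkowski (z + (1 + dt * a) *\<^sub>R (gm t - z)) = 1 + dt * a" using gauge_scale gt by simp
  have g2: "minkowski (gm (t + dt)) = 1" using gm dt(3) gauge_frontier by auto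
  have "\<bar>dt * a\<bar> <= norm (gm (t + dt) - (z + (1 + dt * a) *\<^sub>R (gm t - z))) / r"
   using gauge_Lipschitz[of "gm (t + dt)" "z + (1 + dt * a) *\<^sub>R (gm t - z)"] unfolding g1 g2 by simp
  then have "r * (dt * \<bar>a\<bar>) <= norm (gm (t + dt) - (z + (1 + dt * a) *\<^sub>R (gm t - z)))" using r0 dt(1) by (simp add: abs_mult field_simps)
  also have "gm (t + dt) - (z + (1 + dt * a) *\<^sub>R (gm t - z)) = dt *\<^sub>R (v - a *\<^sub>R X) + (gm (t + dt) - gm t - dt *\<^sub>R v)" by (simp add: X_def algebra_simps)
  also have "norm ... <= dt * norm (v - a *\<^sub>R X) + e * dt" using d(2)[of "t + dt"] dt by (intro order_trans[OF norm_triangle_ineq] add_mono) auto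
  finally have "dt * (r * \<bar>a\<bar>) <= dt * (norm (v - a *\<^sub>R X) + e)" by (simp add: algebra_simps)
  then show "r * \<bar>a\<bar> <= norm (v - a *\<^sub>R X) + e" using dt(1) by simp
 qed
 have rX: "r <= norm X" using gauge_le_norm[of "gm t"] gt r0 by (simp add: X_def pos_le_divide_eq)
 have vn: "(norm v)^2 > 0" using False by simp
 \<comment> \<open>The foot of the perpendicular from \<open>z\<close> to the tangent line:
   \<open>X\<close> minus \<open>b\<close> times \<open>v\<close> is orthogonal to \<open>v\<close>,
   and its length times \<open>norm v\<close> is the absolute cross product.\<close>
 define b where "b = (X \<bullet> v) / (norm v)^2"
 have "r <= norm (X - b *\<^sub>R v)"
 proof (cases "b = 0")
  case False
  have "\<bar>b\<bar> * (r * \<bar>1/b\<bar>) <= \<bar>b\<bar> * norm (v - (1/b) *\<^sub>R X)" by (intro mult_left_mono key) auto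
  also have "\<bar>b\<bar> * norm (v - (1/b) *\<^sub>R X) = norm (b *\<^sub>R (v - (1/b) *\<^sub>R X))" by simp
  also have "b *\<^sub>R (v - (1/b) *\<^sub>R X) = - (X - b *\<^sub>R v)" using False by (simp add: algebra_simps)
  finally show ?thesis using False by (simp add: abs_mult[symmetric] norm_minus_commute)
 qed (use rX in simp)
 then have "r^2 <= (norm (X - b *\<^sub>R v))^2" using r0 by (intro power_mono) auto
 also have "(norm (X - b *\<^sub>R v))^2 = (norm X)^2 - 2 * b * (X \<bullet> v) + b^2 * (norm v)^2" unfolding power2_norm_eq_inner
  by (simp add: inner_diff_left inner_diff_right inner_commute[of v X]) (simp add: power2_eq_square algebra_simps)
 also have "... = (norm X)^2 - (X \<bullet> v)^2 / (norm v)^2"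
 proof -
  have "2 * (p / n) * p - (p / n)^2 * n = p^2 / n" if "n > 0" for p n :: real using that by (simp add: power2_eq_square field_simps)
  from this[OF vn, of "X \<bullet> v"] show ?thesis unfolding b_def by linarith
 qed
 finally have "r^2 * (norm v)^2 <= ((norm X)^2 - (X \<bullet> v)^2 / (norm v)^2) * (norm v)^2" by (rule mult_right_mono) simp
 also have "... = (norm X)^2 * (norm v)^2 - (X \<bullet> v)^2"
 proof -
  have "(A - p / n) * n = A * n - p" if "n > 0" for A p n :: real using that by (simp add: field_simps)
  from this[OF vn] show ?thesis .
 qed
 also have "... = (cross X v)^2" using cross_square[of X v] by simp
 finally have "(r * norm v)^2 <= \<bar>cross X v\<bar>^2" by (simp add: power_mult_distrib)
 then show ?thesis unfolding X_def by (rule power2_le_imp_le) simp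
qed simp

text \<open>Writing an increment as \<open>a X + b v\<close>, the gauge at the displaced point is compared with its
 value \<open>1 + a\<close> at a multiple of the nearby boundary point \<open>gm (t + b)\<close>.\<close>

lemma gauge_has_derivative_frontier:
 assumes gm: "!!t. t \<in> {0..1} ==> gm t \<in> frontier D" and t: "t \<in> {0<..<1}"
  and v: "(gm has_vector_derivative v) (at t)" "v ~= 0"
 shows "(minkowski has_derivative (%w. cross w v / cross (gm t - z) v)) (at (gm t))" unfolding has_derivative_at_alt
proof (intro conjI allI impI)
 define X where "X = gm t - z"
 define c where "c = cross X v"
 have c0: "\<bar>c\<bar> > 0" using tangent_cross[OF gm t v(1)] v(2) r0 unfolding c_def X_def by (smt (verit) mult_pos_pos zero_less_norm_iff)
 have gt: "minkowski (gm t) = 1" using gm[of t] t gauge_frontier by auto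
 show "bounded_linear (%w. cross w v / cross (gm t - z) v)" unfolding divide_inverse by (rule bounded_linear_mult_left[THEN bounded_linear_compose, OF bounded_linear_cross])
 fix e :: real assume e: "e > 0"
 define A where "A = norm v / \<bar>c\<bar>"
 define B where "B = norm X / \<bar>c\<bar>"
 have A0: "A \<ge> 0" and B0: "B \<ge> 0" by (auto simp: A_def B_def)
 define e' where "e' = e * r / (2 * (2 * B + 1))"
 have e': "e' > 0" unfolding e'_def using e r0 B0 by (intro divide_pos_pos mult_pos_pos) auto
 obtain d where d: "d > 0" "!!s. norm (s - t) < d ==> norm (gm s - gm t - (s - t) *\<^sub>R v) <= e' * norm (s - t)"
  using v(1) e' unfolding has_vector_derivative_def has_derivative_at_alt by blast
 \<comment> \<open>The four bounds keep, in turn, \<open>b\<close> within the differentiability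
   radius, \<open>t + b\<close> in the parameter interval, \<open>\<bar>a\<bar>\<close> below 1, and
   the second-order term with \<open>a * b\<close> below \<open>e * r / 2\<close> times the
   displacement.\<close>
 define d1 where "d1 = min (min (d / (B + 1)) (min t (1 - t) / (B + 1))) (min (1 / (A + 1)) (e * r / (2 * (A * B * norm v + 1))))"
 have pos: "B + 1 > 0" "A + 1 > 0" "A * B * norm v + 1 > 0" using A0 B0 by (auto intro: add_nonneg_pos)
 have d1: "d1 > 0" using d(1) t pos e r0 by (auto simp: d1_def intro!: divide_pos_pos mult_pos_pos)
 show "\<exists>d>0. \<forall>y. norm (y - gm t) < d -->
   norm (minkowski y - minkowski (gm t) - cross (y - gm t) v / cross (gm t - z) v) <= e * norm (y - gm t)"
 proof (intro exI[of _ d1] conjI allI impI d1)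
  fix y assume y: "norm (y - gm t) < d1"
  define w where "w = y - gm t"
  define n where "n = norm w"
  have n0: "n \<ge> 0" by (simp add: n_def)
  have nd: "n * (B + 1) < d" "n * (B + 1) < min t (1 - t)" "n * (A + 1) < 1" "n * (A * B * norm v + 1) < e * r / 2"
  proof -
   have "n < d1" using y by (simp add: n_def w_def)
   then have "n < d / (B + 1)" "n < min t (1 - t) / (B + 1)" "n < 1 / (A + 1)" "n < e * r / (2 * (A * B * norm v + 1))" by (auto simp: d1_def)
   then show "n * (B + 1) < d" "n * (B + 1) < min t (1 - t)" "n * (A + 1) < 1" "n * (A * B * norm v + 1) < e * r / 2" using pos by (simp_all add: pos_less_divide_eq mult_ac)
  qed
  define a b where "a = cross w v / c" and "b = cross X w / c"
  have ab: "\<bar>a\<bar> <= A * n" "\<bar>b\<bar> <= B * n"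
  proof -
   show "\<bar>a\<bar> <= A * n" using abs_cross_le[of w v] c0 by (simp add: a_def A_def n_def abs_divide field_simps)
   show "\<bar>b\<bar> <= B * n" using abs_cross_le[of X w] c0 by (simp add: b_def B_def n_def abs_divide field_simps)
  qed
  \<comment> \<open>Cramer's rule in the basis \<open>X\<close>, \<open>v\<close>, whose determinant
    \<open>c\<close> is nonzero by \<open>tangent_cross\<close>.\<close>
  have w: "w = a *\<^sub>R X + b *\<^sub>R v"
  proof -
   have "c *\<^sub>R w = cross w v *\<^sub>R X + cross X w *\<^sub>R v" by (simp add: vec_eq_iff forall_2 c_def cross_def algebra_simps)
   then have "(1/c) *\<^sub>R (c *\<^sub>R w) = (1/c) *\<^sub>R (cross w v *\<^sub>R X + cross X w *\<^sub>R v)" by simp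
   then show ?thesis using c0 by (simp add: a_def b_def scaleR_add_right)
  qed
  have a1: "\<bar>a\<bar> < 1" "\<bar>b\<bar> < d" "\<bar>b\<bar> < min t (1 - t)"
  proof -
   have "A * n <= n * (A + 1)" "B * n <= n * (B + 1)" using n0 by (auto simp: algebra_simps)
   then show "\<bar>a\<bar> < 1" "\<bar>b\<bar> < d" "\<bar>b\<bar> < min t (1 - t)" using ab nd by linarith+
  qed
  have tb: "t + b \<in> {0..1}" using a1(3) by (auto simp: abs_less_iff)
  have g1: "minkowski (z + (1 + a) *\<^sub>R (gm (t + b) - z)) = 1 + a" using a1(1) gm[OF tb] gauge_frontier by (subst gauge_scale) (auto simp: abs_less_iff)
  have "y - (z + (1 + a) *\<^sub>R (gm (t + b) - z)) = - ((1 + a) *\<^sub>R (gm (t + b) - gm t - b *\<^sub>R v)) - (a * b) *\<^sub>R v"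
  proof -
   have y_eq: "y = gm t + (a *\<^sub>R X + b *\<^sub>R v)" using w by (simp add: w_def algebra_simps)
   show ?thesis unfolding y_eq X_def by (simp add: algebra_simps)
  qed
  then have "norm (y - (z + (1 + a) *\<^sub>R (gm (t + b) - z))) <= \<bar>1 + a\<bar> * norm (gm (t + b) - gm t - b *\<^sub>R v) + \<bar>a * b\<bar> * norm v"
   by (metis norm_triangle_ineq4 norm_minus_cancel norm_scaleR)
  also have "... <= 2 * (e' * (B * n)) + (A * n * (B * n)) * norm v"
  proof (intro add_mono mult_mono mult_right_mono)
   show "\<bar>1 + a\<bar> <= 2" using a1(1) by linarith
   have "norm (gm (t + b) - gm t - b *\<^sub>R v) <= e' * \<bar>b\<bar>" using d(2)[of "t + b"] a1(2) by simp
   also have "... <= e' * (B * n)" using ab e' by (intro mult_left_mono) auto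
   finally show "norm (gm (t + b) - gm t - b *\<^sub>R v) <= e' * (B * n)" .
   show "\<bar>a * b\<bar> <= A * n * (B * n)" unfolding abs_mult using ab A0 B0 n0 by (intro mult_mono) auto
  qed (use A0 B0 n0 in auto)
  also have "... <= (e * r / 2) * n + (e * r / 2) * n"
  proof (intro add_mono)
   have "2 * (e' * (B * n)) = e' * (2 * B) * n" by simp
   also have "... <= e' * (2 * B + 1) * n" using e' n0 by (intro mult_right_mono mult_left_mono) auto
   also have "e' * (2 * B + 1) = e * r / 2"
   proof -
    have "e * r / (2 * K) * K = e * r / 2" if "K ~= 0" for K :: real using that by simp
    then show ?thesis using B0 unfolding e'_def by (metis add_nonneg_pos less_irrefl mult_nonneg_nonneg zero_le_numeral zero_less_one)
   qed
   finally show "2 * (e' * (B * n)) <= (e * r / 2) * n" .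
   have "A * n * (B * n) * norm v = n * (A * B * norm v) * n" by simp
   also have "... <= n * (A * B * norm v + 1) * n" using n0 by (intro mult_right_mono mult_left_mono) auto
   also have "... <= (e * r / 2) * n" using nd(4) n0 by (intro mult_right_mono) auto
   finally show "A * n * (B * n) * norm v <= (e * r / 2) * n" .
  qed
  finally have "norm (y - (z + (1 + a) *\<^sub>R (gm (t + b) - z))) <= e * n * r" by simp
  then have "norm (y - (z + (1 + a) *\<^sub>R (gm (t + b) - z))) / r <= e * n" using r0 by (simp add: pos_divide_le_eq)
  then have "\<bar>minkowski y - (1 + a)\<bar> <= e * n" using gauge_Lipschitz[of y "z + (1 + a) *\<^sub>R (gm (t + b) - z)"] unfolding g1 by linarith
  then show "norm (minkowski y - minkowski (gm t) - cross (y - gm t) v / cross (gm t - z) v) <= e * norm (y - gm t)" by (simp add: gt a_def c_def X_def w_def n_def diff_diff_eq)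
 qed
qed

text \<open>A small step from \<open>x\<close> in the direction \<open>\<mu> - \<nu>\<close> lies in
  the inner cone of \<open>\<nu>\<close> and in the outer cone of \<open>\<mu>\<close>, so its end
  point would be both in \<open>D\<close> and outside.\<close>

lemma outward_normal_unique:
 assumes "is_outward_normal D x \<nu>" "is_outward_normal D x \<mu>"
 shows "\<nu> = \<mu>"
proof (rule ccontr)
 assume ne: "\<nu> ~= \<mu>"
 have u: "norm \<nu> = 1" "norm \<mu> = 1" using assms by (auto simp: is_outward_normal_def)
 define w where "w = \<mu> - \<nu>"
 have w0: "norm w > 0" using ne by (simp add: w_def)
 have i: "(norm w)^2 = 2 - 2 * (\<nu> \<bullet> \<mu>)" using u by (simp add: w_def power2_norm_eq_inner inner_diff_left inner_diff_right inner_commute norm_eq_1)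
 have w1: "w \<bullet> \<nu> = - ((norm w)^2) / 2" "w \<bullet> \<mu> = (norm w)^2 / 2" using i u by (simp_all add: w_def inner_diff_left inner_commute[of \<mu> \<nu>] norm_eq_1)
 \<comment> \<open>The largest aperture parameter for which the step still lies in both
   cones.\<close>
 define et where "et = norm w / 2"
 have et: "et > 0" using w0 by (simp add: et_def)
 have "\<forall>\<^sub>F y in at x. ((y - x) \<bullet> \<nu> <= - et * norm (y - x) --> y \<in> D) & ((y - x) \<bullet> \<mu> \<ge> et * norm (y - x) --> y \<notin> D)"
 proof -
  have "\<forall>\<^sub>F y in at x. ((y - x) \<bullet> \<nu> <= - et * norm (y - x) --> y \<in> D) & ((y - x) \<bullet> \<nu> \<ge> et * norm (y - x) --> y \<notin> D)"
   using assms(1) et unfolding is_outward_normal_def by blast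
  moreover have "\<forall>\<^sub>F y in at x. ((y - x) \<bullet> \<mu> <= - et * norm (y - x) --> y \<in> D) & ((y - x) \<bullet> \<mu> \<ge> et * norm (y - x) --> y \<notin> D)"
   using assms(2) et unfolding is_outward_normal_def by blast
  ultimately show ?thesis by eventually_elim blast
 qed
 then obtain d where d: "d > 0" "!!y. y ~= x ==> dist y x < d ==>
   ((y - x) \<bullet> \<nu> <= - et * norm (y - x) --> y \<in> D) & ((y - x) \<bullet> \<mu> \<ge> et * norm (y - x) --> y \<notin> D)" unfolding eventually_at by blast
 define h where "h = d / (2 * norm w)"
 have h: "h > 0" using d w0 by (simp add: h_def)
 have "h * norm w < d" using d w0 by (simp add: h_def)
 then have y: "x + h *\<^sub>R w ~= x" "dist (x + h *\<^sub>R w) x < d" using h w0 by (auto simp: dist_norm)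
 have "h * (norm w)^2 = norm w * (h * norm w)" by (simp add: power2_eq_square)
 then show False using d(2)[OF y] h w1 by (auto simp: et_def)
qed

lemma outward_normal_eqI: "is_outward_normal D x \<nu> ==> outward_normal D x = \<nu>" unfolding outward_normal_def by (rule the_equality) (auto intro: outward_normal_unique)

text \<open>Clockwise rotation by a right angle, which turns cross products into inner
  products.\<close>

definition rot :: "real^2 => real^2" where
 "rot v = vector [v $ 2, - v $ 1]"

lemma inner_rot: "w \<bullet> rot v = cross w v" by (simp add: rot_def cross_def inner_vec_def sum_2)

lemma norm_rot: "norm (rot v) = norm v"
proof -
 have "(norm (rot v))^2 = (norm v)^2" unfolding power2_norm_eq_inner by (simp add: rot_def inner_vec_def sum_2)
 then show ?thesis by simp
qed

text \<open>Near the boundary point the gauge is \<open>1 + m * ((y - gm t) \<bullet> \<nu>)\<close>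
  up to a small error, hence below 1 in every inner cone and above 1 in every outer one. The sign of
  the cross product stands in for the unknown orientation of the curve.\<close>

lemma outward_normal_frontier:
 assumes gm: "!!t. t \<in> {0..1} ==> gm t \<in> frontier D" and t: "t \<in> {0<..<1}"
  and v: "(gm has_vector_derivative v) (at t)" "v ~= 0"
 shows "outward_normal D (gm t) = (sgn (cross (gm t - z) v) / norm v) *\<^sub>R rot v"
proof (rule outward_normal_eqI)
 define c where "c = cross (gm t - z) v"
 define \<nu> where "\<nu> = (sgn c / norm v) *\<^sub>R rot v"
 have c0: "\<bar>c\<bar> > 0" using tangent_cross[OF gm t v(1)] v(2) r0 unfolding c_def by (smt (verit) mult_pos_pos zero_less_norm_iff)
 have gt: "minkowski (gm t) = 1" using gm[of t] t gauge_frontier by auto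
 define m where "m = norm v / \<bar>c\<bar>"
 have m: "m > 0" using v(2) c0 by (simp add: m_def)
 have eq: "cross w v / c = m * (w \<bullet> \<nu>)" for w
 proof -
  have "m * (w \<bullet> \<nu>) = (sgn c / \<bar>c\<bar>) * cross w v" using v(2) by (simp add: m_def \<nu>_def inner_rot)
  moreover have "sgn c / \<bar>c\<bar> = 1 / c" using c0 by (auto simp: sgn_if)
  ultimately show ?thesis by simp
 qed
 have "is_outward_normal D (gm t) \<nu>" unfolding is_outward_normal_def
 proof (intro conjI allI impI)
  have "\<bar>sgn c\<bar> = 1" using c0 by (simp add: abs_sgn_eq)
  then show "norm \<nu> = 1" using v(2) by (simp add: \<nu>_def norm_rot)
  fix et :: real assume et: "et > 0"
  have "m * et / 2 > 0" using m et by simp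
  then obtain d where d: "d > 0" "!!y. norm (y - gm t) < d ==>
    norm (minkowski y - minkowski (gm t) - cross (y - gm t) v / c) <= (m * et / 2) * norm (y - gm t)"
   using gauge_has_derivative_frontier[OF gm t v] unfolding c_def has_derivative_at_alt by blast
  show "\<forall>\<^sub>F y in at (gm t). ((y - gm t) \<bullet> \<nu> <= - et * norm (y - gm t) --> y \<in> D) \<and>
    ((y - gm t) \<bullet> \<nu> \<ge> et * norm (y - gm t) --> y \<notin> D)" unfolding eventually_at
  proof (intro exI[of _ d] conjI ballI impI d(1))
   fix y assume y: "y ~= gm t & dist y (gm t) < d"
   define n where "n = norm (y - gm t)"
   have n: "n > 0" using y by (simp add: n_def)
   have mn: "m * et * n > 0" using m et n by simp
   define P where "P = m * ((y - gm t) \<bullet> \<nu>)"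
   have b: "\<bar>minkowski y - 1 - P\<bar> <= (m * et * n) / 2" using d(2)[of y] y by (simp add: gt eq n_def dist_norm P_def)
   {
    assume "(y - gm t) \<bullet> \<nu> <= - et * norm (y - gm t)"
    then have "P <= m * (- et * n)" using m unfolding P_def by (intro mult_left_mono) (auto simp: n_def)
    then have "P <= - (m * et * n)" by simp
    then have "minkowski y < 1" using b mn by linarith
    then show "y \<in> D" by (simp add: gauge_less_1_iff)
   }
   {
    assume "(y - gm t) \<bullet> \<nu> \<ge> et * norm (y - gm t)"
    then have "m * (et * n) <= P" using m unfolding P_def by (intro mult_left_mono) (auto simp: n_def)
    then have "m * et * n <= P" by simp
    then have "minkowski y > 1" using b mn by linarith
    then show "y \<notin> D" using gauge_less_1_iff[of y] by simp
   }
  qed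
 qed
 then show "is_outward_normal D (gm t) ((sgn (cross (gm t - z) v) / norm v) *\<^sub>R rot v)" by (simp add: \<nu>_def c_def)
qed

end

section \<open>Area, length and flux in polar coordinates\<close>

subsection \<open>Polar coordinates adapted to the boundary\<close>

text \<open>The scalar integrand is sent through \<open>real^1\<close> to meet the vector-valued
  change of variables.\<close>

lemma integral_change_of_variables_scalar:
 fixes f :: "real^2 => real" and g :: "real^2 => real^2"
 assumes S: "S \<in> sets lebesgue" and g: "!!x. x \<in> S ==> (g has_derivative g' x) (at x within S)" "inj_on g S"
  and f: "f absolutely_integrable_on g ` S"
 shows "(%x. \<bar>det (matrix (g' x))\<bar> * f (g x)) absolutely_integrable_on S"
  "integral S (%x. \<bar>det (matrix (g' x))\<bar> * f (g x)) = integral (g ` S) f"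
proof -
 let ?F = "%x. vec (f x) :: real^1"
 let ?G = "%x. \<bar>det (matrix (g' x))\<bar> *\<^sub>R ?F (g x)"
 have bl: "bounded_linear (vec :: real => real^1)" by (simp add: linear_conv_bounded_linear[symmetric] linear_iff vec_eq_iff)
 have bn: "bounded_linear (%v::real^1. v $ 1)" by (rule bounded_linear_vec_nth)
 have F: "?F absolutely_integrable_on g ` S" using absolutely_integrable_linear[OF f bl] by (simp add: o_def)
 have "?G absolutely_integrable_on S & integral S ?G = integral (g ` S) ?F" using has_absolute_integral_change_of_variables[OF S g, of ?F "integral (g ` S) ?F"] F by simp
 then have G: "?G absolutely_integrable_on S" "integral S ?G = integral (g ` S) ?F" by auto
 show "(%x. \<bar>det (matrix (g' x))\<bar> * f (g x)) absolutely_integrable_on S" using absolutely_integrable_linear[OF G(1) bn] by (simp add: o_def)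
 have "integral S ((%v. v $ 1) \<circ> ?G) = (%v. v $ 1) (integral S ?G)"
  by (rule integral_linear[OF _ bn]) (use G(1) in \<open>simp add: set_lebesgue_integral_eq_integral\<close>)
 moreover have "integral (g ` S) ((%v. v $ 1) \<circ> ?F) = (%v. v $ 1) (integral (g ` S) ?F)"
  by (rule integral_linear[OF _ bn]) (use F in \<open>simp add: set_lebesgue_integral_eq_integral\<close>)
 ultimately show "integral S (%x. \<bar>det (matrix (g' x))\<bar> * f (g x)) = integral (g ` S) f" using G(2) by (simp add: o_def)
qed

lemma integral_product_real2:
 fixes u w :: "real => real"
 assumes u: "integrable lborel u" and w: "integrable lborel w"
 shows "integrable lborel (%p::real^2. u (p $ 1) * w (p $ 2))"
  "(LINT p|lborel. u ((p::real^2) $ 1) * w (p $ 2)) = (LINT s|lborel. u s) * (LINT t|lborel. w t)"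
proof -
 have [measurable]: "u \<in> borel_measurable borel" "w \<in> borel_measurable borel" using assms by auto
 have m: "(%(a, b). vector [a, b] :: real^2) \<in> measurable (lborel \<Otimes>\<^sub>M lborel) borel" using measurable_vector2 by (simp cong: measurable_cong_sets)
 have fm: "(%p::real^2. u (p $ 1) * w (p $ 2)) \<in> borel_measurable borel" by (intro borel_measurable_times measurable_compose[OF measurable_nth]) auto
 have pm: "(%x. u (fst x) * w (snd x)) \<in> borel_measurable (lborel \<Otimes>\<^sub>M lborel)" by measurable
 have pi: "integrable (lborel \<Otimes>\<^sub>M lborel) (%x. u (fst x) * w (snd x))"
 proof (rule lborel_pair.Fubini_integrable[OF pm])
  have "integrable lborel (%x. \<bar>u x\<bar> * (LINT y|lborel. \<bar>w y\<bar>))" using u by simp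
  then show "integrable lborel (%x. LINT y|lborel. norm (u (fst (x, y)) * w (snd (x, y))))" by (simp add: abs_mult)
  show "AE x in lborel. integrable lborel (%y. u (fst (x, y)) * w (snd (x, y)))" using w by simp
 qed
 show "integrable lborel (%p::real^2. u (p $ 1) * w (p $ 2))" unfolding lborel_real2 using integrable_distr_eq[OF m fm] pi by (simp add: case_prod_unfold)
 have "(LINT p|lborel. u ((p::real^2) $ 1) * w (p $ 2)) = (LINT x|(lborel \<Otimes>\<^sub>M lborel). u (fst x) * w (snd x))"
  unfolding lborel_real2 using integral_distr[OF m fm] by (simp add: case_prod_unfold)
 also have "... = (LINT x|lborel. LINT y|lborel. u (fst (x, y)) * w (snd (x, y)))" using lborel_pair.integral_fst'[OF pi] by simp
 finally show "(LINT p|lborel. u ((p::real^2) $ 1) * w (p $ 2)) = (LINT s|lborel. u s) * (LINT t|lborel. w t)" by simp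
qed

lemma integral_strip:
 fixes K :: "real => real"
 assumes T: "T \<in> sets borel" "T \<subseteq> {0..1}" and K: "set_borel_measurable borel T K" "!!t. t \<in> T ==> \<bar>K t\<bar> <= M"
  and ab: "a <= b"
 shows "(%p::real^2. K (p $ 2)) absolutely_integrable_on {p. a < p $ 1 & p $ 1 < b & p $ 2 \<in> T}"
  "integral {p::real^2. a < p $ 1 & p $ 1 < b & p $ 2 \<in> T} (%p. K (p $ 2)) = (b - a) * (LINT t|lborel. indicator T t * K t)"
proof -
 let ?S = "{p::real^2. a < p $ 1 & p $ 1 < b & p $ 2 \<in> T}"
 let ?u = "indicator {a<..<b} :: real => real" and ?w = "%t. indicator T t * K t"
 have u: "integrable lborel ?u" using ab by (intro integrable_real_indicator) auto
 have w: "integrable lborel ?w"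
 proof (rule BI_integrable_bound[of _ "%t. M * indicator {0..1} t"])
  show "integrable lborel (%t::real. M * indicator {0..1} t)" by (intro integrable_mult_right integrable_real_indicator) auto
  show "?w \<in> borel_measurable lborel" using K(1) by (simp add: set_borel_measurable_def)
  show "AE t in lborel. norm (?w t) <= norm (M * indicator {0..1} t)" using K(2) T by (intro AE_I2) (force simp: indicator_def)
 qed
 note P = integral_product_real2[OF u w]
 have eq: "(%p::real^2. ?u (p $ 1) * ?w (p $ 2)) = (%p. indicator ?S p *\<^sub>R K (p $ 2))" by (auto simp: fun_eq_iff indicator_def)
 have si: "set_integrable lborel ?S (%p. K (p $ 2))" using P(1) unfolding eq set_integrable_def .
 then have "integrable lebesgue (%p. indicator ?S p *\<^sub>R K (p $ 2))" unfolding set_integrable_def by (subst integrable_completion) auto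
 then show "(%p::real^2. K (p $ 2)) absolutely_integrable_on ?S" unfolding set_integrable_def .
 have "integral ?S (%p. K (p $ 2)) = (LINT p:?S|lborel. K (p $ 2))" using set_borel_integral_eq_integral(2)[OF si] by simp
 also have "... = (LINT s|lborel. ?u s) * (LINT t|lborel. ?w t)" using P(2) unfolding eq set_lebesgue_integral_def .
 also have "(LINT s|lborel. ?u s) = b - a" using ab by simp
 finally show "integral ?S (%p. K (p $ 2)) = (b - a) * (LINT t|lborel. ?w t)" .
qed

text \<open>A Lipschitz path may have zero speed on a set of positive measure, where it determines
  no normal direction. \<open>T\<close> isolates the parameters with a nonzero tangent; almost
  everywhere else the derivative is zero.\<close>

lemma lip_arc_tangents:
 assumes "lip_arc gm"
 shows "\<exists>g T L. L-lipschitz_on {0..1} gm & g \<in> borel_measurable borel & T \<in> sets borel & T \<subseteq> {0<..<1}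
  & (\<forall>t\<in>T. (gm has_vector_derivative g t) (at t) & g t ~= 0 & norm (g t) <= L)
  & (AE t in lborel. t \<in> {0<..<1} --> t \<notin> T --> (gm has_vector_derivative 0) (at t))"
proof -
 obtain L' where L': "L'-lipschitz_on {0..1} gm" using assms by (auto simp: lip_arc_def)
 obtain g L where g: "g \<in> borel_measurable borel" "AE t in I01. (gm has_vector_derivative g t) (at t)"
  "AE t in I01. norm (g t) <= L" by (rule lip_arc_derivative[OF assms], rule that; assumption)
 have "AE t in lborel. t \<in> {0<..<1} --> ((gm has_vector_derivative g t) (at t) & norm (g t) <= L)" using g(2,3) unfolding AE_I01 AE_completion_iff by eventually_elim auto
 then obtain N where N: "N \<in> null_sets lborel"
  "!!t. t \<in> space lborel - N ==> t \<in> {0<..<1} --> ((gm has_vector_derivative g t) (at t) & norm (g t) <= L)" by (rule AE_E3) blast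
 define T where "T = {t \<in> {0<..<1} - N. g t ~= 0}"
 have "g -` (- {0}) \<inter> space borel \<in> sets borel" using g(1) by (rule measurable_sets) simp
 then have "({0<..<1} - N) \<inter> g -` (- {0}) \<in> sets borel" using N(1) by (auto simp: null_sets_def)
 then have T: "T \<in> sets borel" unfolding T_def by (rule back_subst[where P="%A. A \<in> sets borel"]) auto
 have "AE t in lborel. t \<notin> N" by (rule AE_not_in[OF N(1)])
 then have ae: "AE t in lborel. t \<in> {0<..<1} --> t \<notin> T --> (gm has_vector_derivative 0) (at t)"
 proof eventually_elim
  case (elim t)
  show ?case
  proof (intro impI)
   assume "t \<in> {0<..<1}" "t \<notin> T"
   then have "g t = 0" using elim by (simp add: T_def)
   then show "(gm has_vector_derivative 0) (at t)" using N(2)[of t] elim \<open>t \<in> {0<..<1}\<close> by simp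
  qed
 qed
 show ?thesis
 proof (intro exI[of _ g] exI[of _ T] exI[of _ "max L L'"] conjI ballI)
  show "(max L L')-lipschitz_on {0..1} gm" using L' by (rule lipschitz_on_le) simp
  fix t assume "t \<in> T"
  then show "(gm has_vector_derivative g t) (at t)" "g t ~= 0" "norm (g t) <= max L L'" using N(2)[of t] by (auto simp: T_def)
 qed (use g T ae in \<open>auto simp: T_def\<close>)
qed

text \<open>A boundary curve with its set \<open>T\<close> of good parameters and tangents
  \<open>g\<close>. By \<open>ae0\<close> the other parameters have zero derivative almost
  everywhere; \<open>L\<close> bounds both the Lipschitz constant and the tangents.\<close>

locale star_curve = star_domain D z r for D z r +
 fixes gm g :: "real => real^2" and T :: "real set" and L :: real
 assumes arcgm: "arc gm" and lipgm: "L-lipschitz_on {0..1} gm"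
  and frgm: "t \<in> {0..1} ==> gm t \<in> frontier D"
  and gm: "g \<in> borel_measurable borel" and Tm: "T \<in> sets borel" and T01: "T \<subseteq> {0<..<1}"
  and derivgm: "t \<in> T ==> (gm has_vector_derivative g t) (at t)" and g0: "t \<in> T ==> g t ~= 0"
  and gL: "t \<in> T ==> norm (g t) <= L"
  and ae0: "AE t in lborel. t \<in> {0<..<1} --> t \<notin> T --> (gm has_vector_derivative 0) (at t)"
begin

definition polar :: "real^2 => real^2" where
 "polar p = z + p $ 1 *\<^sub>R (gm (p $ 2) - z)"

definition strip :: "real => real => (real^2) set" where
 "strip a b = {p. a < p $ 1 & p $ 1 < b & p $ 2 \<in> T}"

lemma T_I: "t \<in> T ==> t \<in> {0..1}" "t \<in> T ==> t \<in> {0<..<1}" using T01 by auto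

lemma gauge_curve: "t \<in> {0..1} ==> minkowski (gm t) = 1" using frgm gauge_frontier by simp

lemma gauge_polar: "0 <= p $ 1 ==> p $ 2 \<in> {0..1} ==> minkowski (polar p) = p $ 1" unfolding polar_def using gauge_scale gauge_curve by simp

lemma continuous_curve: "continuous_on {0..1} gm" using lipgm by (rule lipschitz_on_continuous_on)

lemma polar_has_derivative:
 assumes "(gm has_vector_derivative v) (at (p $ 2))"
 shows "(polar has_derivative (%h. h $ 1 *\<^sub>R (gm (p $ 2) - z) + (p $ 1 * h $ 2) *\<^sub>R v)) (at p within S)"
proof -
 have nth: "((%p::real^2. p $ i) has_derivative (%h. h $ i)) (at p within S)" for i by (rule bounded_linear_imp_has_derivative) (rule bounded_linear_vec_nth)
 have "((gm \<circ> (%p. p $ 2)) has_derivative (%c. c *\<^sub>R v) \<circ> (%h. h $ 2)) (at p within S)" using assms unfolding has_vector_derivative_def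
  by (intro diff_chain_within[OF nth]) (rule has_derivative_at_withinI)
 then have c: "((%p. gm (p $ 2)) has_derivative (%h. h $ 2 *\<^sub>R v)) (at p within S)" by (simp add: o_def)
 have "((%p. z + p $ 1 *\<^sub>R (gm (p $ 2) - z)) has_derivative
   (%h. 0 + (p $ 1 *\<^sub>R (h $ 2 *\<^sub>R v - 0) + h $ 1 *\<^sub>R (gm (p $ 2) - z)))) (at p within S)"
  by (intro has_derivative_add has_derivative_const has_derivative_scaleR nth has_derivative_diff c)
 then show ?thesis by (simp add: polar_def[abs_def] add.commute)
qed

lemma det_polar: "det (matrix (%h::real^2. h $ 1 *\<^sub>R X + (s * h $ 2) *\<^sub>R v)) = s * cross X v" by (simp add: det_2 matrix_def axis_def cross_def algebra_simps)

text \<open>The gauge recovers the radial coordinate, and injectivity of the arc recovers the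
  parameter.\<close>

lemma inj_polar: "0 <= a ==> inj_on polar (strip a b)"
proof (rule inj_onI)
 fix p q assume a: "0 <= a" and p: "p \<in> strip a b" and q: "q \<in> strip a b" and e: "polar p = polar q"
 have P: "p $ 1 > 0" "q $ 1 > 0" "p $ 2 \<in> {0..1}" "q $ 2 \<in> {0..1}" using a p q T_I by (auto simp: strip_def)
 have "minkowski (polar p) = p $ 1" "minkowski (polar q) = q $ 1" using gauge_polar P by auto
 then have 1: "p $ 1 = q $ 1" using e by simp
 then have "p $ 1 *\<^sub>R (gm (p $ 2) - z) = p $ 1 *\<^sub>R (gm (q $ 2) - z)" using e by (simp add: polar_def)
 then have "gm (p $ 2) = gm (q $ 2)" using P by simp
 then have "p $ 2 = q $ 2" using arcgm P by (auto simp: arc_def inj_on_def)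
 then show "p = q" using 1 by (simp add: vec_eq_iff forall_2)
qed

lemma strip_measurable: "strip a b \<in> sets lebesgue"
proof -
 have "(%p::real^2. p $ 1) -` {a<..<b} \<inter> space borel \<in> sets borel" by (rule measurable_sets[OF measurable_nth]) simp
 moreover have "(%p::real^2. p $ 2) -` T \<inter> space borel \<in> sets borel" by (rule measurable_sets[OF measurable_nth Tm])
 ultimately have "((%p::real^2. p $ 1) -` {a<..<b} \<inter> space borel) \<inter> ((%p::real^2. p $ 2) -` T \<inter> space borel) \<in> sets borel" by (rule sets.Int)
 also have "((%p::real^2. p $ 1) -` {a<..<b} \<inter> space borel) \<inter> ((%p::real^2. p $ 2) -` T \<inter> space borel) = strip a b" by (auto simp: strip_def)
 finally show ?thesis by simp
qed

lemma polar_image_subset: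
 assumes "0 <= a" "b <= 1"
 shows "polar ` strip a b \<subseteq> {x \<in> D. a < minkowski x & minkowski x < b}"
proof (intro image_subsetI)
 fix p assume p: "p \<in> strip a b"
 then have "minkowski (polar p) = p $ 1" using assms T_I by (intro gauge_polar) (auto simp: strip_def)
 then show "polar p \<in> {x \<in> D. a < minkowski x & minkowski x < b}" using p assms gauge_less_1_iff[of "polar p"] by (auto simp: strip_def)
qed

lemma polar_image_measurable: "polar ` strip a b \<in> sets lebesgue"
proof (rule differentiable_image_in_sets_lebesgue[OF strip_measurable])
 show "polar differentiable_on strip a b" unfolding differentiable_on_def differentiable_def using polar_has_derivative[OF derivgm] by (auto simp: strip_def)
qed simp

lemma polar_change_of_variables:
 assumes a: "0 <= a" and F: "F absolutely_integrable_on polar ` strip a b"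
 shows "(%p. p $ 1 * \<bar>cross (gm (p $ 2) - z) (g (p $ 2))\<bar> * F (polar p)) absolutely_integrable_on strip a b"
  "integral (strip a b) (%p. p $ 1 * \<bar>cross (gm (p $ 2) - z) (g (p $ 2))\<bar> * F (polar p)) = integral (polar ` strip a b) F"
proof -
 let ?G' = "%p h::real^2. h $ 1 *\<^sub>R (gm (p $ 2) - z) + (p $ 1 * h $ 2) *\<^sub>R g (p $ 2)"
 have d: "(polar has_derivative ?G' p) (at p within strip a b)" if "p \<in> strip a b" for p using that by (intro polar_has_derivative derivgm) (simp add: strip_def)
 note C = integral_change_of_variables_scalar[OF strip_measurable d inj_polar[OF a] F]
 have eq: "\<bar>det (matrix (?G' p))\<bar> * F (polar p) = p $ 1 * \<bar>cross (gm (p $ 2) - z) (g (p $ 2))\<bar> * F (polar p)" if "p \<in> strip a b" for p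
  using that a unfolding det_polar by (simp add: abs_mult strip_def)
 show "(%p. p $ 1 * \<bar>cross (gm (p $ 2) - z) (g (p $ 2))\<bar> * F (polar p)) absolutely_integrable_on strip a b"
  using C(1) by (subst set_integrable_cong[OF refl refl eq[symmetric]])
 show "integral (strip a b) (%p. p $ 1 * \<bar>cross (gm (p $ 2) - z) (g (p $ 2))\<bar> * F (polar p)) = integral (polar ` strip a b) F"
  by (rule trans[OF Henstock_Kurzweil_Integration.integral_cong C(2)]) (simp add: eq)
qed

text \<open>Two causes are treated apart: a null set of parameters, whose strip is negligible and
  has a negligible image under a Lipschitz map, and parameters with zero derivative, where the
  Jacobian vanishes and Sard's theorem applies.\<close>

lemma polar_exceptional: "negligible (polar ` {p. 0 < p $ 1 & p $ 1 < 1 & p $ 2 \<in> {0..1} - T})"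
proof -
 define Z where "Z = {t \<in> {0..1} - T. \<not> (gm has_vector_derivative 0) (at t)}"
 let ?A = "{p::real^2. 0 < p $ 1 & p $ 1 < 1 & p $ 2 \<in> Z}"
 let ?B = "{p::real^2. 0 < p $ 1 & p $ 1 < 1 & (gm has_vector_derivative 0) (at (p $ 2))}"
 have "AE t in lborel. t \<notin> {0,1::real}" by (intro AE_not_in finite_imp_null_set_lborel) simp
 then have "AE t in lborel. t \<notin> Z" using ae0 by eventually_elim (auto simp: Z_def)
 then obtain N where N: "N \<in> null_sets lborel" "Z \<subseteq> N"
 proof -
  obtain N where N: "N \<in> null_sets lborel" "!!t. t \<in> space lborel - N ==> t \<notin> Z" by (rule AE_E3[OF \<open>AE t in lborel. t \<notin> Z\<close>]) blast
  have "Z \<subseteq> N" using N(2) by auto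
  then show ?thesis by (rule that[OF N(1)])
 qed
 have "negligible {p::real^2. p $ 2 \<in> N}"
 proof -
  have [measurable]: "N \<in> sets borel" using N by (auto simp: null_sets_def)
  have m: "(%p::real^2. p $ 2) -` N \<inter> space borel \<in> sets borel" by (rule measurable_sets[OF measurable_nth]) simp
  then have m': "{p::real^2. p $ 2 \<in> N} \<in> sets borel" by (simp add: vimage_def)
  have "emeasure lborel {p::real^2. p $ 2 \<in> N} = (\<integral>\<^sup>+p. indicator {p::real^2. p $ 2 \<in> N} p \<partial>lborel)" using m' by simp
  also have "... = (\<integral>\<^sup>+a. \<integral>\<^sup>+b. indicator {p::real^2. p $ 2 \<in> N} (vector [a, b] :: real^2) \<partial>lborel \<partial>(lborel :: real measure))"
   using m' by (intro nn_integral_real2) (rule borel_measurable_indicator)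
  also have "... = (\<integral>\<^sup>+a. \<integral>\<^sup>+b. indicator N b \<partial>lborel \<partial>(lborel :: real measure))"
   by (intro nn_integral_cong) (simp add: indicator_def)
  also have "... = 0" using N by (simp add: null_sets_def)
  finally have "{p::real^2. p $ 2 \<in> N} \<in> null_sets lborel" using m' by (auto simp: null_sets_def)
  then have "{p::real^2. p $ 2 \<in> N} \<in> null_sets lebesgue" by (rule null_sets_completionI)
  then show ?thesis by (simp add: negligible_iff_null_sets)
 qed
 then have nA: "negligible ?A" by (rule negligible_subset) (use N in auto)
 obtain M where M: "!!t. t \<in> {0..1} ==> norm (gm t - z) <= M"
 proof -
  have "compact ((%t. gm t - z) ` {0..1})" using continuous_curve by (intro compact_continuous_image continuous_intros) auto
  then have "bounded ((%t. gm t - z) ` {0..1})" by (rule compact_imp_bounded)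
  then obtain M where "\<forall>x\<in>(%t. gm t - z) ` {0..1}. norm x <= M" unfolding bounded_iff by blast
  then show ?thesis by (intro that[of M]) auto
 qed
 have "negligible (polar ` ?A)"
 proof (rule negligible_locally_Lipschitz_image[OF _ nA])
  fix p assume p: "p \<in> ?A"
  have L0: "L \<ge> 0" using lipgm by (rule lipschitz_on_nonneg)
  have "norm (polar q - polar p) <= (M + L) * norm (q - p)" if q: "q \<in> ?A" for q
  proof -
   have Zp: "p $ 2 \<in> {0..1}" "q $ 2 \<in> {0..1}" using p q by (auto simp: Z_def)
   have "polar q - polar p = (q $ 1 - p $ 1) *\<^sub>R (gm (q $ 2) - z) + p $ 1 *\<^sub>R (gm (q $ 2) - gm (p $ 2))" by (simp add: polar_def algebra_simps)
   also have "norm ... <= \<bar>q $ 1 - p $ 1\<bar> * norm (gm (q $ 2) - z) + \<bar>p $ 1\<bar> * norm (gm (q $ 2) - gm (p $ 2))" by (metis norm_scaleR norm_triangle_ineq)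
   also have "... <= norm (q - p) * M + 1 * (L * norm (q - p))"
   proof (intro add_mono mult_mono)
    show "\<bar>q $ 1 - p $ 1\<bar> <= norm (q - p)" using component_le_norm_cart[of "q - p" 1] by simp
    have "norm (gm (q $ 2) - gm (p $ 2)) <= L * \<bar>q $ 2 - p $ 2\<bar>" using lipschitz_onD[OF lipgm Zp(2,1)] by (simp add: dist_norm)
    also have "... <= L * norm (q - p)" using L0 component_le_norm_cart[of "q - p" 2] by (intro mult_left_mono) auto
    finally show "norm (gm (q $ 2) - gm (p $ 2)) <= L * norm (q - p)" .
   qed (use p M Zp L0 in auto)
   finally show ?thesis by (simp add: algebra_simps)
  qed
  then show "\<exists>T B. open T & p \<in> T & (\<forall>q\<in>?A \<inter> T. norm (polar q - polar p) <= B * norm (q - p))" by (intro exI[of _ UNIV] exI[of _ "M + L"]) auto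
 qed simp
 moreover have "negligible (polar ` ?B)"
 proof (rule baby_Sard)
  fix p assume p: "p \<in> ?B"
  show "(polar has_derivative (%h. h $ 1 *\<^sub>R (gm (p $ 2) - z) + (p $ 1 * h $ 2) *\<^sub>R 0)) (at p within ?B)" using p by (intro polar_has_derivative) auto
  have "det (matrix (%h::real^2. h $ 1 *\<^sub>R (gm (p $ 2) - z) + (p $ 1 * h $ 2) *\<^sub>R 0)) = 0" unfolding det_polar by (simp add: cross_def)
  then show "rank (matrix (%h::real^2. h $ 1 *\<^sub>R (gm (p $ 2) - z) + (p $ 1 * h $ 2) *\<^sub>R 0)) < CARD(2)" using det_eq_0_rank by blast
 qed simp
 ultimately have "negligible (polar ` ?A \<union> polar ` ?B)" by (rule negligible_Un)
 then show ?thesis by (rule negligible_subset) (auto simp: Z_def)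
qed

end

subsection \<open>Almost everywhere differentiable Lipschitz functions\<close>

text \<open>Difference quotients along a fixed sequence yield both the measurability of
  \<open>partial\<close> and its bound by a Lipschitz constant.\<close>

lemma partial_quotient:
 assumes "f differentiable (at x)"
 shows "(%n. real (Suc n) * (f (x + (1 / real (Suc n)) *\<^sub>R axis i 1) - f x)) \<longlonglongrightarrow> partial i f x"
proof -
 let ?e = "axis i 1 :: real^2"
 have f: "(f has_derivative frechet_derivative f (at x)) (at x)" using assms frechet_derivative_works by blast
 have "((%t::real. x + t *\<^sub>R ?e) has_derivative (%t. t *\<^sub>R ?e)) (at 0)" by (auto intro!: derivative_eq_intros)
 then have "((%t::real. f (x + t *\<^sub>R ?e)) has_derivative (%t. frechet_derivative f (at x) (t *\<^sub>R ?e))) (at 0)" by (rule has_derivative_compose) (use f in simp)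
 moreover have "frechet_derivative f (at x) (t *\<^sub>R ?e) = partial i f x * t" for t unfolding partial_def using linear_cmul[OF has_derivative_linear[OF f]] by simp
 ultimately have "((%t::real. f (x + t *\<^sub>R ?e)) has_real_derivative partial i f x) (at 0)" by (simp add: has_field_derivative_def)
 then have "((%t. (f (x + t *\<^sub>R ?e) - f x) / t) \<longlongrightarrow> partial i f x) (at 0)" by (simp add: DERIV_def)
 moreover have "filterlim (%n. 1 / real (Suc n)) (at 0) sequentially" using LIMSEQ_inverse_real_of_nat unfolding filterlim_at by (simp add: inverse_eq_divide)
 ultimately have "(%n. (f (x + (1 / real (Suc n)) *\<^sub>R ?e) - f x) / (1 / real (Suc n))) \<longlonglongrightarrow> partial i f x" by (rule filterlim_compose)
 then show ?thesis by (simp add: field_simps)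
qed

lemma partial_Lipschitz_le:
 assumes L: "!!x y. \<bar>f x - f y\<bar> <= K * norm (x - y)" and f: "f differentiable (at x)"
 shows "\<bar>partial i f x\<bar> <= K"
proof (rule LIMSEQ_le_const2[OF tendsto_rabs[OF partial_quotient[OF f]]])
 have e: "norm (axis i (1::real) :: real^2) = 1" by (rule norm_Basis) simp
 have "\<bar>real (Suc n) * (f (x + (1 / real (Suc n)) *\<^sub>R axis i 1) - f x)\<bar> <= K" for n
 proof -
  have "\<bar>f (x + (1 / real (Suc n)) *\<^sub>R axis i 1) - f x\<bar> <= K * (1 / real (Suc n))" using L[of "x + (1 / real (Suc n)) *\<^sub>R axis i 1" x] e by simp
  then have "real (Suc n) * \<bar>f (x + (1 / real (Suc n)) *\<^sub>R axis i 1) - f x\<bar> <= real (Suc n) * (K * (1 / real (Suc n)))" by (rule mult_left_mono) simp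
  then show ?thesis by (simp add: abs_mult del: of_nat_Suc)
 qed
 then show "\<exists>N. \<forall>n\<ge>N. \<bar>real (Suc n) * (f (x + (1 / real (Suc n)) *\<^sub>R axis i 1) - f x)\<bar> <= K" by blast
qed

lemma partial_measurable:
 assumes f: "continuous_on UNIV f" and d: "AE x in lebesgue. f differentiable (at x)"
 shows "partial i f \<in> borel_measurable lebesgue"
proof (rule borel_measurable_AE)
 let ?q = "%n x. real (Suc n) * (f (x + (1 / real (Suc n)) *\<^sub>R axis i 1) - f x)"
 have "?q n \<in> borel_measurable borel" for n by (intro borel_measurable_continuous_onI continuous_intros continuous_on_compose2[OF f]) auto
 then have "?q n \<in> borel_measurable lebesgue" for n by (simp add: measurable_completion)
 then show "(%x. lim (%n. ?q n x)) \<in> borel_measurable lebesgue" by (rule borel_measurable_lim_metric)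
 show "AE x in lebesgue. lim (%n. ?q n x) = partial i f x" using d by eventually_elim (rule limI[OF partial_quotient])
qed

subsection \<open>Boundary integrals in polar coordinates\<close>

context star_curve
begin

text \<open>The outward unit normal times the speed; the sign makes it independent of the direction
  in which the curve is traversed.\<close>

definition conormal :: "real => real^2" where
 "conormal t = sgn (cross (gm t - z) (g t)) *\<^sub>R rot (g t)"

lemma cross_ne_0: "t \<in> T ==> cross (gm t - z) (g t) ~= 0"
proof -
 assume t: "t \<in> T"
 have "r * norm (g t) > 0" using r0 g0[OF t] by simp
 then show ?thesis using tangent_cross[OF frgm T_I(2)[OF t] derivgm[OF t]] by auto
qed

text \<open>The gauge is homogeneous of degree one about \<open>z\<close>, so its derivative is
  constant along rays and can be read off at the boundary.\<close>

lemma gauge_polar_derivative: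
 assumes p: "p $ 1 > 0" "p $ 2 \<in> T"
 shows "(minkowski has_derivative (%w. cross w (g (p $ 2)) / cross (gm (p $ 2) - z) (g (p $ 2)))) (at (polar p))"
proof -
 let ?s = "p $ 1" and ?t = "p $ 2"
 let ?c = "cross (gm ?t - z) (g ?t)"
 have N: "(minkowski has_derivative (%w. cross w (g ?t) / ?c)) (at (gm ?t))" by (rule gauge_has_derivative_frontier[OF frgm T_I(2)[OF p(2)] derivgm[OF p(2)] g0[OF p(2)]])
 have z: "z + (1/?s) *\<^sub>R (polar p - z) = gm ?t" using p by (simp add: polar_def)
 have "((%y. z + (1/?s) *\<^sub>R (y - z)) has_derivative (%w. (1/?s) *\<^sub>R w)) (at (polar p))" by (auto intro!: derivative_eq_intros)
 then have "((%y. minkowski (z + (1/?s) *\<^sub>R (y - z))) has_derivative (%w. cross ((1/?s) *\<^sub>R w) (g ?t) / ?c)) (at (polar p))"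
  by (rule has_derivative_compose) (use N in \<open>simp only: z\<close>)
 then have "((%y. ?s * minkowski (z + (1/?s) *\<^sub>R (y - z))) has_derivative (%w. ?s * (cross ((1/?s) *\<^sub>R w) (g ?t) / ?c))) (at (polar p))"
  by (rule has_derivative_mult_right)
 moreover have "?s * minkowski (z + (1/?s) *\<^sub>R (y - z)) = minkowski y" for y using gauge_scale[of "1/?s" y] p by simp
 moreover have "?s * (cross ((1/?s) *\<^sub>R w) (g ?t) / ?c) = cross w (g ?t) / ?c" for w
 proof -
  have "cross ((1/?s) *\<^sub>R w) (g ?t) = (1/?s) * cross w (g ?t)" by (simp add: cross_def right_diff_distrib)
  then show ?thesis using p by simp
 qed
 ultimately show ?thesis by (simp only:)
qed

lemma conormal_measurable:
 assumes \<Phi>: "continuous_on {0..1} \<Phi>"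
 shows "set_borel_measurable borel T (%t. \<Phi> t \<bullet> conormal t)"
proof -
 have ext: "(%t. indicator {0..1} t *\<^sub>R \<Psi> t) \<in> borel_measurable borel" if "continuous_on {0..1} \<Psi>" for \<Psi> :: "real => real^2"
  by (rule borel_measurable_continuous_on_indicator[OF _ that]) simp
 have cr: "(%t. cross (u t) (v t)) \<in> borel_measurable borel" if "u \<in> borel_measurable borel" "v \<in> borel_measurable borel" for u v :: "real => real^2"
  unfolding cross_def by (intro borel_measurable_diff borel_measurable_times measurable_compose[OF _ measurable_nth] that)
 have sg: "(%t. sgn (u t)) \<in> borel_measurable borel" if [measurable]: "u \<in> borel_measurable borel" for u :: "real => real" unfolding sgn_real_def by measurable
 \<comment> \<open>The curve is continuous on \<open>[0,1]\<close> only; the inner indicators extend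
   it by zero to Borel functions and change nothing on \<open>T\<close>.\<close>
 let ?f = "%t. indicator T t * (sgn (cross (indicator {0..1} t *\<^sub>R (gm t - z)) (g t)) * cross (indicator {0..1} t *\<^sub>R \<Phi> t) (g t))"
 have "?f \<in> borel_measurable borel" by (intro borel_measurable_times borel_measurable_indicator Tm sg cr ext \<Phi> gm continuous_intros continuous_curve)
 moreover have "?f t = indicator T t *\<^sub>R (\<Phi> t \<bullet> conormal t)" for t using T_I(1)[of t] by (auto simp: indicator_def conormal_def inner_rot)
 ultimately show ?thesis unfolding set_borel_measurable_def by simp
qed

lemma norm_conormal: "t \<in> T ==> norm (conormal t) = norm (g t)" using cross_ne_0 by (simp add: conormal_def norm_rot abs_sgn_eq)

lemma inner_conormal_le:
 assumes "t \<in> T" "norm v <= M"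
 shows "\<bar>v \<bullet> conormal t\<bar> <= M * L"
proof -
 have "\<bar>v \<bullet> conormal t\<bar> <= norm v * norm (conormal t)" by (rule Cauchy_Schwarz_ineq2)
 also have "... <= M * L" using assms gL norm_conormal order_trans[OF norm_ge_zero assms(2)] by (intro mult_mono) auto
 finally show ?thesis .
qed

lemma speed_AE: "AE t in lebesgue. t \<in> {0..1} --> speed gm t = indicator T t * norm (g t)"
proof -
 have "AE t in lborel. t \<notin> {0,1::real}" by (intro AE_not_in finite_imp_null_set_lborel) simp
 then have "AE t in lborel. t \<in> {0..1} --> speed gm t = indicator T t * norm (g t)" using ae0
 proof eventually_elim
  case (elim t)
  show ?case
  proof (cases "t \<in> T")
   case True then show ?thesis using vector_derivative_at[OF derivgm[OF True]] by simp
  next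
   case False
   then show ?thesis using elim vector_derivative_at[of gm 0 t] by auto
  qed
 qed
 then show ?thesis by (rule AE_completion)
qed

lemma I01_integral_eq:
 fixes K :: "real => real"
 assumes K: "set_borel_measurable borel T K" and ae: "AE t in lebesgue. t \<in> {0..1} --> f t = indicator T t * K t"
 shows "(LINT t|I01. f t) = (LINT t|lborel. indicator T t * K t)"
proof -
 have m: "(%t. indicator T t * K t :: real) \<in> borel_measurable borel" using K by (simp add: set_borel_measurable_def)
 have ae': "AE t in lebesgue. indicator T t * K t = indicator {0..1} t *\<^sub>R f t" using ae by eventually_elim (use T_I(1) in \<open>auto simp: indicator_def\<close>)
 have "(LINT t|I01. f t) = (LINT t|lebesgue. indicator {0..1} t *\<^sub>R f t)" by (simp add: integral_restrict_space)
 also have "... = (LINT t|lebesgue. indicator T t * K t)"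
 proof (rule BI_integral_cong_AE)
  show b: "(%t. indicator T t * K t) \<in> borel_measurable lebesgue" using m by (simp add: measurable_completion)
  show "(%t. indicator {0..1} t *\<^sub>R f t) \<in> borel_measurable lebesgue" by (rule borel_measurable_AE[OF b ae'])
  show "AE t in lebesgue. indicator {0..1} t *\<^sub>R f t = indicator T t * K t" using ae' by eventually_elim simp
 qed
 also have "... = (LINT t|lborel. indicator T t * K t)" using m by (simp add: integral_completion)
 finally show ?thesis .
qed

text \<open>On \<open>T\<close> normal times speed is the conormal. Elsewhere the speed vanishes
  almost everywhere, so the unspecified values of \<open>outward_normal\<close> do no harm.\<close>

lemma side_integral_normal:
 assumes q: "continuous_on {0..1} (%t. f (gm t) *\<^sub>R q (gm t))"
 shows "side_integral gm (%x. f x * (q x \<bullet> outward_normal D x))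
  = (LINT t|lborel. indicator T t * ((f (gm t) *\<^sub>R q (gm t)) \<bullet> conormal t))" unfolding side_integral_def
proof (rule I01_integral_eq[OF conormal_measurable[OF q]])
 show "AE t in lebesgue. t \<in> {0..1} --> f (gm t) * (q (gm t) \<bullet> outward_normal D (gm t)) * speed gm t
  = indicator T t * ((f (gm t) *\<^sub>R q (gm t)) \<bullet> conormal t)" using speed_AE
 proof eventually_elim
  case (elim t)
  show ?case
  proof (cases "t \<in> T")
   case True
   then have "outward_normal D (gm t) = (sgn (cross (gm t - z) (g t)) / norm (g t)) *\<^sub>R rot (g t)" by (intro outward_normal_frontier frgm T_I(2) derivgm g0)
   then show ?thesis using elim True g0 T_I(1)[OF True] by (simp add: conormal_def)
  qed (use elim in auto)
 qed
qed

lemma length_eq: "(LINT t|I01. speed gm t) = (LINT t|lborel. indicator T t * norm (g t))"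
proof (rule I01_integral_eq[OF _ speed_AE])
 show "set_borel_measurable borel T (%t. norm (g t))" unfolding set_borel_measurable_def using gm Tm by simp
qed

text \<open>The part \<open>1/2 < s < 1\<close> of the domain over the curve has area at least
  \<open>r / 4\<close> times the length: there the Jacobian is at least \<open>r / 2\<close> times
  the speed, and the strip has width \<open>1/2\<close>.\<close>

lemma length_le: "(LINT t|I01. speed gm t) <= 4 / r * measure lebesgue D"
proof -
 let ?S = "strip (1/2) 1"
 let ?c = "%p. p $ 1 * \<bar>cross (gm (p $ 2) - z) (g (p $ 2))\<bar>"
 have Dl: "D \<in> lmeasurable" using openD boundedD by (simp add: lmeasurable_open)
 have im: "polar ` ?S \<subseteq> D" using polar_image_subset[of "1/2" 1] by auto
 have Pl: "polar ` ?S \<in> lmeasurable" using Dl im polar_image_measurable by (meson bounded_set_imp_lmeasurable bounded_subset boundedD)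
 have ng: "set_borel_measurable borel T (%t. norm (g t))" unfolding set_borel_measurable_def using gm Tm by simp
 have TT: "T \<subseteq> {0..1}" using T_I by auto
 note S = integral_strip[OF Tm TT ng, of L "1/2" 1]
 have S1: "(%p. norm (g (p $ 2))) integrable_on ?S" "integral ?S (%p. norm (g (p $ 2))) = (1/2) * (LINT t|lborel. indicator T t * norm (g t))"
  using S gL unfolding strip_def by (auto intro: set_lebesgue_integral_eq_integral)
 have one: "(%x. 1::real) absolutely_integrable_on polar ` ?S" using Pl by (simp add: absolutely_integrable_on_const)
 have ci: "?c integrable_on ?S" "integral ?S ?c = integral (polar ` ?S) (%x. 1)" using polar_change_of_variables[OF _ one] by (auto intro: set_lebesgue_integral_eq_integral)
 have "(1/2) * (LINT t|lborel. indicator T t * norm (g t)) <= integral ?S (%p. (2/r) * ?c p)" unfolding S1(2)[symmetric]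
 proof (rule integral_le[OF S1(1)])
  show "(%p. (2/r) * ?c p) integrable_on ?S" using ci(1) by (rule integrable_on_mult_right)
  fix p assume p: "p \<in> ?S"
  then have t: "p $ 2 \<in> T" "1/2 < p $ 1" by (auto simp: strip_def)
  have "r * norm (g (p $ 2)) <= \<bar>cross (gm (p $ 2) - z) (g (p $ 2))\<bar>" using t by (intro tangent_cross frgm derivgm T_I(2))
  also have "... <= 2 * p $ 1 * \<bar>cross (gm (p $ 2) - z) (g (p $ 2))\<bar>" using t mult_right_mono[of 1 "2 * p $ 1" "\<bar>cross (gm (p $ 2) - z) (g (p $ 2))\<bar>"] by simp
  finally show "norm (g (p $ 2)) <= (2/r) * ?c p" using r0 by (simp add: field_simps)
 qed
 also have "... = (2/r) * measure lebesgue (polar ` ?S)" using ci(2) Pl by (simp add: lmeasure_integral)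
 also have "... <= (2/r) * measure lebesgue D" using r0 im Pl Dl by (intro mult_left_mono measure_mono_fmeasurable) (auto simp: fmeasurable_def)
 finally show ?thesis unfolding length_eq by (simp add: field_simps)
qed

end

subsection \<open>A cutoff function of the gauge\<close>

context star_domain
begin

definition cut :: "real => real => real^2 => real" where
 "cut a b x = min 1 (max 0 ((b - minkowski x) / (b - a)))"

lemma cut_range: "0 <= cut a b x" "cut a b x <= 1" by (auto simp: cut_def)

lemma cut_inner: "a < b ==> minkowski x <= a ==> cut a b x = 1" by (auto simp: cut_def min_def max_def field_simps)

lemma cut_outer: "a < b ==> b <= minkowski x ==> cut a b x = 0"
proof -
 assume "a < b" "b <= minkowski x"
 then have "(b - minkowski x) / (b - a) <= 0" by (auto intro: divide_nonpos_pos)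
 then show "cut a b x = 0" by (simp add: cut_def)
qed

lemma cut_Lipschitz:
 assumes "a < b"
 shows "\<bar>cut a b x - cut a b y\<bar> <= 1 / (r * (b - a)) * norm (x - y)"
proof -
 have "\<bar>cut a b x - cut a b y\<bar> <= \<bar>(b - minkowski x) / (b - a) - (b - minkowski y) / (b - a)\<bar>" unfolding cut_def by linarith
 also have "... = \<bar>minkowski x - minkowski y\<bar> / (b - a)" using assms by (simp add: diff_divide_distrib[symmetric] abs_minus_commute)
 also have "... <= norm (x - y) / r / (b - a)" using assms by (intro divide_right_mono gauge_Lipschitz) auto
 finally show ?thesis by (simp add: field_simps)
qed

lemma continuous_cut: "continuous_on S (cut a b)" unfolding cut_def[abs_def] by (cases "a = b") (auto intro!: continuous_intros continuous_gauge)

lemma cut_has_derivative: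
 assumes "a < minkowski x" "minkowski x < b" and N: "(minkowski has_derivative N') (at x)"
 shows "(cut a b has_derivative (%w. - N' w / (b - a))) (at x)"
proof (rule has_derivative_transform_within_open)
 let ?U = "{y. a < minkowski y} \<inter> {y. minkowski y < b}"
 show "open ?U" by (intro open_Int open_Collect_less continuous_gauge continuous_intros)
 show "x \<in> ?U" using assms by simp
 show "((%y. (b - minkowski y) / (b - a)) has_derivative (%w. - N' w / (b - a))) (at x)" using assms by (auto intro!: derivative_eq_intros N)
 show "(b - minkowski y) / (b - a) = cut a b y" if "y \<in> ?U" for y using that by (auto simp: cut_def min_def max_def field_simps)
qed

lemma cut_has_derivative_0:
 assumes "a < b" "minkowski x < a \<or> b < minkowski x"
 shows "(cut a b has_derivative (%w. 0)) (at x)" using assms(2)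
proof
 assume x: "minkowski x < a"
 show ?thesis
 proof (rule has_derivative_transform_within_open)
  show "open {y. minkowski y < a}" by (intro open_Collect_less continuous_gauge continuous_intros)
  show "((%y. 1) has_derivative (%w. 0)) (at x)" by simp
 qed (use x cut_inner[OF assms(1)] in auto)
next
 assume x: "b < minkowski x"
 show ?thesis
 proof (rule has_derivative_transform_within_open)
  show "open {y. b < minkowski y}" by (intro open_Collect_less continuous_gauge continuous_intros)
  show "((%y. 0) has_derivative (%w. 0)) (at x)" by simp
 qed (use x cut_outer[OF assms(1)] in auto)
qed

text \<open>By homogeneity each ray from \<open>z\<close> meets the level set at most once.\<close>

lemma level_negligible:
 assumes s: "s > 0"
 shows "negligible {x. minkowski x = s}"
proof (rule starlike_negligible[where a=z])
 show "closed {x. minkowski x = s}" by (intro closed_Collect_eq continuous_gauge continuous_intros)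
 fix c x assume "z + c *\<^sub>R x \<in> {x. minkowski x = s}" "0 <= c" "z + x \<in> {x. minkowski x = s}"
 then have "c * s = s" using gauge_scale[of c "z + x"] by simp
 then show "c = 1" using s by simp
qed

end

subsection \<open>The flux through thin shells\<close>

context star_domain
begin

lemma gauge_le_1_closure: "minkowski x <= 1 ==> x \<in> closure D" using gauge_less_1_iff[of x] gauge_eq_1_frontier[of x] closure_subset[of D]
 by (cases "minkowski x = 1") (auto simp: frontier_def)

text \<open>Meaningful only where the cut-off is differentiable, which holds almost everywhere by
  \<open>cut_differentiable_AE\<close>.\<close>

definition gradc :: "real => real => real^2 => real^2" where
 "gradc a b x = vector [partial 1 (cut a b) x, partial 2 (cut a b) x]"

lemma inner_gradc:
 assumes "(cut a b has_derivative c') (at x)"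
 shows "v \<bullet> gradc a b x = c' v"
proof -
 have fd: "frechet_derivative (cut a b) (at x) = c'" using frechet_derivative_at[OF assms] by simp
 have l: "linear c'" using assms by (rule has_derivative_linear)
 have "v = v $ 1 *\<^sub>R axis 1 1 + v $ 2 *\<^sub>R axis 2 1" by (simp add: vec_eq_iff forall_2 axis_def)
 then have "c' v = c' (v $ 1 *\<^sub>R axis 1 1 + v $ 2 *\<^sub>R axis 2 1)" by simp
 also have "... = v $ 1 * c' (axis 1 1) + v $ 2 * c' (axis 2 1)" by (simp only: linear_add[OF l] linear_cmul[OF l] real_scaleR_def)
 finally show ?thesis by (simp add: gradc_def inner_vec_def sum_2 partial_def fd)
qed

end

context star_curve
begin

text \<open>In polar coordinates the field and the radial Jacobian factor \<open>s\<close> are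
  uniformly continuous up to \<open>s = 1\<close>, so the mean over a thin strip tends to the
  boundary integral. The conormal depends on the parameter alone and needs no continuity.\<close>

lemma strip_limit:
 assumes F: "continuous_on (closure D) F"
  and int: "!!a b. 0 < a ==> a < b ==> b < 1 ==> (%p. p $ 1 * (F (polar p) \<bullet> conormal (p $ 2))) integrable_on strip a b"
  and e: "e > 0"
 shows "\<exists>d>0. \<forall>et. 0 < et & et < d -->
  \<bar>(1 / et) * integral (strip (1 - 2 * et) (1 - et)) (%p. p $ 1 * (F (polar p) \<bullet> conormal (p $ 2)))
   - (LINT t|lborel. indicator T t * (F (gm t) \<bullet> conormal t))\<bar> <= e"
proof -
 let ?\<Psi> = "%(s, t). s *\<^sub>R F (z + s *\<^sub>R (gm t - z))"
 have L0: "L \<ge> 0" using lipgm by (rule lipschitz_on_nonneg)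
 have "continuous_on ({0..1} \<times> {0..1::real}) ?\<Psi>" unfolding case_prod_unfold
 proof (intro continuous_intros continuous_on_compose2[OF F] continuous_on_compose2[OF continuous_curve])
  show "(%p. z + fst p *\<^sub>R (gm (snd p) - z)) ` ({0..1} \<times> {0..1}) \<subseteq> closure D"
  proof (intro image_subsetI gauge_le_1_closure)
   fix p :: "real \<times> real" assume "p \<in> {0..1} \<times> {0..1}"
   then show "minkowski (z + fst p *\<^sub>R (gm (snd p) - z)) <= 1" using gauge_scale gauge_curve by auto
  qed
 qed auto
 then have "uniformly_continuous_on ({0..1} \<times> {0..1}) ?\<Psi>" by (rule compact_uniformly_continuous) (intro compact_Times compact_Icc)
 moreover have "e / (L + 1) > 0" using e L0 by (intro divide_pos_pos) auto
 ultimately obtain d where d: "d > 0" "\<forall>x\<in>{0..1} \<times> {0..1}. \<forall>x'\<in>{0..1} \<times> {0..1}. dist x' x < d --> dist (?\<Psi> x') (?\<Psi> x) < e / (L + 1)"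
  unfolding uniformly_continuous_on_def by blast
 have near: "norm (s *\<^sub>R F (z + s *\<^sub>R (gm t - z)) - F (gm t)) <= e / (L + 1)" if "0 <= s" "s <= 1" "1 - s < d" "t \<in> {0..1}" for s t
 proof -
  have "dist (s, t) (1, t) < d" using that by (simp add: dist_Pair_Pair dist_real_def)
  moreover have "(1::real, t) \<in> {0..1} \<times> {0..1}" "(s, t) \<in> {0..1} \<times> {0..1}" using that by auto
  ultimately have "dist (?\<Psi> (s, t)) (?\<Psi> (1, t)) < e / (L + 1)" using d(2) by blast
  then show ?thesis by (simp add: dist_norm less_imp_le)
 qed
 have cF: "continuous_on {0..1} (%t. F (gm t))" by (rule continuous_on_compose2[OF F continuous_curve]) (use frgm in \<open>auto simp: frontier_def\<close>)
 have "bounded ((%t. F (gm t)) ` {0..1})" by (intro compact_imp_bounded compact_continuous_image cF compact_Icc)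
 then obtain M where M: "\<forall>x\<in>(%t. F (gm t)) ` {0..1}. norm x <= M" unfolding bounded_iff by blast
 have TT: "T \<subseteq> {0..1}" using T_I by auto
 have bK: "\<bar>F (gm t) \<bullet> conormal t\<bar> <= M * L" if "t \<in> T" for t using M T_I(1)[OF that] by (intro inner_conormal_le that) auto
 have m1: "set_borel_measurable borel T (%t. 1::real)" unfolding set_borel_measurable_def using Tm by simp
 show ?thesis
 \<comment> \<open>The strip begins at \<open>1 - 2 * et\<close>, hence \<open>d/2\<close>; the
   bound \<open>1/2\<close> keeps this inner level positive.\<close>
 proof (intro exI[of _ "min (d/2) (1/2)"] conjI allI impI)
  fix et assume et: "0 < et & et < min (d/2) (1/2)"
  define a b where "a = 1 - 2 * et" and "b = 1 - et"
  have ab: "0 < a" "a < b" "b < 1" "b - a = et" using et by (auto simp: a_def b_def)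
  note K = integral_strip[OF Tm TT conormal_measurable[OF cF] bK less_imp_le[OF ab(2)], folded strip_def]
  note K1 = integral_strip[OF Tm TT m1 _ less_imp_le[OF ab(2)], folded strip_def, of 1, simplified]
  let ?f = "%p. p $ 1 * (F (polar p) \<bullet> conormal (p $ 2))"
  let ?k = "%p. F (gm (p $ 2)) \<bullet> conormal (p $ 2)"
  have ik: "?k integrable_on strip a b" using K(1) by (rule set_lebesgue_integral_eq_integral(1))
  note fi = int[OF ab(1-3)]
  have i1: "(%p::real^2. 1::real) integrable_on strip a b" using K1(1) by (rule set_lebesgue_integral_eq_integral(1))
  have T1: "(LINT t|lborel. indicator T t) <= (1::real)"
  proof -
   have "emeasure lborel T <= emeasure lborel {0..1::real}" using TT by (intro emeasure_mono) auto
   then have "measure lborel T <= 1" unfolding measure_def by (intro enn2real_leI) auto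
   then show ?thesis by simp
  qed
  have "norm (integral (strip a b) (%p. ?f p - ?k p)) <= integral (strip a b) (%p. e * 1)"
  proof (rule integral_norm_bound_integral)
   show "(%p. ?f p - ?k p) integrable_on strip a b" by (rule integrable_diff[OF fi ik])
   show "(%p. e * 1) integrable_on strip a b" using i1 by (rule integrable_on_mult_right)
   fix p assume p: "p \<in> strip a b"
   then have t: "p $ 2 \<in> T" "0 <= p $ 1" "p $ 1 <= 1" "1 - p $ 1 < d" using ab et by (auto simp: strip_def a_def)
   have "?f p - ?k p = (p $ 1 *\<^sub>R F (polar p) - F (gm (p $ 2))) \<bullet> conormal (p $ 2)" by (simp add: inner_diff_left)
   also have "\<bar>...\<bar> <= (e / (L + 1)) * L" unfolding polar_def by (rule inner_conormal_le[OF t(1) near]) (use t T_I(1) in auto)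
   also have "... <= e" using e L0 by (simp add: field_simps)
   finally show "norm (?f p - ?k p) <= e * 1" by simp
  qed
  also have "... = e * (et * (LINT t|lborel. indicator T t))" unfolding integral_mult_right using K1(2) ab(4) by simp
  also have "... <= e * (et * 1)" using T1 e et by (intro mult_left_mono) auto
  finally have n: "norm (integral (strip a b) (%p. ?f p - ?k p)) <= e * (et * 1)" .
  have Ke: "integral (strip a b) ?k = et * (LINT t|lborel. indicator T t * (F (gm t) \<bullet> conormal t))" using K(2) unfolding ab(4) .
  have "integral (strip a b) (%p. ?f p - ?k p) = integral (strip a b) ?f - et * (LINT t|lborel. indicator T t * (F (gm t) \<bullet> conormal t))"
   using integral_diff[OF fi ik] Ke by (rule trans[OF _ arg_cong])
  then have "\<bar>integral (strip a b) ?f - et * (LINT t|lborel. indicator T t * (F (gm t) \<bullet> conormal t))\<bar> <= e * et"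
   using n by (simp only: real_norm_def mult_1_right)
  then have "(1/et) * \<bar>integral (strip a b) ?f - et * (LINT t|lborel. indicator T t * (F (gm t) \<bullet> conormal t))\<bar> <= (1/et) * (e * et)"
   using et by (intro mult_left_mono) auto
  moreover have "(1/et) * \<bar>A - et * B\<bar> = \<bar>(1/et) * A - B\<bar>" for A B
  proof -
   have "\<bar>1/et\<bar> = 1/et" using et by simp
   then have "(1/et) * \<bar>A - et * B\<bar> = \<bar>(1/et) * (A - et * B)\<bar>" unfolding abs_mult by simp
   also have "(1/et) * (A - et * B) = (1/et) * A - B" using et by (simp add: right_diff_distrib)
   finally show ?thesis .
  qed
  ultimately show "\<bar>(1 / et) * integral (strip (1 - 2 * et) (1 - et)) ?f
   - (LINT t|lborel. indicator T t * (F (gm t) \<bullet> conormal t))\<bar> <= e" using et unfolding a_def b_def by simp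
 qed (use d in auto)
qed

end

text \<open>Disjointness concerns interior parameters only, because neighbouring sides share their
  corners.\<close>

locale star_boundary = star_domain D z r for D z r +
 fixes I :: "nat set" and gm g :: "nat => real => real^2" and T :: "nat => real set" and L :: "nat => real"
 assumes finI: "finite I" and curve: "i \<in> I ==> star_curve D z r (gm i) (g i) (T i) (L i)"
  and cover: "frontier D \<subseteq> (\<Union>i\<in>I. path_image (gm i))"
  and disj: "[|i \<in> I; j \<in> I; i ~= j; s \<in> {0<..<1}; t \<in> {0<..<1}|] ==> gm i s ~= gm j t"
begin

abbreviation "polar i \<equiv> star_curve.polar z (gm i)"
abbreviation "strip i \<equiv> star_curve.strip (T i)"
abbreviation "conormal i \<equiv> star_curve.conormal z (gm i) (g i)"

text \<open>A point of the shell lies on the ray through some boundary point \<open>gm i t\<close>.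
  If no strip reaches it, \<open>t\<close> is outside \<open>T i\<close>, and
  \<open>polar_exceptional\<close> applies.\<close>

lemma shell_cover:
 assumes "0 <= a" "b <= 1"
 shows "negligible ({x. a < minkowski x & minkowski x < b} - (\<Union>i\<in>I. polar i ` strip i a b))"
proof (rule negligible_subset)
 let ?E = "%i. polar i ` {p. 0 < p $ 1 & p $ 1 < 1 & p $ 2 \<in> {0..1} - T i}"
 show "negligible (\<Union>i\<in>I. ?E i)"
 proof (rule negligible_Union)
  fix S assume "S \<in> ?E ` I"
  then obtain i where "i \<in> I" "S = ?E i" by blast
  then show "negligible S" using star_curve.polar_exceptional[OF curve] by (simp only:)
 qed (use finI in simp)
 show "{x. a < minkowski x & minkowski x < b} - (\<Union>i\<in>I. polar i ` strip i a b) \<subseteq> (\<Union>i\<in>I. ?E i)"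
 proof
  fix x assume x: "x \<in> {x. a < minkowski x & minkowski x < b} - (\<Union>i\<in>I. polar i ` strip i a b)"
  let ?s = "minkowski x"
  have s: "0 < ?s" "?s < 1" "a < ?s" "?s < b" using x assms by auto
  have "minkowski (z + (1/?s) *\<^sub>R (x - z)) = 1" using gauge_scale[of "1/?s" x] s by simp
  then have "z + (1/?s) *\<^sub>R (x - z) \<in> (\<Union>i\<in>I. path_image (gm i))" using cover gauge_eq_1_frontier by blast
  then obtain i t where i: "i \<in> I" "t \<in> {0..1}" "z + (1/?s) *\<^sub>R (x - z) = gm i t" by (auto simp: path_image_def)
  have px: "polar i (vector [?s, t]) = x" using s by (simp add: star_curve.polar_def[OF curve[OF i(1)]] i(3)[symmetric])
  have "t \<notin> T i"
  proof
   assume "t \<in> T i"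
   then have "vector [?s, t] \<in> strip i a b" using s by (simp add: star_curve.strip_def[OF curve[OF i(1)]])
   then show False using x px i(1) by (metis (no_types, lifting) DiffE UN_I image_eqI)
  qed
  then have "vector [?s, t] \<in> {p::real^2. 0 < p $ 1 & p $ 1 < 1 & p $ 2 \<in> {0..1} - T i}" using s i by simp
  then show "x \<in> (\<Union>i\<in>I. ?E i)" using i(1) px by (metis (no_types, lifting) UN_I image_eqI)
 qed
qed

lemma shell_disjoint:
 assumes i: "i \<in> I" "j \<in> I" "i ~= j" and a: "0 <= a"
 shows "polar i ` strip i a b \<inter> polar j ` strip j a b = {}"
proof (intro equals0I)
 fix x assume "x \<in> polar i ` strip i a b \<inter> polar j ` strip j a b"
 then obtain p q where pq: "p \<in> strip i a b" "q \<in> strip j a b" "polar i p = x" "polar j q = x" by auto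
 interpret ci: star_curve D z r "gm i" "g i" "T i" "L i" by (rule curve[OF i(1)])
 interpret cj: star_curve D z r "gm j" "g j" "T j" "L j" by (rule curve[OF i(2)])
 have p: "0 < p $ 1" "p $ 2 \<in> T i" and q: "0 < q $ 1" "q $ 2 \<in> T j" using pq a by (auto simp: ci.strip_def cj.strip_def)
 have "minkowski x = p $ 1" "minkowski x = q $ 1" using ci.gauge_polar[of p] cj.gauge_polar[of q] p q ci.T_I(1) cj.T_I(1) pq by auto
 then have 1: "q $ 1 = p $ 1" by simp
 have "z + p $ 1 *\<^sub>R (gm i (p $ 2) - z) = z + q $ 1 *\<^sub>R (gm j (q $ 2) - z)" using pq(3,4) unfolding ci.polar_def cj.polar_def by simp
 then have "p $ 1 *\<^sub>R (gm i (p $ 2) - z) = p $ 1 *\<^sub>R (gm j (q $ 2) - z)" unfolding 1 by (rule add_left_imp_eq)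
 then have "gm i (p $ 2) = gm j (q $ 2)" using p by simp
 then show False using disj[OF i ci.T_I(2)[OF p(2)] cj.T_I(2)[OF q(2)]] by simp
qed

text \<open>Off the shell the cut-off is locally constant, the two level sets are negligible, and
  inside the shell the gauge inherits its derivative from the tangents of the boundary
  curves.\<close>

lemma cut_differentiable_AE:
 assumes ab: "0 < a" "a < b" "b <= 1"
 shows "AE x in lebesgue. cut a b differentiable (at x)"
proof -
 let ?N = "{x. minkowski x = a} \<union> {x. minkowski x = b} \<union> ({x. a < minkowski x & minkowski x < b} - (\<Union>i\<in>I. polar i ` strip i a b))"
 have "negligible ?N" using ab by (intro negligible_Un level_negligible shell_cover) auto
 then have "AE x in lebesgue. x \<notin> ?N" by (intro AE_not_in) (simp add: negligible_iff_null_sets)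
 then show ?thesis
 proof eventually_elim
  case (elim x)
  consider "minkowski x < a \<or> b < minkowski x" | "a < minkowski x" "minkowski x < b" using elim by force
  then show ?case
  proof cases
   case 1 then show ?thesis using cut_has_derivative_0[OF ab(2)] unfolding differentiable_def by blast
  next
   case 2
   then obtain i p where i: "i \<in> I" "p \<in> strip i a b" "x = polar i p" using elim by auto
   interpret ci: star_curve D z r "gm i" "g i" "T i" "L i" by (rule curve[OF i(1)])
   have "p $ 1 > 0" "p $ 2 \<in> T i" using i ab by (auto simp: ci.strip_def)
   from ci.gauge_polar_derivative[OF this] show ?thesis using cut_has_derivative[OF 2] i(3) unfolding differentiable_def by blast
  qed
 qed
qed

lemma flux_integrable:
 assumes ab: "0 < a" "a < b" "b < 1" and F: "continuous_on (closure D) F"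
 shows "(%x. F x \<bullet> gradc a b x) absolutely_integrable_on D"
proof -
 have bD: "compact (closure D)" using boundedD by simp
 have "bounded (F ` closure D)" by (intro compact_imp_bounded compact_continuous_image F bD)
 then obtain M where M: "\<forall>x\<in>F ` closure D. norm x <= M" unfolding bounded_iff by blast
 have MD: "norm (F x) <= M" if "x \<in> D" for x using M that closure_subset by blast
 define K where "K = 1 / (r * (b - a))"
 have d: "AE x in lebesgue. cut a b differentiable (at x)" using ab by (intro cut_differentiable_AE) auto
 have Dl: "D \<in> lmeasurable" using openD boundedD by (simp add: lmeasurable_open)
 note pm = partial_measurable[OF continuous_cut d]
 have Fm: "(%x. indicator D x *\<^sub>R F x) \<in> borel_measurable lebesgue"
 proof -
  have "(%x. indicator D x *\<^sub>R F x) \<in> borel_measurable borel"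
   using openD by (intro borel_measurable_continuous_on_indicator continuous_on_subset[OF F closure_subset]) auto
  then show ?thesis by (simp add: measurable_completion)
 qed
 have m: "(%x. (indicator D x *\<^sub>R F x) $ 1 * partial 1 (cut a b) x + (indicator D x *\<^sub>R F x) $ 2 * partial 2 (cut a b) x) \<in> borel_measurable lebesgue"
  by (intro borel_measurable_add borel_measurable_times pm measurable_compose[OF Fm measurable_nth])
 have eq: "(indicator D x *\<^sub>R F x) $ 1 * partial 1 (cut a b) x + (indicator D x *\<^sub>R F x) $ 2 * partial 2 (cut a b) x
  = indicator D x *\<^sub>R (F x \<bullet> gradc a b x)" for x by (simp add: gradc_def inner_vec_def sum_2 algebra_simps)
 show ?thesis unfolding set_integrable_def
 proof (rule BI_integrable_bound[of _ "%x. (M * K + M * K) * indicator D x"])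
  show "integrable lebesgue (%x. (M * K + M * K) * indicator D x)" using Dl by (intro integrable_mult_right integrable_real_indicator) (auto simp: fmeasurable_def)
  show "(%x. indicator D x *\<^sub>R (F x \<bullet> gradc a b x)) \<in> borel_measurable lebesgue" using m unfolding eq .
  show "AE x in lebesgue. norm (indicator D x *\<^sub>R (F x \<bullet> gradc a b x)) <= norm ((M * K + M * K) * indicator D x)" using d
  proof eventually_elim
   case (elim x)
   have K: "\<bar>partial i (cut a b) x\<bar> <= K" for i unfolding K_def by (rule partial_Lipschitz_le[OF cut_Lipschitz[OF ab(2)] elim])
   have "\<bar>F x \<bullet> gradc a b x\<bar> <= M * K + M * K" if "x \<in> D"
   proof -
    have "\<bar>F x $ i * partial i (cut a b) x\<bar> <= M * K" for i unfolding abs_mult using MD[OF that] component_le_norm_cart[of "F x" i] K[of i]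
    by (intro mult_mono) (auto intro: order_trans[OF norm_ge_zero])
    then have "\<bar>F x $ 1 * partial 1 (cut a b) x + F x $ 2 * partial 2 (cut a b) x\<bar> <= M * K + M * K" by (intro order_trans[OF abs_triangle_ineq] add_mono)
    then show ?thesis by (simp add: gradc_def inner_vec_def sum_2)
   qed
   then show ?case by (auto simp: indicator_def)
  qed
 qed
qed

text \<open>The derivative of the gauge has \<open>cross (gm t - z) (g t)\<close> in its
  denominator, and the Jacobian of the polar coordinates contains its absolute value. Their quotient
  is a sign, and what is left is the conormal.\<close>

lemma flux_strip:
 assumes ab: "0 < a" "a < b" "b < 1" and F: "continuous_on (closure D) F" and i: "i \<in> I"
 shows "(%p. p $ 1 * (F (polar i p) \<bullet> conormal i (p $ 2))) integrable_on strip i a b"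
  "((%x. F x \<bullet> gradc a b x) has_integral
   - (1 / (b - a)) * integral (strip i a b) (%p. p $ 1 * (F (polar i p) \<bullet> conormal i (p $ 2)))) (polar i ` strip i a b)"
proof -
 interpret ci: star_curve D z r "gm i" "g i" "T i" "L i" by (rule curve[OF i])
 have G: "(%x. F x \<bullet> gradc a b x) absolutely_integrable_on polar i ` strip i a b" by (rule set_integrable_subset[OF flux_integrable[OF ab F] ci.polar_image_measurable])
   (use ci.polar_image_subset[of a b] ab in auto)
 note C = ci.polar_change_of_variables[OF less_imp_le[OF ab(1)] G]
 have eq: "p $ 1 * (F (polar i p) \<bullet> conormal i (p $ 2))
   = - (b - a) * (p $ 1 * \<bar>cross (gm i (p $ 2) - z) (g i (p $ 2))\<bar> * (F (polar i p) \<bullet> gradc a b (polar i p)))" if p: "p \<in> strip i a b" for p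
 proof -
  let ?c = "cross (gm i (p $ 2) - z) (g i (p $ 2))"
  have P: "p $ 1 > 0" "p $ 2 \<in> T i" "a < p $ 1" "p $ 1 < b" using p ab by (auto simp: ci.strip_def)
  have N: "minkowski (polar i p) = p $ 1" using P ci.T_I(1) by (intro ci.gauge_polar) auto
  have "(cut a b has_derivative (%w. - (cross w (g i (p $ 2)) / ?c) / (b - a))) (at (polar i p))"
   by (rule cut_has_derivative[OF _ _ ci.gauge_polar_derivative[OF P(1,2)]]) (use P N in auto)
  then have e1: "F (polar i p) \<bullet> gradc a b (polar i p) = - (cross (F (polar i p)) (g i (p $ 2)) / ?c) / (b - a)" by (rule inner_gradc)
  \<comment> \<open>The sign in the conormal is exactly the quotient of the Jacobian factor and the
    denominator of the gauge derivative.\<close>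
  have e2: "sgn ?c = \<bar>?c\<bar> / ?c" using ci.cross_ne_0[OF P(2)] by (auto simp: sgn_if)
  have e3: "P * ((C / c) * x) = - d * (P * C * (- (x / c) / d))" if "d ~= 0" for P d C x c :: real using that by simp
  show ?thesis unfolding e1 ci.conormal_def inner_scaleR_right inner_rot e2 by (rule e3) (use ab in simp)
 qed
 have ii: "(%p. - (b - a) * (p $ 1 * \<bar>cross (gm i (p $ 2) - z) (g i (p $ 2))\<bar> * (F (polar i p) \<bullet> gradc a b (polar i p)))) integrable_on strip i a b"
  by (rule integrable_on_mult_right) (rule set_lebesgue_integral_eq_integral(1)[OF C(1)])
 show "(%p. p $ 1 * (F (polar i p) \<bullet> conormal i (p $ 2))) integrable_on strip i a b" by (rule integrable_eq[OF ii]) (rule eq[symmetric])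
 have "integral (strip i a b) (%p. p $ 1 * (F (polar i p) \<bullet> conormal i (p $ 2)))
  = integral (strip i a b) (%p. - (b - a) * (p $ 1 * \<bar>cross (gm i (p $ 2) - z) (g i (p $ 2))\<bar> * (F (polar i p) \<bullet> gradc a b (polar i p))))"
  by (rule Henstock_Kurzweil_Integration.integral_cong) (rule eq)
 also have "... = - (b - a) * integral (polar i ` strip i a b) (%x. F x \<bullet> gradc a b x)" unfolding integral_mult_right C(2) ..
 finally have "- (1 / (b - a)) * integral (strip i a b) (%p. p $ 1 * (F (polar i p) \<bullet> conormal i (p $ 2)))
  = - (1 / (b - a)) * (- (b - a) * integral (polar i ` strip i a b) (%x. F x \<bullet> gradc a b x))" by (rule arg_cong)
 also have "- (1 / (b - a)) * (- (b - a) * integral (polar i ` strip i a b) (%x. F x \<bullet> gradc a b x))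
  = integral (polar i ` strip i a b) (%x. F x \<bullet> gradc a b x)"
 proof -
  have "- (1 / d) * (- d * X) = X" if "d ~= 0" for d X :: real using that by simp
  from this[of "b - a"] show ?thesis using ab by simp
 qed
 finally have "- (1 / (b - a)) * integral (strip i a b) (%p. p $ 1 * (F (polar i p) \<bullet> conormal i (p $ 2)))
  = integral (polar i ` strip i a b) (%x. F x \<bullet> gradc a b x)" .
 then show "((%x. F x \<bullet> gradc a b x) has_integral
   - (1 / (b - a)) * integral (strip i a b) (%p. p $ 1 * (F (polar i p) \<bullet> conormal i (p $ 2)))) (polar i ` strip i a b)"
  using integrable_integral[OF set_lebesgue_integral_eq_integral(1)[OF G]] by simp
qed

text \<open>The strips are disjoint and fill the shell up to a null set; off the closed shell the
  cut-off is locally constant.\<close>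

lemma flux_shell:
 assumes ab: "0 < a" "a < b" "b < 1" and F: "continuous_on (closure D) F"
 shows "integral D (%x. F x \<bullet> gradc a b x)
  = - (\<Sum>i\<in>I. (1 / (b - a)) * integral (strip i a b) (%p. p $ 1 * (F (polar i p) \<bullet> conormal i (p $ 2))))"
proof -
 let ?U = "\<Union>i\<in>I. polar i ` strip i a b"
 have U: "?U \<subseteq> D" using star_curve.polar_image_subset[OF curve, of _ a b] ab by force
 have "((%x. F x \<bullet> gradc a b x) has_integral
  (\<Sum>i\<in>I. - (1 / (b - a)) * integral (strip i a b) (%p. p $ 1 * (F (polar i p) \<bullet> conormal i (p $ 2))))) ?U"
  by (rule has_integral_UN[OF finI flux_strip(2)[OF ab F]]) (use shell_disjoint ab in \<open>auto simp: pairwise_def\<close>)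
 then have "integral ?U (%x. F x \<bullet> gradc a b x)
  = - (\<Sum>i\<in>I. (1 / (b - a)) * integral (strip i a b) (%p. p $ 1 * (F (polar i p) \<bullet> conormal i (p $ 2))))" by (simp add: integral_unique sum_negf)
 moreover have "integral D (%x. F x \<bullet> gradc a b x) = integral ?U (%x. F x \<bullet> gradc a b x)"
 proof (rule integral_spike_set)
  have "negligible ({x. minkowski x = a} \<union> {x. minkowski x = b} \<union> ({x. a < minkowski x & minkowski x < b} - ?U))"
   using ab by (intro negligible_Un level_negligible shell_cover) auto
  then show "negligible {x \<in> D - ?U. F x \<bullet> gradc a b x ~= 0}"
  proof (rule negligible_subset, intro subsetI)
   fix x assume x: "x \<in> {x \<in> D - ?U. F x \<bullet> gradc a b x ~= 0}"
   have "\<not> (minkowski x < a \<or> b < minkowski x)" using inner_gradc[OF cut_has_derivative_0[OF ab(2)], of x "F x"] x by auto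
   then show "x \<in> {x. minkowski x = a} \<union> {x. minkowski x = b} \<union> ({x. a < minkowski x & minkowski x < b} - ?U)" using x by auto
  qed
  show "negligible {x \<in> ?U - D. F x \<bullet> gradc a b x ~= 0}" using U by (intro negligible_subset[OF negligible_empty]) auto
 qed
 ultimately show ?thesis by simp
qed

lemma flux_limit:
 assumes F: "continuous_on (closure D) F" and e: "e > 0"
 shows "\<exists>d>0. \<forall>et. 0 < et & et < d --> \<bar>integral D (%x. F x \<bullet> gradc (1 - 2 * et) (1 - et) x)
  + (\<Sum>i\<in>I. LINT t|lborel. indicator (T i) t * (F (gm i t) \<bullet> conormal i t))\<bar> <= e"
proof -
 let ?A = "%i et. (1 / et) * integral (strip i (1 - 2 * et) (1 - et)) (%p. p $ 1 * (F (polar i p) \<bullet> conormal i (p $ 2)))"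
 let ?B = "%i. LINT t|lborel. indicator (T i) t * (F (gm i t) \<bullet> conormal i t)"
 define e' where "e' = e / (real (card I) + 1)"
 have e': "e' > 0" using e by (simp add: e'_def)
 have "\<forall>i\<in>I. \<exists>d. d > 0 & (\<forall>et. 0 < et & et < d --> \<bar>?A i et - ?B i\<bar> <= e')"
 proof
  fix i assume i: "i \<in> I"
  show "\<exists>d. d > 0 & (\<forall>et. 0 < et & et < d --> \<bar>?A i et - ?B i\<bar> <= e')"
   by (rule star_curve.strip_limit[OF curve[OF i] F _ e']) (rule flux_strip(1)[OF _ _ _ F i])
 qed
 from bchoice[OF this] obtain d where d': "\<forall>i\<in>I. d i > 0 & (\<forall>et. 0 < et & et < d i --> \<bar>?A i et - ?B i\<bar> <= e')" by (rule exE)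
 have d: "d i > 0" "0 < et ==> et < d i ==> \<bar>?A i et - ?B i\<bar> <= e'" if "i \<in> I" for i et using bspec[OF d' that] by simp_all
 define d0 where "d0 = Min (insert (1/2) (d ` I))"
 have "finite (insert (1/2) (d ` I))" using finI by simp
 then have d0: "d0 > 0" "d0 <= 1/2" "!!i. i \<in> I ==> d0 <= d i" unfolding d0_def using d(1) by (simp, intro Min_le, simp_all)
 show ?thesis
 proof (intro exI[of _ d0] conjI allI impI d0(1))
  fix et assume et: "0 < et & et < d0"
  have "integral D (%x. F x \<bullet> gradc (1 - 2 * et) (1 - et) x) = - (\<Sum>i\<in>I. ?A i et)" using flux_shell[OF _ _ _ F, of "1 - 2 * et" "1 - et"] et d0(2) by simp
  then have "\<bar>integral D (%x. F x \<bullet> gradc (1 - 2 * et) (1 - et) x) + (\<Sum>i\<in>I. ?B i)\<bar> = \<bar>\<Sum>i\<in>I. ?A i et - ?B i\<bar>"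
   by (simp add: sum_subtractf)
  also have "... <= (\<Sum>i\<in>I. e')"
  proof (intro order_trans[OF sum_abs] sum_mono d(2))
   show "et < d i" if "i \<in> I" for i using et d0(3)[OF that] by linarith
  qed (use et in auto)
  also have "... <= e"
  proof -
   have "(\<Sum>i\<in>I. e') <= (real (card I) + 1) * e'" using e' by (simp add: distrib_right)
   also have "... = e" unfolding e'_def by (simp add: add_nonneg_eq_0_iff)
   finally show ?thesis .
  qed
  finally show "\<bar>integral D (%x. F x \<bullet> gradc (1 - 2 * et) (1 - et) x) + (\<Sum>i\<in>I. ?B i)\<bar> <= e" .
 qed
qed

end

section \<open>Green's formula for Sobolev functions\<close>

subsection \<open>Weak derivatives tested on Lipschitz functions\<close>

lemma partial_mollify:
 assumes "eps > 0" "integrable lborel f"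
 shows "partial m (mollify eps i j f) = mollify eps (i + of_bool (m = 1)) (j + of_bool (m = 2)) f"
 using exhaust_2[of m] by (auto simp: fun_eq_iff partial_eqI[OF mollify_has_derivative[OF assms]] axis_def)

lemma mollify_test_function:
 assumes e: "eps > 0" and f: "integrable lborel f" and S: "compact S" "!!x. x \<notin> S ==> f x = 0"
  and D: "!!x. x \<in> S ==> cball x (2 * eps) \<subseteq> D"
 shows "mollify eps 0 0 f \<in> test_functions D"
proof -
 have ex: "\<exists>i j. foldr partial js (mollify eps 0 0 f) = mollify eps i j f" for js
 proof (induction js)
  case (Cons m js)
  then obtain i j where "foldr partial js (mollify eps 0 0 f) = mollify eps i j f" by blast
  then have "foldr partial (m # js) (mollify eps 0 0 f) = mollify eps (i + of_bool (m = 1)) (j + of_bool (m = 2)) f" using partial_mollify[OF e f] by simp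
  then show ?case by blast
 qed auto
 have "smooth (mollify eps 0 0 f)" unfolding smooth_def
 proof (intro allI)
  fix js x
  obtain i j where "foldr partial js (mollify eps 0 0 f) = mollify eps i j f" using ex by blast
  then show "foldr partial js (mollify eps 0 0 f) differentiable (at x)" by (simp only:) (rule differentiableI[OF mollify_has_derivative[OF e f]])
 qed
 moreover define K where "K = {x + y | x y. x \<in> S & y \<in> cball 0 (2 * eps)}"
 have "compact K" unfolding K_def by (intro compact_sums S compact_cball)
 moreover have "K \<subseteq> D"
 proof
  fix v assume "v \<in> K"
  then obtain x y where "x \<in> S" "y \<in> cball 0 (2 * eps)" "v = x + y" by (auto simp: K_def)
  then show "v \<in> D" using D[of x] by (auto simp: dist_norm subset_iff)
 qed
 moreover have "mollify eps 0 0 f x = 0" if "x \<notin> K" for x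
 proof -
  have "f y * mol eps 0 0 (x - y) = 0" for y
  proof (rule ccontr)
   assume n: "f y * mol eps 0 0 (x - y) ~= 0"
   then have "y \<in> S" "norm (x - y) <= 2 * eps" using S(2)[of y] mol_support_norm[OF e] by auto
   then have "x \<in> K" unfolding K_def by (intro CollectI exI[of _ y] exI[of _ "x - y"]) auto
   then show False using that by simp
  qed
  then have "(%y. f y * mol eps 0 0 (x - y)) = (%y. 0)" by (rule ext)
  then show ?thesis unfolding mollify_def by simp
 qed
 ultimately show ?thesis unfolding test_functions_def by blast
qed

lemma mollify_shift:
 assumes e: "eps > 0" and [measurable]: "f \<in> borel_measurable borel"
 shows "mollify eps i j f (x + h) = (LINT y|lborel. f (y + h) * mol eps i j (x - y))"
proof -
 have [measurable]: "(%y. mol eps i j (x + h - y)) \<in> borel_measurable borel" by (rule mol_shift_measurable[OF e])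
 show ?thesis unfolding mollify_def by (subst lborel_distr_plus[of h, symmetric], subst integral_distr) (measurable, simp add: algebra_simps)
qed

text \<open>Mollified with a small radius, \<open>ph\<close> becomes an admissible smooth test
  function, and both sides of the identity converge as the radius tends to 0. This admits products
  with the cut-off, which is only as regular as the gauge.\<close>

lemma weak_deriv_Lipschitz_test:
 assumes D: "open D" "bounded D" and f: "f \<in> L2_space D" and w: "w \<in> L2_space D"
  and fw: "is_weak_deriv D (of_bool (m = 1)) (of_bool (m = 2)) f w"
  and L: "!!x y. \<bar>ph x - ph y\<bar> <= K * norm (x - y)" and d: "AE x in lebesgue. ph differentiable (at x)"
  and S: "compact S" "S \<subseteq> D" "!!x. x \<notin> S ==> ph x = 0"
 shows "L2_inner D f (partial m ph) = - L2_inner D w ph"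
proof -
 have Dl: "D \<in> lmeasurable" using D by (simp add: lmeasurable_open)
 have Ds: "D \<in> sets lebesgue" using D by simp
 obtain f' where f': "represents D f f'" by (rule L2_space_represents[OF Dl f])
 obtain w' where w': "represents D w w'" by (rule L2_space_represents[OF Dl w])
 have fb[measurable]: "f' \<in> borel_measurable borel" and fi: "integrable lborel f'"
  and fin: "!!g. g \<in> borel_measurable borel ==> L2_inner D f g = (LINT x|lborel. f' x * g x)" using f' by (auto simp: represents_def)
 have wb[measurable]: "w' \<in> borel_measurable borel" and wi: "integrable lborel w'"
  and win: "!!g. g \<in> borel_measurable borel ==> L2_inner D w g = (LINT x|lborel. w' x * g x)" using w' by (auto simp: represents_def)
 define K' where "K' = \<bar>K\<bar>"
 have K': "K' \<ge> 0" "!!x y. \<bar>ph x - ph y\<bar> <= K' * norm (x - y)"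
 proof -
  show "\<bar>ph x - ph y\<bar> <= K' * norm (x - y)" for x y using L[of x y] mult_right_mono[OF abs_ge_self[of K] norm_ge_zero[of "x - y"]] unfolding K'_def by linarith
 qed (simp add: K'_def)
 have cph: "continuous_on UNIV ph" by (rule lipschitz_on_continuous_on[of K']) (use K' in \<open>auto intro!: lipschitz_onI simp: dist_norm\<close>)
 have phb[measurable]: "ph \<in> borel_measurable borel" by (rule borel_measurable_continuous_onI[OF cph])
 have iS: "integrable lborel (indicator S :: real^2 => real)"
 proof (rule integrable_real_indicator)
  show "S \<in> sets lborel" using S(1) by (simp add: compact_imp_closed)
  show "emeasure lborel S < \<infinity>" using S(1) compact_imp_bounded emeasure_bounded_finite by blast
 qed
 have phi: "integrable lborel ph"
 proof -
  have "bounded (ph ` S)" by (intro compact_imp_bounded compact_continuous_image S continuous_on_subset[OF cph]) auto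
  then obtain M where M: "\<forall>v\<in>ph ` S. norm v <= M" unfolding bounded_iff by blast
  show ?thesis
  proof (rule BI_integrable_bound[of _ "%x. M * indicator S x"])
   show "integrable lborel (%x. M * indicator S x)" using iS by (rule integrable_mult_right)
   show "AE x in lborel. norm (ph x) <= norm (M * indicator S x)" using M S(3) by (intro AE_I2) (force simp: indicator_def)
  qed simp
 qed
 note pm = partial_measurable[OF cph d, of m]
 have pb: "AE x in lebesgue. \<bar>partial m ph x\<bar> <= K' & (x \<notin> S --> partial m ph x = 0)" using d
 proof eventually_elim
  case (elim x)
  have "partial m ph x = 0" if "x \<notin> S"
  proof -
   have "(ph has_derivative (%h. 0)) (at x)"
   proof (rule has_derivative_transform_within_open)
    show "((%y. 0) has_derivative (%h. 0)) (at x)" by simp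
    show "open (- S)" using S(1) by (simp add: compact_imp_closed open_Compl)
   qed (use that S(3) in auto)
   from partial_eqI[OF this] show ?thesis .
  qed
  then show ?case using partial_Lipschitz_le[OF K'(2) elim] by blast
 qed
 obtain \<psi>0 where p0: "\<psi>0 \<in> borel_measurable borel" "AE x in lborel. partial m ph x = \<psi>0 x" using completion_ex_borel_measurable_real[OF pm] by auto
 \<comment> \<open>Truncation at the Lipschitz constant alters the Borel representative of the
   derivative on a null set only and makes the bound hold everywhere.\<close>
 define \<psi> where "\<psi> x = max (- K') (min K' (\<psi>0 x))" for x
 have \<psi>b[measurable]: "\<psi> \<in> borel_measurable borel" using p0(1) unfolding \<psi>_def[abs_def] by measurable
 have \<psi>K: "\<bar>\<psi> x\<bar> <= K'" for x using K'(1) by (auto simp: \<psi>_def)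
 have \<psi>ae: "AE x in lebesgue. \<psi> x = partial m ph x" using AE_completion[OF p0(2)] pb by eventually_elim (auto simp: \<psi>_def)
 have \<psi>i: "integrable lborel \<psi>"
 proof (rule BI_integrable_bound[of _ "%x. K' * indicator S x"])
  show "integrable lborel (%x. K' * indicator S x)" using iS by (rule integrable_mult_right)
  have "AE x in lebesgue. norm (\<psi> x) <= norm (K' * indicator S x)" using \<psi>ae pb by eventually_elim (auto simp: indicator_def)
  then show "AE x in lborel. norm (\<psi> x) <= norm (K' * indicator S x)" by (simp add: AE_completion_iff)
 qed simp
 \<comment> \<open>The difference quotients of \<open>ph\<close> converge almost everywhere and are
   bounded by \<open>K'\<close>, so dominated convergence moves the derivative under the
   mollifier.\<close>
 have key: "partial m (mollify eps 0 0 ph) x = mollify eps 0 0 \<psi> x" if e: "eps > 0" for eps x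
 proof (rule LIMSEQ_unique)
  let ?h = "%n. (1 / real (Suc n)) *\<^sub>R (axis m 1 :: real^2)"
  let ?q = "%n y. real (Suc n) * (ph (y + ?h n) - ph y)"
  show "(%n. real (Suc n) * (mollify eps 0 0 ph (x + ?h n) - mollify eps 0 0 ph x)) \<longlonglongrightarrow> partial m (mollify eps 0 0 ph) x"
   using mollify_has_derivative[OF e phi] by (intro partial_quotient) (auto simp: differentiable_def)
  have mi: "integrable lborel (%y. mol eps 0 0 (x - y))"
  proof (rule integrableI_nonneg)
   show "(%y. mol eps 0 0 (x - y)) \<in> borel_measurable lborel" using mol_shift_measurable[OF e] by simp
  qed (use mol_nonneg[OF e] nn_integral_mol_reflect[OF e] in auto)
  have mb[measurable]: "(%y. mol eps 0 0 (x - y)) \<in> borel_measurable borel" by (rule mol_shift_measurable[OF e])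
  have "(%n. LINT y|lborel. ?q n y * mol eps 0 0 (x - y)) \<longlonglongrightarrow> (LINT y|lborel. \<psi> y * mol eps 0 0 (x - y))"
  proof (rule integral_dominated_convergence[where w="%y. K' * mol eps 0 0 (x - y)"])
   have "AE y in lebesgue. (%n. ?q n y * mol eps 0 0 (x - y)) \<longlonglongrightarrow> \<psi> y * mol eps 0 0 (x - y)" using d \<psi>ae
   proof eventually_elim
    case (elim y)
    show ?case unfolding elim(2) by (intro tendsto_mult partial_quotient elim(1) tendsto_const)
   qed
   then show "AE y in lborel. (%n. ?q n y * mol eps 0 0 (x - y)) \<longlonglongrightarrow> \<psi> y * mol eps 0 0 (x - y)" by (simp add: AE_completion_iff)
   show "AE y in lborel. norm (?q n y * mol eps 0 0 (x - y)) <= K' * mol eps 0 0 (x - y)" for n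
   proof (rule AE_I2)
    fix y :: "real^2"
    have "norm (axis m (1::real) :: real^2) = 1" by (rule norm_Basis) simp
    then have "\<bar>ph (y + ?h n) - ph y\<bar> <= K' * (1 / real (Suc n))" using K'(2)[of "y + ?h n" y] by simp
    then have "real (Suc n) * \<bar>ph (y + ?h n) - ph y\<bar> <= real (Suc n) * (K' * (1 / real (Suc n)))" by (rule mult_left_mono) simp
    then have "\<bar>?q n y\<bar> <= K'" by (simp add: abs_mult del: of_nat_Suc)
    then show "norm (?q n y * mol eps 0 0 (x - y)) <= K' * mol eps 0 0 (x - y)" unfolding real_norm_def abs_mult using mol_nonneg[OF e, of "x - y"] K'(1) by (intro mult_mono) auto
   qed
   show "integrable lborel (%y. K' * mol eps 0 0 (x - y))" using mi by (rule integrable_mult_right)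
  qed (auto intro!: borel_measurable_continuous_onI continuous_intros continuous_on_compose2[OF cph])
  moreover have "(LINT y|lborel. ?q n y * mol eps 0 0 (x - y))
   = real (Suc n) * (mollify eps 0 0 ph (x + ?h n) - mollify eps 0 0 ph x)" for n
  proof -
   have shi: "integrable lborel (%y. ph (y + ?h n))"
   proof -
    have "integrable (distr lborel borel ((+) (?h n))) ph" using phi by (simp add: lborel_distr_plus)
    then show ?thesis by (subst (asm) integrable_distr_eq) (auto simp: add.commute)
   qed
   have i1: "integrable lborel (%y. ph (y + ?h n) * mol eps 0 0 (x - y))" by (rule mollify_integrable[OF e shi])
   have i2: "integrable lborel (%y. ph y * mol eps 0 0 (x - y))" by (rule mollify_integrable[OF e phi])
   have "(LINT y|lborel. ?q n y * mol eps 0 0 (x - y))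
    = (LINT y|lborel. real (Suc n) * (ph (y + ?h n) * mol eps 0 0 (x - y) - ph y * mol eps 0 0 (x - y)))" by (simp only: mult.assoc left_diff_distrib)
   also have "... = real (Suc n) * ((LINT y|lborel. ph (y + ?h n) * mol eps 0 0 (x - y)) - (LINT y|lborel. ph y * mol eps 0 0 (x - y)))"
    by (simp only: integral_mult_right_zero BI_integral_diff[OF i1 i2])
   also have "(LINT y|lborel. ph (y + ?h n) * mol eps 0 0 (x - y)) = mollify eps 0 0 ph (x + ?h n)" by (rule mollify_shift[OF e phb, symmetric])
   finally show ?thesis unfolding mollify_def[of eps 0 0 ph x] .
  qed
  ultimately show "(%n. real (Suc n) * (mollify eps 0 0 ph (x + ?h n) - mollify eps 0 0 ph x)) \<longlonglongrightarrow> mollify eps 0 0 \<psi> x" by (simp only: mollify_def)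
 qed
 obtain \<rho> where \<rho>: "\<rho> > 0" "(\<Union>x\<in>S. ball x \<rho>) \<subseteq> D" using compact_subset_open_imp_ball_epsilon_subset[OF S(1) D(1) S(2)] by blast
 \<comment> \<open>Mollification spreads the support by at most \<open>2 * eps n\<close>, which
   stays below the distance margin \<open>\<rho>\<close> inside \<open>D\<close>.\<close>
 define eps where "eps n = \<rho> / 3 / real (Suc n)" for n
 have e: "eps n > 0" "2 * eps n < \<rho>" for n
 proof -
  show "eps n > 0" using \<rho> by (simp add: eps_def)
  have "eps n <= \<rho> / 3" unfolding eps_def using \<rho>(1) by (simp add: divide_le_eq field_simps)
  then show "2 * eps n < \<rho>" using \<rho>(1) by linarith
 qed
 have e0: "eps \<longlonglongrightarrow> 0" unfolding eps_def[abs_def] using tendsto_mult_right_zero[OF LIMSEQ_inverse_real_of_nat, of "\<rho>/3"] by (simp add: field_simps)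
 have mb[measurable]: "mollify (eps n) 0 0 g \<in> borel_measurable borel" if "integrable lborel g" for n g
  by (rule borel_measurable_continuous_onI[OF continuous_mollify[OF e(1) that]])
 have eq: "(LINT x|lborel. f' x * mollify (eps n) 0 0 \<psi> x) = - (LINT x|lborel. w' x * mollify (eps n) 0 0 ph x)" for n
 proof -
  have "mollify (eps n) 0 0 ph \<in> test_functions D"
  proof (rule mollify_test_function[OF e(1) phi S(1) S(3)])
   show "cball x (2 * eps n) \<subseteq> D" if "x \<in> S" for x using \<rho>(2) that e(2)[of n] by (force simp: subset_iff)
  qed
  then have "L2_inner D f ((partial 1 ^^ of_bool (m = 1)) ((partial 2 ^^ of_bool (m = 2)) (mollify (eps n) 0 0 ph)))
   = (-1) ^ (of_bool (m = 1) + of_bool (m = 2)) * L2_inner D w (mollify (eps n) 0 0 ph)" using fw unfolding is_weak_deriv_def by blast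
  moreover have "(partial 1 ^^ of_bool (m = 1)) ((partial 2 ^^ of_bool (m = 2)) (mollify (eps n) 0 0 ph)) = partial m (mollify (eps n) 0 0 ph)"
   "(-1) ^ (of_bool (m = 1) + of_bool (m = 2)) = (-1::real)" using exhaust_2[of m] by auto
  moreover have "partial m (mollify (eps n) 0 0 ph) = mollify (eps n) 0 0 \<psi>" using key[OF e(1)] by (rule ext)
  ultimately show ?thesis by (simp add: fin win mb[OF phi] mb[OF \<psi>i])
 qed
 have "(%n. LINT x|lborel. f' x * mollify (eps n) 0 0 \<psi> x) \<longlonglongrightarrow> (LINT x|lborel. f' x * \<psi> x)"
 proof (rule integral_dominated_convergence[where w="%x. \<bar>f' x\<bar> * K'"])
  have "AE x in lebesgue. (%n. f' x * mollify (eps n) 0 0 \<psi> x) \<longlonglongrightarrow> f' x * \<psi> x" using mollify_tendsto_AE[OF \<psi>b \<psi>i]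
  proof eventually_elim
   case (elim x)
   have "(%n. mollify (eps n) 0 0 \<psi> x) \<longlonglongrightarrow> \<psi> x"
   proof (rule LIMSEQ_I)
    fix r :: real assume "r > 0"
    then obtain d where dd: "d > 0" "!!eps. 0 < eps ==> eps < d ==> \<bar>mollify eps 0 0 \<psi> x - \<psi> x\<bar> <= r / 2" using elim by (meson half_gt_zero)
    obtain N where "!!n. n \<ge> N ==> norm (eps n - 0) < d" using LIMSEQ_D[OF e0 dd(1)] by blast
    then have "norm (mollify (eps n) 0 0 \<psi> x - \<psi> x) < r" if "n \<ge> N" for n using dd(2)[OF e(1), of n] that \<open>r > 0\<close> e(1)[of n] by force
    then show "\<exists>N. \<forall>n\<ge>N. norm (mollify (eps n) 0 0 \<psi> x - \<psi> x) < r" by blast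
   qed
   then show ?case by (intro tendsto_mult tendsto_const)
  qed
  then show "AE x in lborel. (%n. f' x * mollify (eps n) 0 0 \<psi> x) \<longlonglongrightarrow> f' x * \<psi> x" by (simp add: AE_completion_iff)
  show "AE x in lborel. norm (f' x * mollify (eps n) 0 0 \<psi> x) <= \<bar>f' x\<bar> * K'" for n
  proof (rule AE_I2)
   fix x
   have "\<bar>mollify (eps n) 0 0 \<psi> x - 0\<bar> <= K'" by (rule mollify_uniform[OF e(1) \<psi>i subset_UNIV, where g=\<psi>]) (use \<psi>K in auto)
   then show "norm (f' x * mollify (eps n) 0 0 \<psi> x) <= \<bar>f' x\<bar> * K'" by (simp add: abs_mult mult_left_mono)
  qed
  show "integrable lborel (%x. \<bar>f' x\<bar> * K')" using fi by simp
 qed (use mb[OF \<psi>i] in measurable)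
 moreover have "(%n. LINT x|lborel. w' x * mollify (eps n) 0 0 ph x) \<longlonglongrightarrow> (LINT x|lborel. w' x * ph x)"
 \<comment> \<open>Mollification changes \<open>ph\<close> by at most
   \<open>K' * (2 * eps n)\<close>, uniformly in \<open>x\<close>, and \<open>eps 0\<close> is the
   largest of the radii.\<close>
 proof (rule integral_dominated_convergence[where w="%x. \<bar>w' x\<bar> * (K' * (2 * eps 0)) + \<bar>w' x * ph x\<bar>"])
  have b: "\<bar>mollify (eps n) 0 0 ph x - ph x\<bar> <= K' * (2 * eps n)" for n x
  proof (rule mollify_uniform[OF e(1) phi subset_UNIV, where g=ph])
   fix y assume "y \<in> cball x (2 * eps n)"
   then have "K' * norm (y - x) <= K' * (2 * eps n)" using K'(1) by (intro mult_left_mono) (auto simp: dist_norm norm_minus_commute)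
   then show "\<bar>ph y - ph x\<bar> <= K' * (2 * eps n)" using K'(2)[of y x] by linarith
  qed auto
  have lim: "(%n. K' * (2 * eps n)) \<longlonglongrightarrow> K' * (2 * 0)" by (intro tendsto_intros e0)
  show "AE x in lborel. (%n. w' x * mollify (eps n) 0 0 ph x) \<longlonglongrightarrow> w' x * ph x"
  proof (intro AE_I2 tendsto_mult tendsto_const)
   fix x
   have "(%n. mollify (eps n) 0 0 ph x - ph x) \<longlonglongrightarrow> 0" by (rule Lim_null_comparison[OF _ lim[simplified]]) (use b in auto)
   then show "(%n. mollify (eps n) 0 0 ph x) \<longlonglongrightarrow> ph x" by (simp add: LIM_zero_iff)
  qed
  show "AE x in lborel. norm (w' x * mollify (eps n) 0 0 ph x) <= \<bar>w' x\<bar> * (K' * (2 * eps 0)) + \<bar>w' x * ph x\<bar>" for n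
  proof (rule AE_I2)
   fix x
   have "eps n <= eps 0" using \<rho>(1) by (simp add: eps_def divide_le_eq field_simps)
   then have "K' * (2 * eps n) <= K' * (2 * eps 0)" using K'(1) by (intro mult_left_mono) auto
   then have "\<bar>mollify (eps n) 0 0 ph x\<bar> <= K' * (2 * eps 0) + \<bar>ph x\<bar>" using b[of n x] by linarith
   then have "\<bar>w' x\<bar> * \<bar>mollify (eps n) 0 0 ph x\<bar> <= \<bar>w' x\<bar> * (K' * (2 * eps 0) + \<bar>ph x\<bar>)" by (rule mult_left_mono) simp
   then show "norm (w' x * mollify (eps n) 0 0 ph x) <= \<bar>w' x\<bar> * (K' * (2 * eps 0)) + \<bar>w' x * ph x\<bar>" unfolding real_norm_def abs_mult distrib_left .
  qed
  have "integrable lborel (%x. w' x * ph x)"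
  proof -
   have "bounded (ph ` S)" by (intro compact_imp_bounded compact_continuous_image S continuous_on_subset[OF cph]) auto
   then obtain M where M: "\<forall>v\<in>ph ` S. norm v <= M" unfolding bounded_iff by blast
   show ?thesis
   proof (rule BI_integrable_bound[of _ "%x. \<bar>M\<bar> * w' x"])
    show "AE x in lborel. norm (w' x * ph x) <= norm (\<bar>M\<bar> * w' x)"
    proof (rule AE_I2)
    fix x
    have "\<bar>ph x\<bar> <= \<bar>M\<bar>" using M S(3)[of x] by (cases "x \<in> S") force+
    then show "norm (w' x * ph x) <= norm (\<bar>M\<bar> * w' x)" by (simp add: abs_mult mult.commute[of "\<bar>w' x\<bar>"] mult_right_mono)
    qed
   qed (use wi in auto)
  qed
  then show "integrable lborel (%x. \<bar>w' x\<bar> * (K' * (2 * eps 0)) + \<bar>w' x * ph x\<bar>)" using wi by (intro BI_integrable_add integrable_abs integrable_mult_left)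
 qed (use mb[OF phi] in measurable)
 then have "(%n. - (LINT x|lborel. w' x * mollify (eps n) 0 0 ph x)) \<longlonglongrightarrow> - (LINT x|lborel. w' x * ph x)" by (rule tendsto_minus)
 ultimately have "(LINT x|lborel. f' x * \<psi> x) = - (LINT x|lborel. w' x * ph x)" unfolding eq by (rule LIMSEQ_unique)
 then have "L2_inner D f \<psi> = - L2_inner D w ph" by (simp add: fin win)
 moreover have "L2_inner D f \<psi> = L2_inner D f (partial m ph)" unfolding L2_inner_def
 proof (rule BI_integral_cong_AE)
  have fm: "f \<in> borel_measurable (lebesgue_on D)" using f by (simp add: L2_space_def)
  have "\<psi> \<in> borel_measurable lebesgue" by (simp add: measurable_completion)
  then have \<psi>D: "\<psi> \<in> borel_measurable (lebesgue_on D)" by (rule measurable_restrict_space1)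
  have pD: "partial m ph \<in> borel_measurable (lebesgue_on D)" using pm by (rule measurable_restrict_space1)
  show "(%x. f x \<bullet> \<psi> x) \<in> borel_measurable (lebesgue_on D)" unfolding inner_real_def by (intro borel_measurable_times fm \<psi>D)
  show "(%x. f x \<bullet> partial m ph x) \<in> borel_measurable (lebesgue_on D)" unfolding inner_real_def by (intro borel_measurable_times fm pD)
  show "AE x in lebesgue_on D. f x \<bullet> \<psi> x = f x \<bullet> partial m ph x" using \<psi>ae Ds by (simp add: AE_restrict_space_iff) (auto elim: eventually_mono)
 qed
 ultimately show ?thesis by simp
qed

subsection \<open>Green's formula\<close>

lemma poly2_partial: "p \<in> poly2 k ==> partial m p \<in> poly2 k"
proof -
 assume p: "p \<in> poly2 k"
 obtain p1 p2 where d: "p1 \<in> poly2 k" "p2 \<in> poly2 k" "!!x. (p has_derivative (%h. p1 x * h $ 1 + p2 x * h $ 2)) (at x)"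
  by (rule poly2_has_derivative[OF p], rule that; assumption)
 have "partial m p = (if m = 1 then p1 else p2)" using exhaust_2[of m] by (auto simp: fun_eq_iff partial_eqI[OF d(3)] axis_def)
 then show ?thesis using d by simp
qed

lemma poly2_differentiable: "p \<in> poly2 k ==> p differentiable (at x)" by (rule poly2_has_derivative[of p k]) (auto simp: differentiable_def)

lemma continuous_vpoly2: "q \<in> vpoly2 k ==> continuous_on S q"
proof -
 assume "q \<in> vpoly2 k"
 then have "continuous_on S (%x. q x $ i)" for i using continuous_poly2 by (auto simp: vpoly2_def)
 then have "continuous_on S (%x. \<chi> i. q x $ i)" by (rule continuous_on_vec_lambda)
 then show ?thesis by (simp add: vec_lambda_eta)
qed

lemma poly2_Lipschitz_on_cball:
 assumes p: "p \<in> poly2 k"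
 shows "\<exists>A\<ge>0. \<forall>x\<in>cball z R. \<bar>p x\<bar> <= A & (\<forall>y\<in>cball z R. \<bar>p x - p y\<bar> <= A * norm (x - y))"
proof -
 obtain p1 p2 where d: "p1 \<in> poly2 k" "p2 \<in> poly2 k" "!!x. (p has_derivative (%h. p1 x * h $ 1 + p2 x * h $ 2)) (at x)"
  by (rule poly2_has_derivative[OF p], rule that; assumption)
 have bd: "\<exists>M. \<forall>x\<in>cball z R. \<bar>u x\<bar> <= M" if "u \<in> poly2 k" for u
 proof -
  have "bounded (u ` cball z R)" by (intro compact_imp_bounded compact_continuous_image continuous_poly2[OF that] compact_cball)
  then obtain M where "\<forall>v\<in>u ` cball z R. norm v <= M" unfolding bounded_iff by blast
  then show ?thesis by (intro exI[of _ M]) auto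
 qed
 obtain M0 M1 M2 where M: "\<forall>x\<in>cball z R. \<bar>p x\<bar> <= M0" "\<forall>x\<in>cball z R. \<bar>p1 x\<bar> <= M1" "\<forall>x\<in>cball z R. \<bar>p2 x\<bar> <= M2"
  using bd[OF p] bd[OF d(1)] bd[OF d(2)] by auto
 define A where "A = \<bar>M0\<bar> + \<bar>M1\<bar> + \<bar>M2\<bar>"
 have on: "onorm (%h::real^2. p1 x * h $ 1 + p2 x * h $ 2) <= A" if x: "x \<in> cball z R" for x
 proof (rule onorm_bound)
  fix h :: "real^2"
  have "\<bar>p1 x * h $ 1 + p2 x * h $ 2\<bar> <= \<bar>p1 x\<bar> * \<bar>h $ 1\<bar> + \<bar>p2 x\<bar> * \<bar>h $ 2\<bar>" by (metis abs_triangle_ineq abs_mult)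
  also have "... <= \<bar>M1\<bar> * norm h + \<bar>M2\<bar> * norm h" using bspec[OF M(2) x] bspec[OF M(3) x] component_le_norm_cart[of h 1] component_le_norm_cart[of h 2]
   by (intro add_mono mult_mono) auto
  also have "... <= A * norm h" by (simp add: A_def distrib_right)
  finally show "norm (p1 x * h $ 1 + p2 x * h $ 2) <= A * norm h" by simp
 qed (simp add: A_def)
 have "\<bar>p x - p y\<bar> <= A * norm (x - y)" if "x \<in> cball z R" "y \<in> cball z R" for x y
  using differentiable_bound[OF convex_cball has_derivative_at_withinI[OF d(3)] on that] by simp
 moreover have "\<bar>p x\<bar> <= A" if "x \<in> cball z R" for x using bspec[OF M(1) that] by (simp add: A_def)
 ultimately show ?thesis by (intro exI[of _ A]) (auto simp: A_def)
qed

lemma poly2_measurable: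
 assumes "p \<in> poly2 k"
 shows "p \<in> borel_measurable (lebesgue_on S)"
proof -
 have "p \<in> borel_measurable borel" by (rule borel_measurable_continuous_onI[OF continuous_poly2[OF assms]])
 then show ?thesis by (simp add: measurable_completion measurable_restrict_space1)
qed

lemma L2_space_integrable:
 assumes D: "D \<in> lmeasurable" and w: "w \<in> L2_space D"
 shows "integrable (lebesgue_on D) w"
proof (rule BI_integrable_bound)
 have "finite_measure (lebesgue_on D)" using D by (rule finite_measure_lebesgue_on)
 then show "integrable (lebesgue_on D) (%x. 1 + (w x)^2)" using w by (intro BI_integrable_add finite_measure.integrable_const) (auto simp: L2_space_def)
 show "w \<in> borel_measurable (lebesgue_on D)" using w by (simp add: L2_space_def)
 show "AE x in lebesgue_on D. norm (w x) <= norm (1 + (w x)^2)"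
 proof (rule AE_I2)
  fix x
  have "\<bar>w x\<bar> <= 1 + \<bar>w x\<bar>^2" using zero_le_power2[of "\<bar>w x\<bar> - 1"] by (simp only: power2_diff) (simp add: power2_eq_square)
  then show "norm (w x) <= norm (1 + (w x)^2)" by simp
 qed
qed

context star_domain
begin

lemma outside_gauge: "x \<notin> D ==> 1 <= minkowski x" using gauge_less_1_iff[of x] by linarith

lemma bounded_cball: "\<exists>R. D \<subseteq> cball z R" using bounded_subset_ballD[OF boundedD, of z] ball_subset_cball by blast

text \<open>The polynomial is Lipschitz on bounded sets only, but the cut-off vanishes outside
  \<open>D\<close>: if just one of the points lies outside, only the increment of the cut-off
  counts.\<close>

lemma cut_poly_Lipschitz:
 assumes ab: "a < b" "b < 1" and p: "p \<in> poly2 k"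
 shows "\<exists>K. \<forall>x y. \<bar>p x * cut a b x - p y * cut a b y\<bar> <= K * norm (x - y)"
proof -
 obtain R where R: "D \<subseteq> cball z R" using bounded_cball by blast
 obtain A where A: "A \<ge> 0" "\<forall>x\<in>cball z R. \<bar>p x\<bar> <= A & (\<forall>y\<in>cball z R. \<bar>p x - p y\<bar> <= A * norm (x - y))"
  using poly2_Lipschitz_on_cball[OF p] by blast
 define C where "C = 1 / (r * (b - a))"
 have C: "C \<ge> 0" using r0 ab by (simp add: C_def)
 have out: "cut a b x = 0" if "x \<notin> D" for x using outside_gauge[OF that] ab by (intro cut_outer) auto
 have pA: "\<bar>p x\<bar> <= A" if "x \<in> D" for x using A(2) R that by blast
 have half: "\<bar>p x * (cut a b x - cut a b y)\<bar> <= A * (C * norm (x - y))" if "x \<in> D" for x y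
  unfolding abs_mult using pA[OF that] cut_Lipschitz[OF ab(1), of x y] A(1) by (intro mult_mono) (auto simp: C_def)
 have "\<bar>p x * cut a b x - p y * cut a b y\<bar> <= (A + A * C) * norm (x - y)" for x y
 proof -
  have nn: "0 <= A * norm (x - y)" "0 <= A * (C * norm (x - y))" using A C by auto
  consider "x \<in> D" "y \<in> D" | "x \<in> D" "y \<notin> D" | "x \<notin> D" "y \<in> D" | "x \<notin> D" "y \<notin> D" by blast
  then have "\<bar>p x * cut a b x - p y * cut a b y\<bar> <= A * norm (x - y) + A * (C * norm (x - y))"
  proof cases
   case 1
   have "p x * cut a b x - p y * cut a b y = p x * (cut a b x - cut a b y) + (p x - p y) * cut a b y" by (simp add: algebra_simps)
   moreover have "\<bar>(p x - p y) * cut a b y\<bar> <= A * norm (x - y) * 1" unfolding abs_mult using A R 1 cut_range[of a b y] by (intro mult_mono) auto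
   ultimately show ?thesis using half[OF 1(1), of y] by linarith
  next
   case 2 then show ?thesis using half[OF 2(1), of y] nn out[OF 2(2)] by simp
  next
   case 3 then show ?thesis using half[OF 3(2), of x] nn out[OF 3(1)] by (simp add: norm_minus_commute abs_minus_commute)
  next
   case 4 then show ?thesis using nn by (simp add: out)
  qed
  then show ?thesis by (simp add: algebra_simps)
 qed
 then show ?thesis by blast
qed

lemma lmeasurable_D: "D \<in> lmeasurable" "D \<in> sets lebesgue" using openD boundedD by (simp_all add: lmeasurable_open)

lemma L2_poly_integrable:
 assumes u: "u \<in> L2_space D" and p: "p \<in> poly2 k"
 shows "integrable (lebesgue_on D) (%x. u x * p x)"
proof -
 obtain R where "D \<subseteq> cball z R" using bounded_cball by blast
 then obtain A where A: "\<forall>x\<in>D. \<bar>p x\<bar> <= A" using poly2_Lipschitz_on_cball[OF p, of z R] by blast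
 have ui: "integrable (lebesgue_on D) u" by (rule L2_space_integrable[OF lmeasurable_D(1) u])
 note pm = poly2_measurable[OF p]
 show ?thesis
 proof (rule BI_integrable_bound[of _ "%x. A * u x"])
  show "integrable (lebesgue_on D) (%x. A * u x)" using ui by simp
  show "(%x. u x * p x) \<in> borel_measurable (lebesgue_on D)" using ui pm by auto
  show "AE x in lebesgue_on D. norm (u x * p x) <= norm (A * u x)"
  proof (rule AE_I2)
   fix x assume "x \<in> space (lebesgue_on D)"
   then have "\<bar>p x\<bar> <= \<bar>A\<bar>" using A by force
   then have "\<bar>u x\<bar> * \<bar>p x\<bar> <= \<bar>u x\<bar> * \<bar>A\<bar>" by (intro mult_left_mono) auto
   then show "norm (u x * p x) <= norm (A * u x)" by (simp add: abs_mult mult.commute)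
  qed
 qed
qed

lemma cut_measurable: "cut a b \<in> borel_measurable (lebesgue_on S)"
proof -
 have "cut a b \<in> borel_measurable borel" by (rule borel_measurable_continuous_onI[OF continuous_cut])
 then show ?thesis by (simp add: measurable_completion measurable_restrict_space1)
qed

text \<open>Each point of \<open>D\<close> has gauge below 1, so the cut-off equals 1 there from
  some index on. The shift by 3 keeps the inner level \<open>1 - 2 / real (n + 3)\<close>
  positive.\<close>

lemma cut_integral_tendsto:
 assumes u: "integrable (lebesgue_on D) u"
 shows "(%n. LINT x|lebesgue_on D. u x * cut (1 - 2 / real (n + 3)) (1 - 1 / real (n + 3)) x) \<longlonglongrightarrow> (LINT x|lebesgue_on D. u x)"
proof (rule integral_dominated_convergence[where w="%x. \<bar>u x\<bar>"])
 show "AE x in lebesgue_on D. (%n. u x * cut (1 - 2 / real (n + 3)) (1 - 1 / real (n + 3)) x) \<longlonglongrightarrow> u x"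
 proof (rule AE_I2)
  fix x assume "x \<in> space (lebesgue_on D)"
  then have N: "minkowski x < 1" using gauge_less_1_iff by simp
  obtain n0 where n0: "2 / (1 - minkowski x) < real n0" using reals_Archimedean2 by blast
  have "u x * cut (1 - 2 / real (n + 3)) (1 - 1 / real (n + 3)) x = u x" if "n \<ge> n0" for n
  proof -
   have "2 / (1 - minkowski x) < real (n + 3)" using n0 that by simp
   then have "2 / real (n + 3) < 1 - minkowski x" using N by (simp add: field_simps)
   moreover have "1 - 2 / real (n + 3) < 1 - 1 / real (n + 3)" by (simp add: divide_strict_right_mono)
   ultimately have "cut (1 - 2 / real (n + 3)) (1 - 1 / real (n + 3)) x = 1" by (intro cut_inner) auto
   then show ?thesis by simp
  qed
  then show "(%n. u x * cut (1 - 2 / real (n + 3)) (1 - 1 / real (n + 3)) x) \<longlonglongrightarrow> u x" by (intro tendsto_eventually) (auto simp: eventually_sequentially)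
 qed
 show "AE x in lebesgue_on D. norm (u x * cut (1 - 2 / real (n + 3)) (1 - 1 / real (n + 3)) x) <= \<bar>u x\<bar>" for n
  using cut_range by (intro AE_I2) (simp add: abs_mult mult_left_le)
 show "integrable (lebesgue_on D) (%x. \<bar>u x\<bar>)" using u by (rule integrable_abs)
 show um: "u \<in> borel_measurable (lebesgue_on D)" using u by auto
 show "(%x. u x * cut (1 - 2 / real (n + 3)) (1 - 1 / real (n + 3)) x) \<in> borel_measurable (lebesgue_on D)" for n by (intro borel_measurable_times um cut_measurable)
qed

end

context star_boundary
begin

text \<open>The weak derivatives are tested on the components of \<open>q\<close> times the cut-off;
  the product rule separates the divergence term from the shell term.\<close>

lemma green_cut:
 assumes ab: "0 < a" "a < b" "b < 1" and xi: "xi \<in> L2_space D" and w: "!!m. w m \<in> L2_space D"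
  and wd: "!!m. is_weak_deriv D (of_bool (m = 1)) (of_bool (m = 2)) xi (w m)"
  and G: "continuous_on (closure D) G" "AE x in lebesgue_on D. G x = xi x" and q: "q \<in> vpoly2 k"
 shows "(LINT x|lebesgue_on D. G x * divergence q x * cut a b x) + integral D (%x. (G x *\<^sub>R q x) \<bullet> gradc a b x)
  = - (\<Sum>m\<in>UNIV. LINT x|lebesgue_on D. w m x * q x $ m * cut a b x)"
proof -
 let ?M = "lebesgue_on D"
 have fin: "finite_measure ?M" using lmeasurable_D(1) by (rule finite_measure_lebesgue_on)
 let ?F = "%x. G x *\<^sub>R q x"
 have d: "AE x in lebesgue. cut a b differentiable (at x)" using ab by (intro cut_differentiable_AE) auto
 have xim: "xi \<in> borel_measurable ?M" using xi by (simp add: L2_space_def)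
 have Gm: "G \<in> borel_measurable ?M" by (rule borel_measurable_lebesgue_on_AE[OF lmeasurable_D(2) xim]) (use G(2) in \<open>auto elim: eventually_mono\<close>)
 note cm = poly2_measurable[where k=k]
 have bd: "\<exists>B. \<forall>x\<in>D. \<bar>u x\<bar> <= B" if "continuous_on (closure D) u" for u :: "real^2 => real"
 proof -
  have "bounded (u ` closure D)" using boundedD by (intro compact_imp_bounded compact_continuous_image that) simp
  then obtain B where "\<forall>v\<in>u ` closure D. norm v <= B" unfolding bounded_iff by blast
  then show ?thesis using closure_subset by (intro exI[of _ B]) auto
 qed
 obtain B where B: "\<forall>x\<in>D. \<bar>G x\<bar> <= B" using bd[OF G(1)] by blast
 have qm: "(%x. q x $ m) \<in> poly2 k" for m using q by (rule vpoly2_nth)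
 have i1: "integrable ?M (%x. G x * (partial m (%y. q y $ m) x * cut a b x))" for m
 proof -
  obtain B' where B': "\<forall>x\<in>D. \<bar>partial m (%y. q y $ m) x\<bar> <= B'" using bd[OF continuous_poly2[OF poly2_partial[OF qm]]] by blast
  show ?thesis
  proof (rule finite_measure.integrable_const_bound[OF fin, where B="B * (B' * 1)"])
   show "AE x in ?M. norm (G x * (partial m (%y. q y $ m) x * cut a b x)) <= B * (B' * 1)"
   proof (rule AE_I2)
    fix x assume "x \<in> space ?M"
    then have x: "x \<in> D" by simp
    show "norm (G x * (partial m (%y. q y $ m) x * cut a b x)) <= B * (B' * 1)"
    unfolding real_norm_def abs_mult using bspec[OF B x] bspec[OF B' x] cut_range[of a b x] by (intro mult_mono) auto
   qed
   show "(%x. G x * (partial m (%y. q y $ m) x * cut a b x)) \<in> borel_measurable ?M" by (intro borel_measurable_times Gm cm poly2_partial qm cut_measurable)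
  qed
 qed
 have pcm: "partial m (cut a b) \<in> borel_measurable ?M" for m by (rule measurable_restrict_space1[OF partial_measurable[OF continuous_cut d]])
 have dD: "AE x in ?M. x \<in> D & cut a b differentiable (at x)" using d lmeasurable_D(2) by (simp add: AE_restrict_space_iff) (auto elim: eventually_mono)
 have i2: "integrable ?M (%x. G x * (q x $ m * partial m (cut a b) x))" for m
 proof -
  obtain B' where B': "\<forall>x\<in>D. \<bar>q x $ m\<bar> <= B'" using bd[OF continuous_poly2[OF qm]] by blast
  show ?thesis
  proof (rule finite_measure.integrable_const_bound[OF fin, where B="B * (B' * (1 / (r * (b - a))))"])
   show "AE x in ?M. norm (G x * (q x $ m * partial m (cut a b) x)) <= B * (B' * (1 / (r * (b - a))))" using dD
   proof eventually_elim
    case (elim x)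
    have "\<bar>partial m (cut a b) x\<bar> <= 1 / (r * (b - a))" using elim by (intro partial_Lipschitz_le[OF cut_Lipschitz[OF ab(2)]]) auto
    then show ?case unfolding real_norm_def abs_mult using bspec[OF B, of x] bspec[OF B', of x] elim by (intro mult_mono) auto
   qed
   show "(%x. G x * (q x $ m * partial m (cut a b) x)) \<in> borel_measurable ?M" by (intro borel_measurable_times Gm cm qm pcm)
  qed
 qed
 have main: "(LINT x|?M. G x * (partial m (%y. q y $ m) x * cut a b x)) + (LINT x|?M. G x * (q x $ m * partial m (cut a b) x))
  = - (LINT x|?M. w m x * q x $ m * cut a b x)" for m
 proof -
  let ?ph = "%x. q x $ m * cut a b x"
  obtain K where K: "\<forall>x y. \<bar>?ph x - ?ph y\<bar> <= K * norm (x - y)" using cut_poly_Lipschitz[OF ab(2,3) qm] by blast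
  have prod: "(?ph has_derivative (%h. q x $ m * frechet_derivative (cut a b) (at x) h
    + frechet_derivative (%y. q y $ m) (at x) h * cut a b x)) (at x)" if "cut a b differentiable (at x)" for x
   using that poly2_differentiable[OF qm] by (intro has_derivative_mult) (simp_all add: frechet_derivative_works[symmetric])
  \<comment> \<open>As \<open>b < 1\<close>, this is a compact subset of \<open>D\<close>, and the
    test function vanishes off it.\<close>
  let ?S = "{x. minkowski x <= b}"
  have dAE: "AE x in lebesgue. ?ph differentiable (at x)" using d
  proof eventually_elim
   case (elim x)
   show ?case unfolding differentiable_def by (rule exI) (rule prod[OF elim])
  qed
  have SD: "?S \<subseteq> D"
  proof
   fix x assume "x \<in> ?S"
   then have "minkowski x < 1" using ab by simp
   then show "x \<in> D" by (simp only: gauge_less_1_iff)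
  qed
  have cS: "compact ?S" unfolding compact_eq_bounded_closed by (intro conjI bounded_subset[OF boundedD SD] closed_Collect_le continuous_gauge continuous_on_const)
  have S0: "?ph x = 0" if "x \<notin> ?S" for x using that cut_outer[OF ab(2), of x] by simp
  have KL: "\<bar>?ph x - ?ph y\<bar> <= K * norm (x - y)" for x y using K by simp
  have "L2_inner D xi (partial m ?ph) = - L2_inner D (w m) ?ph" by (rule weak_deriv_Lipschitz_test[OF openD boundedD xi w wd KL dAE cS SD S0])
  moreover have "L2_inner D xi (partial m ?ph)
   = (LINT x|?M. G x * (partial m (%y. q y $ m) x * cut a b x) + G x * (q x $ m * partial m (cut a b) x))" unfolding L2_inner_def
  proof (rule BI_integral_cong_AE)
   have ae: "AE x in ?M. G x * (partial m (%y. q y $ m) x * cut a b x) + G x * (q x $ m * partial m (cut a b) x) = xi x \<bullet> partial m ?ph x" using dD G(2)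
   proof eventually_elim
    case (elim x)
    have "partial m ?ph x = q x $ m * partial m (cut a b) x + partial m (%y. q y $ m) x * cut a b x" using partial_eqI[OF prod] elim by (simp add: partial_def)
    then show ?case using elim by (simp add: algebra_simps)
   qed
   then show "AE x in ?M. xi x \<bullet> partial m ?ph x = G x * (partial m (%y. q y $ m) x * cut a b x) + G x * (q x $ m * partial m (cut a b) x)" by eventually_elim simp
   show b: "(%x. G x * (partial m (%y. q y $ m) x * cut a b x) + G x * (q x $ m * partial m (cut a b) x)) \<in> borel_measurable ?M"
    using i1[of m] i2[of m] by (intro borel_measurable_add) auto
   show "(%x. xi x \<bullet> partial m ?ph x) \<in> borel_measurable ?M" by (rule borel_measurable_lebesgue_on_AE[OF lmeasurable_D(2) b ae])
  qed
  moreover have "(LINT x|?M. G x * (partial m (%y. q y $ m) x * cut a b x) + G x * (q x $ m * partial m (cut a b) x))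
   = (LINT x|?M. G x * (partial m (%y. q y $ m) x * cut a b x)) + (LINT x|?M. G x * (q x $ m * partial m (cut a b) x))" by (rule BI_integral_add[OF i1 i2])
  moreover have "L2_inner D (w m) ?ph = (LINT x|?M. w m x * q x $ m * cut a b x)" unfolding L2_inner_def by (simp add: mult.assoc)
  ultimately show ?thesis by simp
 qed
 have "(\<Sum>m\<in>UNIV. LINT x|?M. G x * (partial m (%y. q y $ m) x * cut a b x)) = (LINT x|?M. G x * divergence q x * cut a b x)" unfolding BI_integral_sum[OF i1, symmetric]
  by (simp add: divergence_def sum_distrib_left sum_distrib_right mult.assoc)
 moreover have "(\<Sum>m\<in>UNIV. LINT x|?M. G x * (q x $ m * partial m (cut a b) x)) = (LINT x|?M. ?F x \<bullet> gradc a b x)" unfolding BI_integral_sum[OF i2, symmetric]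
  by (simp add: gradc_def inner_vec_def sum_2 mult.assoc distrib_left)
 moreover have "(LINT x|?M. ?F x \<bullet> gradc a b x) = integral D (%x. ?F x \<bullet> gradc a b x)"
 proof (rule lebesgue_integral_eq_integral[OF _ lmeasurable_D(2)])
  have "(%x. ?F x \<bullet> gradc a b x) = (%x. \<Sum>m\<in>UNIV. G x * (q x $ m * partial m (cut a b) x))"
   by (simp add: gradc_def inner_vec_def sum_2 mult.assoc distrib_left fun_eq_iff)
  then show "integrable ?M (%x. ?F x \<bullet> gradc a b x)" using BI_integrable_sum[OF i2] by (simp only:)
 qed
 ultimately show ?thesis unfolding sum_negf[symmetric] main[symmetric] sum.distrib by simp
qed

text \<open>The volume terms converge by domination and the shell term by \<open>flux_limit\<close>.
  The cut-off decreases outwards, which produces the sign that moves the boundary integrals to the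
  other side.\<close>

theorem green:
 assumes xi: "xi \<in> L2_space D" and w: "!!m. w m \<in> L2_space D"
  and wd: "!!m. is_weak_deriv D (of_bool (m = 1)) (of_bool (m = 2)) xi (w m)"
  and G: "continuous_on (closure D) G" "AE x in lebesgue_on D. G x = xi x" and q: "q \<in> vpoly2 k"
 shows "(\<Sum>m\<in>UNIV. LINT x|lebesgue_on D. w m x * q x $ m) + L2_inner D xi (divergence q)
  = (\<Sum>i\<in>I. side_integral (gm i) (%x. G x * (q x \<bullet> outward_normal D x)))"
proof -
 let ?M = "lebesgue_on D"
 let ?a = "%n. 1 - 2 / real (n + 3)" and ?b = "%n. 1 - 1 / real (n + 3)"
 let ?F = "%x. G x *\<^sub>R q x"
 have cq: "continuous_on (closure D) q" by (rule continuous_vpoly2[OF q])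
 have cF: "continuous_on (closure D) ?F" by (intro continuous_intros G cq)
 have ab: "0 < ?a n" "?a n < ?b n" "?b n < 1" for n by (simp_all add: divide_strict_right_mono)
 have qm: "(%x. q x $ m) \<in> poly2 k" for m using q by (rule vpoly2_nth)
 have divq: "divergence q \<in> poly2 k" unfolding divergence_def[abs_def] by (intro poly2_sum poly2_partial qm)
 note pm = poly2_measurable[where k=k] and li = L2_poly_integrable[where k=k]
 have xim: "xi \<in> borel_measurable ?M" using xi by (simp add: L2_space_def)
 have Gm: "G \<in> borel_measurable ?M" by (rule borel_measurable_lebesgue_on_AE[OF lmeasurable_D(2) xim]) (use G(2) in \<open>auto elim: eventually_mono\<close>)
 have Gd: "integrable ?M (%x. G x * divergence q x)"
 proof (rule integrable_cong_AE_imp[OF li[OF xi divq]])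
  show "(%x. G x * divergence q x) \<in> borel_measurable ?M" using Gm pm[OF divq] by simp
  show "AE x in ?M. xi x * divergence q x = G x * divergence q x" using G(2) by eventually_elim simp
 qed
 have Geq: "(LINT x|?M. G x * divergence q x) = L2_inner D xi (divergence q)" unfolding L2_inner_def
 proof (rule BI_integral_cong_AE)
  show "AE x in ?M. G x * divergence q x = xi x \<bullet> divergence q x" using G(2) by eventually_elim simp
 qed (use Gm xim pm[OF divq] in auto)
 let ?B = "%i. LINT t|lborel. indicator (T i) t * (?F (gm i t) \<bullet> conormal i t)"
 have side: "?B i = side_integral (gm i) (%x. G x * (q x \<bullet> outward_normal D x))" if i: "i \<in> I" for i
 proof (rule star_curve.side_integral_normal[OF curve[OF i], symmetric])
  show "continuous_on {0..1} (%t. G (gm i t) *\<^sub>R q (gm i t))" by (rule continuous_on_compose2[OF cF star_curve.continuous_curve[OF curve[OF i]]])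
    (use star_curve.frgm[OF curve[OF i]] in \<open>auto simp: frontier_def\<close>)
 qed
 have Z: "(%n. integral D (%x. ?F x \<bullet> gradc (?a n) (?b n) x)) \<longlonglongrightarrow> - (\<Sum>i\<in>I. ?B i)"
 proof (rule LIMSEQ_I)
  fix e :: real assume e: "e > 0"
  then have "e / 2 > 0" by simp
  from flux_limit[OF cF this] obtain d where d: "d > 0"
   "!!et. 0 < et ==> et < d ==> \<bar>integral D (%x. ?F x \<bullet> gradc (1 - 2 * et) (1 - et) x) + (\<Sum>i\<in>I. ?B i)\<bar> <= e / 2" by blast
  obtain n0 where n0: "1 / d < real n0" using reals_Archimedean2 by blast
  have "norm (integral D (%x. ?F x \<bullet> gradc (?a n) (?b n) x) - - (\<Sum>i\<in>I. ?B i)) < e" if "n \<ge> n0" for n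
  proof -
   have "1 / d < real (n + 3)" using n0 that by simp
   then have "1 / real (n + 3) < d" using d(1) by (simp add: field_simps)
   then have "\<bar>integral D (%x. ?F x \<bullet> gradc (1 - 2 * (1 / real (n + 3))) (1 - 1 / real (n + 3)) x) + (\<Sum>i\<in>I. ?B i)\<bar> <= e / 2" by (intro d(2)) auto
   moreover have "2 * (1 / real (n + 3)) = 2 / real (n + 3)" by simp
   ultimately have "\<bar>integral D (%x. ?F x \<bullet> gradc (?a n) (?b n) x) + (\<Sum>i\<in>I. ?B i)\<bar> <= e / 2" by (simp only:)
   then show ?thesis using e by (simp add: real_norm_def)
  qed
  then show "\<exists>n0. \<forall>n\<ge>n0. norm (integral D (%x. ?F x \<bullet> gradc (?a n) (?b n) x) - - (\<Sum>i\<in>I. ?B i)) < e" by blast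
 qed
 have X: "(%n. LINT x|?M. G x * divergence q x * cut (?a n) (?b n) x) \<longlonglongrightarrow> (LINT x|?M. G x * divergence q x)" by (rule cut_integral_tendsto[OF Gd])
 have Y: "(%n. \<Sum>m\<in>UNIV. LINT x|?M. w m x * q x $ m * cut (?a n) (?b n) x) \<longlonglongrightarrow> (\<Sum>m\<in>UNIV. LINT x|?M. w m x * q x $ m)"
  by (intro tendsto_sum cut_integral_tendsto li w qm)
 have "(LINT x|?M. G x * divergence q x) + - (\<Sum>i\<in>I. ?B i) = - (\<Sum>m\<in>UNIV. LINT x|?M. w m x * q x $ m)"
 proof (rule LIMSEQ_unique[OF tendsto_add[OF X Z]])
  show "(%n. (LINT x|?M. G x * divergence q x * cut (?a n) (?b n) x) + integral D (%x. ?F x \<bullet> gradc (?a n) (?b n) x))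
   \<longlonglongrightarrow> - (\<Sum>m\<in>UNIV. LINT x|?M. w m x * q x $ m)" unfolding green_cut[OF ab xi w wd G q] by (rule tendsto_minus[OF Y])
 qed
 moreover have "(\<Sum>i\<in>I. ?B i) = (\<Sum>i\<in>I. side_integral (gm i) (%x. G x * (q x \<bullet> outward_normal D x)))" by (rule sum.cong[OF refl side])
 ultimately show ?thesis unfolding Geq by linarith
qed

end

subsection \<open>Boundary integrals of the normal component\<close>

lemma integrable_lebesgue_on_AE_cong:
 fixes f g :: "'a::euclidean_space => real"
 assumes "S \<in> sets lebesgue" "integrable (lebesgue_on S) f" "AE x in lebesgue_on S. f x = g x"
 shows "integrable (lebesgue_on S) g" by (rule integrable_cong_AE_imp[OF assms(2) borel_measurable_lebesgue_on_AE[OF assms(1) _ assms(3)]])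
  (use assms in \<open>auto elim: eventually_mono\<close>)

context star_curve
begin

lemma speed_I01: "AE t in I01. t \<in> {0..1} & speed gm t = indicator T t * norm (g t)" using speed_AE by (simp add: AE_restrict_space_iff)

lemma normal_T: "t \<in> T ==> norm (g t) *\<^sub>R outward_normal D (gm t) = conormal t" using outward_normal_frontier[OF frgm T_I(2) derivgm g0] g0 by (simp add: conormal_def)

lemma norm_normal: "t \<in> T ==> norm (outward_normal D (gm t)) = 1" using outward_normal_frontier[OF frgm T_I(2) derivgm g0] g0 cross_ne_0 by (simp add: norm_rot abs_sgn_eq)

text \<open>The integrand agrees almost everywhere with a bounded Borel function of the parameter:
  where the normal is not under control, the speed vanishes.\<close>

lemma normal_integrable:
 assumes e: "continuous_on {0..1} (%t. e (gm t))" and q: "continuous_on UNIV q"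
 shows "integrable I01 (%t. e (gm t) * (q (gm t) \<bullet> outward_normal D (gm t)) * speed gm t)"
proof (rule integrable_lebesgue_on_AE_cong)
 let ?\<Phi> = "%t. e (gm t) *\<^sub>R q (gm t)"
 have c: "continuous_on {0..1} ?\<Phi>" by (intro continuous_on_scaleR e continuous_on_compose2[OF q continuous_curve]) auto
 have "bounded (?\<Phi> ` {0..1})" by (intro compact_imp_bounded compact_continuous_image c compact_Icc)
 then obtain M where M: "\<forall>x\<in>?\<Phi> ` {0..1}. norm x <= M" unfolding bounded_iff by blast
 let ?f = "%t. indicator T t * (?\<Phi> t \<bullet> conormal t)"
 show "integrable I01 ?f"
 proof (rule finite_measure.integrable_const_bound[OF finite_measure_I01, where B="\<bar>M * L\<bar>"])
  show "AE t in I01. norm (?f t) <= \<bar>M * L\<bar>"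
  proof (rule AE_I2)
   fix t
   have "\<bar>?\<Phi> t \<bullet> conormal t\<bar> <= M * L" if "t \<in> T" using M T_I(1)[OF that] by (intro inner_conormal_le that) auto
   then show "norm (?f t) <= \<bar>M * L\<bar>" by (auto simp: indicator_def)
  qed
  have "?f \<in> borel_measurable borel" using conormal_measurable[OF c] by (simp add: set_borel_measurable_def)
  then show "?f \<in> borel_measurable I01" by (rule borel_measurable_I01)
 qed
 show "AE t in I01. ?f t = e (gm t) * (q (gm t) \<bullet> outward_normal D (gm t)) * speed gm t" using speed_I01
 proof eventually_elim
  case (elim t)
  show ?case
  proof (cases "t \<in> T")
   case True
   show ?thesis using elim True by (simp add: normal_T[OF True, symmetric])
  qed (use elim in auto)
 qed
qed simp

text \<open>The normal has length 1 on \<open>T\<close>, and the other parameters have zero speed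
  almost everywhere.\<close>

lemma side_integral_normal_le:
 assumes e: "continuous_on {0..1} (%t. e (gm t))" and S: "!!t. t \<in> {0..1} ==> norm (q (gm t)) <= S" and lip: "lip_arc gm"
 shows "\<bar>side_integral gm (%x. e x * (q x \<bullet> outward_normal D x))\<bar> <= S * (LINT t|I01. \<bar>e (gm t)\<bar> * speed gm t)"
proof -
 let ?F = "%t. e (gm t) * (q (gm t) \<bullet> outward_normal D (gm t)) * speed gm t"
 have "\<bar>LINT t|I01. ?F t\<bar> <= (LINT t|I01. \<bar>?F t\<bar>)" using integral_norm_bound[of I01 ?F] by simp
 also have "... <= (LINT t|I01. S * (\<bar>e (gm t)\<bar> * speed gm t))"
 proof (rule integral_mono_AE')
  show "integrable I01 (%t. S * (\<bar>e (gm t)\<bar> * speed gm t))" by (intro integrable_mult_right speed_integrable_continuous[OF lip] continuous_intros e)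
  show "AE t in I01. \<bar>?F t\<bar> <= S * (\<bar>e (gm t)\<bar> * speed gm t)" using speed_I01
  proof eventually_elim
   case (elim t)
   have "\<bar>?F t\<bar> = \<bar>q (gm t) \<bullet> outward_normal D (gm t)\<bar> * (\<bar>e (gm t)\<bar> * speed gm t)" by (simp add: abs_mult)
   also have "... <= S * (\<bar>e (gm t)\<bar> * speed gm t)"
   proof (cases "t \<in> T")
    case True
    have "\<bar>q (gm t) \<bullet> outward_normal D (gm t)\<bar> <= norm (q (gm t)) * 1"
    using Cauchy_Schwarz_ineq2[of "q (gm t)" "outward_normal D (gm t)"] norm_normal[OF True] by simp
    also have "... <= S" using S elim by simp
    finally show ?thesis by (intro mult_right_mono) auto
   qed (use elim in simp)
   finally show ?case .
  qed
  have "0 <= S" using order_trans[OF norm_ge_zero S[of 0]] by simp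
  then show "AE t in I01. 0 <= S * (\<bar>e (gm t)\<bar> * speed gm t)" by (intro AE_I2) simp
 qed
 finally show ?thesis unfolding side_integral_def by simp
qed

end

context star_domain
begin

lemma L2_proj_poly2:
 assumes u: "u \<in> L2_space D"
 shows "L2_proj D (poly2 k) u \<in> poly2 k" "p \<in> poly2 k ==> L2_inner D (L2_proj D (poly2 k) u) p = L2_inner D u p"
proof -
 have "\<exists>!w. w \<in> poly2 k & (\<forall>q\<in>poly2 k. L2_inner D w q = L2_inner D u q)"
 proof (rule poly2_L2_Riesz[OF openD _ boundedD])
  show "D ~= {}" using zD by blast
  show "L2_inner D u (%x. p x + q x) = L2_inner D u p + L2_inner D u q" if "p \<in> poly2 k" "q \<in> poly2 k" for p q
   unfolding L2_inner_real distrib_left by (intro BI_integral_add L2_poly_integrable[OF u, where k=k] that)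
  show "L2_inner D u (%x. a * p x) = a * L2_inner D u p" if "p \<in> poly2 k" for a p by (simp add: L2_inner_real mult.left_commute)
 qed
 from theI'[OF this] show "L2_proj D (poly2 k) u \<in> poly2 k"
  "p \<in> poly2 k ==> L2_inner D (L2_proj D (poly2 k) u) p = L2_inner D u p" unfolding L2_proj_def by auto
qed

lemma L2_field_integrable:
 assumes u: "!!i. (%x. u x $ i) \<in> L2_space D" and q: "q \<in> vpoly2 k"
 shows "integrable (lebesgue_on D) (%x. u x $ i * q x $ i)" by (rule L2_poly_integrable[OF u vpoly2_nth[OF q]])

lemma L2_field_inner_integrable:
 assumes u: "!!i. (%x. u x $ i) \<in> L2_space D" and q: "q \<in> vpoly2 k"
 shows "integrable (lebesgue_on D) (%x. u x \<bullet> q x)" unfolding inner_vec_def inner_real_def by (intro BI_integrable_sum L2_field_integrable[OF u q])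

lemma L2_proj_vpoly2:
 assumes u: "!!i. (%x. u x $ i) \<in> L2_space D"
 shows "L2_proj D (vpoly2 k) u \<in> vpoly2 k" "q \<in> vpoly2 k ==> L2_inner D (L2_proj D (vpoly2 k) u) q = L2_inner D u q"
proof -
 have "\<exists>!w. w \<in> vpoly2 k & (\<forall>q\<in>vpoly2 k. L2_inner D w q = L2_inner D u q)"
 proof (rule vpoly2_L2_Riesz[OF openD _ boundedD])
  show "D ~= {}" using zD by blast
  show "L2_inner D u (%x. p x + q x) = L2_inner D u p + L2_inner D u q" if "p \<in> vpoly2 k" "q \<in> vpoly2 k" for p q
   unfolding L2_inner_def inner_add_right by (intro BI_integral_add L2_field_inner_integrable[OF u, where k=k] that)
  show "L2_inner D u (%x. a *\<^sub>R p x) = a * L2_inner D u p" if "p \<in> vpoly2 k" for a p by (simp add: L2_inner_def)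
 qed
 from theI'[OF this] show "L2_proj D (vpoly2 k) u \<in> vpoly2 k"
  "q \<in> vpoly2 k ==> L2_inner D (L2_proj D (vpoly2 k) u) q = L2_inner D u q" unfolding L2_proj_def by auto
qed

lemma poly2_L2_space: "p \<in> poly2 k ==> p \<in> L2_space D"
proof -
 assume p: "p \<in> poly2 k"
 have "p \<in> borel_measurable (lebesgue_on D)" by (rule poly2_measurable[OF p])
 moreover have "integrable (lebesgue_on D) (%x. p x * p x)" by (rule poly2_L2_integrable[OF p p boundedD lmeasurable_D(2)])
 ultimately show ?thesis by (simp add: L2_space_def power2_eq_square)
qed

lemma vpoly2_inner_integrable: "w \<in> vpoly2 k ==> q \<in> vpoly2 k ==> integrable (lebesgue_on D) (%x. w x \<bullet> q x)"
 by (rule L2_field_inner_integrable[of w q k]) (auto intro: poly2_L2_space vpoly2_nth)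

lemma divergence_add:
 assumes "p \<in> vpoly2 k" "q \<in> vpoly2 k"
 shows "divergence (%x. p x + q x) x = divergence p x + divergence q x"
proof -
 have "partial i (%y. (p y + q y) $ i) x = partial i (%y. p y $ i) x + partial i (%y. q y $ i) x" for i
 proof -
  have "((%y. p y $ i + q y $ i) has_derivative (%h. frechet_derivative (%y. p y $ i) (at x) h + frechet_derivative (%y. q y $ i) (at x) h)) (at x)"
   using poly2_differentiable[OF vpoly2_nth[OF assms(1)]] poly2_differentiable[OF vpoly2_nth[OF assms(2)]]
   by (intro has_derivative_add) (simp_all add: frechet_derivative_works[symmetric])
  from partial_eqI[OF this] show ?thesis by (simp add: partial_def)
 qed
 then show ?thesis by (simp add: divergence_def sum.distrib)
qed

lemma divergence_scale:
 assumes "p \<in> vpoly2 k"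
 shows "divergence (%x. a *\<^sub>R p x) x = a * divergence p x"
proof -
 have "partial i (%y. (a *\<^sub>R p y) $ i) x = a * partial i (%y. p y $ i) x" for i
 proof -
  have "((%y. a * p y $ i) has_derivative (%h. a * frechet_derivative (%y. p y $ i) (at x) h)) (at x)" using poly2_differentiable[OF vpoly2_nth[OF assms(1)]]
   by (intro has_derivative_mult_right) (simp add: frechet_derivative_works[symmetric])
  from partial_eqI[OF this] show ?thesis by (simp add: partial_def)
 qed
 then show ?thesis by (simp add: divergence_def sum_distrib_left)
qed

lemma divergence_poly2: "q \<in> vpoly2 k ==> divergence q \<in> poly2 k" unfolding divergence_def[abs_def] by (intro poly2_sum poly2_partial vpoly2_nth)

lemma L2_norm_mono_ball:
 assumes B: "ball z s \<subseteq> D" and q: "q \<in> vpoly2 k"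
 shows "L2_norm (ball z s) (%x. q x $ i) <= L2_norm D q"
proof -
 have p: "(%x. q x $ i) \<in> poly2 k" by (rule vpoly2_nth[OF q])
 have iB: "integrable (lebesgue_on (ball z s)) (%x. q x $ i * q x $ i)" by (rule poly2_L2_integrable[OF p p]) auto
 have iD: "integrable (lebesgue_on D) (%x. q x \<bullet> q x)" by (rule vpoly2_inner_integrable[OF q q])
 have "L2_inner (ball z s) (%x. q x $ i) (%x. q x $ i) = integral (ball z s) (%x. q x $ i * q x $ i)" unfolding L2_inner_real by (rule lebesgue_integral_eq_integral[OF iB]) simp
 also have "... <= integral (ball z s) (%x. q x \<bullet> q x)"
 proof (rule integral_le)
  show "(%x. q x $ i * q x $ i) integrable_on ball z s" using integrable_on_lebesgue_on[OF iB] by simp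
  show "(%x. q x \<bullet> q x) integrable_on ball z s"
  proof -
   have "integrable (lebesgue_on (ball z s)) (%x. q x \<bullet> q x)" unfolding inner_vec_def inner_real_def
    by (intro BI_integrable_sum poly2_L2_integrable[OF vpoly2_nth[OF q] vpoly2_nth[OF q]]) auto
   from integrable_on_lebesgue_on[OF this] show ?thesis by simp
  qed
  show "q x $ i * q x $ i <= q x \<bullet> q x" for x using exhaust_2[of i] by (auto simp: inner_vec_def sum_2)
 qed
 also have "... <= integral D (%x. q x \<bullet> q x)"
 proof (rule integral_subset_le[OF B])
  show "(%x. q x \<bullet> q x) integrable_on D" using integrable_on_lebesgue_on[OF iD lmeasurable_D(2)] .
  have "integrable (lebesgue_on (ball z s)) (%x. q x \<bullet> q x)" unfolding inner_vec_def inner_real_def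
   by (intro BI_integrable_sum poly2_L2_integrable[OF vpoly2_nth[OF q] vpoly2_nth[OF q]]) auto
  from integrable_on_lebesgue_on[OF this] show "(%x. q x \<bullet> q x) integrable_on ball z s" by simp
 qed auto
 also have "... = L2_inner D q q" unfolding L2_inner_def by (rule lebesgue_integral_eq_integral[OF iD lmeasurable_D(2), symmetric])
 finally show ?thesis by (simp add: L2_norm_def)
qed

end

section \<open>The boundary-layer element and its estimates\<close>

subsection \<open>The sides of an element\<close>

text \<open>The order is that of \<open>bdry_pairing\<close>, with the inner side as number 3; the
  list of sides becomes a finite sum.\<close>

definition sides :: "bl_element => nat => real => real^2" where
 "sides E i = (if i = 0 then outer_side E else if i = 1 then oi_side1 E else if i = 2 then oi_side2 E else inner_side E)"

lemma bdry_pairing_sides: "bdry_pairing E f v = (\<Sum>i<4. side_integral (sides E i) (%x. f x * v x))" by (simp add: bdry_pairing_def sides_def eval_nat_numeral)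

lemma linepath_Lipschitz: "(norm (b - a))-lipschitz_on S (linepath a b)"
proof (rule lipschitz_onI)
 fix s t
 have "linepath a b s - linepath a b t = (s - t) *\<^sub>R (b - a)" by (simp add: linepath_def algebra_simps)
 then show "dist (linepath a b s) (linepath a b t) <= norm (b - a) * dist s t" by (simp add: dist_norm mult.commute)
qed simp

lemma arc_interior: "arc gm ==> s \<in> {0<..<1} ==> gm s ~= gm 0 & gm s ~= gm 1"
 unfolding arc_def inj_on_def by (metis atLeastAtMost_iff greaterThanLessThan_iff less_eq_real_def less_irrefl zero_le_one order_refl)

locale element =
 fixes E :: bl_element and \<rho> :: real
 assumes regular: "shape_regular \<rho> E" and \<rho>0: "\<rho> > 0"
begin

abbreviation "D \<equiv> region E"
abbreviation "h \<equiv> diameter D"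

lemma loop: "simple_path (bdry_loop E)" "pathfinish (bdry_loop E) = pathstart (bdry_loop E)"
 using regular by (auto simp: shape_regular_def curvilinear_polygon_def bdry_loop_def oi_side2_def)

lemma region_props: "open D" "bounded D" "D ~= {}" "frontier D = path_image (bdry_loop E)" unfolding region_def using Jordan_real2[OF loop] by auto

lemma h0: "h > 0"
proof -
 obtain x e where "e > 0" "ball x e \<subseteq> D" using region_props openE by blast
 then have "diameter (ball x e) <= h" using region_props by (intro diameter_subset) auto
 moreover have "diameter (ball x e) = 2 * e" using \<open>e > 0\<close> by (simp add: diameter_ball)
 ultimately show ?thesis using \<open>e > 0\<close> by linarith
qed

lemma norm_le_h: "x \<in> D ==> y \<in> D ==> norm (x - y) <= h" using diameter_bounded_bound[OF region_props(2)] by (simp add: dist_norm)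

text \<open>The disc of the given element is replaced by the concentric one of radius
  \<open>\<rho> * h\<close> for the prescribed lower bound \<open>\<rho>\<close>; this makes the
  later constants uniform over elements.\<close>

lemma ex_star: "\<exists>z. star_domain D z (\<rho> * h)"
proof -
 obtain \<rho>' z where z: "\<rho>' > \<rho>" "ball z (\<rho>' * h) \<subseteq> D" "star_shaped_wrt D (ball z (\<rho>' * h))" using regular by (auto simp: shape_regular_def)
 have sub: "ball z (\<rho> * h) \<subseteq> ball z (\<rho>' * h)" using z(1) h0 by (intro subset_ball) simp
 show ?thesis
 proof (intro exI[of _ z] star_domain.intro)
  show "star_shaped_wrt D (ball z (\<rho> * h))" using z(3) sub unfolding star_shaped_wrt_def by blast
 qed (use z sub region_props h0 \<rho>0 in auto)
qed

text \<open>A simple closed path that is a join splits into arcs meeting only at the joints; peeling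
  off one side after the other gives the intersections.\<close>

lemma joins:
 shows "arc (outer_side E)" "arc (oi_side1 E)" "arc (oi_side2 E)" "arc (inner_side E)"
  "path_image (outer_side E) \<inter> (path_image (oi_side1 E) \<union> path_image (inner_side E) \<union> path_image (oi_side2 E)) \<subseteq> {outer_side E 0, outer_side E 1}"
  "path_image (oi_side1 E) \<inter> (path_image (inner_side E) \<union> path_image (oi_side2 E)) \<subseteq> {oi_side1 E 1}"
  "path_image (inner_side E) \<inter> path_image (oi_side2 E) \<subseteq> {inner_side E 1}"
  "path_image (bdry_loop E) = path_image (outer_side E) \<union> path_image (oi_side1 E) \<union> path_image (inner_side E) \<union> path_image (oi_side2 E)"
proof -
 let ?o = "outer_side E" and ?a = "oi_side1 E" and ?i = "inner_side E" and ?b = "oi_side2 E"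
 have e: "pathfinish ?o = pathstart ?a" "pathfinish ?a = pathstart ?i" "pathfinish ?i = pathstart ?b" "pathfinish ?b = pathstart ?o"
  by (auto simp: oi_side1_def inner_side_def oi_side2_def)
 have "simple_path (?o +++ (?a +++ ?i +++ ?b))" using loop(1) by (simp add: bdry_loop_def)
 moreover have "pathfinish ?o = pathstart (?a +++ ?i +++ ?b)" using e by simp
 ultimately have "arc ?o & arc (?a +++ ?i +++ ?b) \<and>
  path_image ?o \<inter> path_image (?a +++ ?i +++ ?b) \<subseteq> {pathstart ?o, pathstart (?a +++ ?i +++ ?b)}" by (rule simple_path_joinE) blast
 then have 1: "arc ?o" "arc (?a +++ ?i +++ ?b)"
  "path_image ?o \<inter> path_image (?a +++ ?i +++ ?b) \<subseteq> {pathstart ?o, pathstart (?a +++ ?i +++ ?b)}" by auto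
 have 2: "arc ?a" "arc (?i +++ ?b)" "path_image ?a \<inter> path_image (?i +++ ?b) \<subseteq> {pathstart (?i +++ ?b)}" using 1(2) e by (simp_all add: arc_join_eq)
 have 3: "arc ?i" "arc ?b" "path_image ?i \<inter> path_image ?b \<subseteq> {pathstart ?b}" using 2(2) e by (simp_all add: arc_join_eq)
 have im: "path_image (?i +++ ?b) = path_image ?i \<union> path_image ?b" using e by (simp add: path_image_join)
 have im2: "path_image (?a +++ ?i +++ ?b) = path_image ?a \<union> (path_image ?i \<union> path_image ?b)" using e im by (simp add: path_image_join)
 have im3: "path_image (bdry_loop E) = path_image ?o \<union> (path_image ?a \<union> (path_image ?i \<union> path_image ?b))"
  using e im2 by (simp add: bdry_loop_def path_image_join)
 show "arc ?o" "arc ?a" "arc ?b" "arc ?i" using 1 2 3 by auto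
 show "path_image ?o \<inter> (path_image ?a \<union> path_image ?i \<union> path_image ?b) \<subseteq> {?o 0, ?o 1}"
  using 1(3) unfolding im2 pathstart_join e(1)[symmetric] by (simp add: pathstart_def pathfinish_def Un_assoc)
 show "path_image ?a \<inter> (path_image ?i \<union> path_image ?b) \<subseteq> {?a 1}"
  using 2(3) unfolding im pathstart_join e(2)[symmetric] by (simp add: pathstart_def pathfinish_def)
 show "path_image ?i \<inter> path_image ?b \<subseteq> {?i 1}" using 3(3) unfolding e(3)[symmetric] by (simp add: pathstart_def pathfinish_def)
 show "path_image (bdry_loop E) = path_image ?o \<union> path_image ?a \<union> path_image ?i \<union> path_image ?b" unfolding im3 by blast
qed

lemma corners: "oi_side1 E 1 = inner_side E 0" "inner_side E 1 = oi_side2 E 0" by (simp_all add: oi_side1_def inner_side_def oi_side2_def linepath_def)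

lemma lip_arc_sides: "lip_arc (sides E i)"
proof -
 have "\<exists>L. L-lipschitz_on {0..1} (outer_side E)" using regular by (auto simp: shape_regular_def curvilinear_polygon_def)
 then show ?thesis unfolding lip_arc_def sides_def using joins(1-4) linepath_Lipschitz by (auto simp: oi_side1_def inner_side_def oi_side2_def)
qed

text \<open>This is what the case distinction in \<open>Qb\<close> asks for: at an interior
  parameter of a side none of the preceding cases applies.\<close>

lemma sides_interior:
 assumes t: "t \<in> {0<..<1}"
 shows "outer_side E t \<notin> path_image (oi_side1 E) \<union> path_image (inner_side E) \<union> path_image (oi_side2 E)"
  "oi_side1 E t \<notin> path_image (inner_side E) \<union> path_image (oi_side2 E)"
  "oi_side2 E t \<notin> path_image (inner_side E)" "oi_side2 E t \<notin> path_image (oi_side1 E)"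
  "inner_side E t \<notin> path_image (oi_side2 E)"
proof -
 have m: "gm t \<in> path_image gm" for gm :: "real => real^2" using t by (auto simp: path_image_def)
 note a = arc_interior[OF joins(1) t] arc_interior[OF joins(2) t] arc_interior[OF joins(3) t] arc_interior[OF joins(4) t]
 show "outer_side E t \<notin> path_image (oi_side1 E) \<union> path_image (inner_side E) \<union> path_image (oi_side2 E)" using joins(5) a(1) m[of "outer_side E"] by blast
 show "oi_side1 E t \<notin> path_image (inner_side E) \<union> path_image (oi_side2 E)" using joins(6) a(2) m[of "oi_side1 E"] by blast
 show b: "oi_side2 E t \<notin> path_image (inner_side E)" using joins(7) a(3) m[of "oi_side2 E"] corners(2) by auto
 show "inner_side E t \<notin> path_image (oi_side2 E)" using joins(7) a(4) m[of "inner_side E"] by blast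
 show "oi_side2 E t \<notin> path_image (oi_side1 E)"
 proof
  assume "oi_side2 E t \<in> path_image (oi_side1 E)"
  \<comment> \<open>The first outer-inner side meets the following sides only at its end, which also
    lies on the inner side.\<close>
  then have "oi_side2 E t = inner_side E 0" using joins(6) m[of "oi_side2 E"] corners(1) by auto
  moreover have "inner_side E 0 \<in> path_image (inner_side E)" by (auto simp: path_image_def)
  ultimately show False using b by simp
 qed
qed

lemma sides_disjoint:
 assumes "i < 4" "j < 4" "i ~= j" "s \<in> {0<..<1}" "t \<in> {0<..<1}"
 shows "sides E i s ~= sides E j t"
proof -
 have m: "gm u \<in> path_image gm" if "u \<in> {0<..<1}" for u and gm :: "real => real^2" using that by (auto simp: path_image_def)
 have "i \<in> {0, 1, 2, 3}" "j \<in> {0, 1, 2, 3}" using assms by auto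
 moreover have "outer_side E u ~= oi_side1 E v" "outer_side E u ~= oi_side2 E v" "outer_side E u ~= inner_side E v"
  "oi_side1 E u ~= oi_side2 E v" "oi_side1 E u ~= inner_side E v" "oi_side2 E u ~= inner_side E v" if "u \<in> {0<..<1}" "v \<in> {0<..<1}" for u v
  using sides_interior[OF that(1)] m[OF that(2), of "oi_side1 E"] m[OF that(2), of "oi_side2 E"] m[OF that(2), of "inner_side E"] by auto
 ultimately show ?thesis using assms(3-5) by (auto simp: sides_def dest: sym)
qed

lemma ex_boundary: "\<exists>z g T L. star_boundary D z (\<rho> * h) {..<4} (sides E) g T L"
proof -
 obtain z where z: "star_domain D z (\<rho> * h)" using ex_star by blast
 define P where "P i g T L \<longleftrightarrow> L-lipschitz_on {0..1} (sides E i) & g \<in> borel_measurable borel & T \<in> sets borel & T \<subseteq> {0<..<1}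
  & (\<forall>t\<in>T. (sides E i has_vector_derivative g t) (at t) & g t ~= 0 & norm (g t) <= L)
  & (AE t in lborel. t \<in> {0<..<1} --> t \<notin> T --> (sides E i has_vector_derivative 0) (at t))" for i g T L
 have "\<forall>i. \<exists>g T L. P i g T L" unfolding P_def using lip_arc_tangents[OF lip_arc_sides] by blast
 then obtain g T L where P: "!!i. P i (g i) (T i) (L i)" by metis
 have cov: "frontier D = (\<Union>i<4. path_image (sides E i))" unfolding region_props(4) joins(8) by (auto simp: sides_def eval_nat_numeral lessThan_Suc)
 have "star_boundary D z (\<rho> * h) {..<4} (sides E) g T L"
 proof (intro star_boundary.intro z star_boundary_axioms.intro)
  fix i :: nat assume i: "i \<in> {..<4}"
  show "star_curve D z (\<rho> * h) (sides E i) (g i) (T i) (L i)"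
  proof (intro star_curve.intro z star_curve_axioms.intro)
   show "arc (sides E i)" using lip_arc_sides by (simp add: lip_arc_def)
   show "sides E i t \<in> frontier D" if "t \<in> {0..1}" for t unfolding cov using i that by (auto intro!: bexI[of _ i] simp: path_image_def)
  qed (use P[of i] in \<open>auto simp: P_def\<close>)
 qed (use cov sides_disjoint in auto)
 then show ?thesis by blast
qed

end

subsection \<open>The estimates on an element\<close>

lemma continuous_AE_eq:
 fixes f g :: "real^2 => real"
 assumes D: "open D" and f: "continuous_on (closure D) f" and g: "continuous_on (closure D) g"
  and ae: "AE x in lebesgue_on D. f x = g x" and x: "x \<in> closure D"
 shows "f x = g x"
proof -
 let ?u = "%x. f x - g x"
 have c: "continuous_on (closure D) ?u" by (intro continuous_intros f g)
 have o: "open (D \<inter> ?u -` (- {0}))" by (rule continuous_open_preimage[OF continuous_on_subset[OF c closure_subset] D]) auto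
 have "AE x in lebesgue. x \<notin> D \<inter> ?u -` (- {0})" using ae D by (simp add: AE_restrict_space_iff)
 then obtain N where N: "N \<in> null_sets lebesgue" "!!x. x \<in> space lebesgue - N ==> x \<notin> D \<inter> ?u -` (- {0})" by (rule AE_E3) blast
 have "D \<inter> ?u -` (- {0}) \<subseteq> N" using N(2) by auto
 moreover have "negligible N" using N(1) by (simp add: negligible_iff_null_sets)
 ultimately have "negligible (D \<inter> ?u -` (- {0}))" using negligible_subset by blast
 then have "D \<inter> ?u -` (- {0}) = {}" using o open_not_negligible by blast
 then have "?u y = 0" if "y \<in> D" for y using that by auto
 from continuous_constant_on_closure[OF c this x] show ?thesis by simp
qed

context element
begin

definition approx_const :: "nat => (real^2 => real) => real" where
 "approx_const k xi = 2 ^ (k + 2) * h ^ Suc k / (\<rho> * h) * sobolev_norm (k + 1) D xi"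

lemma approx_const_nonneg: "approx_const k xi \<ge> 0" using h0 \<rho>0 sobolev_norm_nonneg by (simp add: approx_const_def)

text \<open>The representative chosen by \<open>cont_rep\<close> and the constructed one agree
  almost everywhere in the open set \<open>D\<close>, hence on its closure by continuity, so the
  approximation bound carries over.\<close>

lemma cont_rep_props:
 assumes xi: "xi \<in> sobolev (k + 1) D" and k: "k \<ge> 1"
 shows "continuous_on (closure D) (cont_rep D xi)" "AE x in lebesgue_on D. cont_rep D xi x = xi x"
  "dt > 0 ==> \<exists>p\<in>poly2 k. \<forall>x\<in>closure D. \<bar>cont_rep D xi x - p x\<bar> <= approx_const k xi + dt"
proof -
 obtain z where "star_domain D z (\<rho> * h)" using ex_star by blast
 then interpret star_domain D z "\<rho> * h" .
 obtain g where g: "continuous_on (closure D) g" "AE x in lebesgue_on D. g x = xi x"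
  "!!dt. dt > 0 ==> \<exists>p\<in>poly2 k. \<forall>x\<in>closure D. \<bar>g x - p x\<bar> <= 2 ^ (k + 2) * h ^ Suc k / (\<rho> * h) * sobolev_norm (k + 1) D xi + dt"
  by (rule sobolev_approximation[OF openD boundedD starD ballD r0 norm_le_h k xi], assumption, assumption, rule that; assumption)
 have "\<exists>g. continuous_on (closure D) g & (AE x in lebesgue_on D. g x = xi x)" using g by blast
 from someI_ex[OF this] show c: "continuous_on (closure D) (cont_rep D xi)" "AE x in lebesgue_on D. cont_rep D xi x = xi x" unfolding cont_rep_def by blast+
 have "AE x in lebesgue_on D. g x = cont_rep D xi x" using g(2) c(2) by eventually_elim simp
 then have "g x = cont_rep D xi x" if "x \<in> closure D" for x using continuous_AE_eq[OF openD g(1) c(1) _ that] by blast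
 then show "\<exists>p\<in>poly2 k. \<forall>x\<in>closure D. \<bar>cont_rep D xi x - p x\<bar> <= approx_const k xi + dt" if "dt > 0"
  using g(3)[OF that] unfolding approx_const_def by simp
qed

lemma sides_closure:
 assumes "t \<in> {0..1}" "i < 4"
 shows "sides E i t \<in> closure D"
proof -
 obtain z g T L where "star_boundary D z (\<rho> * h) {..<4} (sides E) g T L" using ex_boundary by blast
 then have "star_curve D z (\<rho> * h) (sides E i) (g i) (T i) (L i)" using assms by (intro star_boundary.curve) auto
 from star_curve.frgm[OF this assms(1)] show ?thesis by (simp add: frontier_def)
qed

lemma path_sides_continuous:
 assumes f: "continuous_on (closure D) f" and i: "i < 4"
 shows "continuous_on {0..1} (%t. f (sides E i t))"
proof (rule continuous_on_compose2[OF f])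
 show "continuous_on {0..1} (sides E i)" using lip_arc_sides[of i] by (simp add: lip_arc_def arc_def path_def)
 show "sides E i ` {0..1} \<subseteq> closure D" using sides_closure[OF _ i] by blast
qed

lemma sobolev_grad_L2:
 assumes xi: "xi \<in> sobolev (k + 1) D" and k: "k \<ge> 1"
 shows "(%x. sobolev_grad D xi x $ i) \<in> L2_space D" using exhaust_2[of i] weak_deriv_props(1)[OF xi, of 1 0] weak_deriv_props(1)[OF xi, of 0 1] k
 by (auto simp: sobolev_grad_def)

lemma element_green:
 assumes xi: "xi \<in> sobolev (k + 1) D" and k: "k \<ge> 1" and q: "q \<in> vpoly2 j"
 shows "L2_inner D (sobolev_grad D xi) q + L2_inner D xi (divergence q) = bdry_pairing E (cont_rep D xi) (normal_trace E q)"
proof -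
 obtain z g T L where sb: "star_boundary D z (\<rho> * h) {..<4} (sides E) g T L" using ex_boundary by blast
 interpret star_boundary D z "\<rho> * h" "{..<4}" "sides E" g T L by (rule sb)
 let ?w = "%m x. sobolev_grad D xi x $ m"
 have xi2: "xi \<in> L2_space D" using xi by (simp add: sobolev_def)
 have wd: "is_weak_deriv D (of_bool (m = 1)) (of_bool (m = 2)) xi (?w m)" for m using exhaust_2[of m] weak_deriv_props(2)[OF xi, of 1 0] weak_deriv_props(2)[OF xi, of 0 1] k
  by (auto simp: sobolev_grad_def)
 have "L2_inner D (sobolev_grad D xi) q = (\<Sum>m\<in>UNIV. LINT x|lebesgue_on D. ?w m x * q x $ m)"
  unfolding L2_inner_vec[OF L2_field_integrable[OF sobolev_grad_L2[OF xi k] q]] L2_inner_real ..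
 then show ?thesis using green[OF xi2 sobolev_grad_L2[OF xi k] wd cont_rep_props(1,2)[OF xi k] q] unfolding bdry_pairing_sides normal_trace_def by simp
qed

text \<open>The mean error over the side is what the boundary pairing asks for, and best
  approximation in \<open>L2\<close> bounds it by \<open>M\<close> times the length, whatever the
  shape of the side.\<close>

lemma side_projection:
 assumes f: "continuous_on (closure D) f" and i: "i < 4" and q: "q \<in> poly2 k" and M: "M > 0"
  and a: "!!x. x \<in> closure D ==> \<bar>f x - q x\<bar> <= M"
 shows "\<exists>p\<in>poly2 k. (\<forall>t\<in>{0..1}. side_proj k (sides E i) f (sides E i t) = p (sides E i t))
  & (LINT t|I01. \<bar>p (sides E i t) - f (sides E i t)\<bar> * speed (sides E i) t) <= M * (LINT t|I01. speed (sides E i) t)"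
proof -
 let ?gm = "sides E i"
 note c = path_sides_continuous[OF f i]
 note la = lip_arc_sides[of i]
 obtain p where p: "p \<in> poly2 k" "side_proj k ?gm f = restrict p (path_image ?gm)"
  "(LINT t|I01. (p (?gm t) - f (?gm t))^2 * speed ?gm t) <= (LINT t|I01. (f (?gm t) - q (?gm t))^2 * speed ?gm t)" by (rule side_proj_best[OF la c q], rule that; assumption)
 note cp = poly2_path_continuous[OF la p(1)] and cq = poly2_path_continuous[OF la q]
 let ?e = "%t. p (?gm t) - f (?gm t)"
 let ?len = "LINT t|I01. speed ?gm t"
 have si: "integrable I01 (%t. u t * speed ?gm t)" if "continuous_on {0..1} u" for u by (rule speed_integrable_continuous[OF la that])
 have s1: "integrable I01 (speed ?gm)" using si[of "%t. 1"] by simp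
 have e2: "integrable I01 (%t. (?e t)^2 * speed ?gm t)" by (intro si continuous_intros cp c)
 have "(LINT t|I01. (?e t)^2 * speed ?gm t) <= (LINT t|I01. M^2 * speed ?gm t)"
 proof (rule order_trans[OF p(3) BI_integral_mono])
  show "integrable I01 (%t. (f (?gm t) - q (?gm t))^2 * speed ?gm t)" by (intro si continuous_intros c cq)
  show "integrable I01 (%t. M^2 * speed ?gm t)" using s1 by simp
  fix t assume "t \<in> space I01"
  then have "\<bar>f (?gm t) - q (?gm t)\<bar>^2 <= M^2" using a[OF sides_closure[OF _ i]] by (intro power_mono) auto
  then show "(f (?gm t) - q (?gm t))^2 * speed ?gm t <= M^2 * speed ?gm t" by (intro mult_right_mono) auto
 qed
 then have E2: "(LINT t|I01. (?e t)^2 * speed ?gm t) <= M^2 * ?len" by simp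
 have "(LINT t|I01. \<bar>?e t\<bar> * speed ?gm t) <= (LINT t|I01. (1 / (2 * M)) * ((?e t)^2 * speed ?gm t) + (M / 2) * speed ?gm t)"
 proof (rule BI_integral_mono)
  show "integrable I01 (%t. \<bar>?e t\<bar> * speed ?gm t)" by (intro si continuous_intros cp c)
  show "integrable I01 (%t. (1 / (2 * M)) * ((?e t)^2 * speed ?gm t) + (M / 2) * speed ?gm t)" by (intro BI_integrable_add integrable_mult_right e2 s1)
  fix t
  \<comment> \<open>AM-GM turns the mean square error into a mean error without a Cauchy--Schwarz inequality on the side.\<close>
  have "\<bar>u\<bar> <= (1 / (2 * M)) * u^2 + M / 2" for u :: real
  proof -
   have "2 * M * \<bar>u\<bar> <= u^2 + M^2" using zero_le_power2[of "\<bar>u\<bar> - M"] by (simp add: power2_diff mult_ac)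
   then show ?thesis using M by (simp add: field_simps power2_eq_square)
  qed
  from this[of "?e t"] have "\<bar>?e t\<bar> <= (1 / (2 * M)) * (?e t)^2 + M / 2" .
  then have "\<bar>?e t\<bar> * speed ?gm t <= ((1 / (2 * M)) * (?e t)^2 + M / 2) * speed ?gm t" by (rule mult_right_mono) simp
  then show "\<bar>?e t\<bar> * speed ?gm t <= (1 / (2 * M)) * ((?e t)^2 * speed ?gm t) + (M / 2) * speed ?gm t" by (simp only: distrib_right mult.assoc)
 qed
 also have "... = (1 / (2 * M)) * (LINT t|I01. (?e t)^2 * speed ?gm t) + (M / 2) * ?len"
  by (subst BI_integral_add) (intro integrable_mult_right e2 s1, intro integrable_mult_right s1, simp)
 also have "... <= (1 / (2 * M)) * (M^2 * ?len) + (M / 2) * ?len" using M by (intro add_mono mult_left_mono E2) auto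
 also have "... = M * ?len" using M by (simp add: power2_eq_square)
 finally have m: "(LINT t|I01. \<bar>?e t\<bar> * speed ?gm t) <= M * ?len" .
 have "side_proj k ?gm f (?gm t) = p (?gm t)" if "t \<in> {0..1}" for t unfolding p(2) using path_image_mem[OF that, of ?gm] by simp
 then show ?thesis using p(1) m by blast
qed

text \<open>The factor is that of the inner side: the interpolant is within
  \<open>lebesgue_const k \<tau> * M\<close> of \<open>q\<close>, and \<open>q\<close> is within
  \<open>M\<close> of the function. On the projected sides the factor 1 is weakened to it for
  uniformity.\<close>

lemma Qb_side:
 assumes f: "continuous_on (closure D) (cont_rep D xi)" and i: "i < 4" and q: "q \<in> poly2 k" and M: "M > 0"
  and a: "!!x. x \<in> closure D ==> \<bar>cont_rep D xi x - q x\<bar> <= M" and nd: "nodal_distribution k \<tau>"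
 shows "\<exists>p\<in>poly2 k. (\<forall>t\<in>{0<..<1}. Qb k \<tau> E xi (sides E i t) = p (sides E i t))
  & (LINT t|I01. \<bar>p (sides E i t) - cont_rep D xi (sides E i t)\<bar> * speed (sides E i) t)
    <= (lebesgue_const k \<tau> + 1) * M * (LINT t|I01. speed (sides E i) t)"
proof -
 let ?gm = "sides E i" and ?f = "cont_rep D xi"
 let ?len = "LINT t|I01. speed ?gm t"
 note \<Lambda> = lebesgue_const_nonneg[of k \<tau>]
 have l0: "?len \<ge> 0" by (intro BI_integral_nonneg) auto
 have m: "gm t \<in> path_image gm" if "t \<in> {0<..<1}" for gm :: "real => real^2" and t using that by (auto simp: path_image_def)
 show ?thesis
 proof (cases "i = 3")
  case False
  then have "i \<in> {0, 1, 2}" using i by auto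
  then have Q: "Qb k \<tau> E xi (?gm t) = side_proj k ?gm ?f (?gm t)" if "t \<in> {0<..<1}" for t
   using sides_interior[OF that] m[OF that, of "oi_side1 E"] m[OF that, of "oi_side2 E"] by (auto simp: Qb_def Let_def sides_def)
  obtain p where p: "p \<in> poly2 k" "\<forall>t\<in>{0..1}. side_proj k ?gm ?f (?gm t) = p (?gm t)"
   "(LINT t|I01. \<bar>p (?gm t) - ?f (?gm t)\<bar> * speed ?gm t) <= M * ?len" using side_projection[OF f i q M a] by blast
  have "M * ?len <= (lebesgue_const k \<tau> + 1) * (M * ?len)" using mult_right_mono[of 1 "lebesgue_const k \<tau> + 1" "M * ?len"] \<Lambda> M l0 by simp
  then show ?thesis using p Q by (intro bexI[of _ p]) (auto simp: mult.assoc)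
 next
  case True
  let ?a = "inner_pt1 E" and ?b = "inner_pt2 E"
  have gm: "?gm = linepath ?a ?b" using True by (simp add: sides_def inner_side_def)
  have ab: "?a ~= ?b" using joins(4) arc_distinct_ends[OF joins(4)] by (simp add: inner_side_def)
  have nM: "\<bar>?f (linepath ?a ?b (\<tau> j)) - q (linepath ?a ?b (\<tau> j))\<bar> <= M" if "j <= k" for j
  proof -
   have "\<tau> j \<in> {0..1}" using nodal_distribution_range[OF nd] that by auto
   then show ?thesis using a[OF sides_closure[OF _ i]] unfolding gm by blast
  qed
  obtain p where p: "p \<in> poly2 k" "nodal_interp k \<tau> (linepath ?a ?b) ?f = restrict p (path_image (linepath ?a ?b))"
   "!!t. t \<in> {0..1} ==> \<bar>p (linepath ?a ?b t) - q (linepath ?a ?b t)\<bar> <= lebesgue_const k \<tau> * M"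
   by (rule nodal_interp_bound[where f="?f", OF nd ab q nM], assumption, rule that; assumption)
  have "Qb k \<tau> E xi (?gm t) = p (?gm t)" if "t \<in> {0<..<1}" for t using m[OF that, of "inner_side E"] p(2) unfolding gm by (simp add: Qb_def Let_def inner_side_def)
  moreover have "(LINT t|I01. \<bar>p (?gm t) - ?f (?gm t)\<bar> * speed ?gm t) <= (LINT t|I01. ((lebesgue_const k \<tau> + 1) * M) * speed ?gm t)"
  proof (rule BI_integral_mono)
   show "integrable I01 (%t. \<bar>p (?gm t) - ?f (?gm t)\<bar> * speed ?gm t)"
    by (intro speed_integrable_continuous lip_arc_sides continuous_intros poly2_path_continuous[OF lip_arc_sides p(1)] path_sides_continuous[OF f i])
   show "integrable I01 (%t. ((lebesgue_const k \<tau> + 1) * M) * speed ?gm t)" by (intro speed_integrable_continuous lip_arc_sides continuous_intros)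
   fix t assume "t \<in> space I01"
   then have t: "t \<in> {0..1}" by simp
   have "\<bar>p (?gm t) - q (?gm t)\<bar> <= lebesgue_const k \<tau> * M" using p(3)[OF t] unfolding gm .
   moreover have "\<bar>?f (?gm t) - q (?gm t)\<bar> <= M" by (rule a[OF sides_closure[OF t i]])
   ultimately have "\<bar>p (?gm t) - ?f (?gm t)\<bar> <= (lebesgue_const k \<tau> + 1) * M" unfolding distrib_right by linarith
   then show "\<bar>p (?gm t) - ?f (?gm t)\<bar> * speed ?gm t <= ((lebesgue_const k \<tau> + 1) * M) * speed ?gm t" by (rule mult_right_mono) simp
  qed
  ultimately show ?thesis using p(1) by (intro bexI[of _ p]) auto
 qed
qed

text \<open>\<open>Qb\<close> is matched with one polynomial per side at interior parameters only,
  since its corner values depend on the order of its cases; the end points are a null set.\<close>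

lemma side_integral_interior_cong:
 assumes "!!t. t \<in> {0<..<1} ==> u (gm t) = v (gm t)" and "integrable I01 (%t. u (gm t) * speed gm t)"
 shows "side_integral gm u = side_integral gm v" "integrable I01 (%t. v (gm t) * speed gm t)"
proof -
 have ae: "AE t in I01. u (gm t) * speed gm t = v (gm t) * speed gm t" unfolding AE_I01 by (rule AE_I2) (use assms(1) in auto)
 show i: "integrable I01 (%t. v (gm t) * speed gm t)" by (rule integrable_lebesgue_on_AE_cong[OF _ assms(2) ae]) simp
 show "side_integral gm u = side_integral gm v" unfolding side_integral_def by (rule BI_integral_cong_AE[OF _ _ ae]) (use i assms(2) in auto)
qed

lemma normal_trace_integrable:
 assumes e: "continuous_on {0..1} (%t. e (sides E i t))" and i: "i < 4" and q: "q \<in> vpoly2 j"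
 shows "integrable I01 (%t. e (sides E i t) * normal_trace E q (sides E i t) * speed (sides E i) t)"
proof -
 obtain z g T L where "star_boundary D z (\<rho> * h) {..<4} (sides E) g T L" using ex_boundary by blast
 then have "star_curve D z (\<rho> * h) (sides E i) (g i) (T i) (L i)" using i by (intro star_boundary.curve) auto
 from star_curve.normal_integrable[OF this e continuous_vpoly2[OF q]] show ?thesis by (simp add: normal_trace_def)
qed

text \<open>Only the polynomial form of the trace is extracted, for integrability; the tolerance 1
  is arbitrary.\<close>

lemma Qb_continuous:
 assumes xi: "xi \<in> sobolev (k + 1) D" and k: "k \<ge> 1" and nd: "nodal_distribution k \<tau>" and i: "i < 4"
 shows "\<exists>p\<in>poly2 k. \<forall>t\<in>{0<..<1}. Qb k \<tau> E xi (sides E i t) = p (sides E i t)"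
proof -
 obtain q where q: "q \<in> poly2 k" "\<forall>x\<in>closure D. \<bar>cont_rep D xi x - q x\<bar> <= approx_const k xi + 1" using cont_rep_props(3)[OF xi k, of 1] by auto
 have "approx_const k xi + 1 > 0" using approx_const_nonneg[of k xi] by linarith
 from Qb_side[OF cont_rep_props(1)[OF xi k] i q(1) this _ nd] q(2) show ?thesis by blast
qed

lemma Qb_trace_integrable:
 assumes xi: "xi \<in> sobolev (k + 1) D" and k: "k \<ge> 1" and nd: "nodal_distribution k \<tau>" and i: "i < 4" and q: "q \<in> vpoly2 j"
 shows "integrable I01 (%t. Qb k \<tau> E xi (sides E i t) * normal_trace E q (sides E i t) * speed (sides E i) t)"
proof -
 obtain p where p: "p \<in> poly2 k" "\<forall>t\<in>{0<..<1}. Qb k \<tau> E xi (sides E i t) = p (sides E i t)" using Qb_continuous[OF xi k nd i] by blast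
 show ?thesis by (rule side_integral_interior_cong(2)[where u="%x. p x * normal_trace E q x" and v="%x. Qb k \<tau> E xi x * normal_trace E q x"])
   (use p normal_trace_integrable[OF poly2_path_continuous[OF lip_arc_sides p(1)] i q] in auto)
qed

lemma bdry_pairing_diff:
 assumes xi: "xi \<in> sobolev (k + 1) D" and k: "k \<ge> 1" and nd: "nodal_distribution k \<tau>" and q: "q \<in> vpoly2 j"
 shows "bdry_pairing E (%x. Qb k \<tau> E xi x - cont_rep D xi x) (normal_trace E q)
  = bdry_pairing E (Qb k \<tau> E xi) (normal_trace E q) - bdry_pairing E (cont_rep D xi) (normal_trace E q)" unfolding bdry_pairing_sides sum_subtractf[symmetric]
proof (rule sum.cong[OF refl])
 fix i :: nat assume "i \<in> {..<4}"
 then have i: "i < 4" by simp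
 show "side_integral (sides E i) (%x. (Qb k \<tau> E xi x - cont_rep D xi x) * normal_trace E q x)
  = side_integral (sides E i) (%x. Qb k \<tau> E xi x * normal_trace E q x) - side_integral (sides E i) (%x. cont_rep D xi x * normal_trace E q x)"
  unfolding side_integral_def left_diff_distrib by (rule BI_integral_diff[OF Qb_trace_integrable[OF xi k nd i q]
   normal_trace_integrable[OF path_sides_continuous[OF cont_rep_props(1)[OF xi k] i] i q]])
qed

lemma bdry_pairing_add:
 assumes xi: "xi \<in> sobolev (k + 1) D" and k: "k \<ge> 1" and nd: "nodal_distribution k \<tau>" and q: "p \<in> vpoly2 j" "q \<in> vpoly2 j"
 shows "bdry_pairing E (Qb k \<tau> E xi) (normal_trace E (%x. p x + q x))
  = bdry_pairing E (Qb k \<tau> E xi) (normal_trace E p) + bdry_pairing E (Qb k \<tau> E xi) (normal_trace E q)" unfolding bdry_pairing_sides sum.distrib[symmetric]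
proof (rule sum.cong[OF refl])
 fix i :: nat assume "i \<in> {..<4}"
 then have i: "i < 4" by simp
 have n: "normal_trace E (%x. p x + q x) x = normal_trace E p x + normal_trace E q x" for x by (simp add: normal_trace_def inner_add_left)
 show "side_integral (sides E i) (%x. Qb k \<tau> E xi x * normal_trace E (%x. p x + q x) x)
  = side_integral (sides E i) (%x. Qb k \<tau> E xi x * normal_trace E p x) + side_integral (sides E i) (%x. Qb k \<tau> E xi x * normal_trace E q x)"
  unfolding side_integral_def n distrib_left distrib_right by (rule BI_integral_add[OF Qb_trace_integrable[OF xi k nd i q(1)] Qb_trace_integrable[OF xi k nd i q(2)]])
qed

lemma bdry_pairing_scale:
 "bdry_pairing E v (normal_trace E (%x. a *\<^sub>R p x)) = a * bdry_pairing E v (normal_trace E p)"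
proof -
 have n: "v x * normal_trace E (%x. a *\<^sub>R p x) x * s = a * (v x * normal_trace E p x * s)" for x s by (simp add: normal_trace_def)
 show ?thesis unfolding bdry_pairing_sides side_integral_def sum_distrib_left n by simp
qed

text \<open>The divergence of \<open>q\<close> has degree at most \<open>k\<close>, so the interior
  projection may be replaced by \<open>xi\<close>. Green's formula then exchanges the volume term
  for the gradient and the boundary values of \<open>xi\<close>.\<close>

lemma weak_grad_props:
 assumes xi: "xi \<in> sobolev (k + 1) D" and k: "k \<ge> 1" and nd: "nodal_distribution k \<tau>"
 shows "weak_grad k E (Qh k \<tau> E xi) \<in> vpoly2 (k - 1)"
  "q \<in> vpoly2 (k - 1) ==> L2_inner D (weak_grad k E (Qh k \<tau> E xi)) q
   = L2_inner D (sobolev_grad D xi) q + bdry_pairing E (%x. Qb k \<tau> E xi x - cont_rep D xi x) (normal_trace E q)"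
proof -
 obtain z where "star_domain D z (\<rho> * h)" using ex_star by blast
 then interpret star_domain D z "\<rho> * h" .
 have xi2: "xi \<in> L2_space D" using xi by (simp add: sobolev_def)
 let ?Q = "L2_proj D (poly2 k) xi"
 have Qp: "?Q \<in> poly2 k" by (rule L2_proj_poly2(1)[OF xi2])
 let ?l = "%q. - L2_inner D ?Q (divergence q) + bdry_pairing E (Qb k \<tau> E xi) (normal_trace E q)"
 have ex: "\<exists>!w. w \<in> vpoly2 (k - 1) & (\<forall>q\<in>vpoly2 (k - 1). L2_inner D w q = ?l q)"
 proof (rule vpoly2_L2_Riesz[OF openD _ boundedD])
  show "D ~= {}" using zD by blast
  fix p q assume p: "p \<in> vpoly2 (k - 1)" and q: "q \<in> vpoly2 (k - 1)"
  have "L2_inner D ?Q (divergence (%x. p x + q x)) = L2_inner D ?Q (divergence p) + L2_inner D ?Q (divergence q)" unfolding L2_inner_real divergence_add[OF p q] distrib_left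
   by (intro BI_integral_add L2_poly_integrable[where k="k - 1"] divergence_poly2 p q poly2_L2_space[OF Qp])
  then show "?l (%x. p x + q x) = ?l p + ?l q" using bdry_pairing_add[OF xi k nd p q] by simp
 next
  fix a p assume p: "p \<in> vpoly2 (k - 1)"
  show "?l (%x. a *\<^sub>R p x) = a * ?l p" unfolding L2_inner_real divergence_scale[OF p] bdry_pairing_scale by (simp add: algebra_simps)
 qed
 have W: "weak_grad k E (Qh k \<tau> E xi) \<in> vpoly2 (k - 1) & (\<forall>q\<in>vpoly2 (k - 1). L2_inner D (weak_grad k E (Qh k \<tau> E xi)) q = ?l q)"
  unfolding weak_grad_def Qh_def fst_conv snd_conv by (rule theI'[OF ex])
 show "weak_grad k E (Qh k \<tau> E xi) \<in> vpoly2 (k - 1)" using W by blast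
 assume q: "q \<in> vpoly2 (k - 1)"
 have "divergence q \<in> poly2 k" using divergence_poly2[OF q] poly2_mono[of "k - 1" k] by auto
 then have "L2_inner D ?Q (divergence q) = L2_inner D xi (divergence q)" by (rule L2_proj_poly2(2)[OF xi2])
 then show "L2_inner D (weak_grad k E (Qh k \<tau> E xi)) q
   = L2_inner D (sobolev_grad D xi) q + bdry_pairing E (%x. Qb k \<tau> E xi x - cont_rep D xi x) (normal_trace E q)"
  using bspec[OF conjunct2[OF W] q] element_green[OF xi k q] bdry_pairing_diff[OF xi k nd q] by linarith
qed

text \<open>The area of the element is at most that of a disc of radius \<open>h\<close>, and
  \<open>length_le\<close> divides it by the radius \<open>\<rho> * h\<close>.\<close>

lemma side_length: "i < 4 ==> (LINT t|I01. speed (sides E i) t) <= 4 * unit_ball_vol 2 / \<rho> * h"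
proof -
 assume i: "i < 4"
 obtain z g T L where sb: "star_boundary D z (\<rho> * h) {..<4} (sides E) g T L" using ex_boundary by blast
 interpret star_boundary D z "\<rho> * h" "{..<4}" "sides E" g T L by (rule sb)
 have "D \<subseteq> cball z h" using norm_le_h[OF zD] by (auto simp: dist_norm)
 then have "measure lebesgue D <= measure lebesgue (cball z h)" using lmeasurable_D by (intro measure_mono_fmeasurable) auto
 also have "... = unit_ball_vol 2 * h^2" using h0 content_cball[of h z] by simp
 finally have m: "measure lebesgue D <= unit_ball_vol 2 * h^2" .
 have "(LINT t|I01. speed (sides E i) t) <= 4 / (\<rho> * h) * measure lebesgue D" using i by (intro star_curve.length_le[OF curve]) simp
 also have "... <= 4 / (\<rho> * h) * (unit_ball_vol 2 * h^2)" using h0 \<rho>0 m by (intro mult_left_mono) auto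
 also have "... = 4 * unit_ball_vol 2 / \<rho> * h" using h0 by (simp add: power2_eq_square)
 finally show ?thesis .
qed

text \<open>The constant collects 4 sides, 2 components of \<open>q\<close> with the factor
  \<open>K\<close> of the inverse inequality, the factor of the boundary operator,
  \<open>2 ^ (k + 2)\<close> from the approximation and \<open>4 * unit_ball_vol 2\<close> from the
  length. The last two bring one power of \<open>1 / \<rho>\<close> each.\<close>

lemma bdry_estimate:
 assumes xi: "xi \<in> sobolev (k + 1) D" and k: "k \<ge> 1" and nd: "nodal_distribution k \<tau>" and q: "q \<in> vpoly2 (k - 1)"
  and K: "!!z p x. p \<in> poly2 (k - 1) ==> x \<in> cball z h ==> \<bar>p x\<bar> <= K / h * L2_norm (ball z (\<rho> * h)) p" "K > 0"
 shows "\<bar>bdry_pairing E (%x. Qb k \<tau> E xi x - cont_rep D xi x) (normal_trace E q)\<bar>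
  <= (4 * (2 * K * (lebesgue_const k \<tau> + 1) * 2 ^ (k + 2) * (4 * unit_ball_vol 2)) / \<rho>^2)
    * h ^ k * sobolev_norm (k + 1) D xi * L2_norm D q"
proof -
 obtain z g T L where sb: "star_boundary D z (\<rho> * h) {..<4} (sides E) g T L" using ex_boundary by blast
 interpret star_boundary D z "\<rho> * h" "{..<4}" "sides E" g T L by (rule sb)
 let ?f = "cont_rep D xi" and ?Q = "Qb k \<tau> E xi"
 note cf = cont_rep_props(1)[OF xi k]
 define S where "S = 2 * K / h * L2_norm D q"
 have S0: "S \<ge> 0" using K(2) h0 by (simp add: S_def)
 define \<Lambda> where "\<Lambda> = lebesgue_const k \<tau> + 1"
 have \<Lambda>0: "\<Lambda> \<ge> 0" using lebesgue_const_nonneg[of k \<tau>] by (simp add: \<Lambda>_def)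
 define len where "len = 4 * unit_ball_vol 2 / \<rho> * h"
 have l0: "len \<ge> 0" using h0 \<rho>0 by (simp add: len_def)
 have sub: "closure D \<subseteq> cball z h" using norm_le_h[OF zD] by (intro closure_minimal) (auto simp: dist_norm)
 have qS: "norm (q x) <= S" if x: "x \<in> closure D" for x
 proof -
  have c: "\<bar>q x $ i\<bar> <= K / h * L2_norm D q" for i
  proof -
   have "\<bar>q x $ i\<bar> <= K / h * L2_norm (ball z (\<rho> * h)) (%x. q x $ i)" using sub x by (intro K(1) vpoly2_nth[OF q]) auto
   also have "... <= K / h * L2_norm D q" using K(2) h0 by (intro mult_left_mono L2_norm_mono_ball[OF ballD q]) auto
   finally show ?thesis .
  qed
  have "norm (q x) <= \<bar>q x $ 1\<bar> + \<bar>q x $ 2\<bar>" using norm_le_l1_cart[of "q x"] by (simp add: sum_2)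
  also have "... <= K / h * L2_norm D q + K / h * L2_norm D q" by (intro add_mono c)
  finally show ?thesis by (simp add: S_def)
 qed
 have side: "\<bar>side_integral (sides E i) (%x. (?Q x - ?f x) * normal_trace E q x)\<bar> <= S * (\<Lambda> * (approx_const k xi + dt) * len)"
  if i: "i < 4" and dt: "dt > 0" for i dt
 proof -
  let ?gm = "sides E i" and ?M = "approx_const k xi + dt"
  have M: "?M > 0" using approx_const_nonneg[of k xi] dt by linarith
  obtain q0 where q0: "q0 \<in> poly2 k" "!!x. x \<in> closure D ==> \<bar>?f x - q0 x\<bar> <= ?M" using cont_rep_props(3)[OF xi k dt] by blast
  obtain p where p: "p \<in> poly2 k" "\<forall>t\<in>{0<..<1}. ?Q (?gm t) = p (?gm t)"
   "(LINT t|I01. \<bar>p (?gm t) - ?f (?gm t)\<bar> * speed ?gm t) <= \<Lambda> * ?M * (LINT t|I01. speed ?gm t)"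
   using Qb_side[OF cf i q0(1) M q0(2) nd] unfolding \<Lambda>_def by blast
  have ce: "continuous_on {0..1} (%t. p (?gm t) - ?f (?gm t))" by (intro continuous_intros poly2_path_continuous[OF lip_arc_sides p(1)] path_sides_continuous[OF cf i])
  have "side_integral ?gm (%x. (?Q x - ?f x) * normal_trace E q x) = side_integral ?gm (%x. (p x - ?f x) * normal_trace E q x)"
   by (rule side_integral_interior_cong(1)[symmetric]) (use p(2) normal_trace_integrable[OF ce i q] in auto)
  also have "\<bar>...\<bar> <= S * (LINT t|I01. \<bar>p (?gm t) - ?f (?gm t)\<bar> * speed ?gm t)" unfolding normal_trace_def
   by (rule star_curve.side_integral_normal_le[OF curve ce _ lip_arc_sides]) (use i qS sides_closure in auto)
  also have "... <= S * (\<Lambda> * ?M * len)"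
  proof (intro mult_left_mono S0 order_trans[OF p(3)])
   show "(LINT t|I01. speed ?gm t) <= len" unfolding len_def by (rule side_length[OF i])
   show "0 <= \<Lambda> * ?M" using \<Lambda>0 M by simp
  qed
  finally show ?thesis .
 qed
 have "\<bar>bdry_pairing E (%x. ?Q x - ?f x) (normal_trace E q)\<bar> <= 4 * (S * (\<Lambda> * approx_const k xi * len))"
 proof (rule field_le_epsilon)
  fix e :: real assume e: "e > 0"
  define c where "c = 4 * (S * (\<Lambda> * len))"
  have c0: "c \<ge> 0" using S0 \<Lambda>0 l0 by (simp add: c_def)
  \<comment> \<open>The bound grows by \<open>c * dt\<close> with the slack, which is kept below
    \<open>e\<close>; the summand 1 covers \<open>c = 0\<close>.\<close>
  define dt where "dt = e / (c + 1)"
  have dt: "dt > 0" using e c0 by (simp add: dt_def)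
  have "\<bar>bdry_pairing E (%x. ?Q x - ?f x) (normal_trace E q)\<bar>
   <= (\<Sum>i<4. \<bar>side_integral (sides E i) (%x. (?Q x - ?f x) * normal_trace E q x)\<bar>)" unfolding bdry_pairing_sides by (rule sum_abs)
  also have "... <= (\<Sum>i<4::nat. S * (\<Lambda> * (approx_const k xi + dt) * len))" by (intro sum_mono side dt) simp
  also have "... = 4 * (S * (\<Lambda> * approx_const k xi * len)) + c * dt" by (simp add: c_def algebra_simps)
  also have "c * dt <= (c + 1) * dt" using dt by (intro mult_right_mono) auto
  also have "(c + 1) * dt = e" using c0 by (simp add: dt_def)
  finally show "\<bar>bdry_pairing E (%x. ?Q x - ?f x) (normal_trace E q)\<bar> <= 4 * (S * (\<Lambda> * approx_const k xi * len)) + e" by simp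
 qed
 also have "4 * (S * (\<Lambda> * approx_const k xi * len))
  = (4 * (2 * K * \<Lambda> * 2 ^ (k + 2) * (4 * unit_ball_vol 2)) / \<rho>^2) * h ^ k * sobolev_norm (k + 1) D xi * L2_norm D q"
  using h0 \<rho>0 unfolding S_def len_def approx_const_def by (simp add: field_simps power2_eq_square)
 finally show ?thesis unfolding \<Lambda>_def .
qed

end

theorem lemma5:
  fixes k :: nat and \<tau> :: "nat \<Rightarrow> real" and \<rho>min :: real
  assumes "k \<ge> 1"
    and "nodal_distribution k \<tau>"
    and "\<rho>min > 0"
  shows "\<exists>C>0. \<forall>E. shape_regular \<rho>min E \<longrightarrow>
    (\<forall>\<xi>\<in>sobolev (k + 1) (region E).
      (\<forall>q\<in>vpoly2 (k - 1).
        L2_inner (region E) (weak_grad k E (Qh k \<tau> E \<xi>)) q =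
          L2_inner (region E) (L2_proj (region E) (vpoly2 (k - 1)) (sobolev_grad (region E) \<xi>)) q
          + bdry_pairing E (\<lambda>x. Qb k \<tau> E \<xi> x - cont_rep (region E) \<xi> x) (normal_trace E q)) \<and>
      (\<forall>q\<in>vpoly2 (k - 1).
        \<bar>bdry_pairing E (\<lambda>x. Qb k \<tau> E \<xi> x - cont_rep (region E) \<xi> x) (normal_trace E q)\<bar>
          \<le> C * diameter (region E) ^ k * sobolev_norm (k + 1) (region E) \<xi> * L2_norm (region E) q) \<and>
      L2_norm (region E) (\<lambda>x. weak_grad k E (Qh k \<tau> E \<xi>) x
            - L2_proj (region E) (vpoly2 (k - 1)) (sobolev_grad (region E) \<xi>) x)
        \<le> C * diameter (region E) ^ k * sobolev_norm (k + 1) (region E) \<xi>)"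
proof -
 obtain K where K': "K > 0 \<and>
  (\<forall>z h. \<forall>p\<in>poly2 (k - 1). h > 0 --> (\<forall>x\<in>cball z h. \<bar>p x\<bar> <= K / h * L2_norm (ball z (\<rho>min * h)) p))"
  using inverse_inequality[OF assms(3), of "k - 1"] by (rule exE)
 note K = conjunct1[OF K'] conjunct2[OF K', rule_format]
 \<comment> \<open>\<open>K\<close> was obtained from \<open>\<rho>min\<close> and \<open>k\<close>,
   and \<open>lebesgue_const\<close> involves only the reference nodes, so \<open>C\<close> is
   independent of the element.\<close>
 define C where "C = 4 * (2 * K * (lebesgue_const k \<tau> + 1) * 2 ^ (k + 2) * (4 * unit_ball_vol 2)) / \<rho>min^2"
 have C0: "C > 0"
 proof -
  have "lebesgue_const k \<tau> + 1 > 0" using lebesgue_const_nonneg[of k \<tau>] by linarith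
  moreover have "unit_ball_vol (2::real) > 0" by simp
  ultimately show ?thesis unfolding C_def using K(1) assms(3) by (intro divide_pos_pos mult_pos_pos) auto
 qed
 show ?thesis
 proof (intro exI[of _ C] conjI C0 allI impI ballI)
  fix E xi assume E: "shape_regular \<rho>min E" and xi: "xi \<in> sobolev (k + 1) (region E)"
  interpret element E \<rho>min by (rule element.intro[OF E assms(3)])
  obtain z where "star_domain D z (\<rho>min * h)" using ex_star by blast
  then interpret star_domain D z "\<rho>min * h" .
  let ?w = "weak_grad k E (Qh k \<tau> E xi)" and ?P = "L2_proj D (vpoly2 (k - 1)) (sobolev_grad D xi)"
  let ?b = "%q. bdry_pairing E (%x. Qb k \<tau> E xi x - cont_rep D xi x) (normal_trace E q)"
  note W = weak_grad_props[OF xi assms(1,2)]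
  note P = L2_proj_vpoly2[OF sobolev_grad_L2[OF xi assms(1)], where k="k - 1"]
  have id: "L2_inner D ?w q = L2_inner D ?P q + ?b q" if "q \<in> vpoly2 (k - 1)" for q using W(2)[OF that] P(2)[OF that] by simp
  show "L2_inner D ?w q = L2_inner D ?P q + ?b q" if "q \<in> vpoly2 (k - 1)" for q by (rule id[OF that])
  have est: "\<bar>?b q\<bar> <= C * h ^ k * sobolev_norm (k + 1) D xi * L2_norm D q" if "q \<in> vpoly2 (k - 1)" for q
   unfolding C_def by (rule bdry_estimate[OF xi assms(1,2) that K(2)[OF _ h0] K(1)])
  show "\<bar>?b q\<bar> <= C * h ^ k * sobolev_norm (k + 1) D xi * L2_norm D q" if "q \<in> vpoly2 (k - 1)" for q by (rule est[OF that])
  let ?d = "%x. ?w x - ?P x"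
  have d: "?d \<in> vpoly2 (k - 1)" by (rule vpoly2_diff[OF W(1) P(1)])
  have "L2_inner D ?d ?d = L2_inner D ?w ?d - L2_inner D ?P ?d" unfolding L2_inner_def inner_diff_left[of "?w _"]
   by (rule BI_integral_diff[OF vpoly2_inner_integrable[OF W(1) d] vpoly2_inner_integrable[OF P(1) d]])
  then have "(L2_norm D ?d)^2 = ?b ?d" using id[OF d] unfolding L2_norm_square by simp
  then have sq: "L2_norm D ?d * L2_norm D ?d <= (C * h ^ k * sobolev_norm (k + 1) D xi) * L2_norm D ?d" using est[OF d] unfolding power2_eq_square by linarith
  show "L2_norm D ?d <= C * h ^ k * sobolev_norm (k + 1) D xi"
  proof (cases "L2_norm D ?d = 0")
   case True
   then show ?thesis using C0 h0 sobolev_norm_nonneg by simp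
  next
   case False
   then have "L2_norm D ?d > 0" using L2_norm_nonneg[of D ?d] by linarith
   then show ?thesis using sq by (rule mult_right_le_imp_le[rotated])
  qed
 qed
qed

end
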